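(* Let $\Bbbk$ be an uncountable algebraically closed field of characteristic zero, $\mathtt g=\mathfrak{gl}_2(\Bbbk)$ and $\mathfrak q=\mathfrak q_2$ the queer Lie superalgebra with $\mathfrak q_{\overline 0}=\mathtt g$. Let $t\in\Bbbk\setminus\frac12\mathbb N_0$, where $\mathbb N_0=\{0,1,2,\dots\}$, and $\lambda=(t,-t)$. (i) The assignment $L\mapsto\mathcal L_\lambda\otimes_{U(\mathtt g)}L$ is a bijection from $\mathtt{Irr}^{\mathtt g}_\lambda$ to $\mathrm{Irr}_\lambda$. (ii) For any $L\in\mathtt{Irr}^{\mathtt g}_\lambda$, the supermodule $N=\mathcal L_\lambda\otimes_{U(\mathtt g)}L$ is semisimple as a $\mathtt g$-module, and we have isomorphisms of $\mathtt g$-modules $N\cong L\oplus L$ and $N_{\overline 0}\cong L$.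
   Context: For $z\in\Bbbk$ fix a square root $\sqrt z$, and fix $\mathbf i\in\Bbbk$ with $\mathbf i^2=-1$. The Lie superalgebra $\mathfrak q=\mathfrak q_2$ consists of the block matrices $\mathtt M(A,B)=\begin{pmatrix}A&B\\ B&A\end{pmatrix}$, $A,B\in\mathfrak{gl}_2(\Bbbk)$; the even part consists of the $\mathtt M(A,0)$ and is identified with $\mathtt g$, the odd part consists of the $\mathtt M(0,B)$; the superbracket is $[X,Y]=XY-(-1)^{\overline X\,\overline Y}YX$ for homogeneous $X,Y$. With matrix units $E_{ij}$ put $E=\mathtt M(E_{12},0)$, $F=\mathtt M(E_{21},0)$, $H_i=\mathtt M(E_{ii},0)$, $\overline E=\mathtt M(0,E_{12})$, $\overline F=\mathtt M(0,E_{21})$, $\overline H_i=\mathtt M(0,E_{ii})$. Let $\mathfrak h$ be the span of $H_1,H_2,\overline H_1,\overline H_2$ and $\mathfrak n$ the span of $E,\overline E$. Supermodules $N=N_{\overline 0}\oplus N_{\overline 1}$ are $\mathbb Z/2\mathbb Z$-graded, homomorphisms of supermodules are of degree zero, and $\Pi$ is the parity change functor. Weights are written $\lambda=(\lambda_1,\lambda_2)$, $\lambda_i=\lambda(H_i)$. The $\mathfrak h$-supermodule $\mathcal V(\lambda)$: $\mathcal V(0)=\Bbbk$ is the trivial, purely even supermodule; for $\lambda\ne 0$, $\mathcal V(\lambda)$ has even basis vector $v$ and odd basis vector $\overline v$, $H_i$ acts as $\lambda_i$, and $\overline H_1v=\sqrt{\lambda_1}\,\overline v$, $\overline H_2v=-\mathbf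 i\sqrt{\lambda_2}\,\overline v$, $\overline H_1\overline v=\sqrt{\lambda_1}\,v$, $\overline H_2\overline v=\mathbf i\sqrt{\lambda_2}\,v$. For a simple $\mathfrak h$-supermodule $V$ (with $\mathfrak nV=0$), $M(V)=U(\mathfrak q)\otimes_{U(\mathfrak h\oplus\mathfrak n)}V$ and $L(V)$ is the unique simple top of $M(V)$. $L^{\mathtt g}(\lambda)$ is the simple highest weight $\mathtt g$-module with highest weight $\lambda$. $\mathrm{Irr}_\lambda$ is the set of classes, up to isomorphism and parity change, of simple $\mathfrak q$-supermodules with annihilator $\mathcal I_\lambda=\mathrm{Ann}_{U(\mathfrak q)}L(\mathcal V(\lambda))$. $\mathtt{Irr}^{\mathtt g}_\lambda$ is the set of isomorphism classes of simple $\mathtt g$-modules with annihilator $\mathtt I_\lambda=\mathrm{Ann}_{U(\mathtt g)}L^{\mathtt g}(\lambda)$. For a $\mathtt g$-module $X$ and a $\mathfrak q$-supermodule $Y$, $\mathrm{Hom}_\Bbbk(X,Y)$ is a $U(\mathfrak q)$-$U(\mathtt g)$-bimodule via $(ufu')(x)=u\,f(u'x)$, graded by the grading of $Y$, and $\mathcal L(X,Y)$ is its subbimodule of all elements on which the adjoint action of $\mathtt g$, $a\cdot f=af-fa$, is locally finite. Put $\mathcal L_\lambda=\mathcal L(L^{\mathtt g}(\lambda),L(\mathcal V(\lambda)))$. The supermodule $\mathcal L_\lambda\otimes_{U(\mathtt g)}L$ is graded by the grading of $\mathcal L_\lambda$. *)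

theory Defs
  imports
    "HOL-Computational_Algebra.Polynomial"
    "HOL-Algebra.Module"
    "HOL-Algebra.QuotRing"
    "HOL-Algebra.Generated_Groups"
    "HOL-Analysis.Cartesian_Space"
    "HOL-Library.Poly_Mapping"
    "HOL-Library.Z2"
    "HOL-Library.Countable_Set"
begin

section \<open>The Lie superalgebra q(2) and its subalgebras\<close>

text \<open>
  Parities are elements of \<^typ>\<open>bit\<close>, the field with two elements.  A graded subspace of the
  4 x 4 matrices (in 2 x 2 blocks) is given by its two homogeneous parts, as a function on
  \<^typ>\<open>bit\<close>.  Multiplication of a matrix \<open>X\<close> by a scalar \<open>c\<close> is \<open>mat c ** X\<close>.
\<close>

type_synonym 'k smat = "'k ^ (2 + 2) ^ (2 + 2)"

definition blockM :: "'k ^ 2 ^ 2 \<Rightarrow> 'k ^ 2 ^ 2 \<Rightarrow> 'k smat" where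
  "blockM A B = (\<chi> r s. case (r, s) of
      (Inl i, Inl j) \<Rightarrow> A $ i $ j
    | (Inl i, Inr j) \<Rightarrow> B $ i $ j
    | (Inr i, Inl j) \<Rightarrow> B $ i $ j
    | (Inr i, Inr j) \<Rightarrow> A $ i $ j)"

definition koszul :: "bit \<Rightarrow> bit \<Rightarrow> 'k::ring_1" where
  "koszul i j = (if i = 1 \<and> j = 1 then -1 else 1)"

text \<open>The superbracket of \<open>X\<close> of parity \<open>i\<close> and \<open>Y\<close> of parity \<open>j\<close>.\<close>

definition superbracket :: "bit \<Rightarrow> bit \<Rightarrow> 'k::ring_1 smat \<Rightarrow> 'k smat \<Rightarrow> 'k smat" where
  "superbracket i j X Y = X ** Y - mat (koszul i j) ** (Y ** X)"

definition q_alg :: "bit \<Rightarrow> 'k::ring_1 smat set" where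
  "q_alg i = (if i = 0 then range (\<lambda>A. blockM A 0) else range (\<lambda>B. blockM 0 B))"

definition even_part :: "(bit \<Rightarrow> 'v::zero set) \<Rightarrow> bit \<Rightarrow> 'v set" where
  "even_part S = S(1 := {0})"

text \<open>
  The sum of the span \<open>h\<close> of \<open>H\<^sub>1, H\<^sub>2\<close> and their odd counterparts and of the span \<open>n\<close> of \<open>E\<close> and its
  odd counterpart: both blocks are upper triangular.
\<close>

definition b_alg :: "bit \<Rightarrow> 'k::ring_1 smat set" where
  "b_alg i = (if i = 0 then {blockM A 0 | A. A $ 2 $ 1 = 0} else {blockM 0 B | B. B $ 2 $ 1 = 0})"

text \<open>\<open>gl(2)\<close> is the even part of \<open>q(2)\<close>, and its Borel subalgebra is the even part of \<^const>\<open>b_alg\<close>.\<close>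

abbreviation g_alg :: "bit \<Rightarrow> 'k::ring_1 smat set" where
  "g_alg \<equiv> even_part q_alg"

abbreviation bg_alg :: "bit \<Rightarrow> 'k::ring_1 smat set" where
  "bg_alg \<equiv> even_part b_alg"


section \<open>Universal enveloping superalgebras\<close>

text \<open>
  The free monoid on \<open>'a\<close>, written additively so that finitely supported functions on it form the
  free associative algebra under the multiplication of \<^theory>\<open>HOL-Library.Poly_Mapping\<close>.
\<close>

datatype 'a fword = Word (letters: "'a list")

instantiation fword :: (type) monoid_add
begin

definition zero_fword :: "'a fword" where
  "zero_fword = Word []"

definition plus_fword :: "'a fword \<Rightarrow> 'a fword \<Rightarrow> 'a fword" where
  "plus_fword v w = Word (letters v @ letters w)"

instance
  by standard (simp_all add: zero_fword_def plus_fword_def)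

end

definition free_algebra :: "'v set \<Rightarrow> ('v fword \<Rightarrow>\<^sub>0 'k::ring_1) ring" where
  "free_algebra X =
     \<lparr>carrier = {p. \<forall>w \<in> Poly_Mapping.keys p. set (letters w) \<subseteq> X},
      mult = (*), one = 1, zero = 0, add = (+)\<rparr>"

definition fgen :: "'v \<Rightarrow> 'v fword \<Rightarrow>\<^sub>0 'k::ring_1" where
  "fgen X = Poly_Mapping.single (Word [X]) 1"

definition fconst :: "'k::ring_1 \<Rightarrow> 'v fword \<Rightarrow>\<^sub>0 'k" where
  "fconst c = Poly_Mapping.single 0 c"

text \<open>
  The enveloping algebra of a graded subalgebra \<open>S\<close>: the quotient of the free algebra on the
  homogeneous elements of \<open>S\<close> by linearity of the generators (which gives the tensor algebra) and
  the superbracket relations.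
\<close>

abbreviation env_free :: "(bit \<Rightarrow> 'k::field smat set) \<Rightarrow> ('k smat fword \<Rightarrow>\<^sub>0 'k) ring" where
  "env_free S \<equiv> free_algebra (S 0 \<union> S 1)"

definition env_rels :: "(bit \<Rightarrow> 'k::field smat set) \<Rightarrow> ('k smat fword \<Rightarrow>\<^sub>0 'k) set" where
  "env_rels S =
     {fgen (X + Y) - fgen X - fgen Y | X Y i. X \<in> S i \<and> Y \<in> S i} \<union>
     {fgen (mat c ** X) - fconst c * fgen X | c X i. X \<in> S i} \<union>
     {fgen X * fgen Y - fconst (koszul i j) * fgen Y * fgen X - fgen (superbracket i j X Y) | X Y i j.
        X \<in> S i \<and> Y \<in> S j}"

definition env_ideal :: "(bit \<Rightarrow> 'k::field smat set) \<Rightarrow> ('k smat fword \<Rightarrow>\<^sub>0 'k) set" where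
  "env_ideal S = Idl\<^bsub>env_free S\<^esub> (env_rels S)"

type_synonym 'k uea = "('k smat fword \<Rightarrow>\<^sub>0 'k) set"

definition UEA :: "(bit \<Rightarrow> 'k::field smat set) \<Rightarrow> 'k uea ring" where
  "UEA S = env_free S Quot env_ideal S"

definition env_class :: "(bit \<Rightarrow> 'k::field smat set) \<Rightarrow> ('k smat fword \<Rightarrow>\<^sub>0 'k) \<Rightarrow> 'k uea" where
  "env_class S p = env_ideal S +>\<^bsub>env_free S\<^esub> p"

definition env_gr :: "(bit \<Rightarrow> 'k::field smat set) \<Rightarrow> bit \<Rightarrow> 'k uea set" where
  "env_gr S i = {env_class S p | p. \<forall>w \<in> Poly_Mapping.keys p.
     \<exists>ps. list_all2 (\<lambda>X j. X \<in> S j) (letters w) ps \<and> sum_list ps = i}"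

text \<open>The homomorphism \<open>U(S) \<rightarrow> U(T)\<close> induced by an inclusion \<open>S \<subseteq> T\<close>, on cosets.\<close>

definition env_map ::
    "(bit \<Rightarrow> 'k::field smat set) \<Rightarrow> (bit \<Rightarrow> 'k smat set) \<Rightarrow> 'k uea \<Rightarrow> 'k uea" where
  "env_map S T C = env_ideal T <+>\<^bsub>env_free T\<^esub> C"


section \<open>Modules and supermodules\<close>

text \<open>
  The library's locale \<^locale>\<open>module\<close> is for commutative rings only.  Its record is reused here;
  the fields \<^const>\<open>monoid.mult\<close> and \<^const>\<open>monoid.one\<close> play no role.  A module over an enveloping
  algebra is a vector space through the scalars in that algebra.
\<close>

locale left_module = R?: ring R + M?: abelian_group M for R (structure) and M (structure) +
  assumes lsmult_closed [simp, intro]: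
      "\<lbrakk>a \<in> carrier R; x \<in> carrier M\<rbrakk> \<Longrightarrow> a \<odot>\<^bsub>M\<^esub> x \<in> carrier M"
    and lsmult_l_distr:
      "\<lbrakk>a \<in> carrier R; b \<in> carrier R; x \<in> carrier M\<rbrakk> \<Longrightarrow>
       (a \<oplus> b) \<odot>\<^bsub>M\<^esub> x = a \<odot>\<^bsub>M\<^esub> x \<oplus>\<^bsub>M\<^esub> b \<odot>\<^bsub>M\<^esub> x"
    and lsmult_r_distr:
      "\<lbrakk>a \<in> carrier R; x \<in> carrier M; y \<in> carrier M\<rbrakk> \<Longrightarrow>
       a \<odot>\<^bsub>M\<^esub> (x \<oplus>\<^bsub>M\<^esub> y) = a \<odot>\<^bsub>M\<^esub> x \<oplus>\<^bsub>M\<^esub> a \<odot>\<^bsub>M\<^esub> y"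
    and lsmult_assoc:
      "\<lbrakk>a \<in> carrier R; b \<in> carrier R; x \<in> carrier M\<rbrakk> \<Longrightarrow>
       (a \<otimes> b) \<odot>\<^bsub>M\<^esub> x = a \<odot>\<^bsub>M\<^esub> (b \<odot>\<^bsub>M\<^esub> x)"
    and lsmult_one [simp]:
      "x \<in> carrier M \<Longrightarrow> \<one> \<odot>\<^bsub>M\<^esub> x = x"

definition module_isos ::
    "('a, 'r) ring_scheme \<Rightarrow> ('a, 'b, 'm) module_scheme \<Rightarrow> ('a, 'c, 'n) module_scheme \<Rightarrow> ('b \<Rightarrow> 'c) set" where
  "module_isos R M N = {f. bij_betw f (carrier M) (carrier N) \<and>
     (\<forall>x \<in> carrier M. \<forall>y \<in> carrier M. f (x \<oplus>\<^bsub>M\<^esub> y) = f x \<oplus>\<^bsub>N\<^esub> f y) \<and>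
     (\<forall>r \<in> carrier R. \<forall>x \<in> carrier M. f (r \<odot>\<^bsub>M\<^esub> x) = r \<odot>\<^bsub>N\<^esub> f x)}"

definition module_iso ::
    "('a, 'r) ring_scheme \<Rightarrow> ('a, 'b, 'm) module_scheme \<Rightarrow> ('a, 'c, 'n) module_scheme \<Rightarrow> bool" where
  "module_iso R M N \<longleftrightarrow> module_isos R M N \<noteq> {}"

definition simple_module :: "('a, 'r) ring_scheme \<Rightarrow> ('a, 'b, 'm) module_scheme \<Rightarrow> bool" where
  "simple_module R M \<longleftrightarrow> left_module R M \<and> carrier M \<noteq> {\<zero>\<^bsub>M\<^esub>} \<and>
     (\<forall>H. submodule H R M \<longrightarrow> H = {\<zero>\<^bsub>M\<^esub>} \<or> H = carrier M)"

text \<open>Semisimple means being the sum of the simple submodules.\<close>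

definition semisimple_module :: "('a, 'r) ring_scheme \<Rightarrow> ('a, 'b, 'm) module_scheme \<Rightarrow> bool" where
  "semisimple_module R M \<longleftrightarrow> left_module R M \<and>
     (\<forall>H. submodule H R M \<and>
          (\<forall>K. submodule K R M \<and> simple_module R (M\<lparr>carrier := K\<rparr>) \<longrightarrow> K \<subseteq> H)
        \<longrightarrow> H = carrier M)"

definition annihilator :: "('a, 'r) ring_scheme \<Rightarrow> ('a, 'b, 'm) module_scheme \<Rightarrow> 'a set" where
  "annihilator R M = {r \<in> carrier R. \<forall>x \<in> carrier M. r \<odot>\<^bsub>M\<^esub> x = \<zero>\<^bsub>M\<^esub>}"

definition direct_sum ::
    "('a, 'b, 'm) module_scheme \<Rightarrow> ('a, 'c, 'n) module_scheme \<Rightarrow> ('a, 'b \<times> 'c) module" where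
  "direct_sum M N =
     \<lparr>carrier = carrier M \<times> carrier N, mult = undefined, one = undefined,
      zero = (\<zero>\<^bsub>M\<^esub>, \<zero>\<^bsub>N\<^esub>),
      add = (\<lambda>x y. (fst x \<oplus>\<^bsub>M\<^esub> fst y, snd x \<oplus>\<^bsub>N\<^esub> snd y)),
      smult = (\<lambda>r x. (r \<odot>\<^bsub>M\<^esub> fst x, r \<odot>\<^bsub>N\<^esub> snd x))\<rparr>"

definition restrict_scalars ::
    "(bit \<Rightarrow> 'k::field smat set) \<Rightarrow> (bit \<Rightarrow> 'k smat set) \<Rightarrow> ('k uea, 'b, 'm) module_scheme \<Rightarrow>
     ('k uea, 'b) module" where
  "restrict_scalars S T M =
     (module.truncate M)\<lparr>smult := (\<lambda>u x. env_map S T u \<odot>\<^bsub>M\<^esub> x)\<rparr>"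

record ('a, 'b) supermodule = "('a, 'b) module" +
  gr :: "bit \<Rightarrow> 'b set"

definition is_supermodule ::
    "(bit \<Rightarrow> 'k::field smat set) \<Rightarrow> ('k uea, 'b, 'm) supermodule_scheme \<Rightarrow> bool" where
  "is_supermodule S M \<longleftrightarrow> left_module (UEA S) M \<and>
     (\<forall>i. subgroup (gr M i) (add_monoid M)) \<and>
     (\<forall>x \<in> carrier M. \<exists>!p. fst p \<in> gr M 0 \<and> snd p \<in> gr M 1 \<and> x = fst p \<oplus>\<^bsub>M\<^esub> snd p) \<and>
     (\<forall>i j. \<forall>u \<in> env_gr S i. \<forall>x \<in> gr M j. u \<odot>\<^bsub>M\<^esub> x \<in> gr M (i + j))"

definition graded_submodule ::
    "(bit \<Rightarrow> 'k::field smat set) \<Rightarrow> ('k uea, 'b, 'm) supermodule_scheme \<Rightarrow> 'b set \<Rightarrow> bool" where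
  "graded_submodule S M H \<longleftrightarrow> submodule H (UEA S) M \<and>
     (\<forall>x \<in> H. \<exists>a \<in> H \<inter> gr M 0. \<exists>b \<in> H \<inter> gr M 1. x = a \<oplus>\<^bsub>M\<^esub> b)"

definition simple_supermodule ::
    "(bit \<Rightarrow> 'k::field smat set) \<Rightarrow> ('k uea, 'b, 'm) supermodule_scheme \<Rightarrow> bool" where
  "simple_supermodule S M \<longleftrightarrow> is_supermodule S M \<and> carrier M \<noteq> {\<zero>\<^bsub>M\<^esub>} \<and>
     (\<forall>H. graded_submodule S M H \<longrightarrow> H = {\<zero>\<^bsub>M\<^esub>} \<or> H = carrier M)"

definition supermodule_iso ::
    "(bit \<Rightarrow> 'k::field smat set) \<Rightarrow> ('k uea, 'b, 'm) supermodule_scheme \<Rightarrow>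
     ('k uea, 'c, 'n) supermodule_scheme \<Rightarrow> bool" where
  "supermodule_iso S M N \<longleftrightarrow> (\<exists>f \<in> module_isos (UEA S) M N. \<forall>i. f ` gr M i \<subseteq> gr N i)"

text \<open>
  The action is left unchanged.  The variant in which odd elements act with an additional sign is
  isomorphic to this one, through multiplication by the sign of the parity.
\<close>

definition parity_change :: "('a, 'b, 'm) supermodule_scheme \<Rightarrow> ('a, 'b, 'm) supermodule_scheme" where
  "parity_change M = M\<lparr>gr := (\<lambda>i. gr M (i + 1))\<rparr>"

definition purely_even :: "('a, 'b, 'm) module_scheme \<Rightarrow> ('a, 'b) supermodule" where
  "purely_even M =
     \<lparr>carrier = carrier M, mult = undefined, one = undefined,
      zero = \<zero>\<^bsub>M\<^esub>, add = add M, smult = (\<lambda>r x. r \<odot>\<^bsub>M\<^esub> x),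
      gr = (\<lambda>i. if i = 0 then carrier M else {\<zero>\<^bsub>M\<^esub>})\<rparr>"

definition quotient_module ::
    "('a, 'b, 'm) supermodule_scheme \<Rightarrow> 'b set \<Rightarrow> ('a, 'b set) supermodule" where
  "quotient_module M K =
     \<lparr>carrier = a_rcosets\<^bsub>M\<^esub> K, mult = undefined, one = undefined,
      zero = K, add = set_add M,
      smult = (\<lambda>r C. K <+>\<^bsub>M\<^esub> ((\<lambda>x. r \<odot>\<^bsub>M\<^esub> x) ` C)),
      gr = (\<lambda>i. (\<lambda>x. K +>\<^bsub>M\<^esub> x) ` gr M i)\<rparr>"

definition maximal_graded_submodule ::
    "(bit \<Rightarrow> 'k::field smat set) \<Rightarrow> ('k uea, 'b, 'm) supermodule_scheme \<Rightarrow> 'b set \<Rightarrow> bool" where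
  "maximal_graded_submodule S M H \<longleftrightarrow> graded_submodule S M H \<and> H \<noteq> carrier M \<and>
     (\<forall>K. graded_submodule S M K \<and> H \<subseteq> K \<longrightarrow> K = H \<or> K = carrier M)"

text \<open>The top: the quotient by the radical, the intersection of all maximal graded submodules.\<close>

definition top_of ::
    "(bit \<Rightarrow> 'k::field smat set) \<Rightarrow> ('k uea, 'b, 'm) supermodule_scheme \<Rightarrow> ('k uea, 'b set) supermodule" where
  "top_of S M = quotient_module M (carrier M \<inter> \<Inter>{H. maximal_graded_submodule S M H})"


section \<open>Tensor products and induction\<close>

record ('a, 'b, 'c) superbimodule = "('a, 'b) supermodule" +
  rsmult :: "'b \<Rightarrow> 'c \<Rightarrow> 'b"

text \<open>
  The free abelian group on \<open>M \<times> N\<close>, graded by total degree (in \<^typ>\<open>bit\<close>, \<open>i + (k + i) = k\<close>).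
  Scalars act on the left factor of each pair; this is a module structure only after passing to
  the quotient.
\<close>

definition pre_tensor ::
    "('a, 'b, 'c, 'm) superbimodule_scheme \<Rightarrow> ('c, 'd, 'n) supermodule_scheme \<Rightarrow>
     ('a, 'b \<times> 'd \<Rightarrow>\<^sub>0 int) supermodule" where
  "pre_tensor M N =
     \<lparr>carrier = {p. Poly_Mapping.keys p \<subseteq> carrier M \<times> carrier N}, mult = undefined, one = undefined,
      zero = 0, add = (+),
      smult = (\<lambda>s. frag_extend (\<lambda>(x, y). frag_of (s \<odot>\<^bsub>M\<^esub> x, y))),
      gr = (\<lambda>k. {p. Poly_Mapping.keys p \<subseteq> (\<Union>i. gr M i \<times> gr N (k + i))})\<rparr>"

definition tensor_rels ::
    "('c, 'r) ring_scheme \<Rightarrow> ('a, 'b, 'c, 'm) superbimodule_scheme \<Rightarrow> ('c, 'd, 'n) supermodule_scheme \<Rightarrow>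
     ('b \<times> 'd \<Rightarrow>\<^sub>0 int) set" where
  "tensor_rels R M N =
     {frag_of (x \<oplus>\<^bsub>M\<^esub> x', y) - frag_of (x, y) - frag_of (x', y) | x x' y.
        x \<in> carrier M \<and> x' \<in> carrier M \<and> y \<in> carrier N} \<union>
     {frag_of (x, y \<oplus>\<^bsub>N\<^esub> y') - frag_of (x, y) - frag_of (x, y') | x y y'.
        x \<in> carrier M \<and> y \<in> carrier N \<and> y' \<in> carrier N} \<union>
     {frag_of (rsmult M x r, y) - frag_of (x, r \<odot>\<^bsub>N\<^esub> y) | x r y.
        x \<in> carrier M \<and> r \<in> carrier R \<and> y \<in> carrier N}"

definition tensor ::
    "('c, 'r) ring_scheme \<Rightarrow> ('a, 'b, 'c, 'm) superbimodule_scheme \<Rightarrow> ('c, 'd, 'n) supermodule_scheme \<Rightarrow>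
     ('a, ('b \<times> 'd \<Rightarrow>\<^sub>0 int) set) supermodule" where
  "tensor R M N = quotient_module (pre_tensor M N)
     (generate (add_monoid (pre_tensor M N)) (tensor_rels R M N))"

text \<open>\<open>U(T)\<close> as a \<open>U(T)\<close>-\<open>U(S)\<close>-bimodule, for \<open>S \<subseteq> T\<close>.\<close>

definition env_bimodule ::
    "(bit \<Rightarrow> 'k::field smat set) \<Rightarrow> (bit \<Rightarrow> 'k smat set) \<Rightarrow> ('k uea, 'k uea, 'k uea) superbimodule" where
  "env_bimodule S T =
     \<lparr>carrier = carrier (UEA T), mult = undefined, one = undefined,
      zero = \<zero>\<^bsub>UEA T\<^esub>, add = add (UEA T),
      smult = (\<lambda>u x. u \<otimes>\<^bsub>UEA T\<^esub> x),
      gr = env_gr T,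
      rsmult = (\<lambda>x u. x \<otimes>\<^bsub>UEA T\<^esub> env_map S T u)\<rparr>"

definition induced ::
    "(bit \<Rightarrow> 'k::field smat set) \<Rightarrow> (bit \<Rightarrow> 'k smat set) \<Rightarrow> ('k uea, 'b, 'm) supermodule_scheme \<Rightarrow>
     ('k uea, ('k uea \<times> 'b \<Rightarrow>\<^sub>0 int) set) supermodule" where
  "induced S T V = tensor (UEA S) (env_bimodule S T) V"


section \<open>Highest weight modules\<close>

text \<open>
  Extension of an assignment of matrices to the elements of \<open>S\<close> to the free algebra, and the
  resulting action of \<open>U(S)\<close>: a coset acts as any of its elements, which is well defined when
  the assignment is a representation of \<open>S\<close> on \<open>V\<close>.
\<close>

definition rep_mat :: "('v \<Rightarrow> 'k::field ^ 'n ^ 'n) \<Rightarrow> ('v fword \<Rightarrow>\<^sub>0 'k) \<Rightarrow> 'k ^ 'n ^ 'n" where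
  "rep_mat \<rho> p = (\<Sum>w \<in> Poly_Mapping.keys p.
     mat (Poly_Mapping.lookup p w) ** foldr (\<lambda>X A. \<rho> X ** A) (letters w) (mat 1))"

definition rep_module ::
    "('k::field smat \<Rightarrow> 'k ^ 'n ^ 'n) \<Rightarrow> ('k ^ 'n) set \<Rightarrow> (bit \<Rightarrow> ('k ^ 'n) set) \<Rightarrow>
     ('k uea, 'k ^ 'n) supermodule" where
  "rep_module \<rho> V G =
     \<lparr>carrier = V, mult = undefined, one = undefined, zero = 0, add = (+),
      smult = (\<lambda>C x. the_elem ((\<lambda>p. rep_mat \<rho> p *v x) ` C)),
      gr = G\<rparr>"

text \<open>
  The Verma supermodule for \<open>q(2)\<close> is induced from the following module.  Here \<open>axis 1 1\<close> is the
  even basis vector \<open>v\<close>, \<open>axis 2 1\<close> the odd one, \<open>sq\<close> is the chosen square root function and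
  \<open>im\<close> the chosen square root of \<open>-1\<close>.  The entries of \<open>X = blockM A B\<close> used are \<open>A\<^sub>1\<^sub>1\<close>, \<open>A\<^sub>2\<^sub>2\<close>, \<open>B\<^sub>1\<^sub>1\<close> and
  \<open>B\<^sub>2\<^sub>2\<close>, its coordinates along the two \<open>H\<close>'s and their odd counterparts; \<open>n\<close> acts by zero.
\<close>

definition V_mat :: "('k::field \<Rightarrow> 'k) \<Rightarrow> 'k \<Rightarrow> 'k \<times> 'k \<Rightarrow> 'k smat \<Rightarrow> 'k ^ 2 ^ 2" where
  "V_mat sq im lam X =
     (let a1 = X $ Inl 1 $ Inl 1; a2 = X $ Inl 2 $ Inl 2;
          b1 = X $ Inl 1 $ Inr 1; b2 = X $ Inl 2 $ Inr 2;
          s1 = sq (fst lam); s2 = sq (snd lam)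
      in mat (a1 * fst lam + a2 * snd lam) +
         vector [vector [0, b1 * s1 + b2 * im * s2],
                 vector [b1 * s1 - b2 * im * s2, 0]])"

definition V_mod :: "('k::field \<Rightarrow> 'k) \<Rightarrow> 'k \<Rightarrow> 'k \<times> 'k \<Rightarrow> ('k uea, 'k ^ 2) supermodule" where
  "V_mod sq im lam = rep_module (V_mat sq im lam)
     (if lam = (0, 0) then {x. x $ 2 = 0} else UNIV)
     (\<lambda>i. if i = 0 then {x. x $ 2 = 0} else if lam = (0, 0) then {0} else {x. x $ 1 = 0})"

definition Lq :: "('k::field \<Rightarrow> 'k) \<Rightarrow> 'k \<Rightarrow> 'k \<times> 'k \<Rightarrow>
    ('k uea, ('k uea \<times> ('k ^ 2) \<Rightarrow>\<^sub>0 int) set set) supermodule" where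
  "Lq sq im lam = top_of q_alg (induced b_alg q_alg (V_mod sq im lam))"

text \<open>
  The simple highest weight module of \<open>gl(2)\<close> is the top of the Verma module induced from the
  one-dimensional module of the Borel subalgebra of weight \<open>lam\<close>.
\<close>

definition one_dim :: "'k::field \<times> 'k \<Rightarrow> ('k uea, 'k ^ 1) supermodule" where
  "one_dim lam = rep_module
     (\<lambda>X. mat (X $ Inl 1 $ Inl 1 * fst lam + X $ Inl 2 $ Inl 2 * snd lam))
     UNIV (\<lambda>i. if i = 0 then UNIV else {0})"

definition Lg :: "'k::field \<times> 'k \<Rightarrow>
    ('k uea, ('k uea \<times> ('k ^ 1) \<Rightarrow>\<^sub>0 int) set set) supermodule" where
  "Lg lam = top_of g_alg (induced bg_alg g_alg (one_dim lam))"


section \<open>The bimodule of locally finite maps\<close>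

definition hom_bimodule ::
    "('k::field uea, 'b, 'm) module_scheme \<Rightarrow> ('k uea, 'c, 'n) supermodule_scheme \<Rightarrow>
     ('k uea, 'b \<Rightarrow> 'c, 'k uea) superbimodule" where
  "hom_bimodule X Y =
    (let Hom = {f \<in> carrier X \<rightarrow>\<^sub>E carrier Y.
           (\<forall>x \<in> carrier X. \<forall>y \<in> carrier X. f (x \<oplus>\<^bsub>X\<^esub> y) = f x \<oplus>\<^bsub>Y\<^esub> f y) \<and>
           (\<forall>c. \<forall>x \<in> carrier X.
              f (env_class g_alg (fconst c) \<odot>\<^bsub>X\<^esub> x) = env_class q_alg (fconst c) \<odot>\<^bsub>Y\<^esub> f x)}
     in \<lparr>carrier = Hom, mult = undefined, one = undefined,
         zero = (\<lambda>x \<in> carrier X. \<zero>\<^bsub>Y\<^esub>),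
         add = (\<lambda>f h. \<lambda>x \<in> carrier X. f x \<oplus>\<^bsub>Y\<^esub> h x),
         smult = (\<lambda>u f. \<lambda>x \<in> carrier X. u \<odot>\<^bsub>Y\<^esub> f x),
         gr = (\<lambda>i. {f \<in> Hom. f ` carrier X \<subseteq> gr Y i}),
         rsmult = (\<lambda>f u. \<lambda>x \<in> carrier X. f (u \<odot>\<^bsub>X\<^esub> x))\<rparr>)"

definition k_subspace :: "('k::field uea, 'b, 'm) module_scheme \<Rightarrow> 'b set \<Rightarrow> bool" where
  "k_subspace M W \<longleftrightarrow> subgroup W (add_monoid M) \<and>
     (\<forall>c. \<forall>x \<in> W. env_class q_alg (fconst c) \<odot>\<^bsub>M\<^esub> x \<in> W)"

definition finite_dim_subspace :: "('k::field uea, 'b, 'm) module_scheme \<Rightarrow> 'b set \<Rightarrow> bool" where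
  "finite_dim_subspace M W \<longleftrightarrow> k_subspace M W \<and>
     (\<exists>B \<subseteq> W. finite B \<and> (\<forall>W'. k_subspace M W' \<and> B \<subseteq> W' \<longrightarrow> W \<subseteq> W'))"

definition ad_action ::
    "('k::field uea, 'b, 'k uea, 'm) superbimodule_scheme \<Rightarrow> 'k smat \<Rightarrow> 'b \<Rightarrow> 'b" where
  "ad_action H a f =
     (env_class q_alg (fgen a) \<odot>\<^bsub>H\<^esub> f) \<ominus>\<^bsub>H\<^esub> rsmult H f (env_class g_alg (fgen a))"

definition ad_locally_finite ::
    "('k::field uea, 'b, 'k uea, 'm) superbimodule_scheme \<Rightarrow> 'b set" where
  "ad_locally_finite H = {f. \<exists>W. f \<in> W \<and> finite_dim_subspace H W \<and>
     (\<forall>a \<in> g_alg 0. \<forall>h \<in> W. ad_action H a h \<in> W)}"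

definition locally_finite_bimodule ::
    "('k::field uea, 'b, 'm) module_scheme \<Rightarrow> ('k uea, 'c, 'n) supermodule_scheme \<Rightarrow>
     ('k uea, 'b \<Rightarrow> 'c, 'k uea) superbimodule" where
  "locally_finite_bimodule X Y =
     (let H = hom_bimodule X Y; F = ad_locally_finite H
      in H\<lparr>carrier := F, gr := (\<lambda>i. gr H i \<inter> F)\<rparr>)"

definition L_bimodule where
  "L_bimodule sq im lam = locally_finite_bimodule (Lg lam) (Lq sq im lam)"

text \<open>The supermodule obtained from the \<open>gl(2)\<close>-module \<open>L\<close> by tensoring with this bimodule.\<close>

definition tensor_L where
  "tensor_L sq im lam L = tensor (UEA g_alg) (L_bimodule sq im lam) (purely_even L)"


section \<open>Simple modules with prescribed annihilator\<close>

text \<open>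
  Isomorphism classes are taken among modules whose carrier is a subset of a type \<open>'m\<close> (or \<open>'n\<close>),
  which serves as the universe.  The enveloping algebras have countable dimension over the infinite
  field \<open>'k\<close>, so a simple module has at most as many elements as \<open>'k\<close>; hence every simple module has
  a copy in any type into which \<open>'k\<close> embeds.
\<close>

definition simples_g :: "'k::field \<times> 'k \<Rightarrow> ('k uea, 'm) module set" where
  "simples_g lam = {L. simple_module (UEA g_alg) L \<and>
     annihilator (UEA g_alg) L = annihilator (UEA g_alg) (Lg lam)}"

definition Irr_g :: "'k::field \<times> 'k \<Rightarrow> ('k uea, 'm) module set set" where
  "Irr_g lam = simples_g lam //
     {(L, L'). L \<in> simples_g lam \<and> L' \<in> simples_g lam \<and> module_iso (UEA g_alg) L L'}"

definition simples_q ::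
    "('k::field \<Rightarrow> 'k) \<Rightarrow> 'k \<Rightarrow> 'k \<times> 'k \<Rightarrow> ('k uea, 'n) supermodule set" where
  "simples_q sq im lam = {N. simple_supermodule q_alg N \<and>
     annihilator (UEA q_alg) N = annihilator (UEA q_alg) (Lq sq im lam)}"

definition iso_up_to_parity ::
    "('k::field uea, 'b, 'm) supermodule_scheme \<Rightarrow> ('k uea, 'c, 'n) supermodule_scheme \<Rightarrow> bool" where
  "iso_up_to_parity M N \<longleftrightarrow>
     supermodule_iso q_alg M N \<or> supermodule_iso q_alg M (parity_change N)"

definition Irr_q ::
    "('k::field \<Rightarrow> 'k) \<Rightarrow> 'k \<Rightarrow> 'k \<times> 'k \<Rightarrow> ('k uea, 'n) supermodule set set" where
  "Irr_q sq im lam = simples_q sq im lam //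
     {(N, N'). N \<in> simples_q sq im lam \<and> N' \<in> simples_q sq im lam \<and> iso_up_to_parity N N'}"

text \<open>
  The assignment on classes.  The tensor product of a representative lives on a type of its own;
  its class consists of the supermodules with carrier in \<open>'n\<close> that are isomorphic to it up to
  parity change.
\<close>

definition tensor_class ::
    "('k::field \<Rightarrow> 'k) \<Rightarrow> 'k \<Rightarrow> 'k \<times> 'k \<Rightarrow> ('k uea, 'm) module set \<Rightarrow> ('k uea, 'n) supermodule set" where
  "tensor_class sq im lam c = {N \<in> simples_q sq im lam.
     \<exists>L \<in> c. iso_up_to_parity N (tensor_L sq im lam L)}"

end

theory Submission
  imports Defs "HOL-Algebra.Free_Abelian_Groups" "HOL-Library.Function_Algebras"
begin

text \<open>
  Call a supermodule \<open>N\<close> over \<open>q(2)\<close> a doubling of a \<open>gl(2)\<close>-module \<open>L\<close> if it consists of two copies of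
  \<open>L\<close> of opposite parities and the odd matrix with odd block \<open>B\<close> acts by \<open>B\<close> from the first copy to
  the second and by the scalar \<open>tr B\<close> in the other direction.  A doubling determines \<open>L\<close> (as the image of
  the odd identity matrix), depends functorially on \<open>L\<close>, has the same lattice of submodules, and each of
  the annihilators of \<open>L\<close> and \<open>N\<close> determines the other.

  For \<open>\<lambda> = (t, -t)\<close> with \<open>2t\<close> not a natural number, \<open>Lg \<lambda>\<close> is the Verma module, realised on polynomials
  in one variable, and \<open>Lq \<lambda>\<close> is a doubling of it.  The locally finite endomorphisms of this Verma
  module are the elements of the enveloping algebra: a finite-dimensional space of matrices that is
  stable under the adjoint action is spanned by diagonals, which a recursion along the lowering operator
  identifies.  Hence the bimodule of locally finite maps is free on the two inclusions, up to the
  annihilator, and tensoring with it is the doubling construction.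

  Conversely, in a simple supermodule with the annihilator of \<open>Lq \<lambda>\<close> the products of two traceless odd
  elements, the square of the odd identity and the even identity act by zero.  The kernels of these
  operators give graded submodules, and simplicity forces the supermodule to be a doubling.
\<close>

text \<open>The shape of a doubling comes from the polarised Cayley-Hamilton identity: B D + D B
  equals tr(B) D + tr(D) B up to a scalar matrix. Once the identity matrix acts by zero, letting an
  odd B act as B in one direction and as tr(B) in the other therefore respects the odd brackets. On
  the weight (t, -t) the identity H_1 + H_2 does act by zero, so the odd identity has square zero
  and its kernel singles out one of the copies. The parity of that copy depends on the chosen square
  roots, because i sqrt(-t) equals sqrt(t) only up to sign; hence the parameter
  \<open>\<pi>\<close>. The condition on t is used as (k + 1) (2 t - k) \<noteq> 0, the coefficient
  with which the raising operator takes x^(k+1) to x^k. It makes the Verma module simple, and it is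
  what one divides by on the diagonals that raise the weight. The tensor product lives on a type of
  its own, while the classes live in fixed universes. The comparison of classes therefore goes
  through the relation that N is a doubling of L, which makes sense between modules on arbitrary
  types.\<close>

abbreviation Ag :: "'k::field uea ring" where "Ag \<equiv> UEA g_alg"
abbreviation Aq :: "'k::field uea ring" where "Aq \<equiv> UEA q_alg"
abbreviation Ug :: "'k::field uea set" where "Ug \<equiv> carrier Ag"
abbreviation Uq :: "'k::field uea set" where "Uq \<equiv> carrier Aq"
abbreviation zr :: "('a, 'm) ring_scheme \<Rightarrow> 'a" where "zr R \<equiv> \<zero>\<^bsub>R\<^esub>"

section \<open>Free algebras and enveloping superalgebras\<close>

text \<open>Parities are kept as sums such as \<open>i + j\<close> and \<open>\<pi> + 1\<close>, the
  form in which they index graded pieces.\<close>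

declare add_bit_eq_xor [simp del]

lemma bit_cases: "i = 0 \<or> i = (1::bit)"
  by (cases i) auto

text \<open>\<open>subgroup\<close> speaks multiplicatively about \<open>add_monoid G\<close>. This
  rule and the destruction rules after it restate it additively, the form in which submodules and
  graded pieces are handled.\<close>

lemma (in abelian_group) add_subgroupI:
  assumes "H \<subseteq> carrier G" "\<zero> \<in> H"
    "\<And>x. x \<in> H ==> \<ominus> x \<in> H" "\<And>x y. [|x \<in> H; y \<in> H|] ==> x \<oplus> y \<in> H"
  shows "subgroup H (add_monoid G)"
  by (rule subgroup.intro) (use assms in \<open>auto simp: a_inv_def\<close>)

lemma (in abelian_group) add_subgroupD:
  assumes "subgroup H (add_monoid G)"
  shows "H \<subseteq> carrier G" "\<zero> \<in> H" "x \<in> H ==> \<ominus> x \<in> H"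
    "[|x \<in> H; y \<in> H|] ==> x \<oplus> y \<in> H" "[|x \<in> H; y \<in> H|] ==> x \<ominus> y \<in> H"
  using subgroup.subset[OF assms] subgroup.one_closed[OF assms] subgroup.m_inv_closed[OF assms]
    subgroup.m_closed[OF assms]
  by (auto simp: a_inv_def a_minus_def)

section \<open>The free algebra and its induction principle\<close>

lemma carrier_free_algebra:
  "carrier (free_algebra X) = {p. \<forall>w \<in> Poly_Mapping.keys p. set (letters w) \<subseteq> X}"
  "monoid.mult (free_algebra X) = (*)" "\<one>\<^bsub>free_algebra X\<^esub> = 1"
  "(zr (free_algebra X)) = 0" "add (free_algebra X) = (+)"
  by (simp_all add: free_algebra_def)

lemma letters_plus [simp]: "letters (v + w) = letters v @ letters w"
  by (simp add: plus_fword_def)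

lemma letters_zero [simp]: "letters 0 = []"
  by (simp add: zero_fword_def)

lemma fconst_closed [simp]: "fconst c \<in> carrier (free_algebra X)"
  by (auto simp: carrier_free_algebra fconst_def)

lemma fgen_closed [simp]: "x \<in> X ==> fgen x \<in> carrier (free_algebra X)"
  by (auto simp: carrier_free_algebra fgen_def)

lemma free_algebra_closed:
  assumes "p \<in> carrier (free_algebra X)" "q \<in> carrier (free_algebra X)"
  shows "p + q \<in> carrier (free_algebra X)" "p * q \<in> carrier (free_algebra X)"
    "p - q \<in> carrier (free_algebra X)"
proof -
  show "p + q \<in> carrier (free_algebra X)"
    using assms Poly_Mapping.keys_add[of p q] by (fastforce simp: carrier_free_algebra)
  show "p * q \<in> carrier (free_algebra X)"
    using assms keys_mult[of p q] by (fastforce simp: carrier_free_algebra)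
  show "p - q \<in> carrier (free_algebra X)"
    using assms Poly_Mapping.keys_diff[of p q] by (fastforce simp: carrier_free_algebra)
qed

lemma uminus_closed_free_algebra: "p \<in> carrier (free_algebra X) ==> - p \<in> carrier (free_algebra X)"
  by (auto simp: carrier_free_algebra keys.rep_eq)

lemma zero_closed_free_algebra [simp]: "0 \<in> carrier (free_algebra X)"
  by (simp add: carrier_free_algebra)

lemma one_closed_free_algebra [simp]: "1 \<in> carrier (free_algebra X)"
  by (simp add: carrier_free_algebra)

lemma ring_free_algebra: "ring (free_algebra X)"
proof (rule ringI)
  show "abelian_group (free_algebra X)"
  proof (rule abelian_groupI)
    fix x assume "x \<in> carrier (free_algebra X)"
    then show "\<exists>y\<in>carrier (free_algebra X). y \<oplus>\<^bsub>free_algebra X\<^esub> x = (zr (free_algebra X))"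
      by (intro bexI[of _ "- x"]) (auto simp: carrier_free_algebra(2-) uminus_closed_free_algebra)
  qed (auto simp: carrier_free_algebra(2-) free_algebra_closed add_ac)
  show "monoid (free_algebra X)"
    by unfold_locales (auto simp: carrier_free_algebra(2-) free_algebra_closed mult.assoc)
qed (auto simp: carrier_free_algebra(2-) algebra_simps)

lemma a_inv_free_algebra:
  assumes "p \<in> carrier (free_algebra X)"
  shows "\<ominus>\<^bsub>free_algebra X\<^esub> p = - p"
proof -
  interpret R: ring "free_algebra X" by (rule ring_free_algebra)
  show ?thesis
    by (rule R.minus_equality) (use assms in \<open>auto simp: carrier_free_algebra(2-) uminus_closed_free_algebra\<close>)
qed

lemma a_minus_free_algebra:
  assumes "q \<in> carrier (free_algebra X)"
  shows "p \<ominus>\<^bsub>free_algebra X\<^esub> q = p - q"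
  using assms by (simp add: a_minus_def a_inv_free_algebra carrier_free_algebra(2-))

lemma poly_mapping_eq_sum_single:
  "p = (\<Sum>w\<in>Poly_Mapping.keys p. Poly_Mapping.single w (Poly_Mapping.lookup p w))"
  by (rule poly_mapping_eqI)
    (auto simp: lookup_sum lookup_single when_def sum.delta in_keys_iff)

text \<open>A word with coefficient c arises from the constant c by multiplying with generators from
  the left, and an arbitrary element is a sum of such words. Properties compatible with sums and
  products thus need a check on constants and generators only.\<close>

lemma free_algebra_induct [consumes 1, case_names const gen add mult]:
  fixes p :: "'v fword \<Rightarrow>\<^sub>0 'k::ring_1"
  assumes "p \<in> carrier (free_algebra X)"
    and const: "\<And>c. P (fconst c)" and gen: "\<And>x. x \<in> X ==> P (fgen x)"
    and add: "\<And>p q. [|p \<in> carrier (free_algebra X); q \<in> carrier (free_algebra X); P p; P q|] ==> P (p + q)"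
    and mult: "\<And>p q. [|p \<in> carrier (free_algebra X); q \<in> carrier (free_algebra X); P p; P q|] ==> P (p * q)"
  shows "P p"
proof -
  have word: "P (Poly_Mapping.single (Word xs) c)" if "set xs \<subseteq> X" for xs and c :: 'k
    using that
  proof (induction xs)
    case Nil
    then show ?case using const[of c] by (simp add: fconst_def zero_fword_def)
  next
    case (Cons x xs)
    then have "Poly_Mapping.single (Word xs) c \<in> carrier (free_algebra X)"
      by (simp add: carrier_free_algebra)
    with Cons have "P (fgen x * Poly_Mapping.single (Word xs) c)"
      by (intro mult gen) auto
    then show ?case by (simp add: fgen_def mult_single plus_fword_def)
  qed
  have "P (\<Sum>w\<in>A. Poly_Mapping.single w (Poly_Mapping.lookup p w)) \<and>
      (\<Sum>w\<in>A. Poly_Mapping.single w (Poly_Mapping.lookup p w)) \<in> carrier (free_algebra X)"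
    if "finite A" "A \<subseteq> Poly_Mapping.keys p" for A
    using that
  proof (induction A)
    case empty
    have "fconst 0 = (0 :: 'v fword \<Rightarrow>\<^sub>0 'k)" by (simp add: fconst_def)
    then show ?case using const[of 0] by simp
  next
    case (insert w A)
    have "P (Poly_Mapping.single w (Poly_Mapping.lookup p w))"
      using insert assms(1) word[of "letters w"] by (auto simp: carrier_free_algebra)
    moreover have "Poly_Mapping.single w (Poly_Mapping.lookup p w) \<in> carrier (free_algebra X)"
      using insert assms(1) by (auto simp: carrier_free_algebra)
    ultimately show ?case
      using insert by (auto intro!: add free_algebra_closed)
  qed
  from this[of "Poly_Mapping.keys p"] show ?thesis
    using poly_mapping_eq_sum_single[of p] by simp
qed

section \<open>Enveloping superalgebras of graded matrix Lie superalgebras\<close>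

definition graded_lie :: "(bit \<Rightarrow> 'k::field smat set) \<Rightarrow> bool" where
  "graded_lie S \<longleftrightarrow> (\<forall>i. 0 \<in> S i) \<and> (\<forall>i. \<forall>X\<in>S i. \<forall>Y\<in>S i. X + Y \<in> S i) \<and>
     (\<forall>i c. \<forall>X\<in>S i. mat c ** X \<in> S i) \<and>
     (\<forall>i j. \<forall>X\<in>S i. \<forall>Y\<in>S j. superbracket i j X Y \<in> S (i + j))"

abbreviation ucst :: "(bit \<Rightarrow> 'k::field smat set) \<Rightarrow> 'k \<Rightarrow> 'k uea" where
  "ucst S c \<equiv> env_class S (fconst c)"

abbreviation ugen :: "(bit \<Rightarrow> 'k::field smat set) \<Rightarrow> 'k smat \<Rightarrow> 'k uea" where
  "ugen S X \<equiv> env_class S (fgen X)"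

lemma fgen_env_closed: "X \<in> S i ==> fgen X \<in> carrier (env_free S)"
  by (rule fgen_closed) (metis UnCI bit_cases)

text \<open>Closure under sums, scalars and superbrackets puts the defining relations inside the
  free algebra on \<open>S 0 \<union> S 1\<close>; \<open>env_ideal S\<close> is then a genuine
  ideal and \<open>env_class S\<close> a surjective ring homomorphism.\<close>

locale enveloping =
  fixes S :: "bit \<Rightarrow> 'k::field smat set"
  assumes lie: "graded_lie S"
begin

lemma S_closed:
  "0 \<in> S i" "X \<in> S i ==> Y \<in> S i ==> X + Y \<in> S i" "X \<in> S i ==> mat c ** X \<in> S i"
  "X \<in> S i ==> Y \<in> S j ==> superbracket i j X Y \<in> S (i + j)"
  using lie by (auto simp: graded_lie_def)

lemma env_rels_closed: "env_rels S \<subseteq> carrier (env_free S)"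
  unfolding env_rels_def
  by (auto intro!: free_algebra_closed fconst_closed)
     (blast intro: fgen_env_closed S_closed)+

lemma ideal_env_ideal: "ideal (env_ideal S) (env_free S)"
  unfolding env_ideal_def
  by (rule ring.genideal_ideal[OF ring_free_algebra env_rels_closed])

lemma env_rels_in_ideal: "env_rels S \<subseteq> env_ideal S"
  unfolding env_ideal_def by (rule ring.genideal_self[OF ring_free_algebra env_rels_closed])

lemma env_ideal_minimal:
  assumes "ideal I (env_free S)" "env_rels S \<subseteq> I"
  shows "env_ideal S \<subseteq> I"
  unfolding env_ideal_def by (rule ring.genideal_minimal[OF ring_free_algebra assms])

lemma ring_UEA: "ring (UEA S)"
  unfolding UEA_def by (rule ideal.quotient_is_ring[OF ideal_env_ideal])

lemma env_class_hom: "env_class S \<in> ring_hom (env_free S) (UEA S)"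
  using ideal.rcos_ring_hom[OF ideal_env_ideal] unfolding UEA_def env_class_def[abs_def] .

lemma carrier_UEA: "carrier (UEA S) = env_class S ` carrier (env_free S)"
  unfolding UEA_def FactRing_def env_class_def[abs_def] A_RCOSETS_def' by auto

lemma env_class_closed [simp, intro]: "p \<in> carrier (env_free S) ==> env_class S p \<in> carrier (UEA S)"
  by (simp add: carrier_UEA)

lemma ucst_closed [simp]: "ucst S c \<in> carrier (UEA S)"
  by simp

lemma ugen_closed: "X \<in> S i ==> ugen S X \<in> carrier (UEA S)"
  by (simp add: fgen_env_closed)

lemma env_class_add:
  assumes "p \<in> carrier (env_free S)" "q \<in> carrier (env_free S)"
  shows "env_class S (p + q) = env_class S p \<oplus>\<^bsub>UEA S\<^esub> env_class S q"
  using ring_hom_add[OF env_class_hom assms] by (simp add: carrier_free_algebra)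

lemma env_class_mult:
  assumes "p \<in> carrier (env_free S)" "q \<in> carrier (env_free S)"
  shows "env_class S (p * q) = env_class S p \<otimes>\<^bsub>UEA S\<^esub> env_class S q"
  using ring_hom_mult[OF env_class_hom assms] by (simp add: carrier_free_algebra)

lemma env_class_one: "env_class S 1 = \<one>\<^bsub>UEA S\<^esub>"
  using ring_hom_one[OF env_class_hom] by (simp add: carrier_free_algebra)

lemma env_class_zero: "env_class S 0 = (zr (UEA S))"
  using ring_hom_zero[OF env_class_hom ring_free_algebra ring_UEA] by (simp add: carrier_free_algebra)

lemma env_class_eq_iff:
  assumes "p \<in> carrier (env_free S)" "q \<in> carrier (env_free S)"
  shows "env_class S p = env_class S q \<longleftrightarrow> p - q \<in> env_ideal S"
  using ring.quotient_eq_iff_same_a_r_cos[OF ring_free_algebra ideal_env_ideal assms]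
  by (simp add: env_class_def a_minus_free_algebra assms)

lemma UEA_induct [consumes 1, case_names const gen add mult]:
  assumes "u \<in> carrier (UEA S)"
    and const: "\<And>c. P (ucst S c)" and gen: "\<And>X i. X \<in> S i ==> P (ugen S X)"
    and add: "\<And>u v. [|u \<in> carrier (UEA S); v \<in> carrier (UEA S); P u; P v|] ==> P (u \<oplus>\<^bsub>UEA S\<^esub> v)"
    and mult: "\<And>u v. [|u \<in> carrier (UEA S); v \<in> carrier (UEA S); P u; P v|] ==> P (u \<otimes>\<^bsub>UEA S\<^esub> v)"
  shows "P u"
proof -
  obtain p where p: "p \<in> carrier (env_free S)" "u = env_class S p"
    using assms(1) by (auto simp: carrier_UEA)
  have "P (env_class S p)" using p(1)
  proof (induction rule: free_algebra_induct)
    case (gen x)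
    then show ?case using assms(3) by blast
  next
    case (add p q)
    then show ?case by (simp add: env_class_add assms(4))
  next
    case (mult p q)
    then show ?case by (simp add: env_class_mult assms(5))
  qed (rule const)
  with p show ?thesis by simp
qed

lemma ucst_add: "ucst S (c + d) = ucst S c \<oplus>\<^bsub>UEA S\<^esub> ucst S d"
  by (simp flip: env_class_add) (simp add: fconst_def single_add)

lemma ucst_mult: "ucst S (c * d) = ucst S c \<otimes>\<^bsub>UEA S\<^esub> ucst S d"
  by (simp flip: env_class_mult) (simp add: fconst_def mult_single)

lemma ucst_one: "ucst S 1 = \<one>\<^bsub>UEA S\<^esub>"
  by (simp flip: env_class_one) (simp add: fconst_def)

lemma ucst_zero: "ucst S 0 = (zr (UEA S))"
  by (simp flip: env_class_zero) (simp add: fconst_def)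

lemma ugen_add:
  assumes "X \<in> S i" "Y \<in> S i"
  shows "ugen S (X + Y) = ugen S X \<oplus>\<^bsub>UEA S\<^esub> ugen S Y"
proof -
  have c: "fgen X \<in> carrier (env_free S)" "fgen Y \<in> carrier (env_free S)"
    "fgen (X + Y) \<in> carrier (env_free S)"
    by (rule fgen_env_closed, fact)+ (rule fgen_env_closed, rule S_closed(2)[OF assms])
  have "fgen (X + Y) - fgen X - fgen Y \<in> env_rels S"
    using assms unfolding env_rels_def by blast
  then have "fgen (X + Y) - (fgen X + fgen Y) \<in> env_rels S"
    by (simp only: diff_diff_eq)
  then have "ugen S (X + Y) = env_class S (fgen X + fgen Y)"
    using env_rels_in_ideal c by (auto simp: env_class_eq_iff free_algebra_closed)
  with c show ?thesis by (simp add: env_class_add)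
qed

lemma ugen_scale:
  assumes "X \<in> S i"
  shows "ugen S (mat c ** X) = ucst S c \<otimes>\<^bsub>UEA S\<^esub> ugen S X"
proof -
  have c: "fgen X \<in> carrier (env_free S)" "fgen (mat c ** X) \<in> carrier (env_free S)"
    by (rule fgen_env_closed, fact) (rule fgen_env_closed, rule S_closed(3)[OF assms])
  have "fgen (mat c ** X) - fconst c * fgen X \<in> env_rels S"
    using assms unfolding env_rels_def by blast
  then have "ugen S (mat c ** X) = env_class S (fconst c * fgen X)"
    using env_rels_in_ideal c by (auto simp: env_class_eq_iff free_algebra_closed)
  with c show ?thesis by (simp add: env_class_mult)
qed

lemma ugen_commute:
  assumes "X \<in> S i" "Y \<in> S j"
  shows "ugen S X \<otimes>\<^bsub>UEA S\<^esub> ugen S Y =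
    ucst S (koszul i j) \<otimes>\<^bsub>UEA S\<^esub> ugen S Y \<otimes>\<^bsub>UEA S\<^esub> ugen S X \<oplus>\<^bsub>UEA S\<^esub> ugen S (superbracket i j X Y)"
proof -
  have c: "fgen X \<in> carrier (env_free S)" "fgen Y \<in> carrier (env_free S)"
    "fgen (superbracket i j X Y) \<in> carrier (env_free S)"
    by (rule fgen_env_closed, fact)+ (rule fgen_env_closed, rule S_closed(4)[OF assms])
  have "fgen X * fgen Y - fconst (koszul i j) * fgen Y * fgen X - fgen (superbracket i j X Y) \<in> env_rels S"
    using assms unfolding env_rels_def by blast
  then have "fgen X * fgen Y - (fconst (koszul i j) * fgen Y * fgen X + fgen (superbracket i j X Y)) \<in> env_rels S"
    by (simp only: diff_diff_eq)
  then have "env_class S (fgen X * fgen Y) =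
      env_class S (fconst (koszul i j) * fgen Y * fgen X + fgen (superbracket i j X Y))"
    using env_rels_in_ideal c by (auto simp: env_class_eq_iff free_algebra_closed)
  with c show ?thesis by (simp add: env_class_mult env_class_add free_algebra_closed)
qed

lemma fconst_central:
  fixes p :: "'v fword \<Rightarrow>\<^sub>0 'k"
  shows "fconst c * p = p * fconst c"
proof -
  have "p \<in> carrier (free_algebra UNIV)" by (simp add: carrier_free_algebra)
  then show ?thesis
  proof (induction rule: free_algebra_induct)
    case (mult p q)
    then show ?case by (metis mult.assoc)
  qed (simp_all add: fconst_def fgen_def mult_single algebra_simps)
qed

lemma ucst_central:
  assumes "u \<in> carrier (UEA S)"
  shows "ucst S c \<otimes>\<^bsub>UEA S\<^esub> u = u \<otimes>\<^bsub>UEA S\<^esub> ucst S c"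
proof -
  obtain p where p: "p \<in> carrier (env_free S)" "u = env_class S p"
    using assms by (auto simp: carrier_UEA)
  then show ?thesis by (simp flip: env_class_mult add: fconst_central)
qed

lemma ugen_zero: "ugen S 0 = (zr (UEA S))"
proof -
  interpret ring "UEA S" by (rule ring_UEA)
  have "ugen S (mat 0 ** 0) = ucst S 0 \<otimes>\<^bsub>UEA S\<^esub> ugen S 0"
    by (rule ugen_scale[OF S_closed(1)])
  then show ?thesis
    using ugen_closed[OF S_closed(1)] by (simp add: ucst_zero)
qed

lemma env_gr_closed: "u \<in> env_gr S i ==> u \<in> carrier (UEA S)"
proof -
  assume "u \<in> env_gr S i"
  then obtain p where p: "u = env_class S p" "\<forall>w \<in> Poly_Mapping.keys p.
     \<exists>ps. list_all2 (\<lambda>X j. X \<in> S j) (letters w) ps \<and> sum_list ps = i"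
    by (auto simp: env_gr_def)
  have "set xs \<subseteq> S 0 \<union> S 1" if "list_all2 (\<lambda>X j. X \<in> S j) xs ps" for xs ps
    using that by (induction rule: list_all2_induct) (auto, metis bit_cases)
  with p have "p \<in> carrier (env_free S)"
    by (simp add: carrier_free_algebra) blast
  with p show ?thesis by simp
qed

end

text \<open>The ideal of \<open>T\<close> intersected with the smaller free algebra is an ideal
  there and contains the relations of \<open>S\<close>, so minimality of \<open>env_ideal S\<close>
  applies.\<close>

lemma env_ideal_mono:
  assumes "graded_lie S" "graded_lie T" "\<And>i. S i \<subseteq> T i"
  shows "env_ideal S \<subseteq> env_ideal T"
proof -
  interpret S: enveloping S by standard fact
  interpret T: enveloping T by standard fact
  have sub: "carrier (env_free S) \<subseteq> carrier (env_free T)"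
    using assms(3) by (fastforce simp: carrier_free_algebra)
  interpret I: ideal "env_ideal T" "env_free T" by (rule T.ideal_env_ideal)
  have "ideal (env_ideal T \<inter> carrier (env_free S)) (env_free S)"
  proof (rule idealI[OF ring_free_algebra])
    show "subgroup (env_ideal T \<inter> carrier (env_free S)) (add_monoid (env_free S))"
    proof (rule abelian_group.add_subgroupI[OF ring.is_abelian_group[OF ring_free_algebra]])
      show "(zr (env_free S)) \<in> env_ideal T \<inter> carrier (env_free S)"
        using additive_subgroup.zero_closed[OF I.is_additive_subgroup] by (simp add: carrier_free_algebra(4))
    next
      fix a assume a: "a \<in> env_ideal T \<inter> carrier (env_free S)"
      then have "- a \<in> env_ideal T"
        using additive_subgroup.a_inv_closed[OF I.is_additive_subgroup, of a] sub
        by (auto simp: a_inv_free_algebra)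
      then show "\<ominus>\<^bsub>env_free S\<^esub> a \<in> env_ideal T \<inter> carrier (env_free S)"
        using a by (simp add: uminus_closed_free_algebra a_inv_free_algebra)
    next
      fix a b assume "a \<in> env_ideal T \<inter> carrier (env_free S)" "b \<in> env_ideal T \<inter> carrier (env_free S)"
      then show "a \<oplus>\<^bsub>env_free S\<^esub> b \<in> env_ideal T \<inter> carrier (env_free S)"
        using additive_subgroup.a_closed[OF I.is_additive_subgroup, of a b]
        by (simp add: carrier_free_algebra(2-) free_algebra_closed)
    qed auto
  next
    fix a x assume "a \<in> env_ideal T \<inter> carrier (env_free S)" "x \<in> carrier (env_free S)"
    then show "x \<otimes>\<^bsub>env_free S\<^esub> a \<in> env_ideal T \<inter> carrier (env_free S)"
      "a \<otimes>\<^bsub>env_free S\<^esub> x \<in> env_ideal T \<inter> carrier (env_free S)"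
      using I.I_l_closed[of a x] I.I_r_closed[of a x] sub
      by (auto simp: carrier_free_algebra(2-) free_algebra_closed)
  qed
  moreover have "env_rels S \<subseteq> env_rels T"
    using assms(3) unfolding env_rels_def by blast
  ultimately show ?thesis
    using S.env_ideal_minimal S.env_rels_closed T.env_rels_in_ideal by blast
qed

text \<open>Adding the ideal of \<open>T\<close> to a coset of the smaller ideal of \<open>S\<close>
  produces the full coset for \<open>T\<close>. This turns the description of \<open>env_map\<close>
  by sets into a rule on representatives.\<close>

lemma env_map_class:
  assumes "graded_lie S" "graded_lie T" "\<And>i. S i \<subseteq> T i" "p \<in> carrier (env_free S)"
  shows "env_map S T (env_class S p) = env_class T p"
proof -
  interpret S: enveloping S by standard fact
  interpret T: enveloping T by standard fact
  interpret I: ideal "env_ideal T" "env_free T" by (rule T.ideal_env_ideal)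
  interpret J: ideal "env_ideal S" "env_free S" by (rule S.ideal_env_ideal)
  have "env_ideal T <+>\<^bsub>env_free T\<^esub> (env_ideal S +>\<^bsub>env_free S\<^esub> p) = env_ideal T +>\<^bsub>env_free T\<^esub> p"
  proof (intro equalityI subsetI)
    fix x assume "x \<in> env_ideal T <+>\<^bsub>env_free T\<^esub> (env_ideal S +>\<^bsub>env_free S\<^esub> p)"
    then obtain a b where ab: "a \<in> env_ideal T" "b \<in> env_ideal S" "x = a + (b + p)"
      by (auto simp: set_add_def' a_r_coset_def' carrier_free_algebra(2-))
    then have "a + b \<in> env_ideal T"
      using additive_subgroup.a_closed[OF I.is_additive_subgroup, of a b] env_ideal_mono[OF assms(1-3)] by (auto simp: carrier_free_algebra(2-))
    with ab show "x \<in> env_ideal T +>\<^bsub>env_free T\<^esub> p"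
      by (auto simp: a_r_coset_def' carrier_free_algebra(2-) add.assoc intro!: bexI[of _ "a + b"])
  next
    fix x assume "x \<in> env_ideal T +>\<^bsub>env_free T\<^esub> p"
    then obtain a where a: "a \<in> env_ideal T" "x = a + p"
      by (auto simp: a_r_coset_def' carrier_free_algebra(2-))
    moreover have "0 \<in> env_ideal S" using additive_subgroup.zero_closed[OF J.is_additive_subgroup] by (simp add: carrier_free_algebra(2-))
    ultimately show "x \<in> env_ideal T <+>\<^bsub>env_free T\<^esub> (env_ideal S +>\<^bsub>env_free S\<^esub> p)"
      unfolding set_add_def' a_r_coset_def' carrier_free_algebra(5)
      by (intro UN_I[of a] UN_I[of "0 + p"] UN_I[of 0]) auto
  qed
  then show ?thesis by (simp add: env_map_def env_class_def)
qed

section \<open>Modules over enveloping superalgebras\<close>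

text \<open>Two decompositions of one element give a difference that lies in both graded pieces at
  once; this is how uniqueness of the decomposition is reduced to trivial intersection.\<close>

lemma (in abelian_group) diff_eq_diffI:
  assumes "a \<in> carrier G" "b \<in> carrier G" "c \<in> carrier G" "d \<in> carrier G" "a \<oplus> b = c \<oplus> d"
  shows "a \<ominus> c = d \<ominus> b"
proof -
  have "a \<ominus> c = (a \<oplus> b) \<oplus> (\<ominus> b \<oplus> \<ominus> c)"
    using assms(1-4) by (simp add: a_minus_def a_assoc r_neg2)
  also have "\<dots> = (d \<oplus> c) \<oplus> (\<ominus> c \<oplus> \<ominus> b)"
    unfolding assms(5) using assms(1-4) by (simp add: a_comm)
  also have "\<dots> = d \<ominus> b"
    using assms(1-4) by (simp add: a_minus_def a_assoc r_neg2)
  finally show ?thesis .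
qed

lemma (in abelian_group) diff_eq_zeroD:
  "a \<in> carrier G ==> b \<in> carrier G ==> a \<ominus> b = \<zero> ==> a = b"
  using minus_equality[of a "\<ominus> b"] by (simp add: a_minus_def)

context left_module
begin

lemma lsmult_zero [simp]: "a \<in> carrier R ==> a \<odot>\<^bsub>M\<^esub> (zr M) = (zr M)"
  using lsmult_r_distr[of a "(zr M)" "(zr M)"]
  by (simp add: M.add.l_cancel_one')

lemma zero_lsmult [simp]: "x \<in> carrier M ==> \<zero> \<odot>\<^bsub>M\<^esub> x = (zr M)"
  using lsmult_l_distr[of \<zero> \<zero> x]
  by (simp add: M.add.l_cancel_one')

lemma lsmult_minus:
  assumes "a \<in> carrier R" "x \<in> carrier M"
  shows "a \<odot>\<^bsub>M\<^esub> (\<ominus>\<^bsub>M\<^esub> x) = \<ominus>\<^bsub>M\<^esub> (a \<odot>\<^bsub>M\<^esub> x)"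
proof -
  have "a \<odot>\<^bsub>M\<^esub> (\<ominus>\<^bsub>M\<^esub> x) \<oplus>\<^bsub>M\<^esub> a \<odot>\<^bsub>M\<^esub> x = (zr M)"
    using assms by (simp flip: lsmult_r_distr add: M.l_neg)
  then show ?thesis using assms by (simp add: M.minus_equality)
qed

end

text \<open>Every axiom for \<open>N\<close> is the image of the same axiom for \<open>M\<close>
  under a surjection that respects the operations. One proof then serves for
  \<open>purely_even\<close>, for restricted carriers, for copies on another type and for the top of
  an induced module.\<close>

lemma left_module_image:
  fixes R (structure)
  assumes "left_module R M"
    and im: "f ` carrier M = carrier N"
    and add: "\<And>x y. [|x \<in> carrier M; y \<in> carrier M|] ==> f (x \<oplus>\<^bsub>M\<^esub> y) = f x \<oplus>\<^bsub>N\<^esub> f y"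
    and zero: "f (zr M) = (zr N)"
    and smult: "\<And>r x. [|r \<in> carrier R; x \<in> carrier M|] ==> f (r \<odot>\<^bsub>M\<^esub> x) = r \<odot>\<^bsub>N\<^esub> f x"
  shows "left_module R N"
proof -
  interpret left_module R M by fact
  have ex: "\<exists>x\<in>carrier M. y = f x" if "y \<in> carrier N" for y
    using that im by auto
  have cl: "f x \<in> carrier N" if "x \<in> carrier M" for x
    using that im by auto
  have "abelian_group N"
  proof (rule abelian_groupI)
    fix x y assume "x \<in> carrier N" "y \<in> carrier N"
    then obtain a b where "a \<in> carrier M" "b \<in> carrier M" "x = f a" "y = f b" using ex by metis
    then show "x \<oplus>\<^bsub>N\<^esub> y \<in> carrier N" "x \<oplus>\<^bsub>N\<^esub> y = y \<oplus>\<^bsub>N\<^esub> x"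
      by (simp_all flip: add add: cl M.a_comm)
  next
    fix x y z assume "x \<in> carrier N" "y \<in> carrier N" "z \<in> carrier N"
    then obtain a b c where "a \<in> carrier M" "b \<in> carrier M" "c \<in> carrier M" "x = f a" "y = f b" "z = f c"
      using ex by metis
    then show "x \<oplus>\<^bsub>N\<^esub> y \<oplus>\<^bsub>N\<^esub> z = x \<oplus>\<^bsub>N\<^esub> (y \<oplus>\<^bsub>N\<^esub> z)"
      by (simp flip: add add: M.a_assoc)
  next
    show "(zr N) \<in> carrier N" by (simp flip: zero add: cl)
  next
    fix x assume "x \<in> carrier N"
    then obtain a where a: "a \<in> carrier M" "x = f a" using ex by metis
    then show "(zr N) \<oplus>\<^bsub>N\<^esub> x = x" by (simp flip: zero add)
    show "\<exists>y\<in>carrier N. y \<oplus>\<^bsub>N\<^esub> x = (zr N)"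
      using a by (intro bexI[of _ "f (\<ominus>\<^bsub>M\<^esub> a)"]) (simp_all flip: zero add add: cl M.l_neg)
  qed
  moreover have "left_module_axioms R N"
  proof (unfold_locales)
    fix a x assume a: "a \<in> carrier R" "x \<in> carrier N"
    then obtain y where "y \<in> carrier M" "x = f y" using ex by metis
    with a show "a \<odot>\<^bsub>N\<^esub> x \<in> carrier N" by (simp flip: smult add: cl)
  next
    fix a b x assume a: "a \<in> carrier R" "b \<in> carrier R" "x \<in> carrier N"
    then obtain y where "y \<in> carrier M" "x = f y" using ex by metis
    with a show "(a \<oplus> b) \<odot>\<^bsub>N\<^esub> x = a \<odot>\<^bsub>N\<^esub> x \<oplus>\<^bsub>N\<^esub> b \<odot>\<^bsub>N\<^esub> x"
      "(a \<otimes> b) \<odot>\<^bsub>N\<^esub> x = a \<odot>\<^bsub>N\<^esub> (b \<odot>\<^bsub>N\<^esub> x)"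
      by (simp_all flip: smult add add: lsmult_l_distr lsmult_assoc)
  next
    fix a x z assume a: "a \<in> carrier R" "x \<in> carrier N" "z \<in> carrier N"
    then obtain y w where "y \<in> carrier M" "x = f y" "w \<in> carrier M" "z = f w" using ex by metis
    with a show "a \<odot>\<^bsub>N\<^esub> (x \<oplus>\<^bsub>N\<^esub> z) = a \<odot>\<^bsub>N\<^esub> x \<oplus>\<^bsub>N\<^esub> a \<odot>\<^bsub>N\<^esub> z"
      by (simp flip: smult add add: lsmult_r_distr)
  next
    fix x assume "x \<in> carrier N"
    then obtain y where "y \<in> carrier M" "x = f y" using ex by metis
    then show "\<one> \<odot>\<^bsub>N\<^esub> x = x" by (simp flip: smult)
  qed
  ultimately show ?thesis
    by (simp add: left_module_def R.ring_axioms)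
qed

text \<open>The scalars inside the enveloping algebra make the module a vector space. The lemmas
  with prefix \<open>cs\<close> record this structure, those with prefix \<open>ge\<close> the
  action of the Lie superalgebra itself.\<close>

locale umod = enveloping S + left_module "UEA S" M
  for S :: "bit \<Rightarrow> 'k::field smat set" and M :: "('k uea, 'b, 'm) module_scheme" (structure)
begin

lemma ge_closed: "X \<in> S i ==> x \<in> carrier M ==> ugen S X \<odot> x \<in> carrier M"
  using ugen_closed by blast

lemma cs_closed: "x \<in> carrier M ==> ucst S c \<odot> x \<in> carrier M"
  by simp

lemma cs_add: "x \<in> carrier M ==> ucst S (c + d) \<odot> x = ucst S c \<odot> x \<oplus> ucst S d \<odot> x"
  by (simp add: ucst_add lsmult_l_distr)

lemma cs_mult: "x \<in> carrier M ==> ucst S (c * d) \<odot> x = ucst S c \<odot> (ucst S d \<odot> x)"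
  by (simp add: ucst_mult lsmult_assoc)

lemma cs_one: "x \<in> carrier M ==> ucst S 1 \<odot> x = x"
  by (simp add: ucst_one)

lemma cs_zero: "x \<in> carrier M ==> ucst S 0 \<odot> x = \<zero>"
  by (simp add: ucst_zero)

lemma cs_uminus: "x \<in> carrier M ==> ucst S (- c) \<odot> x = \<ominus> (ucst S c \<odot> x)"
  by (rule M.minus_equality[symmetric]) (simp_all flip: cs_add add: cs_zero)

lemma cs_central:
  "u \<in> carrier (UEA S) ==> x \<in> carrier M ==> ucst S c \<odot> (u \<odot> x) = u \<odot> (ucst S c \<odot> x)"
  by (simp flip: lsmult_assoc add: ucst_central)

lemma cs_inverse: "c \<noteq> 0 ==> x \<in> carrier M ==> ucst S (inverse c) \<odot> (ucst S c \<odot> x) = x"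
  by (simp flip: cs_mult add: cs_one)

lemma cs_cancel: "c \<noteq> 0 ==> x \<in> carrier M ==> ucst S c \<odot> x = \<zero> ==> x = \<zero>"
  using cs_inverse[of c x] by simp

lemma ge_add:
  assumes "X \<in> S i" "Y \<in> S i" "x \<in> carrier M"
  shows "ugen S (X + Y) \<odot> x = ugen S X \<odot> x \<oplus> ugen S Y \<odot> x"
  using assms ugen_closed[OF assms(1)] ugen_closed[OF assms(2)]
  by (simp add: ugen_add[OF assms(1,2)] lsmult_l_distr)

lemma ge_scale:
  assumes "X \<in> S i" "x \<in> carrier M"
  shows "ugen S (mat c ** X) \<odot> x = ucst S c \<odot> (ugen S X \<odot> x)"
  using assms ugen_closed[OF assms(1)] by (simp add: ugen_scale[OF assms(1)] lsmult_assoc)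

lemma ge_commute:
  assumes "X \<in> S i" "Y \<in> S j" "x \<in> carrier M"
  shows "ugen S X \<odot> (ugen S Y \<odot> x) =
    ucst S (koszul i j) \<odot> (ugen S Y \<odot> (ugen S X \<odot> x)) \<oplus> ugen S (superbracket i j X Y) \<odot> x"
  using assms ugen_closed[OF assms(1)] ugen_closed[OF assms(2)] ugen_closed[OF S_closed(4)[OF assms(1,2)]]
  by (simp flip: lsmult_assoc lsmult_l_distr add: ugen_commute[OF assms(1,2)] R.m_assoc)

lemma ge_zero: "x \<in> carrier M ==> ugen S 0 \<odot> x = \<zero>"
  by (simp add: ugen_zero)

lemma usubmoduleI:
  assumes H: "subgroup H (add_monoid M)"
    and c: "\<And>c x. x \<in> H ==> ucst S c \<odot> x \<in> H"
    and g: "\<And>X i x. X \<in> S i ==> x \<in> H ==> ugen S X \<odot> x \<in> H"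
  shows "submodule H (UEA S) M"
proof (intro submodule.intro H submodule_axioms.intro)
  fix u x assume "u \<in> carrier (UEA S)" "x \<in> H"
  then show "u \<odot> x \<in> H"
  proof (induction u arbitrary: x rule: UEA_induct)
    case (add u v)
    moreover have "x \<in> carrier M" using add.prems M.add_subgroupD(1)[OF H] by auto
    ultimately show ?case using M.add_subgroupD(4)[OF H] by (simp add: lsmult_l_distr)
  next
    case (mult u v)
    moreover have "x \<in> carrier M" using mult.prems M.add_subgroupD(1)[OF H] by auto
    ultimately show ?case by (simp add: lsmult_assoc)
  qed (auto intro: c g)
qed

lemma submoduleD:
  assumes "submodule H (UEA S) M"
  shows "H \<subseteq> carrier M" "\<zero> \<in> H" "x \<in> H ==> \<ominus> x \<in> H" "x \<in> H ==> y \<in> H ==> x \<oplus> y \<in> H"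
    "x \<in> H ==> y \<in> H ==> x \<ominus> y \<in> H"
    "u \<in> carrier (UEA S) ==> x \<in> H ==> u \<odot> x \<in> H" "X \<in> S i ==> x \<in> H ==> ugen S X \<odot> x \<in> H"
    "x \<in> H ==> ucst S c \<odot> x \<in> H"
proof -
  note D = M.add_subgroupD[OF submodule.axioms(1)[OF assms]]
  note E = submodule.smult_closed[OF assms]
  show "H \<subseteq> carrier M" "\<zero> \<in> H" by (rule D)+
  show "\<ominus> x \<in> H" if "x \<in> H" using that by (rule D)
  show "x \<oplus> y \<in> H" "x \<ominus> y \<in> H" if "x \<in> H" "y \<in> H" using that by (rule D)+
  show "u \<odot> x \<in> H" if "u \<in> carrier (UEA S)" "x \<in> H" using that by (rule E)
  show "ugen S X \<odot> x \<in> H" if "X \<in> S i" "x \<in> H" using ugen_closed[OF that(1)] that(2) by (rule E)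
  show "ucst S c \<odot> x \<in> H" if "x \<in> H" using ucst_closed that by (rule E)
qed

lemma carrier_submodule: "submodule (carrier M) (UEA S) M"
  by (rule usubmoduleI) (auto intro!: M.add_subgroupI ge_closed)

end

lemma left_module_umod: "graded_lie S ==> left_module (UEA S) M ==> umod S M"
  by (simp add: umod_def enveloping_def)

lemma umod_left_module: "umod S M ==> left_module (UEA S) M"
  by (simp add: umod_def)

subsection \<open>Gradings\<close>

lemma is_supermodule_umod: "graded_lie S ==> is_supermodule S M ==> umod S M"
  by (simp add: is_supermodule_def left_module_umod)

text \<open>A homogeneous element of the enveloping algebra is represented by words of one total
  parity, and each letter shifts the parity of a vector by its own. Compatibility with the grading
  therefore follows from the generators.\<close>

lemma is_supermoduleI:
  fixes M :: "('k::field uea, 'b, 'm) supermodule_scheme"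
  assumes "umod S M"
    and sub: "\<And>i. subgroup (gr M i) (add_monoid M)"
    and dec: "\<And>x. x \<in> carrier M ==> \<exists>a\<in>gr M 0. \<exists>b\<in>gr M 1. x = a \<oplus>\<^bsub>M\<^esub> b"
    and int: "\<And>x. x \<in> gr M 0 ==> x \<in> gr M 1 ==> x = (zr M)"
    and c: "\<And>c x i. x \<in> gr M i ==> ucst S c \<odot>\<^bsub>M\<^esub> x \<in> gr M i"
    and g: "\<And>X i x j. X \<in> S i ==> x \<in> gr M j ==> ugen S X \<odot>\<^bsub>M\<^esub> x \<in> gr M (i + j)"
  shows "is_supermodule S M"
proof -
  interpret umod S M by fact
  have "\<exists>!p. fst p \<in> gr M 0 \<and> snd p \<in> gr M 1 \<and> x = fst p \<oplus>\<^bsub>M\<^esub> snd p" if x: "x \<in> carrier M" for x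
  proof -
    obtain a b where ab: "a \<in> gr M 0" "b \<in> gr M 1" "x = a \<oplus>\<^bsub>M\<^esub> b" using dec[OF x] by auto
    show ?thesis
    proof (rule ex1I[of _ "(a, b)"])
      fix p assume p: "fst p \<in> gr M 0 \<and> snd p \<in> gr M 1 \<and> x = fst p \<oplus>\<^bsub>M\<^esub> snd p"
      have cl: "a \<in> carrier M" "b \<in> carrier M" "fst p \<in> carrier M" "snd p \<in> carrier M"
        using ab p M.add_subgroupD(1)[OF sub] by auto
      have eq: "a \<ominus>\<^bsub>M\<^esub> fst p = snd p \<ominus>\<^bsub>M\<^esub> b"
        by (rule M.diff_eq_diffI[OF cl(1,2,3,4)]) (use ab p in simp)
      have "a \<ominus>\<^bsub>M\<^esub> fst p \<in> gr M 0" "snd p \<ominus>\<^bsub>M\<^esub> b \<in> gr M 1"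
        using ab p M.add_subgroupD(5)[OF sub] by auto
      then have "a \<ominus>\<^bsub>M\<^esub> fst p = (zr M)" "snd p \<ominus>\<^bsub>M\<^esub> b = (zr M)"
        using int eq by metis+
      with cl have "a = fst p" "snd p = b" by (auto intro: M.diff_eq_zeroD)
      then show "p = (a, b)" by (simp add: prod_eq_iff)
    qed (use ab in auto)
  qed
  moreover have "u \<odot>\<^bsub>M\<^esub> x \<in> gr M (i + j)" if u: "u \<in> env_gr S i" and x: "x \<in> gr M j" for i j u x
  proof -
    obtain p where p: "u = env_class S p" "\<forall>w \<in> Poly_Mapping.keys p.
       \<exists>ps. list_all2 (\<lambda>X j. X \<in> S j) (letters w) ps \<and> sum_list ps = i"
      using u by (auto simp: env_gr_def)
    have xM: "x \<in> carrier M" using x M.add_subgroupD(1)[OF sub] by auto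
    have word: "Poly_Mapping.single (Word xs) d \<in> carrier (env_free S) \<and>
        env_class S (Poly_Mapping.single (Word xs) d) \<odot>\<^bsub>M\<^esub> x \<in> gr M (sum_list ps + j)"
      if "list_all2 (\<lambda>X j. X \<in> S j) xs ps" for xs ps d
      using that
    proof (induction rule: list_all2_induct)
      case Nil
      then show ?case using c[OF x, of d] by (simp add: fconst_def zero_fword_def carrier_free_algebra)
    next
      case (Cons X xs k ps)
      have f: "fgen X \<in> carrier (env_free S)" using Cons fgen_env_closed by blast
      have e: "Poly_Mapping.single (Word (X # xs)) d = fgen X * Poly_Mapping.single (Word xs) d"
        by (simp add: fgen_def mult_single plus_fword_def)
      show ?case
        unfolding e using Cons f xM g[OF Cons(1), of "env_class S (Poly_Mapping.single (Word xs) d) \<odot>\<^bsub>M\<^esub> x" "sum_list ps + j"]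
        by (simp add: free_algebra_closed env_class_mult lsmult_assoc add.assoc)
    qed
    let ?s = "\<lambda>A. (\<Sum>w\<in>A. Poly_Mapping.single w (Poly_Mapping.lookup p w))"
    have "?s A \<in> carrier (env_free S) \<and> env_class S (?s A) \<odot>\<^bsub>M\<^esub> x \<in> gr M (i + j)"
      if "finite A" "A \<subseteq> Poly_Mapping.keys p" for A
      using that
    proof (induction A)
      case empty
      then show ?case using M.add_subgroupD(2)[OF sub] xM by (simp add: env_class_zero)
    next
      case (insert w A)
      obtain ps where "list_all2 (\<lambda>X j. X \<in> S j) (letters w) ps" "sum_list ps = i"
        using p insert by blast
      with word[of "letters w" ps "Poly_Mapping.lookup p w"] insert xM
      show ?case using M.add_subgroupD(4)[OF sub, of _ "i+j"]
        by (simp add: free_algebra_closed env_class_add lsmult_l_distr)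
    qed
    from this[of "Poly_Mapping.keys p"] show ?thesis
      unfolding p using poly_mapping_eq_sum_single[of p] by simp
  qed
  ultimately show ?thesis
    using sub left_module_axioms by (simp add: is_supermodule_def)
qed

lemma (in enveloping) ucst_gr: "ucst S c \<in> env_gr S 0"
  unfolding env_gr_def fconst_def
  by (rule CollectI, rule exI[of _ "Poly_Mapping.single 0 c"]) (auto intro!: exI[of _ "[]"])

lemma (in enveloping) ugen_gr: "X \<in> S i ==> ugen S X \<in> env_gr S i"
  unfolding env_gr_def fgen_def
  by (rule CollectI, rule exI[of _ "Poly_Mapping.single (Word [X]) 1"]) (auto intro!: exI[of _ "[i]"])

locale usmod = enveloping S
  for S :: "bit \<Rightarrow> 'k::field smat set" and M :: "('k uea, 'b, 'm) supermodule_scheme" (structure) +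
  assumes smod: "is_supermodule S M"
begin

sublocale umod S M
  using smod lie by (simp add: is_supermodule_def left_module_umod)

lemma gr_sub: "subgroup (gr M i) (add_monoid M)"
  using smod by (simp add: is_supermodule_def)

lemmas grD = M.add_subgroupD[OF gr_sub]

lemma gr_carrier: "x \<in> gr M i ==> x \<in> carrier M"
  using grD(1) by blast

lemma gr_act: "u \<in> env_gr S i ==> x \<in> gr M j ==> u \<odot> x \<in> gr M (i + j)"
  using smod by (simp add: is_supermodule_def)

lemma gr_cs: "x \<in> gr M j ==> ucst S c \<odot> x \<in> gr M j"
  using gr_act[OF ucst_gr, of x j c] by (simp)

lemma gr_ge: "X \<in> S i ==> x \<in> gr M j ==> ugen S X \<odot> x \<in> gr M (i + j)"
  by (rule gr_act[OF ugen_gr])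

lemma gr_dec: "x \<in> carrier M ==> \<exists>a\<in>gr M 0. \<exists>b\<in>gr M 1. x = a \<oplus> b"
  using smod unfolding is_supermodule_def by blast

lemma gr_dec': "x \<in> carrier M ==> \<exists>a\<in>gr M i. \<exists>b\<in>gr M (i + 1). x = a \<oplus> b"
  using bit_cases[of i]
proof
  assume "i = 1" "x \<in> carrier M"
  then obtain a b where "a \<in> gr M 0" "b \<in> gr M 1" "x = a \<oplus> b" using gr_dec by blast
  with \<open>i = 1\<close> show ?thesis
    by (intro bexI[of _ b] bexI[of _ a]) (auto simp: M.a_comm gr_carrier)
qed (use gr_dec in simp)

lemma gr_unique:
  assumes "a \<in> gr M i" "b \<in> gr M (i + 1)" "a' \<in> gr M i" "b' \<in> gr M (i + 1)" "a \<oplus> b = a' \<oplus> b'"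
  shows "a = a'" "b = b'"
proof -
  have u: "p = q" if "fst p \<in> gr M 0 \<and> snd p \<in> gr M 1 \<and> x = fst p \<oplus> snd p"
    "fst q \<in> gr M 0 \<and> snd q \<in> gr M 1 \<and> x = fst q \<oplus> snd q" "x \<in> carrier M" for p q x
    using smod that unfolding is_supermodule_def by blast
  have "a = a' \<and> b = b'"
    using bit_cases[of i]
  proof
    assume "i = 0"
    with u[of "(a, b)" "a \<oplus> b" "(a', b')"] assms gr_carrier show ?thesis by simp
  next
    assume "i = 1"
    with u[of "(b, a)" "b \<oplus> a" "(b', a')"] assms gr_carrier M.a_comm show ?thesis by simp
  qed
  then show "a = a'" "b = b'" by auto
qed

lemma gr_disjoint: "x \<in> gr M i ==> x \<in> gr M (i + 1) ==> x = \<zero>"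
  using gr_unique(1)[of x i "\<zero>" "\<zero>" x] grD(2) gr_carrier by simp

end

lemma simple_supermoduleD:
  assumes "simple_supermodule S M"
  shows "is_supermodule S M" "carrier M \<noteq> {(zr M)}"
    "graded_submodule S M H ==> H = {(zr M)} \<or> H = carrier M"
  using assms by (auto simp: simple_supermodule_def)

subsection \<open>Quotients and tensor products\<close>

locale quot = P: abelian_group P for P :: "('a, 'b, 'm) supermodule_scheme" (structure) +
  fixes K
  assumes K: "subgroup K (add_monoid P)"
begin

lemmas KD = P.add_subgroupD[OF K]

lemma asub: "abelian_subgroup K P"
  by (rule abelian_subgroupI3) (use K in \<open>auto simp: additive_subgroup_def P.abelian_group_axioms\<close>)

abbreviation Q where "Q \<equiv> quotient_module P K"

definition cl where "cl x = K +> x"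

lemma carrier_Q: "carrier Q = cl ` carrier P"
  by (auto simp: quotient_module_def A_RCOSETS_def' cl_def)

lemma gr_Q: "gr Q i = cl ` gr P i"
  by (auto simp: quotient_module_def cl_def)

lemma cl_add:
  assumes "x \<in> carrier P" "y \<in> carrier P"
  shows "cl (x \<oplus> y) = cl x \<oplus>\<^bsub>Q\<^esub> cl y"
  using abelian_subgroup.a_rcos_sum[OF asub assms] by (simp add: quotient_module_def cl_def)

lemma cl_eq_iff:
  assumes "x \<in> carrier P" "y \<in> carrier P"
  shows "cl x = cl y \<longleftrightarrow> x \<ominus> y \<in> K"
proof -
  interpret K: abelian_subgroup K P by (rule asub)
  have "x \<ominus> y \<in> K \<longleftrightarrow> x \<in> K +> y"
    using K.a_rcos_module[OF assms(2,1)] by (simp add: a_minus_def)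
  also have "\<dots> \<longleftrightarrow> K +> y = K +> x"
    using P.a_repr_independence[of x K y] assms K K.a_rcos_self[of x] by auto
  finally show ?thesis unfolding cl_def by auto
qed

lemma cl_zero: "cl \<zero> = (zr Q)"
  using P.a_coset_join2[of \<zero> K] K KD(2) by (simp add: cl_def quotient_module_def)

text \<open>Additivity and stability are asked for the single scalar \<open>r\<close>, because the
  record \<open>pre_tensor\<close> satisfies the module axioms only after passing to the
  quotient.\<close>

lemma cl_smult:
  assumes "x \<in> carrier P"
    and closed: "\<And>x. x \<in> carrier P ==> r \<odot> x \<in> carrier P"
    and add: "\<And>x y. [|x \<in> carrier P; y \<in> carrier P|] ==> r \<odot> (x \<oplus> y) = r \<odot> x \<oplus> r \<odot> y"
    and stable: "\<And>x. x \<in> K ==> r \<odot> x \<in> K"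
  shows "cl (r \<odot> x) = r \<odot>\<^bsub>Q\<^esub> cl x"
proof -
  have "K <+>\<^bsub>P\<^esub> ((\<odot>) r ` (K +> x)) = K +> (r \<odot> x)"
  proof (intro equalityI subsetI)
    fix z assume "z \<in> K <+>\<^bsub>P\<^esub> ((\<odot>) r ` (K +> x))"
    then obtain k k' where k: "k \<in> K" "k' \<in> K" "z = k \<oplus> r \<odot> (k' \<oplus> x)"
      by (auto simp: set_add_def' a_r_coset_def')
    then have "z = (k \<oplus> r \<odot> k') \<oplus> r \<odot> x"
      using KD(1) assms(1) closed by (auto simp: add subset_eq P.a_assoc)
    moreover have "k \<oplus> r \<odot> k' \<in> K" using k KD(4) stable by simp
    ultimately show "z \<in> K +> (r \<odot> x)" unfolding a_r_coset_def' by blast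
  next
    fix z assume "z \<in> K +> (r \<odot> x)"
    then obtain k where k: "k \<in> K" "z = k \<oplus> r \<odot> x" by (auto simp: a_r_coset_def')
    then have "z = k \<oplus> r \<odot> (\<zero> \<oplus> x)" using assms(1) by simp
    with k KD(2) show "z \<in> K <+>\<^bsub>P\<^esub> ((\<odot>) r ` (K +> x))"
      unfolding set_add_def' a_r_coset_def' by (intro UN_I[of k] UN_I[of "r \<odot> (\<zero> \<oplus> x)"] imageI UN_I[of \<zero>]) auto
  qed
  then show ?thesis by (simp add: cl_def quotient_module_def)
qed

end

lemma (in left_module) image_additive_subgroup:
  "abelian_group N ==> subgroup H (add_monoid M) ==>
   (\<And>x y. [|x \<in> carrier M; y \<in> carrier M|] ==> f (x \<oplus>\<^bsub>M\<^esub> y) = f x \<oplus>\<^bsub>N\<^esub> f y) ==>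
   (\<And>x. x \<in> carrier M ==> f x \<in> carrier N) ==> subgroup (f ` H) (add_monoid N)"
proof -
  assume N: "abelian_group N" and H: "subgroup H (add_monoid M)"
    and add: "\<And>x y. [|x \<in> carrier M; y \<in> carrier M|] ==> f (x \<oplus>\<^bsub>M\<^esub> y) = f x \<oplus>\<^bsub>N\<^esub> f y"
    and cl: "\<And>x. x \<in> carrier M ==> f x \<in> carrier N"
  interpret N: abelian_group N by fact
  note HD = M.add_subgroupD[OF H]
  have zero: "f (zr M) = (zr N)"
    using add[of "(zr M)" "(zr M)"] cl[of "(zr M)"] by (simp add: N.add.l_cancel_one')
  have neg: "\<ominus>\<^bsub>N\<^esub> f x = f (\<ominus>\<^bsub>M\<^esub> x)" if "x \<in> carrier M" for x
    by (rule N.minus_equality) (use that in \<open>simp_all flip: add add: cl zero M.l_neg\<close>)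
  show ?thesis
  proof (rule N.add_subgroupI)
    show "f ` H \<subseteq> carrier N" using HD(1) cl by auto
    show "(zr N) \<in> f ` H" using HD(2) zero by force
    show "\<ominus>\<^bsub>N\<^esub> x \<in> f ` H" if "x \<in> f ` H" for x
      using that HD(1,3) by (auto simp: neg subset_eq)
    show "x \<oplus>\<^bsub>N\<^esub> y \<in> f ` H" if xy: "x \<in> f ` H" "y \<in> f ` H" for x y
    proof -
      obtain a b where "a \<in> H" "b \<in> H" "x = f a" "y = f b" using xy by auto
      then show ?thesis using HD(1,4) by (auto simp flip: add simp: subset_eq)
    qed
  qed
qed

text \<open>One development serves two purposes: induction from a Borel subalgebra, and the tensor
  product with the bimodule of locally finite maps.\<close>

locale tens = L: left_module U M + N: abelian_group N
  for U :: "('a, 'r) ring_scheme" and M :: "('a, 'b, 'c, 'm) superbimodule_scheme"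
    and N :: "('c, 'd, 'n) supermodule_scheme" and R :: "('c, 's) ring_scheme" +
  assumes rs_closed: "x \<in> carrier M ==> r \<in> carrier R ==> rsmult M x r \<in> carrier M"
    and rs_assoc: "u \<in> carrier U ==> x \<in> carrier M ==> r \<in> carrier R ==>
      u \<odot>\<^bsub>M\<^esub> rsmult M x r = rsmult M (u \<odot>\<^bsub>M\<^esub> x) r"
    and N_closed: "y \<in> carrier N ==> r \<in> carrier R ==> r \<odot>\<^bsub>N\<^esub> y \<in> carrier N"
begin

abbreviation P where "P \<equiv> pre_tensor M N"
definition K where "K = generate (add_monoid P) (tensor_rels R M N)"
abbreviation T where "T \<equiv> tensor R M N"

lemma P_simps:
  "carrier P = {p. Poly_Mapping.keys p \<subseteq> carrier M \<times> carrier N}" "(zr P) = 0" "add P = (+)"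
  "u \<odot>\<^bsub>P\<^esub> p = frag_extend (\<lambda>(x, y). frag_of (u \<odot>\<^bsub>M\<^esub> x, y)) p"
  "gr P k = {p. Poly_Mapping.keys p \<subseteq> (\<Union>i. gr M i \<times> gr N (k + i))}"
  by (simp_all add: pre_tensor_def)

lemma keys_minus: "Poly_Mapping.keys (- p) = Poly_Mapping.keys (p :: 'z \<Rightarrow>\<^sub>0 int)"
  by (auto simp: keys.rep_eq)

lemma abelian_P: "abelian_group P"
proof (rule abelian_groupI)
  fix x y assume "x \<in> carrier P" "y \<in> carrier P"
  then show "x \<oplus>\<^bsub>P\<^esub> y \<in> carrier P"
    using Poly_Mapping.keys_add[of x y] by (auto simp: P_simps)
next
  fix x assume "x \<in> carrier P"
  then show "\<exists>y\<in>carrier P. y \<oplus>\<^bsub>P\<^esub> x = (zr P)"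
    by (intro bexI[of _ "- x"]) (auto simp: P_simps keys_minus)
qed (auto simp: P_simps add_ac)

lemma P_closed: "p \<in> carrier P ==> q \<in> carrier P ==> p + q \<in> carrier P"
    "p \<in> carrier P ==> q \<in> carrier P ==> p - q \<in> carrier P" "p \<in> carrier P ==> - p \<in> carrier P"
    "x \<in> carrier M ==> y \<in> carrier N ==> frag_of (x, y) \<in> carrier P" "0 \<in> carrier P"
  using Poly_Mapping.keys_add[of p q] Poly_Mapping.keys_diff[of p q]
  by (auto simp: P_simps keys_minus)

lemma P_inv: "p \<in> carrier P ==> \<ominus>\<^bsub>P\<^esub> p = - p"
  by (rule abelian_group.minus_equality[OF abelian_P]) (auto simp: P_simps keys_minus)

lemma P_minus: "q \<in> carrier P ==> p \<ominus>\<^bsub>P\<^esub> q = p - q"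
  by (simp add: a_minus_def P_inv) (simp add: P_simps)

lemma rels_closed: "tensor_rels R M N \<subseteq> carrier P"
  unfolding tensor_rels_def by (auto intro!: P_closed rs_closed N_closed)

lemma K_sub: "subgroup K (add_monoid P)"
  unfolding K_def by (rule group.generate_is_subgroup)
    (use abelian_P rels_closed in \<open>auto simp: abelian_group.a_group\<close>)

lemma K_incl: "z \<in> tensor_rels R M N ==> z \<in> K"
  unfolding K_def by (rule generate.incl)

sublocale quot P K
  by (simp add: quot_def quot_axioms_def abelian_P K_sub)

lemma T_eq: "T = Q"
  by (simp add: tensor_def K_def)

lemma P_smult_frag: "u \<odot>\<^bsub>P\<^esub> frag_of (x, y) = frag_of (u \<odot>\<^bsub>M\<^esub> x, y)"
  by (simp add: P_simps)

lemma P_smult_closed: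
  assumes "u \<in> carrier U" "p \<in> carrier P"
  shows "u \<odot>\<^bsub>P\<^esub> p \<in> carrier P"
  using assms keys_frag_extend[of "\<lambda>(x, y). frag_of (u \<odot>\<^bsub>M\<^esub> x, y)" p]
  by (fastforce simp: P_simps split: prod.splits if_splits)

lemma P_smult_add: "u \<odot>\<^bsub>P\<^esub> (p + q) = u \<odot>\<^bsub>P\<^esub> p + u \<odot>\<^bsub>P\<^esub> q"
  by (simp add: P_simps frag_extend_add)

lemma P_smult_diff: "u \<odot>\<^bsub>P\<^esub> (p - q) = u \<odot>\<^bsub>P\<^esub> p - u \<odot>\<^bsub>P\<^esub> q"
  by (simp add: P_simps frag_extend_diff)

text \<open>Left multiplication turns each relation into one of the same kind, the balancing
  relation because the two actions on \<open>M\<close> commute. This is why the left action descends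
  to the tensor product.\<close>

lemma rels_stable:
  assumes u: "u \<in> carrier U" and z: "z \<in> tensor_rels R M N"
  shows "u \<odot>\<^bsub>P\<^esub> z \<in> tensor_rels R M N"
  using z unfolding tensor_rels_def
proof (elim UnE CollectE exE conjE, goal_cases)
  case (1 x x' y)
  then show ?case
    unfolding 1(1) P_smult_diff P_smult_frag L.lsmult_r_distr[OF u 1(2,3)]
    using u L.lsmult_closed by blast
next
  case (2 x y y')
  then show ?case
    unfolding 2(1) P_smult_diff P_smult_frag using u L.lsmult_closed by blast
next
  case (3 x r y)
  then show ?case
    unfolding 3(1) P_smult_diff P_smult_frag rs_assoc[OF u 3(2,3)] using u L.lsmult_closed by blast
qed

lemma K_stable:
  assumes u: "u \<in> carrier U" and z: "z \<in> K"
  shows "u \<odot>\<^bsub>P\<^esub> z \<in> K"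
  using z[unfolded K_def]
proof (induction rule: generate.induct)
  case one
  have "u \<odot>\<^bsub>P\<^esub> 0 = 0" by (simp add: P_simps)
  then show ?case using KD(2) by (simp add: P_simps)
next
  case (incl h)
  then show ?case using rels_stable[OF u] by (blast intro: K_incl)
next
  case (inv h)
  then have h: "h \<in> carrier P" using rels_closed by auto
  then have "inv\<^bsub>add_monoid P\<^esub> h = - h" using P_inv[OF h] by (simp add: a_inv_def)
  then have "u \<odot>\<^bsub>P\<^esub> inv\<^bsub>add_monoid P\<^esub> h = - (u \<odot>\<^bsub>P\<^esub> h)" by (simp add: P_simps frag_extend_minus)
  also have "\<dots> = \<ominus>\<^bsub>P\<^esub> (u \<odot>\<^bsub>P\<^esub> h)" using P_smult_closed[OF u h] by (simp add: P_inv)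
  finally show ?case using KD(3) rels_stable[OF u inv] K_incl by metis
next
  case (eng h1 h2)
  then show ?case using KD(4) by (simp add: P_simps(3) P_smult_add)
qed

definition tn where "tn x y = cl (frag_of (x, y))"

lemma tn_closed: "x \<in> carrier M ==> y \<in> carrier N ==> tn x y \<in> carrier T"
  unfolding T_eq carrier_Q tn_def by (rule imageI, rule P_closed)

lemma cl_diff_zero:
  assumes "a \<in> carrier P" "b \<in> carrier P" "c \<in> carrier P" "a - b - c \<in> tensor_rels R M N"
  shows "cl a = cl b \<oplus>\<^bsub>T\<^esub> cl c"
proof -
  have "a \<ominus>\<^bsub>P\<^esub> (b + c) \<in> K"
    using assms P_minus[OF P_closed(1)[OF assms(2,3)]] by (simp add: diff_diff_eq K_incl)
  then have "cl a = cl (b \<oplus>\<^bsub>P\<^esub> c)" using cl_eq_iff[OF assms(1), of "b + c"] assms P_closed(1)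
    by (simp add: P_simps(3))
  then show ?thesis using cl_add assms T_eq by simp
qed

lemma tn_addl:
  assumes "x \<in> carrier M" "x' \<in> carrier M" "y \<in> carrier N"
  shows "tn (x \<oplus>\<^bsub>M\<^esub> x') y = tn x y \<oplus>\<^bsub>T\<^esub> tn x' y"
  unfolding tn_def
  by (rule cl_diff_zero) (use assms in \<open>auto intro!: P_closed simp: tensor_rels_def\<close>)

lemma tn_addr:
  assumes "x \<in> carrier M" "y \<in> carrier N" "y' \<in> carrier N"
  shows "tn x (y \<oplus>\<^bsub>N\<^esub> y') = tn x y \<oplus>\<^bsub>T\<^esub> tn x y'"
  unfolding tn_def
  by (rule cl_diff_zero) (use assms in \<open>auto intro!: P_closed simp: tensor_rels_def\<close>)

lemma tn_bal:
  assumes "x \<in> carrier M" "r \<in> carrier R" "y \<in> carrier N"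
  shows "tn (rsmult M x r) y = tn x (r \<odot>\<^bsub>N\<^esub> y)"
proof -
  have c: "frag_of (rsmult M x r, y) \<in> carrier P" "frag_of (x, r \<odot>\<^bsub>N\<^esub> y) \<in> carrier P"
    using assms by (auto intro!: P_closed rs_closed N_closed)
  have "frag_of (rsmult M x r, y) - frag_of (x, r \<odot>\<^bsub>N\<^esub> y) \<in> tensor_rels R M N"
    using assms unfolding tensor_rels_def by blast
  then show ?thesis unfolding tn_def cl_eq_iff[OF c] P_minus[OF c(2)] by (rule K_incl)
qed

lemma cl_smult_T: "u \<in> carrier U ==> p \<in> carrier P ==> cl (u \<odot>\<^bsub>P\<^esub> p) = u \<odot>\<^bsub>T\<^esub> cl p"
  unfolding T_eq using P_smult_add K_stable P_smult_closed
  by (intro cl_smult) (simp_all add: P_simps(3))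

lemma tn_smult:
  "u \<in> carrier U ==> x \<in> carrier M ==> y \<in> carrier N ==> u \<odot>\<^bsub>T\<^esub> tn x y = tn (u \<odot>\<^bsub>M\<^esub> x) y"
  unfolding tn_def by (simp flip: cl_smult_T P_smult_frag add: P_closed)

lemma abelian_T: "abelian_group T"
proof (rule abelian_groupI)
  fix x y assume "x \<in> carrier T" "y \<in> carrier T"
  then obtain a b where "a \<in> carrier P" "b \<in> carrier P" "x = cl a" "y = cl b"
    by (auto simp: T_eq carrier_Q)
  then show "x \<oplus>\<^bsub>T\<^esub> y \<in> carrier T" "x \<oplus>\<^bsub>T\<^esub> y = y \<oplus>\<^bsub>T\<^esub> x"
    by (simp_all add: T_eq carrier_Q flip: cl_add) (auto simp: abelian_monoid.a_comm[OF abelian_group.axioms(1)[OF abelian_P]])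
next
  fix x y z assume "x \<in> carrier T" "y \<in> carrier T" "z \<in> carrier T"
  then obtain a b c where "a \<in> carrier P" "b \<in> carrier P" "c \<in> carrier P" "x = cl a" "y = cl b" "z = cl c"
    by (auto simp: T_eq carrier_Q)
  then show "x \<oplus>\<^bsub>T\<^esub> y \<oplus>\<^bsub>T\<^esub> z = x \<oplus>\<^bsub>T\<^esub> (y \<oplus>\<^bsub>T\<^esub> z)"
    by (simp add: T_eq P.a_assoc flip: cl_add)
next
  show "(zr T) \<in> carrier T" by (auto simp: T_eq carrier_Q simp flip: cl_zero)
next
  fix x assume "x \<in> carrier T"
  then obtain a where a: "a \<in> carrier P" "x = cl a"
    by (auto simp: T_eq carrier_Q)
  then show "(zr T) \<oplus>\<^bsub>T\<^esub> x = x" by (simp add: T_eq flip: cl_zero cl_add)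
  show "\<exists>y\<in>carrier T. y \<oplus>\<^bsub>T\<^esub> x = (zr T)"
    using a by (intro bexI[of _ "cl (\<ominus>\<^bsub>P\<^esub> a)"])
      (simp_all add: T_eq carrier_Q P.l_neg flip: cl_zero cl_add)
qed

sublocale TT: abelian_group T by (rule abelian_T)

lemma tn_zero: "y \<in> carrier N ==> tn (zr M) y = (zr T)"
  using tn_addl[of "(zr M)" "(zr M)" y] tn_closed[of "(zr M)" y] by (simp add: TT.add.l_cancel_one')

lemma tn_zero_right: "x \<in> carrier M ==> tn x (zr N) = (zr T)"
  using tn_addr[of x "(zr N)" "(zr N)"] tn_closed[of x "(zr N)"] by (simp add: TT.add.l_cancel_one')

lemma cl_minus_frag:
  assumes "x \<in> carrier M" "y \<in> carrier N"
  shows "cl (- frag_of (x, y)) = tn (\<ominus>\<^bsub>M\<^esub> x) y"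
proof -
  have c: "frag_of (x, y) \<in> carrier P" "- frag_of (x, y) \<in> carrier P"
    using assms by (auto intro!: P_closed)
  have "cl (- frag_of (x, y)) \<oplus>\<^bsub>T\<^esub> tn x y = (zr T)"
    unfolding tn_def T_eq cl_add[OF c(2,1), symmetric] by (simp add: P_simps(3) flip: cl_zero) (simp add: P_simps)
  moreover have "tn (\<ominus>\<^bsub>M\<^esub> x) y \<oplus>\<^bsub>T\<^esub> tn x y = (zr T)"
    using assms by (simp flip: tn_addl add: L.M.l_neg tn_zero)
  moreover have "cl (- frag_of (x, y)) \<in> carrier T" using c by (simp add: T_eq carrier_Q)
  ultimately show ?thesis using assms tn_closed by (metis L.M.a_inv_closed TT.minus_equality TT.minus_minus)
qed

text \<open>Induction on a free abelian group passes through differences, whereas \<open>A\<close>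
  is closed under sums only. The claim is therefore proved for \<open>p\<close> and
  \<open>- p\<close> together, and \<open>cl_minus_frag\<close> moves the sign into the left
  factor.\<close>

lemma cl_span:
  assumes p: "Poly_Mapping.keys p \<subseteq> S" and S: "S \<subseteq> carrier M \<times> carrier N"
    and z: "A (zr T)"
    and t: "\<And>x y. (x, y) \<in> S ==> A (tn x y)" and m: "\<And>x y. (x, y) \<in> S ==> A (tn (\<ominus>\<^bsub>M\<^esub> x) y)"
    and a: "\<And>a b. [|a \<in> carrier T; b \<in> carrier T; A a; A b|] ==> A (a \<oplus>\<^bsub>T\<^esub> b)"
  shows "A (cl p)"
proof -
  have "A (cl p) \<and> A (cl (- p)) \<and> p \<in> carrier P"
    using p
  proof (induction rule: free_Abelian_group_induct[consumes 1, case_names zero diff frag])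
    case zero
    then show ?case using z cl_zero by (simp add: T_eq P_simps)
  next
    case (diff x y)
    then have c: "x \<in> carrier P" "y \<in> carrier P" "- x \<in> carrier P" "- y \<in> carrier P"
      by (auto intro: P_closed)
    have "x - y = x \<oplus>\<^bsub>P\<^esub> - y" "- (x - y) = - x \<oplus>\<^bsub>P\<^esub> y" by (simp_all add: P_simps)
    with diff c show ?case
      by (simp only: cl_add) (auto simp: carrier_Q T_eq intro!: a[unfolded T_eq] P_closed simp flip: P_simps(3) simp del: P_simps(3))
  next
    case (frag q)
    obtain x y where q: "q = (x, y)" by (cases q)
    with frag S have "x \<in> carrier M" "y \<in> carrier N" by auto
    with frag q show ?case
      using t m by (simp add: cl_minus_frag P_closed flip: tn_def)
  qed
  then show ?thesis by simp
qed

lemma T_induct [consumes 1, case_names tn add]: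
  assumes z: "z \<in> carrier T"
    and t: "\<And>x y. [|x \<in> carrier M; y \<in> carrier N|] ==> A (tn x y)"
    and a: "\<And>a b. [|a \<in> carrier T; b \<in> carrier T; A a; A b|] ==> A (a \<oplus>\<^bsub>T\<^esub> b)"
  shows "A z"
proof -
  obtain p where "p \<in> carrier P" "z = cl p" using z by (auto simp: T_eq carrier_Q)
  moreover have "A (zr T)" using t[of "(zr M)" "(zr N)"] by (simp add: tn_zero)
  ultimately show ?thesis
    using cl_span[of p "carrier M \<times> carrier N" A] t a by (auto simp: P_simps)
qed

lemma T_gr_induct [consumes 1, case_names zero tn add]:
  assumes z: "z \<in> gr T k"
    and sub: "\<And>i. subgroup (gr M i) (add_monoid M)" "\<And>i. gr N i \<subseteq> carrier N"
    and 0: "A (zr T)"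
    and t: "\<And>i x y. [|x \<in> gr M i; y \<in> gr N (k + i)|] ==> A (tn x y)"
    and a: "\<And>a b. [|a \<in> carrier T; b \<in> carrier T; A a; A b|] ==> A (a \<oplus>\<^bsub>T\<^esub> b)"
  shows "A z"
proof -
  note D = L.M.add_subgroupD[OF sub(1)]
  obtain p where p: "p \<in> gr P k" "z = cl p" using z by (auto simp: T_eq gr_Q)
  show ?thesis unfolding p
  proof (rule cl_span[where S = "\<Union>i. gr M i \<times> gr N (k + i)", OF _ _ 0 _ _ a])
    show "Poly_Mapping.keys p \<subseteq> (\<Union>i. gr M i \<times> gr N (k + i))" using p by (simp add: P_simps)
    show "(\<Union>i. gr M i \<times> gr N (k + i)) \<subseteq> carrier M \<times> carrier N" using D(1) sub(2) by fast
    fix x y assume "(x, y) \<in> (\<Union>i. gr M i \<times> gr N (k + i))"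
    then obtain i where i: "x \<in> gr M i" "y \<in> gr N (k + i)" by auto
    then show "A (tn x y)" "A (tn (\<ominus>\<^bsub>M\<^esub> x) y)" using t D(3) by blast+
  qed
qed

lemma tn_gr: "x \<in> gr M i ==> y \<in> gr N (k + i) ==> tn x y \<in> gr T k"
  unfolding T_eq gr_Q tn_def by (rule imageI) (auto simp: P_simps)

lemma T_gr_add:
  assumes "\<And>i. gr M i \<subseteq> carrier M" "\<And>i. gr N i \<subseteq> carrier N" "a \<in> gr T k" "b \<in> gr T k"
  shows "a \<oplus>\<^bsub>T\<^esub> b \<in> gr T k"
proof -
  obtain p q where pq: "p \<in> gr P k" "q \<in> gr P k" "a = cl p" "b = cl q"
    using assms(3,4) by (auto simp: T_eq gr_Q)
  have "gr P k \<subseteq> carrier P" using assms(1,2) by (force simp: P_simps)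
  with pq have "a \<oplus>\<^bsub>T\<^esub> b = cl (p + q)" using cl_add[of p q] by (auto simp: T_eq P_simps(3))
  moreover have "p + q \<in> gr P k"
    using pq(1,2) Poly_Mapping.keys_add[of p q] by (force simp: P_simps)
  ultimately show ?thesis by (simp add: T_eq gr_Q)
qed

lemma T_smult:
  assumes u: "u \<in> carrier U" and "v \<in> carrier T"
  shows "u \<odot>\<^bsub>T\<^esub> v \<in> carrier T"
    "w \<in> carrier T ==> u \<odot>\<^bsub>T\<^esub> (v \<oplus>\<^bsub>T\<^esub> w) = u \<odot>\<^bsub>T\<^esub> v \<oplus>\<^bsub>T\<^esub> u \<odot>\<^bsub>T\<^esub> w"
proof -
  obtain p where p: "p \<in> carrier P" "v = cl p"
    using assms by (auto simp: T_eq carrier_Q)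
  note up = P_smult_closed[OF u p(1)]
  show "u \<odot>\<^bsub>T\<^esub> v \<in> carrier T"
    unfolding p(2) cl_smult_T[OF u p(1), symmetric] unfolding T_eq carrier_Q using up by (rule imageI)
  assume "w \<in> carrier T"
  then obtain q where q: "q \<in> carrier P" "w = cl q" by (auto simp: T_eq carrier_Q)
  note uq = P_smult_closed[OF u q(1)]
  have "cl (u \<odot>\<^bsub>P\<^esub> (p + q)) = cl (u \<odot>\<^bsub>P\<^esub> p) \<oplus>\<^bsub>T\<^esub> cl (u \<odot>\<^bsub>P\<^esub> q)"
    using cl_add[OF up uq] unfolding P_smult_add T_eq P_simps(3) .
  moreover have "v \<oplus>\<^bsub>T\<^esub> w = cl (p + q)"
    using cl_add[OF p(1) q(1)] unfolding T_eq P_simps(3) p q by simp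
  ultimately show "u \<odot>\<^bsub>T\<^esub> (v \<oplus>\<^bsub>T\<^esub> w) = u \<odot>\<^bsub>T\<^esub> v \<oplus>\<^bsub>T\<^esub> u \<odot>\<^bsub>T\<^esub> w"
    using cl_smult_T[OF u] p q P_closed(1) by simp
qed

lemma left_module_T: "left_module U T"
proof (intro left_module.intro L.R.ring_axioms abelian_T left_module_axioms.intro)
  fix a z assume a: "a \<in> carrier U" "z \<in> carrier T"
  then show "a \<odot>\<^bsub>T\<^esub> z \<in> carrier T" by (rule T_smult)
  fix w assume "w \<in> carrier T"
  with a show "a \<odot>\<^bsub>T\<^esub> (z \<oplus>\<^bsub>T\<^esub> w) = a \<odot>\<^bsub>T\<^esub> z \<oplus>\<^bsub>T\<^esub> a \<odot>\<^bsub>T\<^esub> w" by (simp add: T_smult)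
next
  fix z assume "z \<in> carrier T"
  then show "\<one>\<^bsub>U\<^esub> \<odot>\<^bsub>T\<^esub> z = z"
  proof -
    obtain p where "p \<in> carrier P" "z = cl p" using \<open>z \<in> carrier T\<close> by (auto simp: T_eq carrier_Q)
    moreover from this(1) have "\<one>\<^bsub>U\<^esub> \<odot>\<^bsub>P\<^esub> p = frag_extend frag_of p"
      unfolding P_simps(4) by (intro frag_extend_eq) (auto simp: P_simps)
    ultimately show ?thesis by (simp flip: cl_smult_T frag_expansion)
  qed
next
  fix a b z assume ab: "a \<in> carrier U" "b \<in> carrier U" "z \<in> carrier T"
  then obtain p where p: "p \<in> carrier P" "z = cl p" by (auto simp: T_eq carrier_Q)
  have "(a \<otimes>\<^bsub>U\<^esub> b) \<odot>\<^bsub>P\<^esub> p = a \<odot>\<^bsub>P\<^esub> (b \<odot>\<^bsub>P\<^esub> p)"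
  proof -
    have "a \<odot>\<^bsub>P\<^esub> (b \<odot>\<^bsub>P\<^esub> p) = frag_extend ((\<lambda>(x, y). frag_of (a \<odot>\<^bsub>M\<^esub> x, y)) \<circ> (\<lambda>(x, y). (b \<odot>\<^bsub>M\<^esub> x, y))) p"
      unfolding P_simps(4) by (subst frag_extend_compose[symmetric]) (simp add: o_def case_prod_unfold)
    also have "\<dots> = (a \<otimes>\<^bsub>U\<^esub> b) \<odot>\<^bsub>P\<^esub> p"
      unfolding P_simps(4) using p ab by (intro frag_extend_eq) (auto simp: P_simps L.lsmult_assoc)
    finally show ?thesis by simp
  qed
  with p ab show "(a \<otimes>\<^bsub>U\<^esub> b) \<odot>\<^bsub>T\<^esub> z = a \<odot>\<^bsub>T\<^esub> (b \<odot>\<^bsub>T\<^esub> z)"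
    by (simp flip: cl_smult_T add: P_smult_closed)
  show "(a \<oplus>\<^bsub>U\<^esub> b) \<odot>\<^bsub>T\<^esub> z = a \<odot>\<^bsub>T\<^esub> z \<oplus>\<^bsub>T\<^esub> b \<odot>\<^bsub>T\<^esub> z"
    using ab(3)
  proof (induction rule: T_induct)
    case (tn x y)
    with ab show ?case by (simp add: tn_smult L.lsmult_l_distr tn_addl)
  next
    case (add v w)
    with ab show ?case by (simp add: T_smult TT.a_ac)
  qed
qed

text \<open>The map extends to the free abelian group on pairs; biadditivity and balancing say that
  the extension kills the relations, hence the subgroup generated by them.\<close>

lemma T_universal:
  assumes "abelian_group G"
    and cl: "\<And>x y. [|x \<in> carrier M; y \<in> carrier N|] ==> f x y \<in> carrier G"
    and l: "\<And>x x' y. [|x \<in> carrier M; x' \<in> carrier M; y \<in> carrier N|] ==> f (x \<oplus>\<^bsub>M\<^esub> x') y = f x y \<oplus>\<^bsub>G\<^esub> f x' y"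
    and r: "\<And>x y y'. [|x \<in> carrier M; y \<in> carrier N; y' \<in> carrier N|] ==> f x (y \<oplus>\<^bsub>N\<^esub> y') = f x y \<oplus>\<^bsub>G\<^esub> f x y'"
    and b: "\<And>x r y. [|x \<in> carrier M; r \<in> carrier R; y \<in> carrier N|] ==> f (rsmult M x r) y = f x (r \<odot>\<^bsub>N\<^esub> y)"
  obtains h where "\<And>z. z \<in> carrier T ==> h z \<in> carrier G"
    "\<And>z w. [|z \<in> carrier T; w \<in> carrier T|] ==> h (z \<oplus>\<^bsub>T\<^esub> w) = h z \<oplus>\<^bsub>G\<^esub> h w"
    "\<And>x y. [|x \<in> carrier M; y \<in> carrier N|] ==> h (tn x y) = f x y"
proof -
  interpret G: abelian_group G by fact
  have "(\<lambda>(x, y). f x y) ` (carrier M \<times> carrier N) \<subseteq> carrier (add_monoid G)"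
    using cl by auto
  then obtain h where h: "h \<in> hom (free_Abelian_group (carrier M \<times> carrier N)) (add_monoid G)"
    "\<And>x. x \<in> carrier M \<times> carrier N ==> h (frag_of x) = (\<lambda>(x, y). f x y) x"
    using comm_group.free_Abelian_group_universal[OF G.a_comm_group] by metis
  have hc: "h p \<in> carrier G" if "p \<in> carrier P" for p
    using h(1) that by (auto simp: hom_def P_simps)
  have ha: "h (p + q) = h p \<oplus>\<^bsub>G\<^esub> h q" if "p \<in> carrier P" "q \<in> carrier P" for p q
    using h(1) that by (auto simp: hom_def P_simps)
  have h0: "h 0 = (zr G)" using ha[of 0 0] hc[of 0] P_closed(5) by (simp add: G.add.l_cancel_one')
  have hm: "h (- p) = \<ominus>\<^bsub>G\<^esub> h p" if "p \<in> carrier P" for p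
    using ha[of "- p" p] that hc P_closed(3) h0 by (metis G.minus_equality add.left_inverse)
  have hd: "h (p - q) = h p \<ominus>\<^bsub>G\<^esub> h q" if "p \<in> carrier P" "q \<in> carrier P" for p q
    using ha[of p "- q"] that hm P_closed(3) by (simp add: a_minus_def)
  have z: "a = b \<oplus>\<^bsub>G\<^esub> c ==> b \<in> carrier G ==> c \<in> carrier G ==> a \<ominus>\<^bsub>G\<^esub> b \<ominus>\<^bsub>G\<^esub> c = (zr G)" for a b c
    by (simp add: G.a_comm[of b c] a_minus_def G.a_assoc G.r_neg2 G.r_neg)
  have rel: "h z = (zr G)" if "z \<in> tensor_rels R M N" for z
    using that unfolding tensor_rels_def
  proof (elim UnE CollectE exE conjE, goal_cases)
    case (1 x x' y)
    then show ?case
      by (simp add: hd P_closed h(2) z cl l)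
  next
    case (2 x y y')
    then show ?case
      by (simp add: hd P_closed h(2) z cl r)
  next
    case (3 x r y)
    then show ?case
      using cl[OF 3(2) N_closed[OF 3(4,3)]]
      by (simp add: hd P_closed h(2) rs_closed N_closed b a_minus_def G.r_neg)
  qed
  have hK: "h z = (zr G)" if "z \<in> K" for z
  proof -
    have "z \<in> carrier P \<and> h z = (zr G)" using that[unfolded K_def]
    proof (induction rule: generate.induct)
      case one
      then show ?case using h0 by (simp add: P_simps)
    next
      case (incl x)
      then show ?case using rel rels_closed by auto
    next
      case (inv x)
      then have x: "x \<in> carrier P" using rels_closed by auto
      then have "inv\<^bsub>add_monoid P\<^esub> x = - x" using P_inv[OF x] by (simp add: a_inv_def)
      then show ?case using rel[OF inv] hm[OF x] P_closed(3)[OF x] by simp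
    next
      case (eng x y)
      then show ?case using ha P_closed(1) by (simp add: P_simps(3))
    qed
    then show ?thesis by simp
  qed
  \<comment> \<open>The value on a coset is taken at an arbitrary representative; \<open>hK\<close>
    makes the choice immaterial.\<close>
  define h' where "h' z = h (SOME p. p \<in> carrier P \<and> cl p = z)" for z
  have h': "h' (cl p) = h p" if p: "p \<in> carrier P" for p
  proof -
    let ?q = "SOME q. q \<in> carrier P \<and> cl q = cl p"
    have q: "?q \<in> carrier P \<and> cl ?q = cl p" by (rule someI[of _ p]) (use p in auto)
    then have "?q - p \<in> K" using cl_eq_iff[of ?q p] P_minus[OF p] p by simp
    then have "h ?q \<ominus>\<^bsub>G\<^esub> h p = (zr G)" using hK hd[of ?q p] q p by simp
    then show ?thesis unfolding h'_def by (rule G.diff_eq_zeroD[OF hc[OF conjunct1[OF q]] hc[OF p]])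
  qed
  show thesis
  proof (rule that[of h'])
    fix z assume "z \<in> carrier T"
    then obtain p where p: "p \<in> carrier P" "z = cl p" by (auto simp: T_eq carrier_Q)
    then show "h' z \<in> carrier G" by (simp add: h' hc)
    fix w assume "w \<in> carrier T"
    then obtain q where q: "q \<in> carrier P" "w = cl q" by (auto simp: T_eq carrier_Q)
    with p show "h' (z \<oplus>\<^bsub>T\<^esub> w) = h' z \<oplus>\<^bsub>G\<^esub> h' w"
      using cl_add[of p q] h'[OF P_closed(1)[of p q]] by (simp add: T_eq P_simps(3) h' ha)
  next
    fix x y assume "x \<in> carrier M" "y \<in> carrier N"
    then show "h' (tn x y) = f x y" by (simp add: tn_def h' h(2) P_closed)
  qed
qed

end

subsection \<open>Modules from representations\<close>

definition word_act :: "('k::field \<Rightarrow> 'v \<Rightarrow> 'v) \<Rightarrow> ('k smat \<Rightarrow> 'v \<Rightarrow> 'v) \<Rightarrow> ('k smat fword \<Rightarrow>\<^sub>0 'k) \<Rightarrow> 'v \<Rightarrow> 'v::ab_group_add" where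
  "word_act sc \<rho> p x = (\<Sum>w\<in>Poly_Mapping.keys p. sc (Poly_Mapping.lookup p w) (foldr \<rho> (letters w) x))"

text \<open>The analogue of \<open>rep_module\<close> for operators on an arbitrary vector space.
  The Verma modules live on polynomials, which finite matrices do not cover.\<close>

definition rep_mod :: "('k::field \<Rightarrow> 'v \<Rightarrow> 'v) \<Rightarrow> ('k smat \<Rightarrow> 'v \<Rightarrow> 'v) \<Rightarrow> (bit \<Rightarrow> 'v set) \<Rightarrow>
    ('k uea, 'v::ab_group_add) supermodule" where
  "rep_mod sc \<rho> G = \<lparr>carrier = UNIV, mult = undefined, one = undefined, ring.zero = 0, add = (+),
     smult = (\<lambda>C x. the_elem ((\<lambda>p. word_act sc \<rho> p x) ` C)), gr = G\<rparr>"

locale lrep = enveloping S + V: vector_space sc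
  for S :: "bit \<Rightarrow> 'k::field smat set" and sc :: "'k \<Rightarrow> 'v::ab_group_add \<Rightarrow> 'v" +
  fixes \<rho> :: "'k smat \<Rightarrow> 'v \<Rightarrow> 'v"
  assumes rho_add: "\<rho> X (x + y) = \<rho> X x + \<rho> X y"
    and rho_sc: "\<rho> X (sc c x) = sc c (\<rho> X x)"
    and rho_gen_add: "X \<in> S i ==> Y \<in> S i ==> \<rho> (X + Y) x = \<rho> X x + \<rho> Y x"
    and rho_gen_sc: "X \<in> S i ==> \<rho> (mat c ** X) x = sc c (\<rho> X x)"
    and rho_bracket: "X \<in> S i ==> Y \<in> S j ==>
      \<rho> X (\<rho> Y x) = sc (koszul i j) (\<rho> Y (\<rho> X x)) + \<rho> (superbracket i j X Y) x"
begin

abbreviation wa where "wa \<equiv> word_act sc \<rho>"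

lemma rho_zero: "\<rho> X 0 = 0"
  using rho_add[of X 0 0] by simp

lemma rho_sum: "\<rho> X (\<Sum>i\<in>A. f i) = (\<Sum>i\<in>A. \<rho> X (f i))"
  by (induction A rule: infinite_finite_induct) (simp_all add: rho_zero rho_add)

lemma foldr_add: "foldr \<rho> w (x + y) = foldr \<rho> w x + foldr \<rho> w y"
  by (induction w) (simp_all add: rho_add)

lemma foldr_sc: "foldr \<rho> w (sc c x) = sc c (foldr \<rho> w x)"
  by (induction w) (simp_all add: rho_sc)

lemma foldr_sum: "foldr \<rho> w (\<Sum>i\<in>A. f i) = (\<Sum>i\<in>A. foldr \<rho> w (f i))"
  by (induction w) (simp_all add: rho_sum)

lemma wa_superset:
  assumes "finite A" "Poly_Mapping.keys p \<subseteq> A"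
  shows "wa p x = (\<Sum>w\<in>A. sc (Poly_Mapping.lookup p w) (foldr \<rho> (letters w) x))"
  unfolding word_act_def
  by (rule sum.mono_neutral_left) (use assms in \<open>auto simp: in_keys_iff\<close>)

lemma wa_add: "wa (p + q) x = wa p x + wa q x"
proof -
  let ?A = "Poly_Mapping.keys p \<union> Poly_Mapping.keys q"
  show ?thesis
    using Poly_Mapping.keys_add[of p q]
    by (simp add: wa_superset[of ?A] lookup_add V.scale_left_distrib sum.distrib)
qed

lemma wa_right_add: "wa p (x + y) = wa p x + wa p y"
  by (simp add: word_act_def foldr_add V.scale_right_distrib sum.distrib)

lemma wa_zero: "wa 0 x = 0"
  by (simp add: word_act_def)

lemma wa_minus: "wa (p - q) x = wa p x - wa q x"
  using wa_add[of "p - q" q x] by simp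

lemma wa_single: "wa (Poly_Mapping.single w c) x = sc c (foldr \<rho> (letters w) x)"
  by (simp add: word_act_def)

lemma wa_sum: "wa (\<Sum>i\<in>A. f i) x = (\<Sum>i\<in>A. wa (f i) x)"
  by (induction A rule: infinite_finite_induct) (simp_all add: wa_zero wa_add)

lemma wa_mult: "wa (p * q) x = wa p (wa q x)"
proof -
  have 1: "wa (Poly_Mapping.single v c * q) x = sc c (foldr \<rho> (letters v) (wa q x))" for v c
  proof -
    have "Poly_Mapping.single v c * q =
        (\<Sum>w\<in>Poly_Mapping.keys q. Poly_Mapping.single (v + w) (c * Poly_Mapping.lookup q w))"
      by (subst poly_mapping_eq_sum_single[of q]) (simp add: sum_distrib_left mult_single)
    then show ?thesis
      by (simp add: wa_sum wa_single word_act_def[of sc \<rho> q] foldr_sum foldr_sc V.scale_sum_right)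
  qed
  have "p * q = (\<Sum>v\<in>Poly_Mapping.keys p. Poly_Mapping.single v (Poly_Mapping.lookup p v) * q)"
    by (subst poly_mapping_eq_sum_single[of p]) (simp add: sum_distrib_right)
  then have "wa (p * q) x = (\<Sum>v\<in>Poly_Mapping.keys p. sc (Poly_Mapping.lookup p v) (foldr \<rho> (letters v) (wa q x)))"
    by (simp add: wa_sum 1)
  then show ?thesis by (simp add: word_act_def)
qed

lemma wa_fconst: "wa (fconst c) x = sc c x"
  by (simp add: fconst_def wa_single)

lemma wa_fgen: "wa (fgen X) x = \<rho> X x"
  by (simp add: fgen_def wa_single)

lemma wa_one: "wa 1 x = x"
  using wa_fconst[of 1 x] by (simp add: fconst_def)

text \<open>The elements of the free algebra that act by zero form an ideal, and the assumptions on
  \<open>\<rho>\<close> say exactly that it contains the relations. Hence cosets act.\<close>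

lemma wa_ideal:
  assumes "p \<in> env_ideal S"
  shows "wa p x = 0"
proof -
  let ?I = "{p \<in> carrier (env_free S). \<forall>x. wa p x = 0}"
  have "ideal ?I (env_free S)"
  proof (rule idealI[OF ring_free_algebra])
    show "subgroup ?I (add_monoid (env_free S))"
    proof (rule abelian_group.add_subgroupI[OF ring.is_abelian_group[OF ring_free_algebra]])
      fix p assume "p \<in> ?I"
      then show "\<ominus>\<^bsub>env_free S\<^esub> p \<in> ?I"
        using wa_minus[of 0 p] by (simp add: a_inv_free_algebra uminus_closed_free_algebra wa_zero)
    qed (auto simp: carrier_free_algebra(2-) free_algebra_closed wa_add wa_zero)
  qed (auto simp: carrier_free_algebra(2-) free_algebra_closed wa_mult word_act_def[of _ _ _ 0]
      foldr_sc[where c = 0, simplified])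
  moreover have "wa z x = 0" if "z \<in> env_rels S" for z x
    using that unfolding env_rels_def
  proof (elim UnE CollectE exE conjE, goal_cases)
    case (3 X Y i j)
    then show ?case using rho_bracket[OF 3(2,3)] by (simp add: wa_minus wa_mult wa_fgen wa_fconst)
  qed (simp_all add: wa_minus wa_mult wa_fgen wa_fconst rho_gen_add rho_gen_sc)
  then have "env_rels S \<subseteq> ?I" using env_rels_closed by auto
  ultimately show ?thesis using env_ideal_minimal assms by blast
qed

abbreviation "rmod \<equiv> rep_mod sc \<rho>"

lemma rep_smult:
  assumes p: "p \<in> carrier (env_free S)"
  shows "the_elem ((\<lambda>p. wa p x) ` env_class S p) = wa p x"
proof -
  have "(\<lambda>p. wa p x) ` env_class S p = {wa p x}"
  proof -
    have 1: "wa q x = wa p x" if "q \<in> env_class S p" for q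
      using that wa_ideal by (auto simp: env_class_def a_r_coset_def' carrier_free_algebra(5) wa_add)
    have 2: "p \<in> env_class S p"
      using abelian_subgroup.a_rcos_self[OF abelian_subgroupI3[OF ideal.axioms(1)[OF ideal_env_ideal]
        ring.is_abelian_group[OF ring_free_algebra]] p] by (simp add: env_class_def)
    show ?thesis
    proof (rule equalityI)
      show "(\<lambda>p. wa p x) ` env_class S p \<subseteq> {wa p x}"
        by (rule image_subsetI) (metis 1 singletonI)
      show "{wa p x} \<subseteq> (\<lambda>p. wa p x) ` env_class S p"
        using 2 by blast
    qed
  qed
  then show ?thesis by simp
qed

lemma rmod_simps:
  "carrier (rmod G) = UNIV" "(zr (rmod G)) = 0" "add (rmod G) = (+)" "gr (rmod G) = G"
  "p \<in> carrier (env_free S) ==> env_class S p \<odot>\<^bsub>rmod G\<^esub> x = wa p x"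
  by (simp_all add: rep_mod_def rep_smult)

lemma rmod_cs: "ucst S c \<odot>\<^bsub>rmod G\<^esub> x = sc c x"
  by (simp add: rmod_simps wa_fconst)

lemma rmod_ge: "X \<in> S i ==> ugen S X \<odot>\<^bsub>rmod G\<^esub> x = \<rho> X x"
  by (simp add: rmod_simps wa_fgen fgen_env_closed)

lemma abelian_rmod: "abelian_group (rmod G)"
  by (rule abelian_groupI) (auto simp: rmod_simps add_ac intro: exI[of _ "- x" for x])

lemma umod_rmod: "umod S (rmod G)"
proof (rule left_module_umod[OF lie], intro left_module.intro ring_UEA abelian_rmod, unfold_locales)
  fix a b x assume "a \<in> carrier (UEA S)" "b \<in> carrier (UEA S)"
  then obtain p q where "p \<in> carrier (env_free S)" "q \<in> carrier (env_free S)" "a = env_class S p" "b = env_class S q"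
    by (auto simp: carrier_UEA)
  then show "(a \<oplus>\<^bsub>UEA S\<^esub> b) \<odot>\<^bsub>rmod G\<^esub> x = a \<odot>\<^bsub>rmod G\<^esub> x \<oplus>\<^bsub>rmod G\<^esub> b \<odot>\<^bsub>rmod G\<^esub> x"
    "(a \<otimes>\<^bsub>UEA S\<^esub> b) \<odot>\<^bsub>rmod G\<^esub> x = a \<odot>\<^bsub>rmod G\<^esub> (b \<odot>\<^bsub>rmod G\<^esub> x)"
    by (simp_all flip: env_class_add env_class_mult add: rmod_simps free_algebra_closed wa_add wa_mult)
next
  fix a x y assume "a \<in> carrier (UEA S)"
  then obtain p where "p \<in> carrier (env_free S)" "a = env_class S p"
    by (auto simp: carrier_UEA)
  then show "a \<odot>\<^bsub>rmod G\<^esub> (x \<oplus>\<^bsub>rmod G\<^esub> y) = a \<odot>\<^bsub>rmod G\<^esub> x \<oplus>\<^bsub>rmod G\<^esub> a \<odot>\<^bsub>rmod G\<^esub> y"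
    by (simp add: rmod_simps wa_right_add)
qed (simp_all add: rmod_simps wa_one flip: env_class_one)

end

subsection \<open>Block matrices\<close>

lemma sum_UNIV_sum:
  fixes f :: "'a::finite + 'b::finite \<Rightarrow> 'c::comm_monoid_add"
  shows "(\<Sum>r\<in>UNIV. f r) = (\<Sum>i\<in>UNIV. f (Inl i)) + (\<Sum>j\<in>UNIV. f (Inr j))"
  by (simp flip: UNIV_Plus_UNIV add: sum.Plus)

lemma blockM_nth [simp]:
  "blockM A B $ Inl i $ Inl j = A $ i $ j" "blockM A B $ Inl i $ Inr j = B $ i $ j"
  "blockM A B $ Inr i $ Inl j = B $ i $ j" "blockM A B $ Inr i $ Inr j = A $ i $ j"
  by (simp_all add: blockM_def)

lemma smat_eq_iff:
  fixes X Y :: "'k smat"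
  shows "X = Y \<longleftrightarrow> (\<forall>i j. X $ Inl i $ Inl j = Y $ Inl i $ Inl j \<and> X $ Inl i $ Inr j = Y $ Inl i $ Inr j \<and>
     X $ Inr i $ Inl j = Y $ Inr i $ Inl j \<and> X $ Inr i $ Inr j = Y $ Inr i $ Inr j)"
  by (auto simp: vec_eq_iff split_sum_all)

lemma blockM_eq_iff [simp]: "blockM A B = blockM C D \<longleftrightarrow> A = C \<and> B = D"
  by (auto simp: smat_eq_iff vec_eq_iff)

lemma blockM_arith:
  "blockM A B + blockM C D = blockM (A + C) (B + D)"
  "blockM A B - blockM C D = blockM (A - C) (B - D)"
  "- blockM A B = blockM (- A) (- (B :: 'k::ring_1 ^ 2 ^ 2))" "blockM 0 0 = (0 :: 'k smat)"
  by (simp_all add: smat_eq_iff)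

lemma blockM_mult:
  fixes A B C D :: "'k::ring_1 ^ 2 ^ 2"
  shows "blockM A B ** blockM C D = blockM (A ** C + B ** D) (A ** D + B ** C)"
  by (simp add: smat_eq_iff matrix_matrix_mult_def sum_UNIV_sum algebra_simps)

lemma mat_blockM: "mat c = blockM (mat c) (0 :: 'k::ring_1 ^ 2 ^ 2)"
  by (simp add: smat_eq_iff mat_def)

lemma matrix_zero_mult [simp]: "0 ** (A :: 'k::ring_1 ^ 'n ^ 'm) = 0" "(B :: 'k::ring_1 ^ 'n ^ 'm) ** 0 = 0"
  by (simp_all add: matrix_matrix_mult_def vec_eq_iff)

lemma blockM_scale: "mat c ** blockM A (B :: 'k::ring_1 ^ 2 ^ 2) = blockM (mat c ** A) (mat c ** B)"
  by (simp add: mat_blockM blockM_mult)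

lemma mat_uminus_mult: "mat (- 1) ** (A :: 'k::ring_1 ^ 'n ^ 'n) = - A"
  by (simp add: matrix_matrix_mult_def mat_def vec_eq_iff if_distrib[of "\<lambda>x. x * _"] sum.delta cong: if_cong)

lemma mat_mult_nth [simp]: "(mat c ** A) $ i $ j = c * (A :: 'k::ring_1 ^ 'n ^ 'n) $ i $ j"
  by (simp add: matrix_matrix_mult_def mat_def if_distrib[of "\<lambda>x. x * _"] sum.delta cong: if_cong)

lemma superbracket_blockM:
  "superbracket 0 0 (blockM A 0) (blockM C 0) = blockM (A ** C - C ** A) (0 :: 'k::ring_1 ^ 2 ^ 2)"
  "superbracket 0 1 (blockM A 0) (blockM 0 D) = blockM 0 (A ** D - D ** A :: 'k::ring_1 ^ 2 ^ 2)"
  "superbracket 1 0 (blockM 0 B) (blockM C 0) = blockM 0 (B ** C - C ** B :: 'k::ring_1 ^ 2 ^ 2)"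
  "superbracket 1 1 (blockM 0 B) (blockM 0 D) = blockM (B ** D + D ** B) (0 :: 'k::ring_1 ^ 2 ^ 2)"
  by (simp_all add: superbracket_def koszul_def blockM_mult blockM_arith mat_uminus_mult matrix_mul_lid)

lemma superbracket_zero: "superbracket i j 0 Y = 0" "superbracket i j X 0 = (0 :: 'k::ring_1 smat)"
  by (simp_all add: superbracket_def)

lemma q_alg_0: "q_alg 0 = range (\<lambda>A. blockM A 0)" and q_alg_1: "q_alg 1 = range (\<lambda>B. blockM 0 B)"
  by (simp_all add: q_alg_def)

lemma q_algI [simp, intro]: "blockM A 0 \<in> q_alg 0" "blockM 0 B \<in> q_alg 1" "0 \<in> q_alg i"
  by (auto simp: q_alg_def blockM_arith(4) intro!: range_eqI[of _ _ 0])

lemma g_alg_0: "g_alg 0 = q_alg 0" and g_alg_1: "g_alg 1 = {0}"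
  by (simp_all add: even_part_def)

lemma g_algI [simp, intro]: "blockM A 0 \<in> g_alg 0"
  by (simp add: g_alg_0)

lemma g_alg_cases:
  assumes "X \<in> g_alg i"
  obtains A where "i = 0" "X = blockM A 0" | "i = 1" "X = 0"
  using assms bit_cases[of i] by (auto simp: g_alg_0 g_alg_1 q_alg_0)

lemma q_alg_cases:
  assumes "X \<in> q_alg i"
  obtains A where "i = 0" "X = blockM A 0" | B where "i = 1" "X = blockM 0 B"
  using assms bit_cases[of i] by (auto simp: q_alg_0 q_alg_1)

lemma bit_one_plus_one [simp]: "1 + 1 = (0::bit)"
  by (simp add: add_bit_eq_xor)

lemma graded_lie_q: "graded_lie (q_alg :: bit \<Rightarrow> 'k::field smat set)"
  unfolding graded_lie_def
proof (intro conjI allI ballI)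
  fix i j and X Y :: "'k smat" assume "X \<in> q_alg i" "Y \<in> q_alg j"
  then show "superbracket i j X Y \<in> q_alg (i + j)"
    by (elim q_alg_cases) (simp_all add: superbracket_blockM)
next
  fix i and X Y :: "'k smat" assume "X \<in> q_alg i" "Y \<in> q_alg i"
  then show "X + Y \<in> q_alg i"
    by (elim q_alg_cases) (simp_all add: blockM_arith)
next
  fix i c and X :: "'k smat" assume "X \<in> q_alg i"
  then show "mat c ** X \<in> q_alg i"
    by (elim q_alg_cases) (simp_all add: blockM_scale)
qed simp

lemma graded_lie_even_part:
  assumes "graded_lie S" shows "graded_lie (even_part S)"
proof -
  interpret enveloping S by standard fact
  have "superbracket i j X Y \<in> even_part S (i + j)" if "X \<in> even_part S i" "Y \<in> even_part S j" for i j X Y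
    using that S_closed(4)[of X 0 Y 0] bit_cases[of i] bit_cases[of j]
    by (auto simp: even_part_def superbracket_zero S_closed(1))
  then show ?thesis
    using S_closed(1-3) by (auto simp: graded_lie_def even_part_def split: if_splits)
qed

lemmas graded_lie_g = graded_lie_even_part[OF graded_lie_q]

lemma b_alg_cases:
  assumes "X \<in> b_alg i"
  obtains A where "i = 0" "X = blockM A 0" "A $ 2 $ 1 = 0" | B where "i = 1" "X = blockM 0 B" "B $ 2 $ 1 = 0"
  using assms bit_cases[of i] by (auto simp: b_alg_def)

lemma b_algI: "A $ 2 $ 1 = 0 ==> blockM A 0 \<in> b_alg 0" "A $ 2 $ 1 = 0 ==> blockM 0 A \<in> b_alg 1"
  by (auto simp: b_alg_def)

lemma mult_nth_2: "((A :: 'k::ring_1 ^ 2 ^ 2) ** B) $ i $ j = A $ i $ 1 * B $ 1 $ j + A $ i $ 2 * B $ 2 $ j"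
  by (simp add: matrix_matrix_mult_def sum_2)

lemma graded_lie_b: "graded_lie (b_alg :: bit \<Rightarrow> 'k::field smat set)"
  unfolding graded_lie_def
proof (intro conjI allI ballI)
  fix i j and X Y :: "'k smat" assume "X \<in> b_alg i" "Y \<in> b_alg j"
  then show "superbracket i j X Y \<in> b_alg (i + j)"
    by (elim b_alg_cases) (simp_all add: superbracket_blockM b_algI mult_nth_2)
next
  fix i and X Y :: "'k smat" assume "X \<in> b_alg i" "Y \<in> b_alg i"
  then show "X + Y \<in> b_alg i"
    by (elim b_alg_cases) (simp_all add: blockM_arith b_algI)
next
  fix i c and X :: "'k smat" assume "X \<in> b_alg i"
  then show "mat c ** X \<in> b_alg i"
    by (elim b_alg_cases) (simp_all add: blockM_scale b_algI)
next
  fix i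
  have "0 = blockM (0 :: 'k ^ 2 ^ 2) 0" by (simp add: blockM_arith)
  then show "(0 :: 'k smat) \<in> b_alg i"
    using bit_cases[of i] b_algI[of "0 :: 'k ^ 2 ^ 2"] by auto
qed

lemmas graded_lie_bg = graded_lie_even_part[OF graded_lie_b]

lemma even_part_subset: "graded_lie S ==> even_part S i \<subseteq> S i"
  using bit_cases[of i] by (auto simp: even_part_def graded_lie_def)

lemma b_subset_q: "b_alg i \<subseteq> q_alg i"
  using bit_cases[of i] by (auto simp: b_alg_def q_alg_def)

lemma even_part_mono: "(\<And>i. S i \<subseteq> T i) ==> even_part S i \<subseteq> even_part T i"
  using bit_cases[of i] by (auto simp: even_part_def)

definition mx :: "'k \<Rightarrow> 'k \<Rightarrow> 'k \<Rightarrow> 'k \<Rightarrow> 'k ^ 2 ^ 2" where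
  "mx a b c d = (\<chi> i j. if i = 1 then if j = 1 then a else b else if j = 1 then c else d)"

lemma mx_nth [simp]: "mx a b c d $ 1 $ 1 = a" "mx a b c d $ 1 $ 2 = b" "mx a b c d $ 2 $ 1 = c" "mx a b c d $ 2 $ 2 = d"
  by (simp_all add: mx_def)

lemma mx_eqI:
  "A $ 1 $ 1 = B $ 1 $ 1 ==> A $ 1 $ 2 = B $ 1 $ 2 ==> A $ 2 $ 1 = B $ 2 $ 1 ==> A $ 2 $ 2 = B $ 2 $ 2 ==> A = (B :: 'k ^ 2 ^ 2)"
  by (simp add: vec_eq_iff forall_2)

subsection \<open>Isomorphisms and tops\<close>

lemma supermodule_image:
  assumes lie: "graded_lie S" and M: "is_supermodule S M"
    and bij: "bij_betw f (carrier M) (carrier N)"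
    and add: "\<And>x y. [|x \<in> carrier M; y \<in> carrier M|] ==> f (x \<oplus>\<^bsub>M\<^esub> y) = f x \<oplus>\<^bsub>N\<^esub> f y"
    and zero: "f (zr M) = (zr N)"
    and smult: "\<And>r x. [|r \<in> carrier (UEA S); x \<in> carrier M|] ==> f (r \<odot>\<^bsub>M\<^esub> x) = r \<odot>\<^bsub>N\<^esub> f x"
    and gr: "\<And>i. gr N i = f ` gr M i"
  shows "is_supermodule S N"
proof -
  interpret M: usmod S M using lie M by unfold_locales
  have im: "f ` carrier M = carrier N" using bij by (simp add: bij_betw_def)
  have N: "umod S N"
    by (rule left_module_umod[OF lie left_module_image[OF M.left_module_axioms im add zero smult]])
  then interpret N: umod S N .
  have cl: "f x \<in> carrier N" if "x \<in> carrier M" for x using that im by auto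
  show ?thesis
  proof (rule is_supermoduleI[OF N])
    fix i show "subgroup (gr N i) (add_monoid N)"
      unfolding gr by (rule M.image_additive_subgroup[OF N.M.abelian_group_axioms M.gr_sub add cl])
  next
    fix x assume "x \<in> carrier N"
    then obtain y where y: "y \<in> carrier M" "x = f y" using im by auto
    then obtain a b where "a \<in> gr M 0" "b \<in> gr M 1" "y = a \<oplus>\<^bsub>M\<^esub> b" using M.gr_dec by blast
    with y show "\<exists>a\<in>gr N 0. \<exists>b\<in>gr N 1. x = a \<oplus>\<^bsub>N\<^esub> b"
      using add M.gr_carrier unfolding gr by blast
  next
    fix x assume "x \<in> gr N 0" "x \<in> gr N 1"
    then obtain a b where "a \<in> gr M 0" "b \<in> gr M 1" "x = f a" "x = f b" unfolding gr by blast
    moreover from this have "a = b" using inj_onD[OF bij_betw_imp_inj_on[OF bij], of a b] M.gr_carrier[of a 0] M.gr_carrier[of b 1]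
      by simp
    ultimately show "x = (zr N)" using M.gr_disjoint[of a 0] zero by simp
  next
    fix c x i assume "x \<in> gr N i"
    then show "ucst S c \<odot>\<^bsub>N\<^esub> x \<in> gr N i"
      unfolding gr using M.gr_cs M.gr_carrier by (auto simp flip: smult)
  next
    fix X i x j assume "X \<in> S i" "x \<in> gr N j"
    then show "ugen S X \<odot>\<^bsub>N\<^esub> x \<in> gr N (i + j)"
      unfolding gr using M.gr_ge M.gr_carrier M.ugen_closed by (auto simp flip: smult)
  qed
qed

lemma module_isosD:
  assumes "f \<in> module_isos R M N"
  shows "bij_betw f (carrier M) (carrier N)" "x \<in> carrier M ==> f x \<in> carrier N"
    "[|x \<in> carrier M; y \<in> carrier M|] ==> f (x \<oplus>\<^bsub>M\<^esub> y) = f x \<oplus>\<^bsub>N\<^esub> f y"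
    "[|r \<in> carrier R; x \<in> carrier M|] ==> f (r \<odot>\<^bsub>M\<^esub> x) = r \<odot>\<^bsub>N\<^esub> f x"
    "[|x \<in> carrier M; y \<in> carrier M; f x = f y|] ==> x = y"
  using assms by (auto simp: module_isos_def bij_betw_def inj_on_def)

lemma module_isos_zero:
  assumes "f \<in> module_isos R M N" "left_module R M" "left_module R N"
  shows "f (zr M) = (zr N)"
proof -
  interpret M: left_module R M by fact
  interpret N: left_module R N by fact
  have "f (zr M) = f (zr M) \<oplus>\<^bsub>N\<^esub> f (zr M)"
    using module_isosD(3)[OF assms(1), of "(zr M)" "(zr M)"] by simp
  then show ?thesis using module_isosD(2)[OF assms(1), of "(zr M)"] by (simp add: N.add.l_cancel_one')
qed

lemma module_isos_comp:
  assumes "f \<in> module_isos R M N" "g \<in> module_isos R N P"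
  shows "g \<circ> f \<in> module_isos R M P"
  using assms module_isosD[OF assms(1)] by (auto simp: module_isos_def bij_betw_trans)

lemma module_isos_inv:
  assumes f: "f \<in> module_isos R M N" and "left_module R M"
  shows "inv_into (carrier M) f \<in> module_isos R N M"
proof -
  interpret left_module R M by fact
  let ?g = "inv_into (carrier M) f"
  note b = module_isosD(1)[OF f]
  have g: "?g (f x) = x" if "x \<in> carrier M" for x
    using b that by (simp add: bij_betw_inv_into_left)
  have ex: "\<exists>x\<in>carrier M. y = f x" if "y \<in> carrier N" for y
    using b that by (auto simp: bij_betw_def)
  have "?g (x \<oplus>\<^bsub>N\<^esub> y) = ?g x \<oplus>\<^bsub>M\<^esub> ?g y" if "x \<in> carrier N" "y \<in> carrier N" for x y
  proof -
    obtain a c where "a \<in> carrier M" "c \<in> carrier M" "x = f a" "y = f c" using ex \<open>x \<in> carrier N\<close> \<open>y \<in> carrier N\<close> by metis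
    then show ?thesis using g by (simp flip: module_isosD(3)[OF f])
  qed
  moreover have "?g (r \<odot>\<^bsub>N\<^esub> x) = r \<odot>\<^bsub>M\<^esub> ?g x" if r: "r \<in> carrier R" "x \<in> carrier N" for r x
  proof -
    obtain a where "a \<in> carrier M" "x = f a" using ex r by metis
    then show ?thesis using g r by (simp flip: module_isosD(4)[OF f])
  qed
  ultimately show ?thesis using bij_betw_inv_into[OF b] by (simp add: module_isos_def)
qed

lemma module_isos_annihilator:
  assumes f: "f \<in> module_isos R M N" and M: "left_module R M" and N: "left_module R N"
  shows "annihilator R M = annihilator R N"
proof -
  interpret M: left_module R M by fact
  interpret N: left_module R N by fact
  have z: "f x = (zr N) \<longleftrightarrow> x = (zr M)" if "x \<in> carrier M" for x
    using module_isos_zero[OF assms] module_isosD(5)[OF f that, of "(zr M)"] by auto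
  have im: "f ` carrier M = carrier N" using module_isosD(1)[OF f] by (simp add: bij_betw_def)
  have "(\<forall>x\<in>carrier M. r \<odot>\<^bsub>M\<^esub> x = (zr M)) \<longleftrightarrow> (\<forall>y\<in>carrier N. r \<odot>\<^bsub>N\<^esub> y = (zr N))" if r: "r \<in> carrier R" for r
    unfolding im[symmetric] ball_simps using r by (simp flip: module_isosD(4)[OF f] add: z)
  then show ?thesis unfolding annihilator_def by auto
qed

lemma module_isos_simple:
  assumes f: "f \<in> module_isos R M N" and M: "simple_module R M" and N: "left_module R N"
  shows "simple_module R N"
proof -
  have lM: "left_module R M" using M by (simp add: simple_module_def)
  interpret M: left_module R M by fact
  interpret N: left_module R N by fact
  have im: "f ` carrier M = carrier N" using module_isosD(1)[OF f] by (simp add: bij_betw_def)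
  note z = module_isos_zero[OF f lM N]
  have "carrier N \<noteq> {(zr N)}"
  proof
    assume "carrier N = {(zr N)}"
    then have "x = (zr M)" if "x \<in> carrier M" for x
      using im z module_isosD(5)[OF f that, of "(zr M)"] that by auto
    then show False using M by (auto simp: simple_module_def)
  qed
  moreover have "H = {(zr N)} \<or> H = carrier N" if H: "submodule H R N" for H
  proof -
    interpret H: submodule H R N by fact
    note HD = N.M.add_subgroupD[OF H.subgroup_axioms]
    let ?H = "{x \<in> carrier M. f x \<in> H}"
    have "submodule ?H R M"
    proof (intro submodule.intro submodule_axioms.intro M.M.add_subgroupI)
      show "\<ominus>\<^bsub>M\<^esub> x \<in> ?H" if "x \<in> ?H" for x
      proof -
        have "f (\<ominus>\<^bsub>M\<^esub> x) = \<ominus>\<^bsub>N\<^esub> f x"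
          by (rule N.minus_equality[symmetric])
            (use that module_isosD[OF f] z in \<open>simp_all flip: module_isosD(3)[OF f] add: M.M.l_neg\<close>)
        then show ?thesis using that HD(3) by simp
      qed
    qed (use HD module_isosD[OF f] z H.smult_closed in auto)
    then have "?H = {(zr M)} \<or> ?H = carrier M" using M by (simp add: simple_module_def)
    moreover have "H = f ` ?H"
    proof (intro equalityI subsetI)
      fix y assume "y \<in> H"
      moreover then obtain x where "x \<in> carrier M" "y = f x" using HD(1) im by blast
      ultimately show "y \<in> f ` ?H" by blast
    qed blast
    moreover have "H = {(zr N)} \<or> H = carrier N"
      if "H' = {(zr M)} \<or> H' = carrier M" "H = f ` H'" for H'
      using that(1) unfolding that(2) using z im by auto
    ultimately show ?thesis by blast
  qed
  ultimately show ?thesis using N by (simp add: simple_module_def)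
qed

text \<open>A supermodule with a surjection onto a simple one has it as its top as soon as
  no proper graded submodule surjects.\<close>

lemma top_of_iso:
  fixes I :: "('k::field uea, 'b, 'm) supermodule_scheme" and N :: "('k uea, 'c, 'n) supermodule_scheme"
  assumes I: "umod S I"
    and grI: "\<And>i. gr I i \<subseteq> carrier I" "\<And>x. x \<in> carrier I ==> \<exists>a\<in>gr I 0. \<exists>b\<in>gr I 1. x = a \<oplus>\<^bsub>I\<^esub> b"
    and N: "simple_supermodule S N"
    and cl: "\<And>x. x \<in> carrier I ==> \<pi> x \<in> carrier N"
    and add: "\<And>x y. [|x \<in> carrier I; y \<in> carrier I|] ==> \<pi> (x \<oplus>\<^bsub>I\<^esub> y) = \<pi> x \<oplus>\<^bsub>N\<^esub> \<pi> y"
    and smult: "\<And>r x. [|r \<in> carrier (UEA S); x \<in> carrier I|] ==> \<pi> (r \<odot>\<^bsub>I\<^esub> x) = r \<odot>\<^bsub>N\<^esub> \<pi> x"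
    and surj: "\<pi> ` carrier I = carrier N"
    and gr: "\<And>i x. x \<in> gr I i ==> \<pi> x \<in> gr N i"
    and cover: "\<And>H. graded_submodule S I H ==> \<pi> ` H = carrier N ==> H = carrier I"
  obtains f where "f \<in> module_isos (UEA S) (top_of S I) N" "\<And>i. f ` gr (top_of S I) i = gr N i"
    "is_supermodule S (top_of S I)"
proof -
  interpret I: umod S I by fact
  interpret N: usmod S N using simple_supermoduleD(1)[OF N] I.lie by unfold_locales
  have zero: "\<pi> (zr I) = (zr N)"
    using add[of "(zr I)" "(zr I)"] cl[of "(zr I)"] by (simp add: N.add.l_cancel_one')
  have neg: "\<pi> (\<ominus>\<^bsub>I\<^esub> x) = \<ominus>\<^bsub>N\<^esub> \<pi> x" if "x \<in> carrier I" for x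
    by (rule N.minus_equality[symmetric]) (use that in \<open>simp_all flip: add add: cl zero I.M.l_neg\<close>)
  let ?K = "{x \<in> carrier I. \<pi> x = (zr N)}"
  have sK: "submodule ?K (UEA S) I"
    by (intro submodule.intro submodule_axioms.intro I.M.add_subgroupI) (auto simp: zero neg add smult)
  have gK: "graded_submodule S I ?K"
    unfolding graded_submodule_def
  proof (intro conjI sK ballI)
    fix x assume x: "x \<in> ?K"
    then obtain a b where ab: "a \<in> gr I 0" "b \<in> gr I 1" "x = a \<oplus>\<^bsub>I\<^esub> b" using grI(2) by blast
    moreover have "\<pi> a \<oplus>\<^bsub>N\<^esub> \<pi> b = (zr N) \<oplus>\<^bsub>N\<^esub> (zr N)"
    proof -
      have "a \<in> carrier I" "b \<in> carrier I" using ab grI(1) by blast+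
      then show ?thesis using ab x by (simp flip: add)
    qed
    then have "\<pi> a = (zr N)" "\<pi> b = (zr N)"
      using N.gr_unique[of "\<pi> a" 0 "\<pi> b" "(zr N)" "(zr N)"] ab gr N.grD(2) by auto
    ultimately show "\<exists>a\<in>?K \<inter> gr I 0. \<exists>b\<in>?K \<inter> gr I 1. x = a \<oplus>\<^bsub>I\<^esub> b" using grI(1) by blast
  qed
  have img: "\<pi> ` H = {(zr N)} \<or> \<pi> ` H = carrier N" if H: "graded_submodule S I H" for H
  proof -
    have H': "submodule H (UEA S) I" using H by (simp add: graded_submodule_def)
    note HD = I.submoduleD[OF H']
    have "submodule (\<pi> ` H) (UEA S) N"
    proof (intro submodule.intro submodule_axioms.intro)
      show "subgroup (\<pi> ` H) (add_monoid N)"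
        by (rule I.image_additive_subgroup[OF N.M.abelian_group_axioms submodule.axioms(1)[OF H'] add cl])
      fix u x assume "u \<in> carrier (UEA S)" "x \<in> \<pi> ` H"
      then show "u \<odot>\<^bsub>N\<^esub> x \<in> \<pi> ` H" using HD(1,6) by (auto simp: subset_eq simp flip: smult)
    qed
    moreover have "\<exists>a\<in>\<pi> ` H \<inter> gr N 0. \<exists>b\<in>\<pi> ` H \<inter> gr N 1. x = a \<oplus>\<^bsub>N\<^esub> b" if x: "x \<in> \<pi> ` H" for x
    proof -
      obtain y where "y \<in> H" "x = \<pi> y" using x by auto
      moreover then obtain a b where "a \<in> H \<inter> gr I 0" "b \<in> H \<inter> gr I 1" "y = a \<oplus>\<^bsub>I\<^esub> b"
        using H unfolding graded_submodule_def by blast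
      ultimately show ?thesis using gr add grI(1) by blast
    qed
    ultimately have "graded_submodule S N (\<pi> ` H)" by (simp add: graded_submodule_def)
    then show ?thesis by (rule simple_supermoduleD(3)[OF N])
  qed
  define K where "K = ?K"
  have K_iff: "x \<in> K \<longleftrightarrow> x \<in> carrier I \<and> \<pi> x = (zr N)" for x by (simp add: K_def)
  note sK = sK[folded K_def] and gK = gK[folded K_def]
  \<comment> \<open>A proper graded submodule does not surject by \<open>cover\<close>, so
    simplicity of \<open>N\<close> makes its image zero. The kernel is thus the largest proper
    graded submodule and equals the radical.\<close>
  have small: "H \<subseteq> K" if H: "graded_submodule S I H" "H \<noteq> carrier I" for H
  proof -
    have "\<pi> ` H = {(zr N)}" using img[OF H(1)] cover[OF H(1)] H(2) by auto
    moreover have "H \<subseteq> carrier I" using H(1) I.submoduleD(1)[of H] by (simp add: graded_submodule_def)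
    ultimately show ?thesis unfolding K_def by blast
  qed
  have KI: "K \<noteq> carrier I"
  proof
    assume "K = carrier I"
    then have "\<pi> ` carrier I \<subseteq> {(zr N)}" by (auto simp: K_iff)
    then show False using surj simple_supermoduleD(2)[OF N] N.M.zero_closed by blast
  qed
  have "maximal_graded_submodule S I H \<longleftrightarrow> H = K" for H
  proof
    assume H: "maximal_graded_submodule S I H"
    then have "H \<subseteq> K" using small by (simp add: maximal_graded_submodule_def)
    then show "H = K" using H gK KI unfolding maximal_graded_submodule_def by metis
  next
    assume H: "H = K"
    have "L = K \<or> L = carrier I" if "graded_submodule S I L" "K \<subseteq> L" for L
      using small[OF that(1)] that(2) by blast
    then show "maximal_graded_submodule S I H"
      unfolding maximal_graded_submodule_def H using gK KI by blast
  qed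
  then have "{H. maximal_graded_submodule S I H} = {K}" by blast
  then have "carrier I \<inter> \<Inter>{H. maximal_graded_submodule S I H} = K"
    using I.submoduleD(1)[OF sK] by auto
  then have top: "top_of S I = quotient_module I K" by (simp add: top_of_def)
  interpret Q: quot I K
    using submodule.axioms(1)[OF sK] by (simp add: quot_def quot_axioms_def I.M.abelian_group_axioms)
  note sD = I.submoduleD[OF sK]
  have cl_eq: "Q.cl x = Q.cl y \<longleftrightarrow> \<pi> x = \<pi> y" if "x \<in> carrier I" "y \<in> carrier I" for x y
  proof -
    have "Q.cl x = Q.cl y \<longleftrightarrow> \<pi> x \<ominus>\<^bsub>N\<^esub> \<pi> y = (zr N)"
      unfolding Q.cl_eq_iff[OF that] using that by (simp add: K_iff a_minus_def add neg)
    then show ?thesis using N.M.diff_eq_zeroD[OF cl cl, OF that] that cl by (auto simp: a_minus_def N.M.r_neg)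
  qed
  \<comment> \<open>The map runs from \<open>N\<close> to the quotient, so that the supermodule
    structure of the quotient is transported from \<open>N\<close>.\<close>
  define g where "g y = Q.cl (SOME x. x \<in> carrier I \<and> \<pi> x = y)" for y
  have g: "g (\<pi> x) = Q.cl x" if "x \<in> carrier I" for x
  proof -
    have "(SOME z. z \<in> carrier I \<and> \<pi> z = \<pi> x) \<in> carrier I \<and> \<pi> (SOME z. z \<in> carrier I \<and> \<pi> z = \<pi> x) = \<pi> x"
      by (rule someI[of _ x]) (use that in auto)
    then show ?thesis unfolding g_def using cl_eq that by blast
  qed
  have ex: "\<exists>x\<in>carrier I. y = \<pi> x" if "y \<in> carrier N" for y using that surj by auto
  have smQ: "Q.cl (r \<odot>\<^bsub>I\<^esub> x) = r \<odot>\<^bsub>Q.Q\<^esub> Q.cl x" if "r \<in> carrier (UEA S)" "x \<in> carrier I" for r x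
    by (rule Q.cl_smult) (use that I.lsmult_r_distr sD(6) in simp_all)
  have bij: "bij_betw g (carrier N) (carrier Q.Q)"
  proof (rule bij_betw_imageI)
    show "inj_on g (carrier N)"
    proof (rule inj_onI)
      fix x y assume xy: "x \<in> carrier N" "y \<in> carrier N" "g x = g y"
      then obtain a b where "a \<in> carrier I" "b \<in> carrier I" "x = \<pi> a" "y = \<pi> b" using ex by metis
      with xy(3) show "x = y" by (simp add: g cl_eq)
    qed
    show "g ` carrier N = carrier Q.Q"
      unfolding surj[symmetric] Q.carrier_Q image_image by (rule image_cong) (simp_all add: g)
  qed
  have gadd: "g (x \<oplus>\<^bsub>N\<^esub> y) = g x \<oplus>\<^bsub>Q.Q\<^esub> g y" if xy: "x \<in> carrier N" "y \<in> carrier N" for x y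
  proof -
    obtain a b where "a \<in> carrier I" "b \<in> carrier I" "x = \<pi> a" "y = \<pi> b" using ex xy by metis
    then show ?thesis by (simp flip: add add: g Q.cl_add)
  qed
  have gsm: "g (r \<odot>\<^bsub>N\<^esub> x) = r \<odot>\<^bsub>Q.Q\<^esub> g x" if x: "r \<in> carrier (UEA S)" "x \<in> carrier N" for r x
  proof -
    obtain a where "a \<in> carrier I" "x = \<pi> a" using ex x by metis
    then show ?thesis using x by (simp flip: smult add: g smQ)
  qed
  have ggr: "gr Q.Q i = g ` gr N i" for i
  proof -
    \<comment> \<open>A preimage of a homogeneous element may fail to be homogeneous, but its
      component of the right parity is again a preimage, by uniqueness of the decomposition in
      \<open>N\<close>.\<close>
    have "\<pi> ` gr I i = gr N i"
    proof (intro equalityI subsetI)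
      fix y assume y: "y \<in> gr N i"
      then obtain x where x: "x \<in> carrier I" "y = \<pi> x" using ex N.gr_carrier by blast
      then obtain a b where ab: "a \<in> gr I 0" "b \<in> gr I 1" "x = a \<oplus>\<^bsub>I\<^esub> b" using grI(2) by blast
      have "a \<in> carrier I" "b \<in> carrier I" using ab(1,2) grI(1) by blast+
      with ab have e: "y = \<pi> a \<oplus>\<^bsub>N\<^esub> \<pi> b" "\<pi> a \<in> gr N 0" "\<pi> b \<in> gr N 1" "\<pi> a \<in> carrier N" "\<pi> b \<in> carrier N"
        using x add gr cl by auto
      show "y \<in> \<pi> ` gr I i"
        using bit_cases[of i]
      proof
        assume "i = 0"
        with e ab y show ?thesis using N.gr_unique(1)[of y 0 "(zr N)" "\<pi> a" "\<pi> b"] N.grD(2) N.gr_carrier[OF y] by auto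
      next
        assume "i = 1"
        with e ab y show ?thesis using N.gr_unique(2)[of "(zr N)" 0 y "\<pi> a" "\<pi> b"] N.grD(2) N.gr_carrier[OF y] by auto
      qed
    qed (use gr in auto)
    then have "g ` gr N i = (\<lambda>x. g (\<pi> x)) ` gr I i" by (metis image_image)
    also have "\<dots> = Q.cl ` gr I i" by (rule image_cong[OF refl]) (meson g grI(1) subsetD)
    finally show ?thesis by (simp add: Q.gr_Q)
  qed
  have gzero: "g (zr N) = (zr (Q.Q))" using g[of "(zr I)"] zero by (simp add: Q.cl_zero)
  have sQ: "is_supermodule S Q.Q"
    by (rule supermodule_image[OF I.lie N.smod bij gadd gzero gsm ggr])
  have giso: "g \<in> module_isos (UEA S) N Q.Q"
    using bij gadd gsm by (simp add: module_isos_def)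
  let ?f = "inv_into (carrier N) g"
  show thesis
  proof (rule that[of ?f])
    show "?f \<in> module_isos (UEA S) (top_of S I) N"
      unfolding top by (rule module_isos_inv[OF giso N.left_module_axioms])
    show "is_supermodule S (top_of S I)" using sQ top by simp
    fix i
    have "?f ` g ` gr N i = (\<lambda>x. x) ` gr N i"
      unfolding image_image by (rule image_cong[OF refl]) (rule bij_betw_inv_into_left[OF bij N.gr_carrier])
    then show "?f ` gr (top_of S I) i = gr N i" unfolding top ggr by simp
  qed
qed

subsection \<open>Induced highest weight modules\<close>

context enveloping
begin

lemma env_gr_add:
  assumes "u \<in> env_gr S i" "v \<in> env_gr S i"
  shows "u \<oplus>\<^bsub>UEA S\<^esub> v \<in> env_gr S i"
proof -
  let ?G = "\<lambda>p. \<forall>w \<in> Poly_Mapping.keys p. \<exists>ps. list_all2 (\<lambda>X j. X \<in> S j) (letters w) ps \<and> sum_list ps = i"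
  have mem: "p \<in> carrier (env_free S)" if "?G p" for p :: "'k smat fword \<Rightarrow>\<^sub>0 'k"
  proof -
    have "set xs \<subseteq> S 0 \<union> S 1" if "list_all2 (\<lambda>X j. X \<in> S j) xs ps" for xs ps
      using that by (induction rule: list_all2_induct) (auto, metis bit_cases)
    with that show ?thesis by (simp add: carrier_free_algebra) blast
  qed
  obtain p q where pq: "?G p" "u = env_class S p" "?G q" "v = env_class S q"
    using assms unfolding env_gr_def by blast
  then have "?G (p + q)" using Poly_Mapping.keys_add[of p q] by blast
  then have "env_class S (p + q) \<in> env_gr S i" unfolding env_gr_def by blast
  with pq mem show ?thesis by (simp add: env_class_add)
qed

lemma env_gr_mult:
  assumes "u \<in> env_gr S i" "v \<in> env_gr S j"
  shows "u \<otimes>\<^bsub>UEA S\<^esub> v \<in> env_gr S (i + j)"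
proof -
  let ?G = "\<lambda>i p. \<forall>w \<in> Poly_Mapping.keys p. \<exists>ps. list_all2 (\<lambda>X j. X \<in> S j) (letters w) ps \<and> sum_list ps = i"
  have mem: "p \<in> carrier (env_free S)" if "?G i p" for i and p :: "'k smat fword \<Rightarrow>\<^sub>0 'k"
  proof -
    have "set xs \<subseteq> S 0 \<union> S 1" if "list_all2 (\<lambda>X j. X \<in> S j) xs ps" for xs ps
      using that by (induction rule: list_all2_induct) (auto, metis bit_cases)
    with that show ?thesis by (simp add: carrier_free_algebra) blast
  qed
  obtain p q where pq: "?G i p" "u = env_class S p" "?G j q" "v = env_class S q"
    using assms unfolding env_gr_def by blast
  have "?G (i + j) (p * q)"
  proof
    fix w assume "w \<in> Poly_Mapping.keys (p * q)"
    then obtain a b where ab: "w = a + b" "a \<in> Poly_Mapping.keys p" "b \<in> Poly_Mapping.keys q"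
      using keys_mult[of p q] by blast
    with pq obtain ps qs where "list_all2 (\<lambda>X j. X \<in> S j) (letters a) ps" "sum_list ps = i"
      "list_all2 (\<lambda>X j. X \<in> S j) (letters b) qs" "sum_list qs = j" by meson
    with ab show "\<exists>ps. list_all2 (\<lambda>X j. X \<in> S j) (letters w) ps \<and> sum_list ps = i + j"
      by (intro exI[of _ "ps @ qs"]) (auto intro: list_all2_appendI)
  qed
  then have "env_class S (p * q) \<in> env_gr S (i + j)" unfolding env_gr_def by blast
  with pq mem show ?thesis by (simp add: env_class_mult)
qed

lemma env_gr_subgroup: "subgroup (env_gr S i) (add_monoid (UEA S))"
proof -
  interpret R: ring "UEA S" by (rule ring_UEA)
  show ?thesis
  proof (rule R.add_subgroupI)
    show "env_gr S i \<subseteq> carrier (UEA S)" using env_gr_closed by blast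
    have "env_class S 0 \<in> env_gr S i"
      unfolding env_gr_def by (rule CollectI, rule exI[of _ 0]) simp
    then show "(zr (UEA S)) \<in> env_gr S i" by (simp add: env_class_zero)
    fix u assume u: "u \<in> env_gr S i"
    have "ucst S (- 1) \<otimes>\<^bsub>UEA S\<^esub> u \<in> env_gr S (0 + i)" by (rule env_gr_mult[OF ucst_gr u])
    moreover have "ucst S (- 1) \<otimes>\<^bsub>UEA S\<^esub> u = \<ominus>\<^bsub>UEA S\<^esub> u"
    proof (rule R.minus_equality[symmetric])
      have "ucst S (- 1) \<otimes>\<^bsub>UEA S\<^esub> u \<oplus>\<^bsub>UEA S\<^esub> ucst S 1 \<otimes>\<^bsub>UEA S\<^esub> u = (zr (UEA S))"
        using env_gr_closed[OF u] by (simp flip: R.l_distr ucst_add) (simp add: ucst_zero)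
      then show "ucst S (- 1) \<otimes>\<^bsub>UEA S\<^esub> u \<oplus>\<^bsub>UEA S\<^esub> u = (zr (UEA S))"
        using env_gr_closed[OF u] by (simp add: ucst_one)
    qed (use env_gr_closed[OF u] in auto)
    ultimately show "\<ominus>\<^bsub>UEA S\<^esub> u \<in> env_gr S i" by simp
  qed (rule env_gr_add)
qed

lemma env_gr_dec:
  assumes "u \<in> carrier (UEA S)"
  shows "\<exists>a\<in>env_gr S 0. \<exists>b\<in>env_gr S 1. u = a \<oplus>\<^bsub>UEA S\<^esub> b"
proof -
  interpret R: ring "UEA S" by (rule ring_UEA)
  note D = R.add_subgroupD[OF env_gr_subgroup]
  have z: "a \<in> env_gr S i ==> ?thesis \<or> True" for a i by simp
  have c: "a \<in> carrier (UEA S)" if "a \<in> env_gr S i" for a i using that D(1) by blast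
  show ?thesis using assms
  proof (induction rule: UEA_induct)
    case (const k)
    have "ucst S k = ucst S k \<oplus>\<^bsub>UEA S\<^esub> (zr (UEA S))" by simp
    then show ?case using ucst_gr[of k] D(2) by blast
  next
    case (gen X i)
    have e: "ugen S X = ugen S X \<oplus>\<^bsub>UEA S\<^esub> (zr (UEA S))" "ugen S X = (zr (UEA S)) \<oplus>\<^bsub>UEA S\<^esub> ugen S X"
      using ugen_closed[OF gen] by simp_all
    show ?case
      using bit_cases[of i]
    proof
      assume "i = 0" then show ?thesis using ugen_gr[OF gen] D(2) e(1) by blast
    next
      assume "i = 1" then show ?thesis using ugen_gr[OF gen] D(2) e(2) by blast
    qed
  next
    case (add u v)
    then obtain a b a' b' where *: "a \<in> env_gr S 0" "b \<in> env_gr S 1" "u = a \<oplus>\<^bsub>UEA S\<^esub> b"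
      "a' \<in> env_gr S 0" "b' \<in> env_gr S 1" "v = a' \<oplus>\<^bsub>UEA S\<^esub> b'" by blast
    then have "u \<oplus>\<^bsub>UEA S\<^esub> v = (a \<oplus>\<^bsub>UEA S\<^esub> a') \<oplus>\<^bsub>UEA S\<^esub> (b \<oplus>\<^bsub>UEA S\<^esub> b')"
      using c by (simp add: R.add.m_ac)
    then show ?case using env_gr_add * by blast
  next
    case (mult u v)
    then obtain a b a' b' where *: "a \<in> env_gr S 0" "b \<in> env_gr S 1" "u = a \<oplus>\<^bsub>UEA S\<^esub> b"
      "a' \<in> env_gr S 0" "b' \<in> env_gr S 1" "v = a' \<oplus>\<^bsub>UEA S\<^esub> b'" by blast
    then have "u \<otimes>\<^bsub>UEA S\<^esub> v = (a \<otimes>\<^bsub>UEA S\<^esub> a' \<oplus>\<^bsub>UEA S\<^esub> b \<otimes>\<^bsub>UEA S\<^esub> b') \<oplus>\<^bsub>UEA S\<^esub> (a \<otimes>\<^bsub>UEA S\<^esub> b' \<oplus>\<^bsub>UEA S\<^esub> b \<otimes>\<^bsub>UEA S\<^esub> a')"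
      using c by (simp add: R.add.m_ac R.l_distr R.r_distr)
    moreover have "a \<otimes>\<^bsub>UEA S\<^esub> a' \<oplus>\<^bsub>UEA S\<^esub> b \<otimes>\<^bsub>UEA S\<^esub> b' \<in> env_gr S 0"
      using env_gr_mult[of a 0 a' 0] env_gr_mult[of b 1 b' 1] env_gr_add * by simp
    moreover have "a \<otimes>\<^bsub>UEA S\<^esub> b' \<oplus>\<^bsub>UEA S\<^esub> b \<otimes>\<^bsub>UEA S\<^esub> a' \<in> env_gr S 1"
      using env_gr_mult[of a 0 b' 1] env_gr_mult[of b 1 a' 0] env_gr_add * by simp
    ultimately show ?case by blast
  qed
qed

end

text \<open>These are the even and the odd lowering element and H_1. Both lowering elements have
  weight -1 under the adjoint action of H_1, so \<open>H1m\<close> alone measures the depth of a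
  vector below the highest weight.\<close>

abbreviation "Fm \<equiv> blockM (mx 0 0 1 0) 0"
abbreviation "Fb \<equiv> blockM 0 (mx 0 0 1 0)"
abbreviation "H1m \<equiv> blockM (mx 1 0 0 0) 0"

lemma bracket_lowering:
  "superbracket 0 0 H1m Fm = mat (- 1) ** (Fm :: 'k::field smat)"
  "superbracket 0 1 H1m Fb = mat (- 1) ** (Fb :: 'k::field smat)"
  "superbracket 1 1 Fb Fb = (0 :: 'k::field smat)"
  "superbracket 0 1 Fm Fb = (0 :: 'k::field smat)"
  "superbracket 1 0 Fb Fm = (0 :: 'k::field smat)"
  by (simp_all add: superbracket_blockM blockM_scale blockM_arith(4)[symmetric] mat_uminus_mult)
    (auto intro!: mx_eqI simp: mult_nth_2)

text \<open>The locale covers gl(2) and q(2) at once. The disjunction in \<open>S1\<close> accounts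
  for gl(2), whose odd part is zero and does not contain \<open>Fb\<close>; apart from the action of
  H_1 by \<open>tt\<close>, nothing specific is assumed about \<open>V\<close>.\<close>

locale hw = enveloping S + b: enveloping b + V: umod b V
  for S b :: "bit \<Rightarrow> 'k::field_char_0 smat set" and V :: "('k uea, 'v, 'm) supermodule_scheme" +
  fixes tt :: 'k
  assumes b_sub: "b i \<subseteq> S i"
    and Fm: "Fm \<in> S 0" and H1m: "H1m \<in> b 0"
    and S0: "X \<in> S 0 ==> \<exists>Y\<in>b 0. \<exists>c. X = Y + mat c ** Fm"
    and S1: "X \<in> S 1 ==> \<exists>Y\<in>b 1. \<exists>c. X = Y + mat c ** Fb \<and> (Fb \<in> S 1 \<or> c = 0)"
    and H1V: "w \<in> carrier V ==> ugen b H1m \<odot>\<^bsub>V\<^esub> w = ucst b tt \<odot>\<^bsub>V\<^esub> w"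
    and grV: "gr V i \<subseteq> carrier V" "w \<in> carrier V ==> \<exists>x\<in>gr V 0. \<exists>y\<in>gr V 1. w = x \<oplus>\<^bsub>V\<^esub> y"
begin

abbreviation E where "E \<equiv> env_bimodule b S"
abbreviation Ind where "Ind \<equiv> induced b S V"

lemma E_simps:
  "carrier E = carrier (UEA S)" "(zr E) = (zr (UEA S))" "add E = add (UEA S)"
  "u \<odot>\<^bsub>E\<^esub> x = u \<otimes>\<^bsub>UEA S\<^esub> x" "gr E = env_gr S" "rsmult E x r = x \<otimes>\<^bsub>UEA S\<^esub> env_map b S r"
  by (simp_all add: env_bimodule_def)

lemma env_map_b: "p \<in> carrier (env_free b) ==> env_map b S (env_class b p) = env_class S p"
  by (rule env_map_class[OF b.lie lie b_sub])

lemma free_b: "p \<in> carrier (env_free b) ==> p \<in> carrier (env_free S)"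
  using b_sub by (fastforce simp: carrier_free_algebra)

lemma env_map_b_closed: "r \<in> carrier (UEA b) ==> env_map b S r \<in> carrier (UEA S)"
  by (auto simp: b.carrier_UEA env_map_b free_b)

lemma left_module_E: "left_module (UEA S) E"
proof -
  interpret R: ring "UEA S" by (rule ring_UEA)
  have "abelian_group E"
    by (rule abelian_groupI)
      (auto simp: E_simps R.add.m_ac intro!: bexI[of _ "\<ominus>\<^bsub>UEA S\<^esub> x" for x] R.l_neg)
  then show ?thesis
    by (intro left_module.intro R.ring_axioms left_module_axioms.intro)
      (auto simp: E_simps R.l_distr R.r_distr R.m_assoc)
qed

sublocale tens "UEA S" E V "UEA b"
proof -
  interpret R: ring "UEA S" by (rule ring_UEA)
  show "tens (UEA S) E V (UEA b)"
    by (intro tens.intro left_module_E tens_axioms.intro V.M.abelian_group_axioms)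
      (auto simp: E_simps env_map_b_closed R.m_assoc)
qed

lemma Ind_T: "Ind = T"
  by (simp add: induced_def)

sublocale I: umod S Ind
  unfolding Ind_T by (rule left_module_umod[OF lie left_module_T])

definition e where "e w = tn \<one>\<^bsub>UEA S\<^esub> w"

lemma e_closed: "w \<in> carrier V ==> e w \<in> carrier Ind"
  unfolding e_def Ind_T by (rule tn_closed) (simp_all add: E_simps L.R.one_closed)

lemma tn_eq: "u \<in> carrier (UEA S) ==> w \<in> carrier V ==> tn u w = u \<odot>\<^bsub>Ind\<^esub> e w"
  unfolding e_def Ind_T by (subst tn_smult) (simp_all add: E_simps)

lemma e_add: "w \<in> carrier V ==> w' \<in> carrier V ==> e (w \<oplus>\<^bsub>V\<^esub> w') = e w \<oplus>\<^bsub>Ind\<^esub> e w'"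
  unfolding e_def Ind_T by (rule tn_addr) (simp_all add: E_simps)

lemma e_act:
  assumes "p \<in> carrier (env_free b)" "w \<in> carrier V"
  shows "e (env_class b p \<odot>\<^bsub>V\<^esub> w) = env_class S p \<odot>\<^bsub>Ind\<^esub> e w"
proof -
  have "tn (rsmult E \<one>\<^bsub>UEA S\<^esub> (env_class b p)) w = e (env_class b p \<odot>\<^bsub>V\<^esub> w)"
    unfolding e_def by (rule tn_bal) (simp_all add: E_simps assms)
  with assms show ?thesis by (simp add: E_simps env_map_b free_b flip: tn_eq)
qed

lemma e_cs: "w \<in> carrier V ==> ucst S c \<odot>\<^bsub>Ind\<^esub> e w = e (ucst b c \<odot>\<^bsub>V\<^esub> w)"
  by (simp add: e_act)

lemma e_ge: "X \<in> b i ==> w \<in> carrier V ==> ugen S X \<odot>\<^bsub>Ind\<^esub> e w = e (ugen b X \<odot>\<^bsub>V\<^esub> w)"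
  by (simp add: e_act fgen_env_closed)

text \<open>The spanning half of a Poincare-Birkhoff-Witt basis: the vectors F^j w and F^(j-1) Fb w,
  where the index is the depth below the highest weight and w runs through \<open>V\<close>.\<close>

inductive spk :: "nat \<Rightarrow> _ \<Rightarrow> bool" where
  base: "w \<in> carrier V ==> spk 0 (e w)"
| fb: "w \<in> carrier V ==> Fb \<in> S 1 ==> spk 1 (ugen S Fb \<odot>\<^bsub>Ind\<^esub> e w)"
| f: "spk j x ==> spk (Suc j) (ugen S Fm \<odot>\<^bsub>Ind\<^esub> x)"

inductive spn where
  zero: "spn (zr Ind)"
| add: "spk j x ==> spn y ==> spn (x \<oplus>\<^bsub>Ind\<^esub> y)"

lemma spk_0:
  assumes "spk 0 x"
  shows "\<exists>w\<in>carrier V. x = e w"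
  using assms by cases (simp_all, blast)

lemma spk_closed: "spk j x ==> x \<in> carrier Ind"
  by (induction rule: spk.induct) (auto intro: e_closed I.ge_closed[OF Fm] I.ge_closed)

lemma spn_closed: "spn x ==> x \<in> carrier Ind"
  by (induction rule: spn.induct) (auto dest: spk_closed)

lemma spk_cs: "spk j x ==> spk j (ucst S c \<odot>\<^bsub>Ind\<^esub> x)"
proof (induction rule: spk.induct)
  case (base w)
  then show ?case by (simp add: e_cs spk.base V.cs_closed)
next
  case (fb w)
  then show ?case
    using spk.fb[of "ucst b c \<odot>\<^bsub>V\<^esub> w"] I.cs_central[OF ugen_closed[OF fb(2)] e_closed[OF fb(1)]]
    by (simp add: e_cs)
next
  case (f j x)
  then show ?case
    using spk.f[OF f.IH] I.cs_central[OF ugen_closed[OF Fm] spk_closed[OF f(1)]] by simp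
qed

lemma spn_add: "spn x ==> spn y ==> spn (x \<oplus>\<^bsub>Ind\<^esub> y)"
  by (induction rule: spn.induct)
    (auto simp: spn_closed spk_closed I.M.a_assoc intro!: spn.intros)

lemma spk_spn: "spk j x ==> spn x"
  using spn.add[OF _ spn.zero] spk_closed by fastforce

lemma spn_map:
  assumes "spn x" "u \<in> carrier (UEA S)" "\<And>j y. spk j y ==> spn (u \<odot>\<^bsub>Ind\<^esub> y)"
  shows "spn (u \<odot>\<^bsub>Ind\<^esub> x)"
  using assms(1)
  by (induction rule: spn.induct)
    (use assms(2,3) in \<open>auto simp: spn.zero spn_closed spk_closed I.lsmult_r_distr intro: spn_add\<close>)

lemma spn_cs: "spn x ==> spn (ucst S c \<odot>\<^bsub>Ind\<^esub> x)"
  by (rule spn_map) (auto intro: spk_spn spk_cs)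

lemma spn_Fm: "spn x ==> spn (ugen S Fm \<odot>\<^bsub>Ind\<^esub> x)"
  by (rule spn_map) (auto intro: spk_spn spk.f ugen_closed[OF Fm])

text \<open>The self-bracket of the odd lowering element is twice its square and it vanishes;
  characteristic zero allows dividing by two.\<close>

lemma FbFb:
  assumes "Fb \<in> S 1" "x \<in> carrier Ind"
  shows "ugen S Fb \<odot>\<^bsub>Ind\<^esub> (ugen S Fb \<odot>\<^bsub>Ind\<^esub> x) = (zr Ind)"
proof -
  let ?y = "ugen S Fb \<odot>\<^bsub>Ind\<^esub> (ugen S Fb \<odot>\<^bsub>Ind\<^esub> x)"
  have y: "?y \<in> carrier Ind" by (intro I.ge_closed[OF assms(1)] assms)
  have "?y = ucst S (- 1) \<odot>\<^bsub>Ind\<^esub> ?y"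
    using I.ge_commute[OF assms(1,1,2)] assms y by (simp add: bracket_lowering I.ge_zero koszul_def)
  then have "ucst S (1 + 1) \<odot>\<^bsub>Ind\<^esub> ?y = ucst S 1 \<odot>\<^bsub>Ind\<^esub> ?y \<oplus>\<^bsub>Ind\<^esub> ucst S (- 1) \<odot>\<^bsub>Ind\<^esub> ?y"
    using y by (simp only: I.cs_add I.cs_one)
  also have "\<dots> = (zr Ind)"
    unfolding I.cs_add[OF y, symmetric] by (simp add: I.cs_zero y)
  finally show ?thesis using I.cs_cancel[OF _ y, of "1 + 1"] by simp
qed

lemma FbFm:
  assumes "Fb \<in> S 1" "x \<in> carrier Ind"
  shows "ugen S Fb \<odot>\<^bsub>Ind\<^esub> (ugen S Fm \<odot>\<^bsub>Ind\<^esub> x) = ugen S Fm \<odot>\<^bsub>Ind\<^esub> (ugen S Fb \<odot>\<^bsub>Ind\<^esub> x)"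
  using I.ge_commute[OF assms(1) Fm assms(2)] I.ge_closed[OF Fm I.ge_closed[OF assms]] assms
  by (simp add: bracket_lowering I.ge_zero koszul_def I.cs_one)

text \<open>On a highest weight vector the Borel part of a generator is absorbed into
  \<open>V\<close> through the balanced tensor product, and a multiple of the lowering element of
  the same parity remains. The third alternative is the case where the odd lowering element is
  absent, as in gl(2).\<close>

lemma split_gen:
  assumes X: "X \<in> S i" and w: "w \<in> carrier V"
  obtains w' c where "w' \<in> carrier V" "i = 0" "ugen S X \<odot>\<^bsub>Ind\<^esub> e w = e w' \<oplus>\<^bsub>Ind\<^esub> ucst S c \<odot>\<^bsub>Ind\<^esub> (ugen S Fm \<odot>\<^bsub>Ind\<^esub> e w)"
  | w' c where "w' \<in> carrier V" "i = 1" "Fb \<in> S 1" "ugen S X \<odot>\<^bsub>Ind\<^esub> e w = e w' \<oplus>\<^bsub>Ind\<^esub> ucst S c \<odot>\<^bsub>Ind\<^esub> (ugen S Fb \<odot>\<^bsub>Ind\<^esub> e w)"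
  | w' where "w' \<in> carrier V" "i = 1" "ugen S X \<odot>\<^bsub>Ind\<^esub> e w = e w'"
proof -
  have mem: "Y \<in> S j" if "Y \<in> b j" for Y j using b_sub that by blast
  consider "i = 0" | "i = 1" using bit_cases[of i] by blast
  then show thesis
  proof cases
    case 1
    then obtain Y c where Y: "Y \<in> b 0" "X = Y + mat c ** Fm" using S0 X by blast
    show ?thesis
    proof (rule that(1)[of "ugen b Y \<odot>\<^bsub>V\<^esub> w" c])
      show "ugen b Y \<odot>\<^bsub>V\<^esub> w \<in> carrier V" by (rule V.ge_closed[OF Y(1) w])
      show "ugen S X \<odot>\<^bsub>Ind\<^esub> e w = e (ugen b Y \<odot>\<^bsub>V\<^esub> w) \<oplus>\<^bsub>Ind\<^esub> ucst S c \<odot>\<^bsub>Ind\<^esub> (ugen S Fm \<odot>\<^bsub>Ind\<^esub> e w)"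
        unfolding Y(2) I.ge_add[OF mem[OF Y(1)] S_closed(3)[OF Fm] e_closed[OF w]]
          I.ge_scale[OF Fm e_closed[OF w]] e_ge[OF Y(1) w] ..
    qed fact
  next
    case 2
    then obtain Y c where Y: "Y \<in> b 1" "X = Y + mat c ** Fb" "Fb \<in> S 1 \<or> c = 0" using S1 X by blast
    show ?thesis
    proof (cases "Fb \<in> S 1")
      case True
      show ?thesis
      proof (rule that(2)[of "ugen b Y \<odot>\<^bsub>V\<^esub> w" c])
        show "ugen b Y \<odot>\<^bsub>V\<^esub> w \<in> carrier V" by (rule V.ge_closed[OF Y(1) w])
        show "ugen S X \<odot>\<^bsub>Ind\<^esub> e w = e (ugen b Y \<odot>\<^bsub>V\<^esub> w) \<oplus>\<^bsub>Ind\<^esub> ucst S c \<odot>\<^bsub>Ind\<^esub> (ugen S Fb \<odot>\<^bsub>Ind\<^esub> e w)"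
          unfolding Y(2) I.ge_add[OF mem[OF Y(1)] S_closed(3)[OF True] e_closed[OF w]]
            I.ge_scale[OF True e_closed[OF w]] e_ge[OF Y(1) w] ..
      qed fact+
    next
      case False
      then have "X = Y" using Y(2,3) by (simp add: smat_eq_iff mat_mult_nth)
      then show ?thesis using e_ge[OF Y(1) w] V.ge_closed[OF Y(1) w] 2 that(3) by blast
    qed
  qed
qed

lemma spn_Xe:
  assumes "X \<in> S i" "w \<in> carrier V"
  shows "spn (ugen S X \<odot>\<^bsub>Ind\<^esub> e w)"
  using assms
proof (rule split_gen)
  fix w' c assume "w' \<in> carrier V" "ugen S X \<odot>\<^bsub>Ind\<^esub> e w = e w' \<oplus>\<^bsub>Ind\<^esub> ucst S c \<odot>\<^bsub>Ind\<^esub> (ugen S Fm \<odot>\<^bsub>Ind\<^esub> e w)"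
  then show ?thesis using assms by (auto intro!: spn_add spn_cs spn_Fm spk_spn[OF spk.base])
next
  fix w' c assume "w' \<in> carrier V" "Fb \<in> S 1" "ugen S X \<odot>\<^bsub>Ind\<^esub> e w = e w' \<oplus>\<^bsub>Ind\<^esub> ucst S c \<odot>\<^bsub>Ind\<^esub> (ugen S Fb \<odot>\<^bsub>Ind\<^esub> e w)"
  then show ?thesis using assms by (auto intro!: spn_add spn_cs spk_spn[OF spk.base] spk_spn[OF spk.fb])
next
  fix w' assume "w' \<in> carrier V" "ugen S X \<odot>\<^bsub>Ind\<^esub> e w = e w'"
  then show ?thesis by (auto intro!: spk_spn[OF spk.base])
qed

lemma spn_FbXe:
  assumes "X \<in> S i" "w \<in> carrier V" and Fb: "Fb \<in> S 1"
  shows "spn (ugen S Fb \<odot>\<^bsub>Ind\<^esub> (ugen S X \<odot>\<^bsub>Ind\<^esub> e w))"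
proof -
  note ce = e_closed[OF assms(2)]
  have s: "spn (ugen S Fb \<odot>\<^bsub>Ind\<^esub> e w')" if "w' \<in> carrier V" for w'
    by (rule spk_spn[OF spk.fb[OF that Fb]])
  show ?thesis
    using assms(1,2)
  proof (rule split_gen)
    fix w' c assume w': "w' \<in> carrier V" and eq: "ugen S X \<odot>\<^bsub>Ind\<^esub> e w = e w' \<oplus>\<^bsub>Ind\<^esub> ucst S c \<odot>\<^bsub>Ind\<^esub> (ugen S Fm \<odot>\<^bsub>Ind\<^esub> e w)"
    note c1 = I.ge_closed[OF Fm ce]
    show ?thesis
      unfolding eq I.lsmult_r_distr[OF ugen_closed[OF Fb] e_closed[OF w'] I.cs_closed[OF c1]]
        I.cs_central[OF ugen_closed[OF Fb] c1, symmetric] FbFm[OF Fb ce]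
      by (intro spn_add spn_cs spn_Fm s w' assms(2))
  next
    fix w' c assume w': "w' \<in> carrier V" and eq: "ugen S X \<odot>\<^bsub>Ind\<^esub> e w = e w' \<oplus>\<^bsub>Ind\<^esub> ucst S c \<odot>\<^bsub>Ind\<^esub> (ugen S Fb \<odot>\<^bsub>Ind\<^esub> e w)"
    note c1 = I.ge_closed[OF Fb ce]
    show ?thesis
      unfolding eq I.lsmult_r_distr[OF ugen_closed[OF Fb] e_closed[OF w'] I.cs_closed[OF c1]]
        I.cs_central[OF ugen_closed[OF Fb] c1, symmetric] FbFb[OF Fb ce]
      by (intro spn_add spn_cs spn.zero s w')
  next
    fix w' assume "w' \<in> carrier V" "ugen S X \<odot>\<^bsub>Ind\<^esub> e w = e w'"
    then show ?thesis using s by simp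
  qed
qed

text \<open>A generator is moved to the right past the lowering elements. Each commutation leaves a
  superbracket, which is again a generator acting on a vector of smaller depth; hence the induction
  generalises over \<open>X\<close>.\<close>

lemma spn_X: "spk j x ==> X \<in> S i ==> spn (ugen S X \<odot>\<^bsub>Ind\<^esub> x)"
proof (induction arbitrary: X i rule: spk.induct)
  case (base w)
  then show ?case by (rule spn_Xe[rotated])
next
  case (fb w)
  show ?case
    unfolding I.ge_commute[OF fb(3,2) e_closed[OF fb(1)]]
    by (intro spn_add spn_cs spn_FbXe[OF fb(3,1,2)] spn_Xe[OF S_closed(4)[OF fb(3,2)] fb(1)])
next
  case (f j x)
  show ?case
    unfolding I.ge_commute[OF f.prems Fm spk_closed[OF f.hyps]]
    by (intro spn_add spn_cs spn_Fm f.IH[OF f.prems] f.IH[OF S_closed(4)[OF f.prems Fm]])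
qed

lemma spn_all:
  assumes "x \<in> carrier Ind"
  shows "spn x"
proof -
  have act: "spn (u \<odot>\<^bsub>Ind\<^esub> x)" if "u \<in> carrier (UEA S)" "spn x" for u x
    using that
  proof (induction arbitrary: x rule: UEA_induct)
    case (gen X i)
    show ?case by (rule spn_map[OF gen(2) ugen_closed[OF gen(1)] spn_X[OF _ gen(1)]])
  next
    case (add u v)
    show ?case
      unfolding I.lsmult_l_distr[OF add(1,2) spn_closed[OF add(5)]]
      by (rule spn_add[OF add(3)[OF add(5)] add(4)[OF add(5)]])
  next
    case (mult u v)
    show ?case
      unfolding I.lsmult_assoc[OF mult(1,2) spn_closed[OF mult(5)]]
      by (rule mult(3)[OF mult(4)[OF mult(5)]])
  next
    case (const c)
    show ?case by (rule spn_cs[OF const])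
  qed
  have "x \<in> carrier T" using assms by (simp add: Ind_T)
  then show ?thesis
  proof (induction rule: T_induct)
    case (tn u w)
    then show ?case using act[OF _ spk_spn[OF spk.base]] by (simp add: E_simps tn_eq)
  next
    case (add x y)
    then show ?case using spn_add by (simp add: Ind_T)
  qed
qed

lemma spk_weight:
  "spk j x ==> ugen S H1m \<odot>\<^bsub>Ind\<^esub> x = ucst S (tt - of_nat j) \<odot>\<^bsub>Ind\<^esub> x"
proof (induction rule: spk.induct)
  case (base w)
  then show ?case by (simp add: e_ge[OF H1m] H1V e_cs)
next
  case (fb w)
  have H: "H1m \<in> S 0" using H1m b_sub by blast
  note c = e_closed[OF fb(1)]
  note c2 = I.ge_closed[OF fb(2) c]
  have "ugen S H1m \<odot>\<^bsub>Ind\<^esub> (ugen S Fb \<odot>\<^bsub>Ind\<^esub> e w) =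
      ugen S Fb \<odot>\<^bsub>Ind\<^esub> (ucst S tt \<odot>\<^bsub>Ind\<^esub> e w) \<oplus>\<^bsub>Ind\<^esub> ucst S (- 1) \<odot>\<^bsub>Ind\<^esub> (ugen S Fb \<odot>\<^bsub>Ind\<^esub> e w)"
    unfolding I.ge_commute[OF H fb(2) c] bracket_lowering I.ge_scale[OF fb(2) c]
    using fb c by (simp add: koszul_def e_ge[OF H1m] H1V e_cs I.cs_one I.ge_closed[OF fb(2)] e_closed)
  then show ?case
    unfolding I.cs_central[OF ugen_closed[OF fb(2)] c, symmetric] I.cs_add[OF c2, symmetric] by simp
next
  case (f j x)
  have H: "H1m \<in> S 0" using H1m b_sub by blast
  note c = spk_closed[OF f.hyps]
  note c2 = I.ge_closed[OF Fm c]
  have "ugen S H1m \<odot>\<^bsub>Ind\<^esub> (ugen S Fm \<odot>\<^bsub>Ind\<^esub> x) =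
      ugen S Fm \<odot>\<^bsub>Ind\<^esub> (ucst S (tt - of_nat j) \<odot>\<^bsub>Ind\<^esub> x) \<oplus>\<^bsub>Ind\<^esub> ucst S (- 1) \<odot>\<^bsub>Ind\<^esub> (ugen S Fm \<odot>\<^bsub>Ind\<^esub> x)"
    unfolding I.ge_commute[OF H Fm c] bracket_lowering I.ge_scale[OF Fm c] f.IH
    using c by (simp add: koszul_def I.cs_one I.ge_closed[OF Fm])
  then show ?case
    unfolding I.cs_central[OF ugen_closed[OF Fm] c, symmetric] I.cs_add[OF c2, symmetric]
    by (simp add: algebra_simps)
qed

text \<open>These elements of the enveloping algebra act by 1 on the weight \<open>tt\<close> and kill
  finitely many lower weights.\<close>

fun pel :: "nat \<Rightarrow> 'k uea" where
  "pel 0 = \<one>\<^bsub>UEA S\<^esub>"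
| "pel (Suc n) = (ucst S (1 / of_nat (Suc n)) \<otimes>\<^bsub>UEA S\<^esub>
     (ugen S H1m \<oplus>\<^bsub>UEA S\<^esub> ucst S (of_nat (Suc n) - tt))) \<otimes>\<^bsub>UEA S\<^esub> pel n"

lemma H1S: "H1m \<in> S 0" using H1m b_sub by blast

lemma pel_closed: "pel n \<in> carrier (UEA S)"
  using ugen_closed[OF H1S] by (induction n) (auto intro!: L.R.m_closed)

text \<open>On the weight \<open>tt - k\<close> the i-th factor is the scalar (i - k) / i. It equals
  1 for k = 0 and vanishes for i = k, so the product dies as soon as n reaches a positive depth
  k.\<close>

lemma pel_weight:
  assumes "umod S M" and x: "x \<in> carrier M"
    and wt: "ugen S H1m \<odot>\<^bsub>M\<^esub> x = ucst S (tt - of_nat k) \<odot>\<^bsub>M\<^esub> x"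
  shows "pel n \<odot>\<^bsub>M\<^esub> x = ucst S (\<Prod>i=1..n. (of_nat i - of_nat k) / of_nat i) \<odot>\<^bsub>M\<^esub> x"
proof -
  interpret M: umod S M by fact
  show ?thesis
  proof (induction n)
    case 0
    then show ?case using x by (simp add: M.cs_one)
  next
    case (Suc n)
    let ?c = "\<Prod>i=1..n. (of_nat i - of_nat k) / of_nat i :: 'k"
    let ?u = "ugen S H1m \<oplus>\<^bsub>UEA S\<^esub> ucst S (of_nat (Suc n) - tt)"
    have u: "?u \<in> carrier (UEA S)" using ugen_closed[OF H1S] by (intro L.R.add.m_closed) auto
    have "?u \<odot>\<^bsub>M\<^esub> x = ucst S (of_nat (Suc n) - of_nat k) \<odot>\<^bsub>M\<^esub> x"
      using x ugen_closed[OF H1S] by (simp add: M.lsmult_l_distr wt flip: M.cs_add)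
    note ux = this
    have "pel (Suc n) \<odot>\<^bsub>M\<^esub> x = ucst S (1 / of_nat (Suc n)) \<odot>\<^bsub>M\<^esub> (?u \<odot>\<^bsub>M\<^esub> (pel n \<odot>\<^bsub>M\<^esub> x))"
      unfolding pel.simps M.lsmult_assoc[OF L.R.m_closed[OF ucst_closed u] pel_closed x]
        M.lsmult_assoc[OF ucst_closed u M.lsmult_closed[OF pel_closed x]] ..
    also have "\<dots> = ucst S (1 / of_nat (Suc n)) \<odot>\<^bsub>M\<^esub> (ucst S ?c \<odot>\<^bsub>M\<^esub> (ucst S (of_nat (Suc n) - of_nat k) \<odot>\<^bsub>M\<^esub> x))"
      unfolding Suc M.cs_central[OF u x, symmetric] ux ..
    also have "\<dots> = ucst S (1 / of_nat (Suc n) * (?c * (of_nat (Suc n) - of_nat k))) \<odot>\<^bsub>M\<^esub> x"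
      by (simp only: M.cs_mult x M.cs_closed)
    finally show ?case by (simp add: mult.commute)
  qed
qed

lemma pel_top:
  assumes "umod S M" "x \<in> carrier M" "ugen S H1m \<odot>\<^bsub>M\<^esub> x = ucst S tt \<odot>\<^bsub>M\<^esub> x"
  shows "pel n \<odot>\<^bsub>M\<^esub> x = x"
proof -
  have "(\<Prod>i=1..n. (of_nat i - of_nat 0) / of_nat i :: 'k) = 1" by (rule prod.neutral) auto
  then show ?thesis
    using pel_weight[OF assms(1,2), of 0 n] assms umod.cs_one[OF assms(1,2)] by simp
qed

text \<open>A vector is a finite sum, so for large n all summands of positive depth are killed while
  those of depth zero stay fixed. Having the same \<open>w\<close> for all large n is what lets the
  bounds of two summands be combined.\<close>

lemma pel_spn: "spn x ==> \<exists>w\<in>carrier V. \<exists>n0. \<forall>n\<ge>n0. pel n \<odot>\<^bsub>Ind\<^esub> x = e w"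
proof (induction rule: spn.induct)
  case zero
  have "e (zr V) = (zr Ind)"
    unfolding e_def Ind_T by (rule tn_zero_right) (simp add: E_simps)
  then show ?case by (intro bexI[of _ "(zr V)"]) (simp_all add: pel_closed)
next
  case (add j x y)
  then obtain w n0 where w: "w \<in> carrier V" "\<forall>n\<ge>n0. pel n \<odot>\<^bsub>Ind\<^esub> y = e w" by blast
  have d: "pel n \<odot>\<^bsub>Ind\<^esub> (x \<oplus>\<^bsub>Ind\<^esub> y) = pel n \<odot>\<^bsub>Ind\<^esub> x \<oplus>\<^bsub>Ind\<^esub> pel n \<odot>\<^bsub>Ind\<^esub> y" for n
    by (rule I.lsmult_r_distr[OF pel_closed spk_closed[OF add(1)] spn_closed[OF add(2)]])
  show ?case
  proof (cases j)
    case 0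
    obtain w' where w': "w' \<in> carrier V" "x = e w'" using spk_0 add(1) unfolding 0 by blast
    have wt: "ugen S H1m \<odot>\<^bsub>Ind\<^esub> e w' = ucst S tt \<odot>\<^bsub>Ind\<^esub> e w'"
      using spk_weight[OF spk.base[OF w'(1)]] unfolding of_nat_0 diff_zero .
    have "pel n \<odot>\<^bsub>Ind\<^esub> x = e w'" for n
      unfolding w'(2) by (rule pel_top[OF I.umod_axioms e_closed[OF w'(1)] wt])
    then show ?thesis using w w'(1)
      by (intro bexI[of _ "w' \<oplus>\<^bsub>V\<^esub> w"] exI[of _ n0]) (simp_all add: d e_add)
  next
    case (Suc k)
    have "pel n \<odot>\<^bsub>Ind\<^esub> x = (zr Ind)" if "n \<ge> j" for n
    proof -
      have 0: "(\<Prod>i=1..n. (of_nat i - of_nat j) / of_nat i :: 'k) = 0"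
        using that Suc by (intro prod_zero) (auto intro!: bexI[of _ j])
      note c = spk_closed[OF add(1)]
      show ?thesis
        unfolding pel_weight[OF I.umod_axioms c spk_weight[OF add(1)]] 0 by (rule I.cs_zero[OF c])
    qed
    then show ?thesis using w
      by (intro bexI[of _ w] exI[of _ "max n0 j"]) (simp_all add: d e_closed)
  qed
qed

lemma Ind_gr: "gr Ind i \<subseteq> carrier Ind" "x \<in> carrier Ind ==> \<exists>a\<in>gr Ind 0. \<exists>b\<in>gr Ind 1. x = a \<oplus>\<^bsub>Ind\<^esub> b"
proof -
  interpret R: ring "UEA S" by (rule ring_UEA)
  have sub: "subgroup (gr E i) (add_monoid E)" for i
    using env_gr_subgroup[of i] by (simp add: subgroup_def m_inv_def E_simps)
  have grc: "gr E i \<subseteq> carrier E" for i using env_gr_closed by (auto simp: E_simps)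
  show 1: "gr Ind i \<subseteq> carrier Ind" for i
  proof
    fix x assume "x \<in> gr Ind i"
    then have "x \<in> gr T i" by (simp add: Ind_T)
    then have "x \<in> carrier T"
      using sub grV(1)
    proof (rule T_gr_induct)
      fix j u w assume "u \<in> gr E j" "w \<in> gr V (i + j)"
      then show "tn u w \<in> carrier T" using grc grV(1) tn_closed by blast
    qed auto
    then show "x \<in> carrier Ind" by (simp add: Ind_T)
  qed
  assume "x \<in> carrier Ind"
  then have "x \<in> carrier T" by (simp add: Ind_T)
  then have "\<exists>a\<in>gr T 0. \<exists>b\<in>gr T 1. x = a \<oplus>\<^bsub>T\<^esub> b"
  proof (induction rule: T_induct)
    case (tn u w)
    obtain p q where u: "p \<in> env_gr S 0" "q \<in> env_gr S 1" "u = p \<oplus>\<^bsub>UEA S\<^esub> q"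
      using env_gr_dec[of u] tn(1) unfolding E_simps(1) by blast
    obtain y z where w: "y \<in> gr V 0" "z \<in> gr V 1" "w = y \<oplus>\<^bsub>V\<^esub> z" using grV(2)[OF tn(2)] by blast
    have c: "p \<in> carrier E" "q \<in> carrier E" "y \<in> carrier V" "z \<in> carrier V"
      using u w grV(1) env_gr_closed by (auto simp: E_simps)
    have t: "tn p y \<in> gr T 0" "tn q z \<in> gr T 0" "tn p z \<in> gr T 1" "tn q y \<in> gr T 1"
      using tn_gr[of p 0 y 0] tn_gr[of q 1 z 0] tn_gr[of p 0 z 1] tn_gr[of q 1 y 1] u w by (simp_all add: E_simps)
    have "u = p \<oplus>\<^bsub>E\<^esub> q" using u by (simp add: E_simps)
    then have "tn u w = (tn p y \<oplus>\<^bsub>T\<^esub> tn q z) \<oplus>\<^bsub>T\<^esub> (tn p z \<oplus>\<^bsub>T\<^esub> tn q y)"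
      using c w(3) tn_closed by (simp add: tn_addl tn_addr TT.a_ac)
    then show ?case using T_gr_add[OF grc grV(1)] t by blast
  next
    case (add x y)
    then obtain a b c d where *: "a \<in> gr T 0" "b \<in> gr T 1" "x = a \<oplus>\<^bsub>T\<^esub> b" "c \<in> gr T 0" "d \<in> gr T 1" "y = c \<oplus>\<^bsub>T\<^esub> d"
      by blast
    then have "a \<in> carrier T" "b \<in> carrier T" "c \<in> carrier T" "d \<in> carrier T"
      using 1 by (auto simp: Ind_T)
    with * have "x \<oplus>\<^bsub>T\<^esub> y = (a \<oplus>\<^bsub>T\<^esub> c) \<oplus>\<^bsub>T\<^esub> (b \<oplus>\<^bsub>T\<^esub> d)" by (simp add: TT.a_ac)
    then show ?case using T_gr_add[OF grc grV(1)] * by blast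
  qed
  then show "\<exists>a\<in>gr Ind 0. \<exists>b\<in>gr Ind 1. x = a \<oplus>\<^bsub>Ind\<^esub> b" by (simp add: Ind_T)
qed

text \<open>The universal property turns \<open>\<iota>\<close> into a graded homomorphism onto the
  simple module \<open>N\<close>; its image is a nonzero graded submodule. Weights then show that no
  proper graded submodule surjects, and \<open>top_of_iso\<close> identifies the top.\<close>

theorem hw_top:
  assumes N: "simple_supermodule S N"
    and cl: "\<And>w. w \<in> carrier V ==> \<iota> w \<in> carrier N"
    and add: "\<And>w w'. [|w \<in> carrier V; w' \<in> carrier V|] ==> \<iota> (w \<oplus>\<^bsub>V\<^esub> w') = \<iota> w \<oplus>\<^bsub>N\<^esub> \<iota> w'"
    and c: "\<And>c w. w \<in> carrier V ==> \<iota> (ucst b c \<odot>\<^bsub>V\<^esub> w) = ucst S c \<odot>\<^bsub>N\<^esub> \<iota> w"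
    and g: "\<And>X i w. X \<in> b i ==> w \<in> carrier V ==> \<iota> (ugen b X \<odot>\<^bsub>V\<^esub> w) = ugen S X \<odot>\<^bsub>N\<^esub> \<iota> w"
    and gr: "\<And>i w. w \<in> gr V i ==> \<iota> w \<in> gr N i"
    and inj: "inj_on \<iota> (carrier V)" and ne: "carrier V \<noteq> {(zr V)}"
  obtains f where "f \<in> module_isos (UEA S) (top_of S Ind) N" "\<And>i. f ` gr (top_of S Ind) i = gr N i"
    "is_supermodule S (top_of S Ind)"
proof -
  interpret N: usmod S N using simple_supermoduleD(1)[OF N] lie by unfold_locales
  have lin: "\<iota> (r \<odot>\<^bsub>V\<^esub> w) = env_map b S r \<odot>\<^bsub>N\<^esub> \<iota> w" if "r \<in> carrier (UEA b)" "w \<in> carrier V" for r w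
  proof -
    have "\<exists>p\<in>carrier (env_free b). r = env_class b p" using that by (auto simp: b.carrier_UEA)
    then obtain p where p: "p \<in> carrier (env_free b)" "r = env_class b p" by blast
    have "\<forall>w\<in>carrier V. \<iota> (env_class b p \<odot>\<^bsub>V\<^esub> w) = env_class S p \<odot>\<^bsub>N\<^esub> \<iota> w" using p(1)
    proof (induction rule: free_algebra_induct)
      case (gen x)
      then show ?case using g by blast
    next
      case (add p q)
      then show ?case
        using assms(3) cl free_b by (simp add: b.env_class_add env_class_add V.lsmult_l_distr N.lsmult_l_distr)
    next
      case (mult p q)
      then show ?case
        using cl free_b by (simp add: b.env_class_mult env_class_mult V.lsmult_assoc N.lsmult_assoc)
    qed (use c in auto)
    then show ?thesis using p that by (simp add: env_map_b)
  qed
  obtain \<pi> where \<pi>: "\<And>z. z \<in> carrier T ==> \<pi> z \<in> carrier N"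
    "\<And>z w. [|z \<in> carrier T; w \<in> carrier T|] ==> \<pi> (z \<oplus>\<^bsub>T\<^esub> w) = \<pi> z \<oplus>\<^bsub>N\<^esub> \<pi> w"
    "\<And>u w. [|u \<in> carrier E; w \<in> carrier V|] ==> \<pi> (tn u w) = u \<odot>\<^bsub>N\<^esub> \<iota> w"
    by (rule T_universal[OF N.M.abelian_group_axioms, of "\<lambda>u w. u \<odot>\<^bsub>N\<^esub> \<iota> w"])
      (use lin cl add env_map_b_closed in \<open>auto simp: E_simps N.lsmult_l_distr N.lsmult_r_distr N.lsmult_assoc\<close>)
  note \<pi>' = \<pi>[folded Ind_T, unfolded E_simps]
  have sm: "\<pi> (r \<odot>\<^bsub>Ind\<^esub> x) = r \<odot>\<^bsub>N\<^esub> \<pi> x" if r: "r \<in> carrier (UEA S)" and x: "x \<in> carrier Ind" for r x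
  proof -
    have "x \<in> carrier T" using x by (simp add: Ind_T)
    then have "x \<in> carrier Ind \<and> \<pi> (r \<odot>\<^bsub>Ind\<^esub> x) = r \<odot>\<^bsub>N\<^esub> \<pi> x"
    proof (induction rule: T_induct)
      case (tn u w)
      then have "r \<odot>\<^bsub>Ind\<^esub> tn u w = tn (r \<otimes>\<^bsub>UEA S\<^esub> u) w"
        using r by (simp add: Ind_T tn_smult) (simp add: E_simps)
      then show ?case using tn r cl tn_closed[of u w] by (simp add: Ind_T E_simps \<pi>(3) N.lsmult_assoc)
    next
      case (add x y)
      then show ?case using r \<pi>' by (simp add: Ind_T[symmetric] I.lsmult_r_distr N.lsmult_r_distr)
    qed
    then show ?thesis by simp
  qed
  have \<pi>e: "\<pi> (e w) = \<iota> w" if "w \<in> carrier V" for w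
    using that \<pi>'(3)[of "\<one>\<^bsub>UEA S\<^esub>" w] cl unfolding e_def by simp
  have wtN: "ugen S H1m \<odot>\<^bsub>N\<^esub> \<iota> w = ucst S tt \<odot>\<^bsub>N\<^esub> \<iota> w" if "w \<in> carrier V" for w
    using that by (simp flip: g[OF H1m] c add: H1V)
  have grE: "subgroup (gr E i) (add_monoid E)" for i
    using env_gr_subgroup[of i] by (simp add: subgroup_def m_inv_def E_simps)
  have \<pi>gr: "\<pi> x \<in> gr N i" if "x \<in> gr Ind i" for i x
  proof -
    have "x \<in> gr T i" using that by (simp add: Ind_T)
    then have "x \<in> carrier T \<and> \<pi> x \<in> gr N i"
      using grE grV(1)
    proof (rule T_gr_induct)
      show "(zr T) \<in> carrier T \<and> \<pi> (zr T) \<in> gr N i"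
        using \<pi>(3)[of "(zr E)" "(zr V)"] cl N.grD(2) tn_zero[of "(zr V)"] by (simp add: E_simps)
    next
      fix j u w assume *: "u \<in> gr E j" "w \<in> gr V (i + j)"
      then have "u \<in> carrier E" "w \<in> carrier V" using grV(1) env_gr_closed by (auto simp: E_simps)
      moreover have "u \<odot>\<^bsub>N\<^esub> \<iota> w \<in> gr N (j + (i + j))"
        using * by (intro N.gr_act gr) (auto simp: E_simps)
      moreover have "j + (i + j) = i" using bit_cases[of i] bit_cases[of j] by auto
      ultimately show "tn u w \<in> carrier T \<and> \<pi> (tn u w) \<in> gr N i" by (simp add: \<pi>(3) tn_closed)
    next
      fix x y assume "x \<in> carrier T \<and> \<pi> x \<in> gr N i" "y \<in> carrier T \<and> \<pi> y \<in> gr N i"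
      then show "x \<oplus>\<^bsub>T\<^esub> y \<in> carrier T \<and> \<pi> (x \<oplus>\<^bsub>T\<^esub> y) \<in> gr N i" using \<pi>(2) N.grD(4) by simp
    qed
    then show ?thesis by simp
  qed
  have \<pi>zero: "\<pi> (zr Ind) = (zr N)"
    using \<pi>'(2)[of "(zr Ind)" "(zr Ind)"] \<pi>'(1)[of "(zr Ind)"] by (simp add: N.M.add.l_cancel_one')
  have imgrad: "graded_submodule S N (\<pi> ` carrier Ind)"
    unfolding graded_submodule_def
  proof (intro conjI submodule.intro submodule_axioms.intro ballI)
    show "subgroup (\<pi> ` carrier Ind) (add_monoid N)"
      by (rule I.image_additive_subgroup[OF N.M.abelian_group_axioms
        submodule.axioms(1)[OF I.carrier_submodule] \<pi>'(2,1)])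
    fix u x assume "u \<in> carrier (UEA S)" "x \<in> \<pi> ` carrier Ind"
    then show "u \<odot>\<^bsub>N\<^esub> x \<in> \<pi> ` carrier Ind" by (auto simp flip: sm)
  next
    fix y assume "y \<in> \<pi> ` carrier Ind"
    then obtain x where x: "x \<in> carrier Ind" "y = \<pi> x" by auto
    then obtain p q where "p \<in> gr Ind 0" "q \<in> gr Ind 1" "x = p \<oplus>\<^bsub>Ind\<^esub> q" using Ind_gr(2) by blast
    then show "\<exists>a\<in>\<pi> ` carrier Ind \<inter> gr N 0. \<exists>b\<in>\<pi> ` carrier Ind \<inter> gr N 1. y = a \<oplus>\<^bsub>N\<^esub> b"
      using x(2) \<pi>'(2) \<pi>gr Ind_gr(1) by blast
  qed
  obtain w0 where w0: "w0 \<in> carrier V" "w0 \<noteq> (zr V)" using ne V.M.zero_closed by blast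
  have "\<iota> (zr V) = (zr N)"
    using add[of "(zr V)" "(zr V)"] cl[of "(zr V)"] by (simp add: N.M.add.l_cancel_one')
  then have "\<pi> (e w0) \<noteq> (zr N)" using w0 inj \<pi>e[OF w0(1)] by (metis V.M.zero_closed inj_onD)
  then have "\<pi> ` carrier Ind \<noteq> {(zr N)}" using e_closed[OF w0(1)] by blast
  then have surj: "\<pi> ` carrier Ind = carrier N" using simple_supermoduleD(3)[OF N imgrad] by blast
  \<comment> \<open>A preimage x of \<open>\<iota> w\<close> in \<open>H\<close> is projected by
    \<open>pel n\<close> to some \<open>e w'\<close> in \<open>H\<close>. Since \<open>pel n\<close>
    fixes \<open>\<iota> w\<close>, injectivity of \<open>\<iota>\<close> gives w' = w, and the
    vectors \<open>e w\<close> generate the induced module.\<close>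
  have cover: "H = carrier Ind" if H: "graded_submodule S Ind H" "\<pi> ` H = carrier N" for H
  proof -
    have sH: "submodule H (UEA S) Ind" using H(1) by (simp add: graded_submodule_def)
    note HD = I.submoduleD[OF sH]
    have eH: "e w \<in> H" if w: "w \<in> carrier V" for w
    proof -
      obtain x where x: "x \<in> H" "\<pi> x = \<iota> w" using H(2) cl[OF w] by (metis imageE)
      then have xc: "x \<in> carrier Ind" using HD(1) by blast
      obtain w' n where w': "w' \<in> carrier V" "pel n \<odot>\<^bsub>Ind\<^esub> x = e w'"
        using pel_spn[OF spn_all[OF xc]] by blast
      have "\<iota> w' = pel n \<odot>\<^bsub>N\<^esub> \<iota> w" using \<pi>e[OF w'(1)] sm[OF pel_closed[of n] xc] w'(2) x(2) by simp
      also have "\<dots> = \<iota> w" by (rule pel_top[OF N.umod_axioms cl[OF w] wtN[OF w]])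
      finally have "w' = w" using inj w w'(1) by (simp add: inj_on_eq_iff)
      then show ?thesis using HD(6)[OF pel_closed x(1), of n] w'(2) by simp
    qed
    have "x \<in> H" if "x \<in> carrier T" for x
      using that
    proof (induction rule: T_induct)
      case (tn u w)
      then show ?case using HD(6)[OF _ eH[of w]] by (simp add: E_simps tn_eq)
    next
      case (add x y)
      then show ?case using HD(4) by (simp add: Ind_T)
    qed
    then show ?thesis using HD(1) by (auto simp: Ind_T)
  qed
  show thesis
    by (rule top_of_iso[OF I.umod_axioms Ind_gr N \<pi>'(1) \<pi>'(2) sm surj \<pi>gr cover that])
qed

end

lemma (in abelian_group) a_inv_zero: "\<ominus> \<zero> = \<zero>"
  by (rule minus_equality) simp_all

section \<open>Doubling a module over gl(2)\<close>

definition tr2 :: "'k::comm_monoid_add ^ 2 ^ 2 \<Rightarrow> 'k" where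
  "tr2 A = A $ 1 $ 1 + A $ 2 $ 2"

text \<open>\<open>N\<close> consists of two copies of \<open>L\<close>, of parities \<open>\<pi>\<close> and \<open>\<pi> + 1\<close>; the odd matrix with odd block \<open>B\<close>
  acts by \<open>(x, y) \<mapsto> (tr B \<cdot> y, B x)\<close>.  This is a module over \<open>q(2)\<close> whenever the identity matrix
  acts by zero on \<open>L\<close>.\<close>

locale doubling = L: umod g_alg L + N: usmod q_alg N
  for L :: "('k::field_char_0 uea, 'l, 'p) module_scheme" and N :: "('k uea, 'n, 'q) supermodule_scheme" +
  fixes \<pi> :: bit and \<Phi> :: "'l \<Rightarrow> 'l \<Rightarrow> 'n"
  assumes bij: "bij_betw (\<lambda>(x, y). \<Phi> x y) (carrier L \<times> carrier L) (carrier N)"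
    and Phi_add: "[|x \<in> carrier L; x' \<in> carrier L; y \<in> carrier L; y' \<in> carrier L|] ==>
      \<Phi> (x \<oplus>\<^bsub>L\<^esub> x') (y \<oplus>\<^bsub>L\<^esub> y') = \<Phi> x y \<oplus>\<^bsub>N\<^esub> \<Phi> x' y'"
    and Phi_cst: "[|x \<in> carrier L; y \<in> carrier L|] ==>
      ucst q_alg c \<odot>\<^bsub>N\<^esub> \<Phi> x y = \<Phi> (ucst g_alg c \<odot>\<^bsub>L\<^esub> x) (ucst g_alg c \<odot>\<^bsub>L\<^esub> y)"
    and Phi_even: "[|x \<in> carrier L; y \<in> carrier L|] ==>
      ugen q_alg (blockM A 0) \<odot>\<^bsub>N\<^esub> \<Phi> x y =
        \<Phi> (ugen g_alg (blockM A 0) \<odot>\<^bsub>L\<^esub> x) (ugen g_alg (blockM A 0) \<odot>\<^bsub>L\<^esub> y)"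
    and Phi_odd: "[|x \<in> carrier L; y \<in> carrier L|] ==>
      ugen q_alg (blockM 0 B) \<odot>\<^bsub>N\<^esub> \<Phi> x y =
        \<Phi> (ucst g_alg (tr2 B) \<odot>\<^bsub>L\<^esub> y) (ugen g_alg (blockM B 0) \<odot>\<^bsub>L\<^esub> x)"
    and gr0: "gr N \<pi> = (\<lambda>x. \<Phi> x (zr L)) ` carrier L"
    and gr1: "gr N (\<pi> + 1) = (\<lambda>y. \<Phi> (zr L) y) ` carrier L"
begin

lemma Phi_closed: "x \<in> carrier L ==> y \<in> carrier L ==> \<Phi> x y \<in> carrier N"
  using bij by (auto simp: bij_betw_def)

lemma Phi_ex: "z \<in> carrier N ==> \<exists>x\<in>carrier L. \<exists>y\<in>carrier L. z = \<Phi> x y"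
proof -
  assume "z \<in> carrier N"
  then have "z \<in> (\<lambda>(x, y). \<Phi> x y) ` (carrier L \<times> carrier L)" using bij by (simp add: bij_betw_def)
  then show ?thesis by auto
qed

lemma Phi_inj:
  "[|x \<in> carrier L; y \<in> carrier L; x' \<in> carrier L; y' \<in> carrier L; \<Phi> x y = \<Phi> x' y'|] ==> x = x' \<and> y = y'"
  using bij by (auto simp: bij_betw_def inj_on_def)

lemma Phi_zero: "\<Phi> (zr L) (zr L) = (zr N)"
  using Phi_add[of "(zr L)" "(zr L)" "(zr L)" "(zr L)"] Phi_closed[of "(zr L)" "(zr L)"]
  by (simp add: N.M.add.l_cancel_one')

lemma Phi_split: "x \<in> carrier L ==> y \<in> carrier L ==> \<Phi> x y = \<Phi> x (zr L) \<oplus>\<^bsub>N\<^esub> \<Phi> (zr L) y"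
  by (simp flip: Phi_add)

lemma Phi_neg:
  assumes "x \<in> carrier L" "y \<in> carrier L"
  shows "\<ominus>\<^bsub>N\<^esub> \<Phi> x y = \<Phi> (\<ominus>\<^bsub>L\<^esub> x) (\<ominus>\<^bsub>L\<^esub> y)"
  by (rule N.M.minus_equality) (use assms in \<open>simp_all flip: Phi_add add: L.M.l_neg Phi_zero Phi_closed\<close>)

lemma g_closed: "x \<in> carrier L ==> ugen g_alg (blockM A 0) \<odot>\<^bsub>L\<^esub> x \<in> carrier L"
  by (rule L.ge_closed[OF g_algI])

lemma g_sub_q: "g_alg i \<subseteq> (q_alg i :: 'k smat set)"
  by (rule even_part_subset[OF graded_lie_q])

lemma env_map_g:
  fixes p :: "'k smat fword \<Rightarrow>\<^sub>0 'k"
  shows "p \<in> carrier (env_free g_alg) ==> env_map g_alg q_alg (env_class g_alg p) = env_class q_alg p"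
  by (rule env_map_class[OF L.lie N.lie g_sub_q])

lemma free_g:
  fixes p :: "'k smat fword \<Rightarrow>\<^sub>0 'k"
  shows "p \<in> carrier (env_free g_alg) ==> p \<in> carrier (env_free (q_alg :: bit \<Rightarrow> 'k smat set))"
  using g_sub_q by (fastforce simp: carrier_free_algebra)

lemma env_map_g_closed:
  fixes u :: "'k uea"
  assumes "u \<in> Ug"
  shows "env_map g_alg q_alg u \<in> Uq"
proof -
  have "\<exists>p\<in>carrier (env_free g_alg). u = env_class g_alg p" using assms by (auto simp: L.carrier_UEA)
  then show ?thesis using env_map_g free_g N.env_class_closed by auto
qed

lemma gen_zero:
  assumes "x \<in> carrier L" "y \<in> carrier L"
  shows "ugen q_alg (0 :: 'k smat) \<odot>\<^bsub>N\<^esub> \<Phi> x y = \<Phi> (ugen g_alg 0 \<odot>\<^bsub>L\<^esub> x) (ugen g_alg 0 \<odot>\<^bsub>L\<^esub> y)"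
  using Phi_even[OF assms, of 0] by (simp add: blockM_arith(4))

lemma env_map_act:
  assumes u: "u \<in> Ug" and x: "x \<in> carrier L" "y \<in> carrier L"
  shows "env_map g_alg q_alg u \<odot>\<^bsub>N\<^esub> \<Phi> x y = \<Phi> (u \<odot>\<^bsub>L\<^esub> x) (u \<odot>\<^bsub>L\<^esub> y)"
proof -
  have "\<exists>p\<in>carrier (env_free g_alg). u = env_class g_alg p" using u by (auto simp: L.carrier_UEA)
  then obtain p where p: "p \<in> carrier (env_free g_alg)" "u = env_class g_alg p" by blast
  have "\<forall>x\<in>carrier L. \<forall>y\<in>carrier L. env_class q_alg p \<odot>\<^bsub>N\<^esub> \<Phi> x y = \<Phi> (env_class g_alg p \<odot>\<^bsub>L\<^esub> x) (env_class g_alg p \<odot>\<^bsub>L\<^esub> y)"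
    using p(1)
  proof (induction rule: free_algebra_induct)
    case (gen X)
    then consider A where "X = blockM A 0" | "X = 0" by (auto simp: g_alg_0 g_alg_1 q_alg_0)
    then show ?case
    proof cases
      case 1
      then show ?thesis using Phi_even by simp
    next
      case 2
      then show ?thesis using gen_zero by simp
    qed
  next
    case (add p q)
    then show ?case
      using free_g by (simp add: L.env_class_add N.env_class_add L.lsmult_l_distr N.lsmult_l_distr Phi_closed Phi_add)
  next
    case (mult p q)
    then show ?case
      using free_g by (simp add: L.env_class_mult N.env_class_mult L.lsmult_assoc N.lsmult_assoc Phi_closed)
  qed (simp add: Phi_cst)
  with p x show ?thesis by (simp add: env_map_g)
qed

text \<open>The odd bracket of the odd identity with itself is twice the even identity I, so the odd
  identity squares to I. The doubling formula makes the same square act on the first slot by tr(1) I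
  = 2 I, and comparison leaves I x = 0.\<close>

lemma identity_acts_zero:
  assumes x: "x \<in> carrier L"
  shows "ugen g_alg (blockM (mat 1) 0) \<odot>\<^bsub>L\<^esub> x = (zr L)"
proof -
  let ?I = "ugen g_alg (blockM (mat 1) 0)" and ?z = "ugen q_alg (blockM 0 (mat 1 :: 'k ^ 2 ^ 2))"
  have t: "tr2 (mat 1 :: 'k ^ 2 ^ 2) = 2" by (simp add: tr2_def mat_def)
  have Ix: "?I \<odot>\<^bsub>L\<^esub> x \<in> carrier L" using g_closed[OF x] .
  have IIx: "ucst g_alg 2 \<odot>\<^bsub>L\<^esub> (?I \<odot>\<^bsub>L\<^esub> x) \<in> carrier L" using Ix by simp
  have P: "\<Phi> x (zr L) \<in> carrier N" using Phi_closed x by simp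
  have zz: "?z \<odot>\<^bsub>N\<^esub> (?z \<odot>\<^bsub>N\<^esub> \<Phi> x (zr L)) = \<Phi> (ucst g_alg 2 \<odot>\<^bsub>L\<^esub> (?I \<odot>\<^bsub>L\<^esub> x)) (zr L)"
    using x Ix L.ugen_closed[OF g_algI, of "mat 1"] by (simp add: Phi_odd t)
  have "blockM (mat 1 ** mat 1 + mat 1 ** mat 1) 0 = mat 2 ** blockM (mat 1) (0 :: 'k ^ 2 ^ 2)"
    by (simp add: blockM_scale matrix_mul_lid, rule mx_eqI) (simp_all add: mult_nth_2 mat_def)
  then have b: "superbracket 1 1 (blockM 0 (mat 1)) (blockM 0 (mat 1)) = mat 2 ** blockM (mat 1) (0 :: 'k ^ 2 ^ 2)"
    by (simp add: superbracket_blockM)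
  have "\<Phi> (ucst g_alg 2 \<odot>\<^bsub>L\<^esub> (?I \<odot>\<^bsub>L\<^esub> x)) (zr L) = ucst q_alg (koszul 1 1) \<odot>\<^bsub>N\<^esub> \<Phi> (ucst g_alg 2 \<odot>\<^bsub>L\<^esub> (?I \<odot>\<^bsub>L\<^esub> x)) (zr L)
      \<oplus>\<^bsub>N\<^esub> ucst q_alg 2 \<odot>\<^bsub>N\<^esub> \<Phi> (?I \<odot>\<^bsub>L\<^esub> x) (zr L)"
    using N.ge_commute[OF q_algI(2) q_algI(2) P, of "mat 1" "mat 1", unfolded b N.ge_scale[OF q_algI(1) P] zz]
      Phi_even[OF x L.M.zero_closed, of "mat 1"] L.ugen_closed[OF g_algI, of "mat 1"] by simp
  also have "\<dots> = \<Phi> (ucst g_alg (- 1) \<odot>\<^bsub>L\<^esub> (ucst g_alg 2 \<odot>\<^bsub>L\<^esub> (?I \<odot>\<^bsub>L\<^esub> x)) \<oplus>\<^bsub>L\<^esub> ucst g_alg 2 \<odot>\<^bsub>L\<^esub> (?I \<odot>\<^bsub>L\<^esub> x)) (zr L)"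
    using Ix IIx by (simp add: koszul_def Phi_cst flip: Phi_add)
  also have "\<dots> = \<Phi> (zr L) (zr L)"
    using Ix by (simp flip: L.cs_mult L.cs_add add: L.cs_zero)
  finally have "ucst g_alg 2 \<odot>\<^bsub>L\<^esub> (?I \<odot>\<^bsub>L\<^esub> x) = (zr L)"
    using Phi_inj[OF IIx L.M.zero_closed L.M.zero_closed L.M.zero_closed] by blast
  then show ?thesis using L.cs_cancel[OF _ Ix, of 2] by simp
qed

text \<open>Kernel and image of the odd identity are thus both the first slot, which makes this slot
  intrinsic to \<open>N\<close>.\<close>

lemma zbar:
  assumes "x \<in> carrier L" "y \<in> carrier L"
  shows "ugen q_alg (blockM 0 (mat 1)) \<odot>\<^bsub>N\<^esub> \<Phi> x y = \<Phi> (ucst g_alg 2 \<odot>\<^bsub>L\<^esub> y) (zr L)"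
  using Phi_odd[OF assms, of "mat 1"] identity_acts_zero[OF assms(1)] by (simp add: tr2_def mat_def)

lemma slots_submodule:
  assumes K1: "submodule K1 Ag L" and K2: "submodule K2 Ag L"
    and t: "\<And>c y. y \<in> K2 ==> ucst g_alg c \<odot>\<^bsub>L\<^esub> y \<in> K1"
    and B: "\<And>B x. x \<in> K1 ==> ugen g_alg (blockM B 0) \<odot>\<^bsub>L\<^esub> x \<in> K2"
  shows "graded_submodule q_alg N {\<Phi> x y | x y. x \<in> K1 \<and> y \<in> K2}" (is "graded_submodule _ _ ?H")
proof -
  note D1 = L.submoduleD[OF K1] and D2 = L.submoduleD[OF K2]
  have c: "x \<in> carrier L" if "x \<in> K1 \<or> x \<in> K2" for x using that D1(1) D2(1) by blast
  have "submodule ?H Aq N"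
  proof (rule N.usubmoduleI)
    show "subgroup ?H (add_monoid N)"
    proof (rule N.M.add_subgroupI)
      show "?H \<subseteq> carrier N" using c Phi_closed by blast
      show "(zr N) \<in> ?H" using D1(2) D2(2) Phi_zero by force
      show "\<ominus>\<^bsub>N\<^esub> z \<in> ?H" if "z \<in> ?H" for z
        using that D1(3) D2(3) Phi_neg c by blast
      show "z \<oplus>\<^bsub>N\<^esub> w \<in> ?H" if zw: "z \<in> ?H" "w \<in> ?H" for z w
      proof -
        obtain x y x' y' where "x \<in> K1" "y \<in> K2" "z = \<Phi> x y" "x' \<in> K1" "y' \<in> K2" "w = \<Phi> x' y'"
          using zw by blast
        moreover from this have "z \<oplus>\<^bsub>N\<^esub> w = \<Phi> (x \<oplus>\<^bsub>L\<^esub> x') (y \<oplus>\<^bsub>L\<^esub> y')" using c by (simp add: Phi_add)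
        ultimately show ?thesis using D1(4) D2(4) by blast
      qed
    qed
  next
    fix k z assume "z \<in> ?H"
    then obtain x y where "x \<in> K1" "y \<in> K2" "z = \<Phi> x y" by blast
    moreover from this have "ucst q_alg k \<odot>\<^bsub>N\<^esub> z = \<Phi> (ucst g_alg k \<odot>\<^bsub>L\<^esub> x) (ucst g_alg k \<odot>\<^bsub>L\<^esub> y)"
      using c by (simp add: Phi_cst)
    ultimately show "ucst q_alg k \<odot>\<^bsub>N\<^esub> z \<in> ?H" using D1(8) D2(8) by blast
  next
    fix X :: "'k smat" and i z assume X: "X \<in> q_alg i" and "z \<in> ?H"
    then obtain x y where z: "x \<in> K1" "y \<in> K2" "z = \<Phi> x y" by blast
    then have xy: "x \<in> carrier L" "y \<in> carrier L" using c by auto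
    show "ugen q_alg X \<odot>\<^bsub>N\<^esub> z \<in> ?H"
      using X
    proof (cases rule: q_alg_cases)
      case (1 A)
      then show ?thesis unfolding 1 z(3) Phi_even[OF xy] using z D1(7)[OF g_algI] D2(7)[OF g_algI] by blast
    next
      case (2 B)
      then show ?thesis unfolding 2 z(3) Phi_odd[OF xy] using z t B by blast
    qed
  qed
  moreover have "\<exists>a\<in>?H \<inter> gr N 0. \<exists>b\<in>?H \<inter> gr N 1. z = a \<oplus>\<^bsub>N\<^esub> b" if z: "z \<in> ?H" for z
  proof -
    obtain x y where xy: "x \<in> K1" "y \<in> K2" "z = \<Phi> x y" using z by blast
    then have c: "x \<in> carrier L" "y \<in> carrier L" using c by auto
    have g: "\<Phi> x (zr L) \<in> ?H \<inter> gr N \<pi>" "\<Phi> (zr L) y \<in> ?H \<inter> gr N (\<pi> + 1)"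
      using xy c D1(2) D2(2) unfolding gr0 gr1 by blast+
    show ?thesis
      using bit_cases[of \<pi>]
    proof
      assume "\<pi> = 0"
      then show ?thesis using g Phi_split[OF c] xy(3) by auto
    next
      assume "\<pi> = 1"
      then have g': "\<Phi> x (zr L) \<in> ?H \<inter> gr N 1" "\<Phi> (zr L) y \<in> ?H \<inter> gr N 0" using g by simp_all
      have "z = \<Phi> (zr L) y \<oplus>\<^bsub>N\<^esub> \<Phi> x (zr L)"
        using Phi_split[OF c] xy(3) c by (simp add: N.M.a_comm Phi_closed)
      then show ?thesis using g' by blast
    qed
  qed
  ultimately show ?thesis unfolding graded_submodule_def by blast
qed

lemma simple_L:
  assumes "simple_supermodule q_alg N"
  shows "simple_module Ag L"
  unfolding simple_module_def
proof (intro conjI allI impI L.left_module_axioms)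
  show "carrier L \<noteq> {(zr L)}"
  proof
    assume 0: "carrier L = {(zr L)}"
    have "z = (zr N)" if "z \<in> carrier N" for z
      using Phi_ex[OF that] 0 Phi_zero by auto
    then show False using simple_supermoduleD(2)[OF assms] N.M.zero_closed by blast
  qed
  fix K assume K: "submodule K Ag L"
  note D = L.submoduleD[OF K]
  let ?H = "{\<Phi> x y | x y. x \<in> K \<and> y \<in> K}"
  have "graded_submodule q_alg N ?H"
    by (rule slots_submodule[OF K K D(8) D(7)[OF g_algI]])
  then consider "?H = {(zr N)}" | "?H = carrier N" using simple_supermoduleD(3)[OF assms] by blast
  then show "K = {(zr L)} \<or> K = carrier L"
  proof cases
    case 1
    have "x = (zr L)" if "x \<in> K" for x
    proof -
      have "\<Phi> x x = \<Phi> (zr L) (zr L)" using 1 that Phi_zero by auto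
      then show ?thesis using Phi_inj[of x x "(zr L)" "(zr L)"] that D(1) by auto
    qed
    then show ?thesis using D(2) by blast
  next
    case 2
    have "x \<in> K" if "x \<in> carrier L" for x
    proof -
      have "\<Phi> x x \<in> ?H" using 2 Phi_closed[OF that that] by simp
      then obtain a b where ab: "\<Phi> x x = \<Phi> a b" "a \<in> K" "b \<in> K" by auto
      then have "x = a \<and> x = b" by (intro Phi_inj) (use that D(1) in auto)
      then show ?thesis using ab by simp
    qed
    then show ?thesis using D(1) by blast
  qed
qed

text \<open>A graded submodule consists of submodules K1 and K2 of \<open>L\<close> in the two
  slots. The odd identity takes K2 into K1, and the odd version of \<open>B0\<close> takes the first
  slot to the second. The nonzero action in \<open>nt\<close> excludes the trivial module, for whose
  doubling the first slot would be a proper submodule.\<close>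

lemma simple_N:
  assumes L: "simple_module Ag L"
    and nt: "x0 \<in> carrier L" "ugen g_alg (blockM B0 0) \<odot>\<^bsub>L\<^esub> x0 \<noteq> (zr L)"
  shows "simple_supermodule q_alg N"
  unfolding simple_supermodule_def
proof (intro conjI allI impI N.smod)
  have "x0 \<noteq> (zr L)" using nt L.ugen_closed[OF g_algI, of B0] by auto
  then have "\<Phi> x0 (zr L) \<noteq> (zr N)"
    using Phi_inj[of x0 "(zr L)" "(zr L)" "(zr L)"] nt(1) Phi_zero by auto
  then show "carrier N \<noteq> {(zr N)}" using Phi_closed[OF nt(1) L.M.zero_closed] by auto
  fix H assume H: "graded_submodule q_alg N H"
  then have sH: "submodule H Aq N" by (simp add: graded_submodule_def)
  note D = N.submoduleD[OF sH]
  let ?K1 = "{x \<in> carrier L. \<Phi> x (zr L) \<in> H}" and ?K2 = "{y \<in> carrier L. \<Phi> (zr L) y \<in> H}"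
  have K: "submodule {x \<in> carrier L. \<Psi> x \<in> H} Ag L"
    if c: "\<And>x. x \<in> carrier L ==> \<Psi> x \<in> carrier N" and a: "\<And>x y. [|x \<in> carrier L; y \<in> carrier L|] ==> \<Psi> (x \<oplus>\<^bsub>L\<^esub> y) = \<Psi> x \<oplus>\<^bsub>N\<^esub> \<Psi> y"
      and z: "\<Psi> (zr L) = (zr N)" and n: "\<And>x. x \<in> carrier L ==> \<Psi> (\<ominus>\<^bsub>L\<^esub> x) = \<ominus>\<^bsub>N\<^esub> \<Psi> x"
      and s: "\<And>u x. [|u \<in> Ug; x \<in> carrier L|] ==> \<Psi> (u \<odot>\<^bsub>L\<^esub> x) = env_map g_alg q_alg u \<odot>\<^bsub>N\<^esub> \<Psi> x" for \<Psi>
  proof (intro submodule.intro submodule_axioms.intro L.M.add_subgroupI)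
    fix u :: "'k uea" and x assume u: "u \<in> Ug" and x: "x \<in> {x \<in> carrier L. \<Psi> x \<in> H}"
    from env_map_g_closed[OF u] u x D(6) s show "u \<odot>\<^bsub>L\<^esub> x \<in> {x \<in> carrier L. \<Psi> x \<in> H}" by simp
  qed (use D(2-4) a z n in auto)
  have K1: "submodule ?K1 Ag L"
    by (rule K) (auto simp: Phi_closed Phi_zero Phi_neg L.M.a_inv_zero env_map_act simp flip: Phi_add)
  have K2: "submodule ?K2 Ag L"
    by (rule K) (auto simp: Phi_closed Phi_zero Phi_neg L.M.a_inv_zero env_map_act simp flip: Phi_add)
  have split: "\<Phi> x y \<in> H \<longleftrightarrow> x \<in> ?K1 \<and> y \<in> ?K2" if xy: "x \<in> carrier L" "y \<in> carrier L" for x y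
  proof
    assume "\<Phi> x y \<in> H"
    then obtain a b where ab: "a \<in> H \<inter> gr N 0" "b \<in> H \<inter> gr N 1" "\<Phi> x y = a \<oplus>\<^bsub>N\<^esub> b"
      using H unfolding graded_submodule_def by blast
    have "\<exists>a\<in>H \<inter> gr N \<pi>. \<exists>b\<in>H \<inter> gr N (\<pi> + 1). \<Phi> x y = a \<oplus>\<^bsub>N\<^esub> b"
      using bit_cases[of \<pi>]
    proof
      assume "\<pi> = 1"
      moreover have "\<Phi> x y = b \<oplus>\<^bsub>N\<^esub> a" using ab N.gr_carrier by (auto simp: N.M.a_comm)
      ultimately show ?thesis using ab by auto
    qed (use ab in auto)
    then obtain a b where ab: "a \<in> H" "a \<in> gr N \<pi>" "b \<in> H" "b \<in> gr N (\<pi> + 1)" "\<Phi> x y = a \<oplus>\<^bsub>N\<^esub> b" by blast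
    then obtain x' y' where x': "x' \<in> carrier L" "a = \<Phi> x' (zr L)" "y' \<in> carrier L" "b = \<Phi> (zr L) y'"
      unfolding gr0 gr1 by blast
    then have "\<Phi> x y = \<Phi> x' y'" using ab(5) by (simp add: Phi_split[symmetric])
    then have "x = x' \<and> y = y'" using Phi_inj xy x' by blast
    then show "x \<in> ?K1 \<and> y \<in> ?K2" using ab x' by auto
  next
    assume "x \<in> ?K1 \<and> y \<in> ?K2"
    then show "\<Phi> x y \<in> H" using Phi_split[OF xy] D(4) by auto
  qed
  have dich: "K = {(zr L)} \<or> K = carrier L" if "submodule K Ag L" for K
    using L that by (auto simp: simple_module_def)
  have up: "\<Phi> (ucst g_alg 2 \<odot>\<^bsub>L\<^esub> y) (zr L) \<in> H" if "y \<in> ?K2" for y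
    using D(7)[OF q_algI(2)[of "mat 1"], of "\<Phi> (zr L) y"] zbar[of "(zr L)" y] that by simp
  show "H = {(zr N)} \<or> H = carrier N"
  proof (cases "?K1 = {(zr L)}")
    case True
    \<comment> \<open>Twice an element of K2 lies in K1, so K1 = 0 forces K2 = 0.\<close>
    have 2: "y = (zr L)" if y: "y \<in> ?K2" for y
    proof -
      have "ucst g_alg 2 \<odot>\<^bsub>L\<^esub> y \<in> ?K1" using up[OF y] y by simp
      then have "ucst g_alg 2 \<odot>\<^bsub>L\<^esub> y = (zr L)" unfolding True by simp
      then show ?thesis using L.cs_cancel[of 2 y] y by simp
    qed
    have "z = (zr N)" if z: "z \<in> H" for z
    proof -
      obtain x y where xy: "x \<in> carrier L" "y \<in> carrier L" "z = \<Phi> x y"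
        using Phi_ex[of z] D(1) z by blast
      then have "x \<in> ?K1" "y \<in> ?K2" using split[OF xy(1,2)] z by blast+
      then have "x = (zr L)" "y = (zr L)" using True 2 by blast+
      then show ?thesis using xy(3) Phi_zero by simp
    qed
    then show ?thesis using D(2) by blast
  next
    case False
    then have 1: "?K1 = carrier L" using dich[OF K1] by blast
    then have "\<Phi> x0 (zr L) \<in> H" using nt(1) by blast
    then have "\<Phi> (ucst g_alg (tr2 B0) \<odot>\<^bsub>L\<^esub> (zr L)) (ugen g_alg (blockM B0 0) \<odot>\<^bsub>L\<^esub> x0) \<in> H"
      using D(7)[OF q_algI(2)[of B0]] Phi_odd[OF nt(1) L.M.zero_closed, of B0] by metis
    then have "ugen g_alg (blockM B0 0) \<odot>\<^bsub>L\<^esub> x0 \<in> ?K2" using g_closed[OF nt(1)] by simp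
    then have "?K2 \<noteq> {(zr L)}" using nt(2) by blast
    then have 2: "?K2 = carrier L" using dich[OF K2] by blast
    have "z \<in> H" if z: "z \<in> carrier N" for z
    proof -
      obtain x y where xy: "x \<in> carrier L" "y \<in> carrier L" "z = \<Phi> x y" using Phi_ex[OF z] by blast
      then have "x \<in> ?K1 \<and> y \<in> ?K2" using 1 2 by blast
      then show ?thesis using split[OF xy(1,2)] xy(3) by blast
    qed
    then show ?thesis using D(1) by blast
  qed
qed

end

text \<open>The matrix over \<open>U(gl(2))\<close> by which an element of \<open>U(q(2))\<close> acts in every doubling.\<close>

inductive dmat :: "'k::field uea \<Rightarrow> 'k uea \<Rightarrow> 'k uea \<Rightarrow> 'k uea \<Rightarrow> 'k uea \<Rightarrow> bool" where
  const: "dmat (ucst q_alg c) (ucst g_alg c) (zr Ag) (zr Ag) (ucst g_alg c)"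
| even: "dmat (ugen q_alg (blockM A 0)) (ugen g_alg (blockM A 0)) (zr Ag) (zr Ag) (ugen g_alg (blockM A 0))"
| odd: "dmat (ugen q_alg (blockM 0 B)) (zr Ag) (ucst g_alg (tr2 B)) (ugen g_alg (blockM B 0)) (zr Ag)"
| add: "[|u \<in> Uq; v \<in> Uq; dmat u a b c d; dmat v a' b' c' d'|] ==>
    dmat (u \<oplus>\<^bsub>Aq\<^esub> v) (a \<oplus>\<^bsub>Ag\<^esub> a') (b \<oplus>\<^bsub>Ag\<^esub> b') (c \<oplus>\<^bsub>Ag\<^esub> c') (d \<oplus>\<^bsub>Ag\<^esub> d')"
| mult: "[|u \<in> Uq; v \<in> Uq; dmat u a b c d; dmat v a' b' c' d'|] ==>
    dmat (u \<otimes>\<^bsub>Aq\<^esub> v)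
      (a \<otimes>\<^bsub>Ag\<^esub> a' \<oplus>\<^bsub>Ag\<^esub> b \<otimes>\<^bsub>Ag\<^esub> c') (a \<otimes>\<^bsub>Ag\<^esub> b' \<oplus>\<^bsub>Ag\<^esub> b \<otimes>\<^bsub>Ag\<^esub> d')
      (c \<otimes>\<^bsub>Ag\<^esub> a' \<oplus>\<^bsub>Ag\<^esub> d \<otimes>\<^bsub>Ag\<^esub> c') (c \<otimes>\<^bsub>Ag\<^esub> b' \<oplus>\<^bsub>Ag\<^esub> d \<otimes>\<^bsub>Ag\<^esub> d')"

lemma enveloping_g: "enveloping (g_alg :: bit \<Rightarrow> 'k::field smat set)"
  by unfold_locales (rule graded_lie_g)

lemma enveloping_q: "enveloping (q_alg :: bit \<Rightarrow> 'k::field smat set)"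
  by unfold_locales (rule graded_lie_q)

text \<open>\<open>dmat\<close> is a relation: different expressions for one element may yield
  different matrices, since the odd relations hold only up to multiples of the identity matrix,
  which acts by zero in every doubling. Existence is all that the action formulas use.\<close>

lemma dmat_ex:
  fixes u :: "'k::field uea"
  assumes "u \<in> Uq"
  shows "\<exists>a b c d. dmat u a b c d"
  using assms
proof (induction rule: enveloping.UEA_induct[OF enveloping_q, consumes 1, case_names const gen add mult])
  case (const c)
  then show ?case using dmat.const by blast
next
  case (gen X i)
  then show ?case using dmat.even dmat.odd by (cases rule: q_alg_cases) blast+
next
  case (add u v)
  then show ?case using dmat.add by meson
next
  case (mult u v)
  then show ?case using dmat.mult by meson
qed

lemma dmat_closed:
  fixes u :: "'k::field uea"
  assumes "dmat u a b c d"
  shows "a \<in> Ug" "b \<in> Ug" "c \<in> Ug" "d \<in> Ug"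
proof -
  interpret G: enveloping "g_alg :: bit \<Rightarrow> 'k smat set" by (rule enveloping_g)
  interpret R: ring "Ag :: 'k uea ring" by (rule G.ring_UEA)
  have "a \<in> Ug \<and> b \<in> Ug \<and> c \<in> Ug \<and> d \<in> Ug"
    using assms by (induction rule: dmat.induct) (auto simp: G.ugen_closed[OF g_algI])
  then show "a \<in> Ug" "b \<in> Ug" "c \<in> Ug" "d \<in> Ug"
    by auto
qed

context doubling
begin

lemma dmat_act:
  assumes "dmat u a b c d" "x \<in> carrier L" "y \<in> carrier L"
  shows "u \<odot>\<^bsub>N\<^esub> \<Phi> x y = \<Phi> (a \<odot>\<^bsub>L\<^esub> x \<oplus>\<^bsub>L\<^esub> b \<odot>\<^bsub>L\<^esub> y) (c \<odot>\<^bsub>L\<^esub> x \<oplus>\<^bsub>L\<^esub> d \<odot>\<^bsub>L\<^esub> y)"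
  using assms
proof (induction arbitrary: x y rule: dmat.induct)
  case (const c)
  then show ?case by (simp add: Phi_cst)
next
  case (even A)
  then show ?case by (simp add: Phi_even g_closed)
next
  case (odd B)
  then show ?case by (simp add: Phi_odd g_closed)
next
  case (add u v a b c d a' b' c' d')
  note cl = dmat_closed[OF add(3)] dmat_closed[OF add(4)]
  from add cl show ?case
    by (simp add: N.lsmult_l_distr L.lsmult_l_distr Phi_closed L.M.a_ac flip: Phi_add)
next
  case (mult u v a b c d a' b' c' d')
  note cl = dmat_closed[OF mult(3)] dmat_closed[OF mult(4)]
  from mult cl show ?case
    by (simp add: N.lsmult_assoc L.lsmult_l_distr L.lsmult_r_distr L.lsmult_assoc Phi_closed L.M.a_ac)
qed

text \<open>Evaluating on the two slots separately shows that an element acts by zero iff all four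
  entries do. As \<open>dmat\<close> does not mention \<open>L\<close>, the right-hand side depends
  on \<open>L\<close> only through its annihilator.\<close>

lemma annihilator_N:
  "annihilator Aq N = {u \<in> Uq. \<exists>a b c d. dmat u a b c d \<and>
     {a, b, c, d} \<subseteq> annihilator Ag L}"
proof -
  have "(\<forall>z\<in>carrier N. u \<odot>\<^bsub>N\<^esub> z = (zr N)) \<longleftrightarrow> {a, b, c, d} \<subseteq> annihilator Ag L" if "dmat u a b c d" for u a b c d
  proof
    note cl = dmat_closed[OF that]
    have z: "\<Phi> x y = (zr N) ==> x = (zr L) \<and> y = (zr L)" if "x \<in> carrier L" "y \<in> carrier L" for x y
      using Phi_inj[OF that L.M.zero_closed L.M.zero_closed] Phi_zero by simp
    assume 0: "\<forall>z\<in>carrier N. u \<odot>\<^bsub>N\<^esub> z = (zr N)"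
    have "a \<odot>\<^bsub>L\<^esub> x = (zr L) \<and> c \<odot>\<^bsub>L\<^esub> x = (zr L) \<and> b \<odot>\<^bsub>L\<^esub> x = (zr L) \<and> d \<odot>\<^bsub>L\<^esub> x = (zr L)" if x: "x \<in> carrier L" for x
    proof -
      have "\<Phi> (a \<odot>\<^bsub>L\<^esub> x) (c \<odot>\<^bsub>L\<^esub> x) = (zr N)" "\<Phi> (b \<odot>\<^bsub>L\<^esub> x) (d \<odot>\<^bsub>L\<^esub> x) = (zr N)"
        using 0 dmat_act[OF \<open>dmat u a b c d\<close>, of x "(zr L)"] dmat_act[OF \<open>dmat u a b c d\<close>, of "(zr L)" x] x cl
        by (simp_all add: Phi_closed)
      then show ?thesis using z x cl by blast
    qed
    then show "{a, b, c, d} \<subseteq> annihilator Ag L" using cl by (auto simp: annihilator_def)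
  next
    assume "{a, b, c, d} \<subseteq> annihilator Ag L"
    then have *: "a \<odot>\<^bsub>L\<^esub> x = (zr L)" "b \<odot>\<^bsub>L\<^esub> x = (zr L)" "c \<odot>\<^bsub>L\<^esub> x = (zr L)" "d \<odot>\<^bsub>L\<^esub> x = (zr L)" if "x \<in> carrier L" for x
      using that by (auto simp: annihilator_def)
    show "\<forall>z\<in>carrier N. u \<odot>\<^bsub>N\<^esub> z = (zr N)"
    proof
      fix z assume "z \<in> carrier N"
      then obtain x y where "x \<in> carrier L" "y \<in> carrier L" "z = \<Phi> x y" using Phi_ex by blast
      then show "u \<odot>\<^bsub>N\<^esub> z = (zr N)" by (simp add: dmat_act[OF that] * Phi_zero)
    qed
  qed
  note iff = this
  show ?thesis
  proof (intro Set.set_eqI iffI)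
    fix u assume "u \<in> annihilator Aq N"
    then have u: "u \<in> Uq" and z: "\<forall>z\<in>carrier N. u \<odot>\<^bsub>N\<^esub> z = (zr N)"
      by (simp_all add: annihilator_def)
    obtain a b c d where m: "dmat u a b c d" using dmat_ex[OF u] by blast
    have "{a, b, c, d} \<subseteq> annihilator Ag L" using iff[OF m] z by (rule iffD1)
    with u m show "u \<in> {u \<in> Uq. \<exists>a b c d. dmat u a b c d \<and>
        {a, b, c, d} \<subseteq> annihilator Ag L}" by blast
  next
    fix u assume "u \<in> {u \<in> Uq. \<exists>a b c d. dmat u a b c d \<and>
        {a, b, c, d} \<subseteq> annihilator Ag L}"
    then have u: "u \<in> Uq"
      and "\<exists>a b c d. dmat u a b c d \<and> {a, b, c, d} \<subseteq> annihilator Ag L"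
      unfolding mem_Collect_eq by (rule conjunct1, rule conjunct2)
    then obtain a b c d where m: "dmat u a b c d" and ann: "{a, b, c, d} \<subseteq> annihilator Ag L"
      by (elim exE conjE) (rule that)
    have "\<forall>z\<in>carrier N. u \<odot>\<^bsub>N\<^esub> z = (zr N)" using iff[OF m] ann by (rule iffD2)
    with u show "u \<in> annihilator Aq N" by (simp add: annihilator_def)
  qed
qed

text \<open>Even elements act diagonally, by the same operator in both slots. This gives the passage
  back from the annihilator of \<open>N\<close>.\<close>

lemma annihilator_L:
  "annihilator Ag L = {u \<in> Ug. env_map g_alg q_alg u \<in> annihilator Aq N}"
proof -
  have "(\<forall>x\<in>carrier L. u \<odot>\<^bsub>L\<^esub> x = (zr L)) \<longleftrightarrow> (\<forall>z\<in>carrier N. env_map g_alg q_alg u \<odot>\<^bsub>N\<^esub> z = (zr N))"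
    if u: "u \<in> Ug" for u :: "'k uea"
  proof
    assume "\<forall>x\<in>carrier L. u \<odot>\<^bsub>L\<^esub> x = (zr L)"
    then show "\<forall>z\<in>carrier N. env_map g_alg q_alg u \<odot>\<^bsub>N\<^esub> z = (zr N)"
      using Phi_ex env_map_act[OF u] Phi_zero by metis
  next
    assume 0: "\<forall>z\<in>carrier N. env_map g_alg q_alg u \<odot>\<^bsub>N\<^esub> z = (zr N)"
    show "\<forall>x\<in>carrier L. u \<odot>\<^bsub>L\<^esub> x = (zr L)"
    proof
      fix x assume x: "x \<in> carrier L"
      have "\<Phi> (u \<odot>\<^bsub>L\<^esub> x) (u \<odot>\<^bsub>L\<^esub> x) = \<Phi> (zr L) (zr L)"
        using 0 env_map_act[OF u x x] Phi_closed[OF x x] Phi_zero by metis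
      then show "u \<odot>\<^bsub>L\<^esub> x = (zr L)" using Phi_inj u x by blast
    qed
  qed
  note iff = this
  show ?thesis
  proof (intro Set.set_eqI iffI)
    fix u assume "u \<in> annihilator Ag L"
    then have u: "u \<in> Ug" and z: "\<forall>x\<in>carrier L. u \<odot>\<^bsub>L\<^esub> x = (zr L)"
      by (simp_all add: annihilator_def)
    have "\<forall>z\<in>carrier N. env_map g_alg q_alg u \<odot>\<^bsub>N\<^esub> z = (zr N)" using iff[OF u] z by (rule iffD1)
    with u env_map_g_closed[OF u]
    show "u \<in> {u \<in> Ug. env_map g_alg q_alg u \<in> annihilator Aq N}"
      by (simp add: annihilator_def)
  next
    fix u assume "u \<in> {u \<in> Ug. env_map g_alg q_alg u \<in> annihilator Aq N}"
    then have u: "u \<in> Ug" and z: "\<forall>z\<in>carrier N. env_map g_alg q_alg u \<odot>\<^bsub>N\<^esub> z = (zr N)"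
      by (simp_all add: annihilator_def)
    have "\<forall>x\<in>carrier L. u \<odot>\<^bsub>L\<^esub> x = (zr L)" using iff[OF u] z by (rule iffD2)
    with u show "u \<in> annihilator Ag L" by (simp add: annihilator_def)
  qed
qed

end

text \<open>Serves to pass from the polynomial models to the highest weight modules, and later to
  copies of modules in the universe types.\<close>

lemma doubling_transport:
  assumes "doubling L N \<pi> \<Phi>" and L': "umod g_alg L'" and N': "is_supermodule q_alg N'"
    and f: "f \<in> module_isos Ag L' L" and g: "g \<in> module_isos Aq N N'"
    and gr: "\<And>i. g ` gr N i = gr N' i"
  shows "doubling L' N' \<pi> (\<lambda>x y. g (\<Phi> (f x) (f y)))"
proof -
  interpret D: doubling L N \<pi> \<Phi> by fact
  interpret L': umod g_alg L' by fact
  interpret N': usmod q_alg N' using N' graded_lie_q by unfold_locales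
  note fD = module_isosD[OF f] and gD = module_isosD[OF g]
  have f0: "f (zr L') = (zr L)" by (rule module_isos_zero[OF f L'.left_module_axioms D.L.left_module_axioms])
  have gens: "f (ugen g_alg (blockM A 0) \<odot>\<^bsub>L'\<^esub> x) = ugen g_alg (blockM A 0) \<odot>\<^bsub>L\<^esub> f x" if "x \<in> carrier L'" for A x
    using fD(4) that D.L.ugen_closed[OF g_algI] by blast
  have genq: "g (ugen q_alg X \<odot>\<^bsub>N\<^esub> x) = ugen q_alg X \<odot>\<^bsub>N'\<^esub> g x" if "X \<in> q_alg i" "x \<in> carrier N" for X i x
    using gD(4)[OF D.N.ugen_closed[OF that(1)] that(2)] .
  have imf: "f ` carrier L' = carrier L" using fD(1) by (simp add: bij_betw_def)
  show ?thesis
  proof (intro doubling.intro doubling_axioms.intro L' N'.usmod_axioms)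
    have "bij_betw (map_prod f f) (carrier L' \<times> carrier L') (carrier L \<times> carrier L)"
      by (rule bij_betw_map_prod[OF fD(1) fD(1)])
    from bij_betw_trans[OF bij_betw_trans[OF this D.bij] gD(1)]
    show "bij_betw (\<lambda>(x, y). g (\<Phi> (f x) (f y))) (carrier L' \<times> carrier L') (carrier N')"
      by (simp add: comp_def case_prod_unfold map_prod_def)
  next
    show "gr N' \<pi> = (\<lambda>x. g (\<Phi> (f x) (f (zr L')))) ` carrier L'"
      unfolding gr[symmetric] D.gr0 imf[symmetric] image_image f0 ..
    show "gr N' (\<pi> + 1) = (\<lambda>y. g (\<Phi> (f (zr L')) (f y))) ` carrier L'"
      unfolding gr[symmetric] D.gr1 imf[symmetric] image_image f0 ..
  qed (simp_all add: fD(2-4) gD(2,3) D.Phi_closed gens D.Phi_add L'.ge_closed[OF g_algI] D.Phi_cst D.Phi_even D.Phi_odd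
      flip: genq[OF q_algI(1)] genq[OF q_algI(2)] gD(4))
qed

section \<open>The Verma modules\<close>

abbreviation psm :: "'k::comm_semiring_0 \<Rightarrow> 'k poly \<Rightarrow> 'k poly" where "psm \<equiv> Polynomial.smult"

text \<open>Constants and the variable are treated as opaque ring elements, so that the relations
  between operators become ring identities, open to \<open>algebra_simps\<close>.\<close>

definition cp :: "'k::comm_ring_1 \<Rightarrow> 'k poly" where "cp a = [:a:]"
definition PX :: "'k::comm_ring_1 poly" where "PX = [:0, 1:]"

lemma cp_simps: "cp (a + b) = cp a + cp b" "cp (a - b) = cp a - cp b" "cp (a * b) = cp a * cp b"
    "cp (- a) = - cp a" "cp 0 = 0" "cp 1 = 1" "cp (numeral n) = numeral n"
  by (simp_all add: cp_def numeral_poly)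

lemma smult_cp: "psm c p = cp c * p"
  by (simp add: cp_def)

lemma pderiv_cp: "pderiv (cp a) = 0" "pderiv PX = 1" "pderiv (numeral n :: 'k::field_char_0 poly) = 0"
  by (simp_all add: cp_def PX_def pderiv_pCons numeral_poly)

lemmas pderiv_rules = pderiv_cp pderiv_add pderiv_diff pderiv_mult pderiv_minus

text \<open>The Verma module of highest weight \<open>(t, -t)\<close>, realised on polynomials in the lowering operator.\<close>

definition vact :: "'k::field_char_0 \<Rightarrow> 'k ^ 2 ^ 2 \<Rightarrow> 'k poly \<Rightarrow> 'k poly" where
  "vact t A p = cp (A $ 1 $ 1 - A $ 2 $ 2) * (cp t * p - PX * pderiv p) + cp (A $ 2 $ 1) * (PX * p)
     + cp (A $ 1 $ 2) * (2 * (cp t * pderiv p) - PX * pderiv (pderiv p))"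

lemma vact_right: "vact t A (p + q) = vact t A p + vact t A q" "vact t A (psm c p) = psm c (vact t A p)"
  by (simp_all add: vact_def smult_cp pderiv_rules algebra_simps)

lemma vact_left: "vact t (A + B) p = vact t A p + vact t B p" "vact t (mat c ** A) p = psm c (vact t A p)"
    "vact t 0 p = 0" "vact t A 0 = 0"
  by (simp_all add: vact_def smult_cp cp_simps algebra_simps)

lemma vact_bracket: "vact t A (vact t B p) = vact t B (vact t A p) + vact t (A ** B - B ** A) p"
  by (simp add: vact_def mult_nth_2 cp_simps pderiv_rules) (simp add: algebra_simps)

text \<open>Polarised Cayley-Hamilton: the two sides come from matrices that differ by a multiple of
  the identity, and \<open>vact\<close> depends on the diagonal only through the difference of its
  entries. This is the odd bracket relation of the doubling.\<close>

lemma vact_anti: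
  "vact t (A ** B + B ** A) p = psm (tr2 A) (vact t B p) + psm (tr2 B) (vact t A p)"
  by (simp add: vact_def tr2_def mult_nth_2 smult_cp cp_simps algebra_simps)

definition ul :: "'k smat \<Rightarrow> 'k ^ 2 ^ 2" where "ul X = (\<chi> i j. X $ Inl i $ Inl j)"
definition ur :: "'k smat \<Rightarrow> 'k ^ 2 ^ 2" where "ur X = (\<chi> i j. X $ Inl i $ Inr j)"

lemma ul_blockM [simp]: "ul (blockM A B) = A" "ur (blockM A B) = B"
  by (simp_all add: ul_def ur_def vec_eq_iff)

lemma ul_zero [simp]: "ul 0 = 0" "ur 0 = 0"
  by (simp_all add: ul_def ur_def vec_eq_iff)

lemma vector_space_smult: "vector_space (psm :: 'k::field \<Rightarrow> 'k poly \<Rightarrow> 'k poly)"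
  by unfold_locales (simp_all add: smult_add_right smult_add_left)

definition gverma :: "'k::field_char_0 \<Rightarrow> ('k uea, 'k poly) supermodule" where
  "gverma t = rep_mod psm (\<lambda>X. vact t (ul X)) (\<lambda>i. if i = 0 then UNIV else {0})"

lemma lrep_gverma: "lrep g_alg psm (\<lambda>X. vact t (ul X :: 'k::field_char_0 ^ 2 ^ 2))"
proof (intro lrep.intro lrep_axioms.intro enveloping_g vector_space_smult)
  fix X Y :: "'k smat" and i j x assume X: "X \<in> g_alg i" and Y: "Y \<in> g_alg j"
  show "vact t (ul X) (vact t (ul Y) x) = psm (koszul i j) (vact t (ul Y) (vact t (ul X) x)) + vact t (ul (superbracket i j X Y)) x"
    using X Y
    by (elim g_alg_cases) (simp_all add: superbracket_blockM koszul_def vact_left superbracket_zero vact_bracket[symmetric])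
next
  fix X Y :: "'k smat" and i x assume X: "X \<in> g_alg i" and Y: "Y \<in> g_alg i"
  then show "vact t (ul (X + Y)) x = vact t (ul X) x + vact t (ul Y) x"
    by (elim g_alg_cases) (simp_all add: blockM_arith vact_left)
next
  fix X :: "'k smat" and i c x assume X: "X \<in> g_alg i"
  then show "vact t (ul (mat c ** X)) x = psm c (vact t (ul X) x)"
    by (elim g_alg_cases) (simp_all add: blockM_scale vact_left)
qed (simp_all add: vact_right)

lemma gverma_simps:
  fixes t :: "'k::field_char_0"
  shows "carrier (gverma t) = UNIV" "(zr (gverma t)) = 0" "add (gverma t) = (+)"
    "gr (gverma t) i = (if i = 0 then UNIV else {0})"
    "ucst g_alg c \<odot>\<^bsub>gverma t\<^esub> p = psm c p"
    "X \<in> g_alg i ==> ugen g_alg X \<odot>\<^bsub>gverma t\<^esub> p = vact t (ul X) p"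
    "ugen g_alg (blockM A 0) \<odot>\<^bsub>gverma t\<^esub> p = vact t A p"
  using lrep.rmod_simps[OF lrep_gverma[of t]] lrep.rmod_cs[OF lrep_gverma[of t]] lrep.rmod_ge[OF lrep_gverma[of t]]
    lrep.rmod_ge[OF lrep_gverma[of t] g_algI[of A]]
  by (simp_all add: gverma_def)

lemma gverma_gen_zero: "ugen g_alg 0 \<odot>\<^bsub>gverma t\<^esub> p = 0"
  using gverma_simps(7)[where A = 0 and t = t and p = p] by (simp add: blockM_arith(4) vact_left)

lemma umod_gverma: "umod g_alg (gverma t)"
  unfolding gverma_def by (rule lrep.umod_rmod[OF lrep_gverma])

lemma gverma_supermodule: "is_supermodule g_alg (gverma (t :: 'k::field_char_0))"
proof -
  interpret umod g_alg "gverma t" by (rule umod_gverma)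
  have inv: "\<ominus>\<^bsub>gverma t\<^esub> x = - x" for x
    by (rule M.minus_equality) (simp_all add: gverma_simps)
  show ?thesis
  proof (rule is_supermoduleI[OF umod_gverma])
    fix i show "subgroup (gr (gverma t) i) (add_monoid (gverma t))"
      by (rule M.add_subgroupI) (auto simp: gverma_simps inv)
  next
    fix X :: "'k smat" and i x j assume "X \<in> g_alg i" "x \<in> gr (gverma t) j"
    then show "ugen g_alg X \<odot>\<^bsub>gverma t\<^esub> x \<in> gr (gverma t) (i + j)"
      by (elim g_alg_cases) (auto simp: gverma_simps vact_left gverma_gen_zero split: if_splits)
  qed (auto simp: gverma_simps split: if_splits)
qed

text \<open>The factor 2 t - k is the one place where t decides about reducibility: it vanishes for
  some k exactly when 2 t is a natural number.\<close>

lemma coeff_vact_raise: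
  "coeff (vact t (mx 0 1 0 0) p) k = of_nat (Suc k) * (2 * t - of_nat k) * coeff p (Suc k)"
proof -
  have eq: "vact t (mx 0 1 0 0) p = psm (2 * t) (pderiv p) - pCons 0 (pderiv (pderiv p))"
    by (simp add: vact_def smult_cp cp_simps PX_def algebra_simps)
  show ?thesis
    unfolding eq by (cases k) (simp_all add: coeff_pderiv algebra_simps)
qed

lemma vact_lower: "vact t (mx 0 0 1 0) p = pCons 0 p"
  by (simp add: vact_def cp_simps PX_def)

text \<open>Raising lowers the degree of a nonconstant polynomial by exactly one, because the
  leading coefficient is multiplied by a nonzero number. So a nonzero submodule contains 1, from
  which multiplication by x, the lowering operator, produces everything.\<close>

lemma gverma_simple:
  fixes t :: "'k::field_char_0"
  assumes t: "\<And>n. 2 * t \<noteq> of_nat n"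
  shows "simple_module Ag (gverma t)"
  unfolding simple_module_def
proof (intro conjI allI impI)
  interpret umod g_alg "gverma t" by (rule umod_gverma)
  show "left_module Ag (gverma t)" by (rule left_module_axioms)
  have "(1 :: 'k poly) \<noteq> 0" by simp
  then show "carrier (gverma t) \<noteq> {(zr (gverma t))}" unfolding gverma_simps by blast
  fix H assume H: "submodule H Ag (gverma t)"
  note D = submoduleD[OF H, unfolded gverma_simps]
  have E: "vact t A p \<in> H" if "p \<in> H" for A p using submoduleD(7)[OF H g_algI[of A] that] by (simp add: gverma_simps)
  have C: "psm c p \<in> H" if "p \<in> H" for c p using submoduleD(8)[OF H that, of c] by (simp add: gverma_simps)
  have one: "1 \<in> H" if "p \<in> H" "p \<noteq> 0" for p
    using that
  proof (induction "degree p" arbitrary: p)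
    case 0
    then obtain a where a: "p = [:a:]" using degree_eq_zeroE by metis
    then have "psm (1 / a) p = 1" using 0 by (simp add: one_pCons)
    then show ?case using C[OF 0(2), of "1 / a"] by simp
  next
    case (Suc n)
    let ?q = "vact t (mx 0 1 0 0) p"
    have lc: "coeff ?q n \<noteq> 0"
      unfolding coeff_vact_raise using Suc.hyps(2) Suc.prems t[of n] leading_coeff_neq_0[of p]
      by (simp del: of_nat_Suc)
    have "degree ?q \<le> n"
      by (rule degree_le) (simp add: coeff_vact_raise coeff_eq_0 Suc.hyps(2)[symmetric])
    with lc have "degree ?q = n" using le_degree[OF lc] by simp
    then show ?case using Suc.hyps(1)[of ?q] E[OF Suc.prems(1)] lc by auto
  qed
  show "H = {(zr (gverma t))} \<or> H = carrier (gverma t)"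
  proof (cases "\<exists>p\<in>H. p \<noteq> 0")
    case True
    then have 1: "1 \<in> H" using one by blast
    have "p \<in> H" for p
    proof (induction p)
      case (pCons a p)
      have "pCons a p = psm a 1 + pCons 0 p" by (simp add: one_pCons)
      then show ?case
        using D(4)[OF C[OF 1, of a] E[OF pCons(2), of "mx 0 0 1 0"]] by (simp add: vact_lower)
    qed (rule D(2))
    then show ?thesis by (auto simp: gverma_simps)
  next
    case False
    then show ?thesis using D(2) by (auto simp: gverma_simps)
  qed
qed

definition sc2 :: "'k::field \<Rightarrow> 'k poly \<times> 'k poly \<Rightarrow> 'k poly \<times> 'k poly" where
  "sc2 c z = (psm c (fst z), psm c (snd z))"

definition qact :: "'k::field_char_0 \<Rightarrow> 'k smat \<Rightarrow> 'k poly \<times> 'k poly \<Rightarrow> 'k poly \<times> 'k poly" where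
  "qact t X z = (vact t (ul X) (fst z) + psm (tr2 (ur X)) (snd z), vact t (ul X) (snd z) + vact t (ur X) (fst z))"

text \<open>The parity of the first slot is a parameter, since both values occur for the highest
  weight supermodule, depending on the square roots.\<close>

definition qverma :: "'k::field_char_0 \<Rightarrow> bit \<Rightarrow> ('k uea, 'k poly \<times> 'k poly) supermodule" where
  "qverma t \<pi> = rep_mod sc2 (qact t) (\<lambda>i. if i = \<pi> then {z. snd z = 0} else {z. fst z = 0})"

lemma tr2_simps: "tr2 (0 :: 'k::field ^ 2 ^ 2) = 0" "tr2 (A + B) = tr2 A + tr2 (B :: 'k::field ^ 2 ^ 2)"
    "tr2 (mat c ** A) = c * tr2 (A :: 'k::field ^ 2 ^ 2)"
  by (simp_all add: tr2_def algebra_simps)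

lemma tr2_commutator: "tr2 (A ** B - B ** A) = (0 :: 'k::field)"
  by (simp add: tr2_def mult_nth_2 algebra_simps)

text \<open>For an even and an odd element the slot with the scalar action is consistent because
  commutators have trace zero. For two odd elements the relation is \<open>vact_anti\<close>, once
  in each slot.\<close>

lemma lrep_qverma: "lrep q_alg sc2 (qact (t :: 'k::field_char_0))"
proof (intro lrep.intro lrep_axioms.intro enveloping_q)
  show "vector_space (sc2 :: 'k \<Rightarrow> _)"
    by unfold_locales (simp_all add: sc2_def smult_add_right smult_add_left)
next
  fix X Y :: "'k smat" and i j x assume X: "X \<in> q_alg i" and Y: "Y \<in> q_alg j"
  show "qact t X (qact t Y x) = sc2 (koszul i j) (qact t Y (qact t X x)) + qact t (superbracket i j X Y) x"
    using X
  proof (cases rule: q_alg_cases)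
    case X: (1 A)
    show ?thesis
      using Y
    proof (cases rule: q_alg_cases)
      case (1 C)
      then show ?thesis using X
        by (simp add: qact_def sc2_def superbracket_blockM koszul_def tr2_simps vact_left vact_bracket[of t A C])
    next
      case (2 D)
      then show ?thesis using X
        by (simp add: qact_def sc2_def superbracket_blockM koszul_def tr2_simps tr2_commutator vact_left vact_right
          vact_bracket[of t A D])
    qed
  next
    case X: (2 B)
    show ?thesis
      using Y
    proof (cases rule: q_alg_cases)
      case (1 C)
      then show ?thesis using X
        by (simp add: qact_def sc2_def superbracket_blockM koszul_def tr2_simps tr2_commutator vact_left vact_right
          vact_bracket[of t B C])
    next
      case (2 D)
      then show ?thesis using X vact_anti[of t B D "fst x"] vact_anti[of t B D "snd x"]
        by (simp add: qact_def sc2_def superbracket_blockM koszul_def tr2_simps vact_left vact_right algebra_simps)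
    qed
  qed
next
  fix X Y :: "'k smat" and i x assume X: "X \<in> q_alg i" and Y: "Y \<in> q_alg i"
  then show "qact t (X + Y) x = qact t X x + qact t Y x"
    by (elim q_alg_cases) (simp_all add: blockM_arith vact_left qact_def tr2_simps smult_add_left)
next
  fix X :: "'k smat" and i c x assume X: "X \<in> q_alg i"
  then show "qact t (mat c ** X) x = sc2 c (qact t X x)"
    by (elim q_alg_cases) (simp_all add: blockM_scale vact_left qact_def sc2_def tr2_simps)
qed (simp_all add: qact_def sc2_def vact_right smult_add_right algebra_simps)

lemma qverma_simps:
  fixes t :: "'k::field_char_0"
  shows "carrier (qverma t \<pi>) = UNIV" "\<zero>\<^bsub>qverma t \<pi>\<^esub> = 0" "add (qverma t \<pi>) = (+)"
    "gr (qverma t \<pi>) i = (if i = \<pi> then {z. snd z = 0} else {z. fst z = 0})"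
    "ucst q_alg c \<odot>\<^bsub>qverma t \<pi>\<^esub> z = sc2 c z"
    "ugen q_alg (blockM A 0) \<odot>\<^bsub>qverma t \<pi>\<^esub> (p, q) = (vact t A p, vact t A q)"
    "ugen q_alg (blockM 0 B) \<odot>\<^bsub>qverma t \<pi>\<^esub> (p, q) = (psm (tr2 B) q, vact t B p)"
  using lrep.rmod_simps[OF lrep_qverma[of t]] lrep.rmod_cs[OF lrep_qverma[of t]]
    lrep.rmod_ge[OF lrep_qverma[of t] q_algI(1)] lrep.rmod_ge[OF lrep_qverma[of t] q_algI(2)]
  by (simp_all add: qverma_def qact_def tr2_simps vact_left)

lemma umod_qverma: "umod q_alg (qverma t \<pi>)"
  unfolding qverma_def by (rule lrep.umod_rmod[OF lrep_qverma])

lemma qverma_supermodule: "is_supermodule q_alg (qverma (t :: 'k::field_char_0) \<pi>)"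
proof -
  interpret umod q_alg "qverma t \<pi>" by (rule umod_qverma)
  have inv: "\<ominus>\<^bsub>qverma t \<pi>\<^esub> x = - x" for x
    by (rule M.minus_equality) (simp_all add: qverma_simps)
  show ?thesis
  proof (rule is_supermoduleI[OF umod_qverma])
    fix i show "subgroup (gr (qverma t \<pi>) i) (add_monoid (qverma t \<pi>))"
      by (rule M.add_subgroupI) (auto simp: qverma_simps inv)
  next
    fix z :: "'k poly \<times> 'k poly"
    have "z = (fst z, 0) + (0, snd z)" "z = (0, snd z) + (fst z, 0)" by (simp_all add: prod_eq_iff)
    then show "\<exists>a\<in>gr (qverma t \<pi>) 0. \<exists>b\<in>gr (qverma t \<pi>) 1. z = a \<oplus>\<^bsub>qverma t \<pi>\<^esub> b"
      unfolding qverma_simps using bit_cases[of \<pi>] by (metis (mono_tags, lifting) bit_not_one_iff fst_conv mem_Collect_eq snd_conv zero_neq_one)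
  next
    fix X :: "'k smat" and i x j assume "X \<in> q_alg i" "x \<in> gr (qverma t \<pi>) j"
    then show "ugen q_alg X \<odot>\<^bsub>qverma t \<pi>\<^esub> x \<in> gr (qverma t \<pi>) (i + j)"
      using bit_cases[of j] bit_cases[of \<pi>]
      by (cases x, elim q_alg_cases) (auto simp: qverma_simps vact_left split: if_splits)
  qed (auto simp: qverma_simps sc2_def prod_eq_iff split: if_splits)
qed

lemma qverma_doubling: "doubling (gverma t) (qverma t \<pi>) \<pi> Pair"
proof (intro doubling.intro doubling_axioms.intro umod_gverma usmod.intro enveloping_q usmod_axioms.intro qverma_supermodule)
  show "bij_betw (\<lambda>(x, y). (x, y)) (carrier (gverma t) \<times> carrier (gverma t)) (carrier (qverma t \<pi>))"
    by (simp add: gverma_simps qverma_simps bij_betw_def)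
  show "gr (qverma t \<pi>) \<pi> = (\<lambda>x. (x, (zr (gverma t)))) ` carrier (gverma t)"
    by (auto simp: gverma_simps qverma_simps)
  show "gr (qverma t \<pi>) (\<pi> + 1) = (\<lambda>y. ((zr (gverma t)), y)) ` carrier (gverma t)"
    using bit_cases[of \<pi>] by (auto simp: gverma_simps qverma_simps)
qed (simp_all add: gverma_simps qverma_simps sc2_def)

lemma qverma_simple:
  assumes t: "\<And>n. 2 * t \<noteq> of_nat n"
  shows "simple_supermodule q_alg (qverma t \<pi>)"
proof (rule doubling.simple_N[OF qverma_doubling gverma_simple[OF t]])
  have "vact t (mx 0 0 1 0) 1 \<noteq> 0" by (simp add: vact_lower)
  then show "ugen g_alg (blockM (mx 0 0 1 0) 0) \<odot>\<^bsub>gverma t\<^esub> 1 \<noteq> (zr (gverma t))" by (simp add: gverma_simps)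
qed (simp add: gverma_simps)

subsection \<open>Identification of the simple highest weight modules\<close>

lemma rep_module_rep_mod:
  fixes \<rho> :: "'k::field smat \<Rightarrow> 'k ^ 'n ^ 'n"
  shows "rep_module \<rho> UNIV G = rep_mod (*s) (\<lambda>X x. \<rho> X *v x) G"
proof -
  have f: "foldr (\<lambda>X A. \<rho> X ** A) w (mat 1) *v x = foldr (\<lambda>X x. \<rho> X *v x) w x" for w x
    by (induction w) (simp_all flip: matrix_vector_mul_assoc)
  have m: "mat c *v y = c *s y" for c :: 'k and y :: "'k ^ 'n"
    by (simp add: vec_eq_iff matrix_vector_mult_def mat_def if_distrib[of "\<lambda>x. x * _"] sum.delta cong: if_cong)
  have s: "(\<Sum>w\<in>A. M w) *v x = (\<Sum>w\<in>A. M w *v x)" for A :: "'b set" and M :: "'b \<Rightarrow> 'k ^ 'n ^ 'n" and x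
    by (induction A rule: infinite_finite_induct) (simp_all add: matrix_vector_mult_add_rdistrib)
  have "rep_mat \<rho> p *v x = word_act (*s) (\<lambda>X x. \<rho> X *v x) p x" for p x
    by (simp add: rep_mat_def word_act_def s f m flip: matrix_vector_mul_assoc)
  then show ?thesis by (simp add: rep_module_def rep_mod_def)
qed

lemma bg_alg_cases:
  assumes "X \<in> bg_alg i"
  obtains A where "i = 0" "X = blockM A 0" "A $ 2 $ 1 = 0" | "i = 1" "X = 0"
  using assms bit_cases[of i] by (auto simp: even_part_def b_alg_def)

lemma split_lower: "A = mx (A $ 1 $ 1) (A $ 1 $ 2) 0 (A $ 2 $ 2) + mat (A $ 2 $ 1) ** mx 0 0 1 (0 :: 'k::field)"
  by (rule mx_eqI) simp_all

lemma matrix_vector_2: "((A :: 'k::field ^ 2 ^ 2) *v w) $ i = A $ i $ 1 * w $ 1 + A $ i $ 2 * w $ 2"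
  by (simp add: matrix_vector_mult_def sum_2)

definition wt1 :: "'k::field \<Rightarrow> 'k smat \<Rightarrow> 'k ^ 1 ^ 1" where
  "wt1 t X = mat (X $ Inl 1 $ Inl 1 * t + X $ Inl 2 $ Inl 2 * (- t))"

lemma one_dim_eq: "one_dim (t, - t) = rep_mod (*s) (\<lambda>X x. wt1 t X *v x) (\<lambda>i. if i = 0 then UNIV else {0})"
  unfolding one_dim_def wt1_def[abs_def] rep_module_rep_mod by simp

lemma wt1_act: "wt1 t X *v w = (X $ Inl 1 $ Inl 1 * t + X $ Inl 2 $ Inl 2 * (- t)) *s w"
  by (simp add: wt1_def vec_eq_iff matrix_vector_mult_def mat_def)

lemma lrep_one_dim: "lrep bg_alg (*s) (\<lambda>X (x :: 'k::field_char_0 ^ 1). wt1 t X *v x)"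
proof (intro lrep.intro lrep_axioms.intro enveloping.intro graded_lie_bg vec.vector_space_axioms)
  fix X Y :: "'k smat" and i j and x :: "'k ^ 1" assume X: "X \<in> bg_alg i" and Y: "Y \<in> bg_alg j"
  show "wt1 t X *v (wt1 t Y *v x) = koszul i j *s (wt1 t Y *v (wt1 t X *v x)) + wt1 t (superbracket i j X Y) *v x"
    using X Y
    by (elim bg_alg_cases)
      (hypsubst, simp add: superbracket_blockM koszul_def superbracket_zero wt1_act mult_nth_2 vec_eq_iff)+
next
  fix X Y :: "'k smat" and i and x :: "'k ^ 1" assume X: "X \<in> bg_alg i" and Y: "Y \<in> bg_alg i"
  then show "wt1 t (X + Y) *v x = wt1 t X *v x + wt1 t Y *v x"
    by (elim bg_alg_cases) (simp_all add: wt1_act vec_eq_iff algebra_simps)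
next
  fix X :: "'k smat" and i c and x :: "'k ^ 1" assume X: "X \<in> bg_alg i"
  then show "wt1 t (mat c ** X) *v x = c *s (wt1 t X *v x)"
    by (elim bg_alg_cases) (simp_all add: wt1_act vec_eq_iff algebra_simps)
qed (simp_all add: wt1_act vec_eq_iff algebra_simps)

lemma one_dim_simps:
  fixes t :: "'k::field_char_0"
  shows "carrier (one_dim (t, - t)) = UNIV" "(zr (one_dim (t, - t))) = 0" "add (one_dim (t, - t)) = (+)"
    "gr (one_dim (t, - t)) i = (if i = 0 then UNIV else {0})"
    "ucst bg_alg c \<odot>\<^bsub>one_dim (t, - t)\<^esub> w = c *s w"
    "X \<in> bg_alg i ==> ugen bg_alg X \<odot>\<^bsub>one_dim (t, - t)\<^esub> w = wt1 t X *v w"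
  unfolding one_dim_eq
  by (rule lrep.rmod_simps[OF lrep_one_dim] lrep.rmod_cs[OF lrep_one_dim])+
    (simp_all add: lrep.rmod_simps[OF lrep_one_dim] lrep.rmod_cs[OF lrep_one_dim] lrep.rmod_ge[OF lrep_one_dim])

lemma Fm_gen:
  fixes X :: "'k::field smat"
  assumes "X \<in> q_alg 0"
  shows "\<exists>Y\<in>b_alg 0. \<exists>c. X = Y + mat c ** Fm"
proof -
  obtain A where X: "X = blockM A 0" using assms by (auto simp: q_alg_0)
  show ?thesis
    unfolding X
    by (rule bexI[OF _ b_algI(1)[of "mx (A $ 1 $ 1) (A $ 1 $ 2) 0 (A $ 2 $ 2)"]], rule exI[of _ "A $ 2 $ 1"])
      (simp_all add: blockM_scale blockM_arith split_lower[symmetric])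
qed

lemma Fb_gen:
  fixes X :: "'k::field smat"
  assumes "X \<in> q_alg 1"
  shows "\<exists>Y\<in>b_alg 1. \<exists>c. X = Y + mat c ** Fb"
proof -
  obtain A where X: "X = blockM 0 A" using assms by (auto simp: q_alg_1)
  show ?thesis
    unfolding X
    by (rule bexI[OF _ b_algI(2)[of "mx (A $ 1 $ 1) (A $ 1 $ 2) 0 (A $ 2 $ 2)"]], rule exI[of _ "A $ 2 $ 1"])
      (simp_all add: blockM_scale blockM_arith split_lower[symmetric])
qed

lemma Lg_iso:
  fixes t :: "'k::field_char_0"
  assumes t: "\<And>n. 2 * t \<noteq> of_nat n"
  obtains f where "f \<in> module_isos Ag (Lg (t, - t)) (gverma t)" "umod g_alg (Lg (t, - t))"
proof -
  interpret V: hw g_alg bg_alg "one_dim (t, - t)" t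
  proof (intro hw.intro hw_axioms.intro enveloping_g enveloping.intro graded_lie_bg)
    show "umod bg_alg (one_dim (t, - t))" unfolding one_dim_eq by (rule lrep.umod_rmod[OF lrep_one_dim])
    show "bg_alg i \<subseteq> (g_alg i :: 'k smat set)" for i by (rule even_part_mono) (rule b_subset_q)
    show "(Fm :: 'k smat) \<in> g_alg 0" by simp
    show H: "(H1m :: 'k smat) \<in> bg_alg 0" by (simp add: even_part_def b_algI)
    show "\<exists>Y\<in>bg_alg 0. \<exists>c. X = Y + mat c ** Fm" if "X \<in> g_alg 0" for X :: "'k smat"
      using Fm_gen[of X] that by (simp add: even_part_def)
    show "\<exists>Y\<in>bg_alg 1. \<exists>c. X = Y + mat c ** Fb \<and> (Fb \<in> g_alg 1 \<or> c = 0)" if "X \<in> g_alg 1" for X :: "'k smat"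
      using that by (auto simp: even_part_def blockM_scale smat_eq_iff intro!: exI[of _ 0])
    show "ugen bg_alg H1m \<odot>\<^bsub>one_dim (t, - t)\<^esub> w = ucst bg_alg t \<odot>\<^bsub>one_dim (t, - t)\<^esub> w" for w
      by (simp add: one_dim_simps(5) one_dim_simps(6)[OF H] wt1_act)
  qed (auto simp: one_dim_simps)
  have s: "simple_supermodule g_alg (gverma t)"
    using gverma_simple[OF t] gverma_supermodule[of t]
    by (auto simp: simple_supermodule_def simple_module_def graded_submodule_def)
  \<comment> \<open>The highest weight line goes to the constant polynomials, which the raising
    operator kills and on which H_1 acts by t.\<close>
  show thesis
  proof (rule V.hw_top[OF s, of "\<lambda>w. [:w $ 1:]"])
    fix X :: "'k smat" and i w assume X: "X \<in> bg_alg i"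
    show "[:(ugen bg_alg X \<odot>\<^bsub>one_dim (t, - t)\<^esub> w) $ 1:] = ugen g_alg X \<odot>\<^bsub>gverma t\<^esub> [:w $ 1:]"
      unfolding one_dim_simps(6)[OF X] using X
      by (elim bg_alg_cases)
        (simp_all add: gverma_simps gverma_gen_zero wt1_act vact_def cp_def PX_def pderiv_pCons algebra_simps)
  next
    fix f assume f: "f \<in> module_isos Ag (top_of g_alg V.Ind) (gverma t)"
      and s: "is_supermodule g_alg (top_of g_alg V.Ind)"
    then show thesis
      using that[of f] is_supermodule_umod[OF graded_lie_g s] by (simp add: Lg_def)
  next
    have "(vec 1 :: 'k ^ 1) \<noteq> 0" by (simp add: vec_eq_iff)
    then show "carrier (one_dim (t, - t)) \<noteq> {(zr (one_dim (t, - t)))}" unfolding one_dim_simps by blast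
  qed (auto simp: gverma_simps one_dim_simps inj_on_def vec_eq_iff forall_1 split: if_splits)
qed

context
  fixes sq :: "'k::field_char_0 \<Rightarrow> 'k" and im t :: 'k
  assumes sq: "\<And>z. sq z ^ 2 = z" and im: "im ^ 2 = - 1" and t0: "t \<noteq> 0"
begin

abbreviation "Vm \<equiv> V_mat sq im (t, - t)"
abbreviation "Vq \<equiv> V_mod sq im (t, - t)"
abbreviation "Vgr \<equiv> (\<lambda>i::bit. if i = 0 then {x. x $ 2 = 0} else {x :: 'k ^ 2. x $ 1 = 0})"

lemma Vq_eq: "Vq = rep_mod (*s) (\<lambda>X x. Vm X *v x) Vgr"
  using t0 unfolding V_mod_def by (simp add: rep_module_rep_mod)

lemma vector_2_nth: "(vector [vector [a, b], vector [c, d]] :: 'k ^ 2 ^ 2) = mx a b c d"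
  by (rule mx_eqI) simp_all

lemma Vm_act:
  "Vm X *v w = (\<chi> i. (X $ Inl 1 $ Inl 1 - X $ Inl 2 $ Inl 2) * t * w $ i +
     (if i = 1 then (X $ Inl 1 $ Inr 1 * sq t + X $ Inl 2 $ Inr 2 * im * sq (- t)) * w $ 2
      else (X $ Inl 1 $ Inr 1 * sq t - X $ Inl 2 $ Inr 2 * im * sq (- t)) * w $ 1))"
  by (simp add: vec_eq_iff forall_2 matrix_vector_2 V_mat_def Let_def vector_2_nth mat_def algebra_simps)

lemma sq_rules: "sq z * sq z = z" "sq z * (sq z * x) = z * x" "im * im = - 1" "im * (im * x) = - x"
  using sq[of z] im by (simp_all add: power2_eq_square flip: mult.assoc)

lemma lrep_Vq: "lrep b_alg (*s) (\<lambda>X x. Vm X *v x)"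
proof (intro lrep.intro lrep_axioms.intro enveloping.intro graded_lie_b vec.vector_space_axioms)
  fix X Y :: "'k smat" and i j x assume X: "X \<in> b_alg i" and Y: "Y \<in> b_alg j"
  show "Vm X *v (Vm Y *v x) = koszul i j *s (Vm Y *v (Vm X *v x)) + Vm (superbracket i j X Y) *v x"
    using X Y
    by (elim b_alg_cases)
      (hypsubst, simp add: superbracket_blockM koszul_def Vm_act mult_nth_2 vec_eq_iff forall_2 algebra_simps sq_rules)+
next
  fix X Y :: "'k smat" and i x assume X: "X \<in> b_alg i" and Y: "Y \<in> b_alg i"
  then show "Vm (X + Y) *v x = Vm X *v x + Vm Y *v x"
    by (simp add: Vm_act vec_eq_iff forall_2 algebra_simps)
next
  fix X :: "'k smat" and i c x assume X: "X \<in> b_alg i"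
  then show "Vm (mat c ** X) *v x = c *s (Vm X *v x)"
    by (simp add: Vm_act vec_eq_iff forall_2 algebra_simps)
qed (simp_all add: Vm_act vec_eq_iff forall_2 algebra_simps)

lemma Vq_simps:
  shows "carrier Vq = UNIV" "(zr Vq) = 0" "add Vq = (+)" "gr Vq = Vgr"
    "ucst b_alg c \<odot>\<^bsub>Vq\<^esub> w = c *s w"
    "X \<in> b_alg i ==> ugen b_alg X \<odot>\<^bsub>Vq\<^esub> w = Vm X *v w"
  unfolding Vq_eq
  by (simp_all add: lrep.rmod_simps[OF lrep_Vq] lrep.rmod_cs[OF lrep_Vq] lrep.rmod_ge[OF lrep_Vq])

text \<open>The odd identity acts on the even vector v by sqrt(t) - i sqrt(-t) and on the odd one by
  sqrt(t) + i sqrt(-t); the product of the two numbers is zero. The vector that it kills must lie in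
  the first slot, and this fixes the parity of that slot.\<close>

lemma Lq_iso:
  assumes t: "\<And>n. 2 * t \<noteq> of_nat n"
  obtains f \<pi> where "f \<in> module_isos Aq (Lq sq im (t, - t)) (qverma t \<pi>)"
    "\<And>i. f ` gr (Lq sq im (t, - t)) i = gr (qverma t \<pi>) i" "is_supermodule q_alg (Lq sq im (t, - t))"
proof -
  interpret V: hw q_alg b_alg Vq t
  proof (intro hw.intro hw_axioms.intro enveloping_q enveloping.intro graded_lie_b)
    show "umod b_alg Vq" unfolding Vq_eq by (rule lrep.umod_rmod[OF lrep_Vq])
    show "b_alg i \<subseteq> (q_alg i :: 'k smat set)" for i by (rule b_subset_q)
    show "(Fm :: 'k smat) \<in> q_alg 0" by simp
    show H: "(H1m :: 'k smat) \<in> b_alg 0" by (simp add: b_algI)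
    show "\<exists>Y\<in>b_alg 0. \<exists>c. X = Y + mat c ** Fm" if "X \<in> q_alg 0" for X :: "'k smat"
      by (rule Fm_gen[OF that])
    show "\<exists>Y\<in>b_alg 1. \<exists>c. X = Y + mat c ** Fb \<and> (Fb \<in> q_alg 1 \<or> c = 0)" if "X \<in> q_alg 1" for X :: "'k smat"
      using Fb_gen[OF that] by simp
    show "ugen b_alg H1m \<odot>\<^bsub>Vq\<^esub> w = ucst b_alg t \<odot>\<^bsub>Vq\<^esub> w" for w
      by (simp add: Vq_simps(5) Vq_simps(6)[OF H] Vm_act vec_eq_iff forall_2)
    show "\<exists>x\<in>gr Vq 0. \<exists>y\<in>gr Vq 1. w = x \<oplus>\<^bsub>Vq\<^esub> y" for w
      unfolding Vq_simps
      by (rule bexI[of _ "\<chi> i. if i = 1 then w $ 1 else 0"], rule bexI[of _ "\<chi> i. if i = 1 then 0 else w $ 2"])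
        (simp_all add: vec_eq_iff forall_2)
  qed (simp_all add: Vq_simps)
  have ne: "carrier Vq \<noteq> {(zr Vq)}"
  proof -
    have "(vec 1 :: 'k ^ 2) \<noteq> 0" by (simp add: vec_eq_iff)
    then show ?thesis unfolding Vq_simps by blast
  qed
  have s0: "sq t \<noteq> 0" using sq[of t] t0 by (metis power_zero_numeral)
  \<comment> \<open>Both squares equal t, so the two numbers agree up to a sign that depends on the
    choice of the roots.\<close>
  have "(im * sq (- t)) ^ 2 = sq t ^ 2" by (simp add: power_mult_distrib sq im)
  then consider "im * sq (- t) = sq t" | "im * sq (- t) = - sq t" by (auto simp: power2_eq_iff)
  then show thesis
  proof cases
    case 1
    then have e: "x * im * sq (- t) = x * sq t" "im * (x * sq (- t)) = x * sq t" for x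
      by (simp_all add: mult.assoc mult.left_commute[of im])
    have e3: "im * (x * (sq (- t) * y)) = x * (sq t * y)" for x y
      unfolding 1[symmetric] by (simp add: algebra_simps)
    \<comment> \<open>Here the odd identity kills the even vector, which therefore spans the
      constants of the first slot. The factor \<open>sq t\<close> on the odd coordinate matches the
      odd H_1, which sends (1, 0) to (0, t) in the model.\<close>
    show ?thesis
    proof (rule V.hw_top[OF qverma_simple[OF t, of 0], of "\<lambda>w. ([:w $ 1:], [:sq t * w $ 2:])"])
      fix X :: "'k smat" and i w assume X: "X \<in> b_alg i"
      show "([:(ugen b_alg X \<odot>\<^bsub>Vq\<^esub> w) $ 1:], [:sq t * (ugen b_alg X \<odot>\<^bsub>Vq\<^esub> w) $ 2:]) =
          ugen q_alg X \<odot>\<^bsub>qverma t 0\<^esub> ([:w $ 1:], [:sq t * w $ 2:])"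
        unfolding Vq_simps(6)[OF X] using X
        by (elim b_alg_cases)
          (simp_all add: qverma_simps Vm_act 1 e e3 tr2_def vact_def cp_def PX_def pderiv_pCons algebra_simps sq_rules)
    next
      fix f assume "f \<in> module_isos Aq (top_of q_alg V.Ind) (qverma t 0)"
        "\<And>i. f ` gr (top_of q_alg V.Ind) i = gr (qverma t 0) i" "is_supermodule q_alg (top_of q_alg V.Ind)"
      then show thesis by (rule that[unfolded Lq_def])
    qed (use ne s0 in \<open>auto simp: qverma_simps Vq_simps sc2_def inj_on_def vec_eq_iff forall_2 algebra_simps split: if_splits\<close>)
  next
    case 2
    then have e: "x * im * sq (- t) = - (x * sq t)" "im * (x * sq (- t)) = - (x * sq t)" for x
      by (simp_all add: mult.assoc mult.left_commute[of im])
    have e3: "im * (x * (sq (- t) * y)) = - (x * (sq t * y))" for x y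
    proof -
      have "im * (x * (sq (- t) * y)) = x * ((im * sq (- t)) * y)" by (simp add: algebra_simps)
      then show ?thesis unfolding 2 by simp
    qed
    \<comment> \<open>Now the odd identity kills the odd vector, so the roles of the two coordinates
      are exchanged and the first slot is odd.\<close>
    show ?thesis
    proof (rule V.hw_top[OF qverma_simple[OF t, of 1], of "\<lambda>w. ([:w $ 2:], [:sq t * w $ 1:])"])
      fix X :: "'k smat" and i w assume X: "X \<in> b_alg i"
      show "([:(ugen b_alg X \<odot>\<^bsub>Vq\<^esub> w) $ 2:], [:sq t * (ugen b_alg X \<odot>\<^bsub>Vq\<^esub> w) $ 1:]) =
          ugen q_alg X \<odot>\<^bsub>qverma t 1\<^esub> ([:w $ 2:], [:sq t * w $ 1:])"
        unfolding Vq_simps(6)[OF X] using X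
        by (elim b_alg_cases)
          (simp_all add: qverma_simps Vm_act 2 e e3 tr2_def vact_def cp_def PX_def pderiv_pCons algebra_simps sq_rules)
    next
      fix f assume "f \<in> module_isos Aq (top_of q_alg V.Ind) (qverma t 1)"
        "\<And>i. f ` gr (top_of q_alg V.Ind) i = gr (qverma t 1) i" "is_supermodule q_alg (top_of q_alg V.Ind)"
      then show thesis by (rule that[unfolded Lq_def])
    qed (use ne s0 in \<open>auto simp: qverma_simps Vq_simps sc2_def inj_on_def vec_eq_iff forall_2 algebra_simps split: if_splits\<close>)
  qed
qed

end

section \<open>Locally finite endomorphisms of the Verma module\<close>

text \<open>A sequence killed by an iterated difference operator is polynomial.\<close>

lemma difference_sequence:
  fixes \<sigma> :: "nat \<Rightarrow> nat \<Rightarrow> 'k::field_char_0"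
  assumes "\<And>n k. \<sigma> (Suc n) k = s * (\<sigma> n (Suc k) - \<sigma> n k)" "s \<noteq> 0" "\<And>k. \<sigma> N k = 0"
  shows "\<exists>c. \<forall>k. \<sigma> 0 k = (\<Sum>i<N. c i * of_nat (k choose i))"
  using assms(1,3)
proof (induction N arbitrary: \<sigma>)
  case 0
  then show ?case by simp
next
  case (Suc N)
  obtain c where c: "\<And>k. \<sigma> 1 k = (\<Sum>i<N. c i * of_nat (k choose i))"
    using Suc.IH[of "\<lambda>n. \<sigma> (Suc n)"] Suc.prems by auto
  have step: "\<sigma> 0 (Suc k) = \<sigma> 0 k + \<sigma> 1 k / s" for k
    using Suc.prems(1)[of 0 k] assms(2) by (simp add: field_simps)
  have "\<sigma> 0 k = \<sigma> 0 0 + (\<Sum>i<N. c i / s * of_nat (k choose Suc i))" for k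
  proof (induction k)
    case (Suc k)
    then show ?case
      by (simp add: step c[unfolded One_nat_def] sum_divide_distrib algebra_simps add_divide_distrib flip: sum.distrib)
  qed simp
  note eq = this
  have "(\<Sum>i<Suc N. (case i of 0 \<Rightarrow> \<sigma> 0 0 | Suc j \<Rightarrow> c j / s) * of_nat (k choose i)) =
      \<sigma> 0 0 + (\<Sum>i<N. c i / s * of_nat (k choose Suc i))" for k
    by (simp add: sum.lessThan_Suc_shift del: sum.lessThan_Suc)
  then show ?case using eq by metis
qed

lemma choose_poly: "\<exists>q. \<forall>k. of_nat (k choose i) = poly q (of_nat k :: 'k::field_char_0)"
  by (rule exI[of _ "Polynomial.smult (1 / fact i) (\<Prod>j = 0..<i. [:- of_nat j, 1:])"])
    (simp add: binomial_gbinomial gbinomial_prod_rev poly_prod)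

lemma difference_poly:
  fixes \<sigma> :: "nat \<Rightarrow> nat \<Rightarrow> 'k::field_char_0"
  assumes "\<And>n k. \<sigma> (Suc n) k = s * (\<sigma> n (Suc k) - \<sigma> n k)" "s \<noteq> 0" "\<And>k. \<sigma> N k = 0"
  obtains q where "\<And>k. \<sigma> 0 k = poly q (of_nat k)"
proof -
  obtain c where c: "\<And>k. \<sigma> 0 k = (\<Sum>i<N. c i * of_nat (k choose i))"
    using difference_sequence[of \<sigma> s N] assms by blast
  obtain q where q: "\<And>i k. of_nat (k choose i) = poly (q i) (of_nat k :: 'k)"
    using choose_poly by metis
  show thesis
    by (rule that[of "\<Sum>i<N. Polynomial.smult (c i) (q i)"]) (simp add: c q poly_sum)
qed

text \<open>These are \<open>card B + 1\<close> vectors in the span of \<open>B\<close>. Linear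
  dependence is a property of sets, so a repetition among the vectors has to be turned into a
  relation separately.\<close>

lemma (in vector_space) iterate_relation:
  assumes "finite B" "\<And>i. v i \<in> span B"
  obtains c where "\<exists>i\<le>card B. c i \<noteq> 0" "(\<Sum>i\<le>card B. scale (c i) (v i)) = 0"
proof (cases "inj_on v {..card B}")
  case True
  have "dependent (v ` {..card B})"
  proof (rule ccontr)
    assume "independent (v ` {..card B})"
    then have "card (v ` {..card B}) \<le> card B"
      using independent_span_bound[OF assms(1)] assms(2) by blast
    then show False by (simp add: card_image True)
  qed
  then obtain u where u: "\<exists>w\<in>v ` {..card B}. u w \<noteq> 0" "(\<Sum>w\<in>v ` {..card B}. scale (u w) w) = 0"
    by (auto simp: dependent_finite)
  show thesis
    by (rule that[of "\<lambda>i. u (v i)"]) (use u in \<open>auto simp: sum.reindex[OF True]\<close>)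
next
  case False
  then obtain i j where ij: "i \<le> card B" "j \<le> card B" "v i = v j" "i \<noteq> j" by (auto simp: inj_on_def)
  let ?c = "\<lambda>l. if l = i then 1 else if l = j then -1 else (0 :: 'a)"
  have "(\<Sum>l\<le>card B. scale (?c l) (v l)) = (\<Sum>l\<in>{i, j}. scale (?c l) (v l))"
    by (rule sum.mono_neutral_right) (use ij in auto)
  also have "\<dots> = 0" using ij by simp
  finally have 0: "(\<Sum>l\<le>card B. scale (?c l) (v l)) = 0" .
  show thesis
  proof (rule that[OF _ 0])
    show "\<exists>l\<le>card B. ?c l \<noteq> 0" using ij(1) by (intro exI[of _ i]) simp
  qed
qed

interpretation fs: vector_space "\<lambda>c (f :: 'i \<Rightarrow> 'k::field) x. c * f x"
  by unfold_locales (auto simp: algebra_simps)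

lemma sum_apply: "(\<Sum>i\<in>A. f i) x = (\<Sum>i\<in>A. f i x)"
  by (induction A rule: infinite_finite_induct) simp_all

text \<open>Operators on matrix entries \<open>T (j, k)\<close>, the coefficient of \<open>x^j\<close> in the image of \<open>x^k\<close>, induced
  by the adjoint action of \<open>H\<^sub>1\<close>, \<open>F\<close> and \<open>E\<close>.\<close>

definition vc :: "'k::field_char_0 \<Rightarrow> nat \<Rightarrow> 'k" where
  "vc t k = of_nat k * (2 * t - of_nat k + 1)"

definition adH :: "(nat \<times> nat \<Rightarrow> 'k::field_char_0) \<Rightarrow> nat \<times> nat \<Rightarrow> 'k" where
  "adH T = (\<lambda>(j, k). (of_nat k - of_nat j) * T (j, k))"
definition adF :: "(nat \<times> nat \<Rightarrow> 'k::field_char_0) \<Rightarrow> nat \<times> nat \<Rightarrow> 'k" where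
  "adF T = (\<lambda>(j, k). (if j = 0 then 0 else T (j - 1, k)) - T (j, Suc k))"
text \<open>At k = 0 the truncated index \<open>k - 1\<close> is harmless, since
  \<open>vc t 0 = 0\<close>.\<close>

definition adE :: "'k::field_char_0 \<Rightarrow> (nat \<times> nat \<Rightarrow> 'k) \<Rightarrow> nat \<times> nat \<Rightarrow> 'k" where
  "adE t T = (\<lambda>(j, k). vc t (Suc j) * T (Suc j, k) - vc t k * T (j, k - 1))"

text \<open>\<open>adH\<close> multiplies the diagonal k - j = d by d. The iterates of
  \<open>T\<close> stay in a finite-dimensional space, so a nonzero polynomial p in
  \<open>adH\<close> kills \<open>T\<close>, and \<open>T\<close> can be nonzero only on diagonals d
  with p(d) = 0. Characteristic zero keeps distinct integers distinct as roots.\<close>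

lemma finite_diagonals:
  fixes W :: "(nat \<times> nat \<Rightarrow> 'k::field_char_0) set"
  assumes "finite B" "W \<subseteq> fs.span B" "\<And>T. T \<in> W ==> adH T \<in> W" "T \<in> W"
  shows "\<exists>D. finite D \<and> (\<forall>j k. T (j, k) \<noteq> 0 \<longrightarrow> int k - int j \<in> D)"
proof -
  have it: "(adH ^^ i) T = (\<lambda>(j, k). (of_nat k - of_nat j) ^ i * T (j, k))" for i
    by (induction i) (auto simp: adH_def fun_eq_iff)
  have "(adH ^^ i) T \<in> W" for i using assms(3,4) by (induction i) auto
  then have "(adH ^^ i) T \<in> fs.span B" for i using assms(2) by blast
  then obtain c where c: "\<exists>i\<le>card B. c i \<noteq> 0" "(\<Sum>i\<le>card B. (\<lambda>x. c i * (adH ^^ i) T x)) = 0"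
    using fs.iterate_relation[OF assms(1), of "\<lambda>i. (adH ^^ i) T"] by blast
  define p where "p = (\<Sum>i\<le>card B. monom (c i) i)"
  have cf: "coeff p i = c i" if "i \<le> card B" for i
    using that by (simp add: p_def coeff_sum coeff_monom sum.delta)
  then have "p \<noteq> 0" using c(1) by auto
  have z: "poly p (of_int (int k - int j)) * T (j, k) = 0" for j k
  proof -
    have "(\<Sum>i\<le>card B. c i * ((of_nat k - of_nat j) ^ i * T (j, k))) = 0"
      using fun_cong[OF c(2), of "(j, k)"] by (simp add: it sum_apply)
    then show ?thesis
      by (simp add: p_def poly_sum poly_monom sum_distrib_right mult.assoc)
  qed
  let ?D = "{d::int. poly p (of_int d) = 0}"
  have "finite ((of_int :: int \<Rightarrow> 'k) -` {x. poly p x = 0})"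
    by (rule finite_vimageI[OF poly_roots_finite[OF \<open>p \<noteq> 0\<close>]]) (simp add: inj_on_def)
  then have "finite ?D" by (simp add: vimage_def)
  then show ?thesis using z by (intro exI[of _ ?D]) auto
qed

definition realized :: "'k::field_char_0 \<Rightarrow> ('k poly \<Rightarrow> 'k poly) \<Rightarrow> bool" where
  "realized t R \<longleftrightarrow> (\<exists>u\<in>Ug. \<forall>p. u \<odot>\<^bsub>gverma t\<^esub> p = R p)"

lemma realized_intros:
  "realized t (\<lambda>p. psm c p)" "realized t (vact t A)"
  "realized t R ==> realized t R' ==> realized t (\<lambda>p. R p + R' p)"
  "realized t R ==> realized t R' ==> realized t (\<lambda>p. R (R' p))"
proof -
  interpret umod g_alg "gverma t" by (rule umod_gverma)
  show "realized t (\<lambda>p. psm c p)"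
    unfolding realized_def by (rule bexI[of _ "ucst g_alg c"]) (simp_all add: gverma_simps)
  show "realized t (vact t A)"
    unfolding realized_def by (rule bexI[OF _ ugen_closed[OF g_algI[of A]]]) (simp add: gverma_simps)
  assume "realized t R" "realized t R'"
  then obtain u v where u: "u \<in> Ug" "\<And>p. u \<odot>\<^bsub>gverma t\<^esub> p = R p"
    and v: "v \<in> Ug" "\<And>p. v \<odot>\<^bsub>gverma t\<^esub> p = R' p" unfolding realized_def by metis
  show "realized t (\<lambda>p. R p + R' p)"
    unfolding realized_def
    by (rule bexI[of _ "u \<oplus>\<^bsub>Ag\<^esub> v"]) (use u v lsmult_l_distr[of u v] in \<open>simp_all add: gverma_simps\<close>)
  show "realized t (\<lambda>p. R (R' p))"
    unfolding realized_def
    by (rule bexI[of _ "u \<otimes>\<^bsub>Ag\<^esub> v"]) (use u v lsmult_assoc[of u v] in \<open>simp_all add: gverma_simps\<close>)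
qed

lemma realized_funpow: "realized t R ==> realized t (R ^^ n)"
proof (induction n)
  case 0
  show ?case using realized_intros(1)[of t 1] by (simp add: id_def)
next
  case (Suc n)
  then show ?case using realized_intros(4)[of t R "R ^^ n"] by (simp add: comp_def)
qed

lemma realized_sum: "finite D ==> (\<And>d. d \<in> D ==> realized t (R d)) ==> realized t (\<lambda>p. \<Sum>d\<in>D. R d p)"
proof (induction rule: finite_induct)
  case empty
  show ?case using realized_intros(1)[of t 0] by simp
next
  case (insert d D)
  then show ?case using realized_intros(3)[of t "R d" "\<lambda>p. \<Sum>d\<in>D. R d p"] by simp
qed

lemma realized_linear:
  assumes "realized t R"
  shows "R (p + q) = R p + R q" "R (psm c p) = psm c (R p)" "R 0 = 0"
proof -
  interpret umod g_alg "gverma t" by (rule umod_gverma)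
  obtain u where u: "u \<in> Ug" "\<And>p. R p = u \<odot>\<^bsub>gverma t\<^esub> p"
    using assms unfolding realized_def by metis
  show "R (p + q) = R p + R q" using lsmult_r_distr[OF u(1), of p q] by (simp add: u gverma_simps)
  show c: "R (psm c p) = psm c (R p)" for c p
    using cs_central[OF u(1), of p c] by (simp add: u(2) gverma_simps)
  show "R 0 = 0" using c[of 0 0] by simp
qed

text \<open>A polynomial in the Euler operator \<open>x d/dx\<close>.\<close>

lemma realized_euler: "\<exists>R. realized t R \<and> (\<forall>c k. R (monom c k) = monom (poly q (of_nat k) * c) k)"
proof -
  \<comment> \<open>H_1 acts as t - x d/dx, so this combination is the Euler operator.\<close>
  define X where "X = (\<lambda>p. psm t p + psm (- 1) (vact t (mx 1 0 0 0) p))"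
  have X: "realized t X"
    unfolding X_def by (intro realized_intros(3) realized_intros(1) realized_intros(4)[OF realized_intros(1) realized_intros(2)])
  have Xm: "X (monom c k) = monom (of_nat k * c) k" for c k
  proof -
    have "X (monom c k) = PX * pderiv (monom c k)"
      by (simp add: X_def vact_def cp_simps smult_cp)
    then show ?thesis by (cases k) (simp_all add: PX_def pderiv_monom mult_monom smult_monom monom_Suc[symmetric])
  qed
  show ?thesis
  proof (induction q)
    case 0
    show ?case using realized_intros(1)[of t 0] by (intro exI[of _ "psm 0"]) simp
  next
    case (pCons a q)
    then obtain R where R: "realized t R" "\<And>c k. R (monom c k) = monom (poly q (of_nat k) * c) k" by blast
    show ?case
      by (rule exI[of _ "\<lambda>p. psm a p + X (R p)"])
        (use realized_intros(3)[OF realized_intros(1)[of t a] realized_intros(4)[OF X R(1)]] in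
          \<open>simp add: R(2) Xm smult_monom add_monom algebra_simps\<close>)
  qed
qed

lemma vact_raise_monom: "vact t (mx 0 1 0 0) (monom c k) = monom (vc t k * c) (k - 1)"
  by (cases k; rule poly_eqI) (auto simp: coeff_vact_raise vc_def algebra_simps)

lemma vact_lower_monom: "vact t (mx 0 0 1 0) (monom c k) = monom c (Suc k)"
  by (simp add: vact_lower monom_Suc)

section \<open>Diagonals of an ad-stable finite-dimensional space of matrices\<close>

context
  fixes t :: "'k::field_char_0" and W :: "(nat \<times> nat \<Rightarrow> 'k) set" and B
  assumes t: "\<And>n. 2 * t \<noteq> of_nat n"
    and B: "finite B" "B \<subseteq> W" "W \<subseteq> fs.span B"
    and W: "\<And>T. T \<in> W ==> adH T \<in> W" "\<And>T. T \<in> W ==> adF T \<in> W" "\<And>T. T \<in> W ==> adE t T \<in> W"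
begin

text \<open>A single finite set of diagonals for all of \<open>W\<close> is what terminates the
  iterations below: \<open>adF\<close> and \<open>adE\<close> shift the diagonal by one and stay in
  \<open>W\<close>, so their iterates eventually vanish along the shifted diagonal.\<close>

lemma uniform_diagonals: "\<exists>D. finite D \<and> (\<forall>T\<in>W. \<forall>j k. T (j, k) \<noteq> 0 \<longrightarrow> int k - int j \<in> D)"
proof -
  have "\<forall>T\<in>B. \<exists>D. finite D \<and> (\<forall>j k. T (j, k) \<noteq> 0 \<longrightarrow> int k - int j \<in> D)"
    using finite_diagonals[OF B(1,3) W(1)] B(2) by blast
  then obtain D where D: "\<And>T. T \<in> B ==> finite (D T)"
    "\<And>T j k. T \<in> B ==> T (j, k) \<noteq> 0 ==> int k - int j \<in> D T" by metis
  let ?D = "\<Union>T\<in>B. D T"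
  have "T (j, k) = 0" if T: "T \<in> fs.span B" and n: "int k - int j \<notin> ?D" for T j k
    using T
  proof (induction rule: fs.span_induct_alt)
    case (step c x y)
    moreover have "x (j, k) = 0" using D(2)[OF step(1)] n step(1) by blast
    ultimately show ?case by simp
  qed simp
  then show ?thesis using B(1,3) D(1) by (intro exI[of _ ?D]) blast
qed

lemma large_diagonal:
  assumes "finite (D :: int set)"
  shows "\<exists>n. int a + int n \<notin> D" "\<exists>n. - int a - int n \<notin> D"
proof -
  have "finite (int -` ((\<lambda>d. d - int a) ` D))" "finite (int -` ((\<lambda>d. - d - int a) ` D))"
    using assms by (auto intro!: finite_vimageI simp: inj_on_def)
  then obtain n m where "n \<notin> int -` ((\<lambda>d. d - int a) ` D)" "m \<notin> int -` ((\<lambda>d. - d - int a) ` D)"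
    by (metis ex_new_if_finite infinite_UNIV_nat)
  then have "int a + int n \<notin> D" "- int a - int m \<notin> D" by (force simp: image_iff)+
  then show "\<exists>n. int a + int n \<notin> D" "\<exists>n. - int a - int n \<notin> D" by blast+
qed

text \<open>The hypothesis on t enters the study of locally finite maps here; \<open>vc t\<close> is
  divided by in \<open>realized_raise\<close>.\<close>

lemma vc_nonzero: "vc t (Suc k) \<noteq> 0"
proof
  assume "vc t (Suc k) = 0"
  then have "2 * t = of_nat k" by (simp add: vc_def del: of_nat_Suc) simp
  with t show False by blast
qed

text \<open>Along the diagonals j = k + d + n the operator \<open>adF\<close> is, up to sign, the
  difference operator in k. Some iterate vanishes, so T(k + d, k) is a polynomial q in k. That
  diagonal is then the operator F^d q(x d/dx), which lies in the image of the enveloping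
  algebra.\<close>

lemma realized_lower:
  assumes T: "T \<in> W"
  shows "\<exists>R. realized t R \<and> (\<forall>j k. coeff (R (monom 1 k)) j = (if j = k + d then T (j, k) else 0))"
proof -
  obtain D where D: "finite D" "\<And>T j k. T \<in> W ==> T (j, k) \<noteq> 0 ==> int k - int j \<in> D"
    using uniform_diagonals by blast
  obtain N where N: "- int d - int N \<notin> D" using large_diagonal(2)[OF D(1)] by blast
  define \<sigma> where "\<sigma> n k = (adF ^^ n) T (k + d + n, k)" for n k
  have it: "(adF ^^ n) T \<in> W" for n using T W(2) by (induction n) auto
  have s: "\<sigma> (Suc n) k = - 1 * (\<sigma> n (Suc k) - \<sigma> n k)" for n k
    by (simp add: \<sigma>_def adF_def)
  have z: "\<sigma> N k = 0" for k
    using D(2)[OF it[of N], of "k + d + N" k] N by (auto simp: \<sigma>_def)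
  obtain q where q: "\<And>k. \<sigma> 0 k = poly q (of_nat k)"
    by (rule difference_poly[of \<sigma> "- 1" N]) (use s z in auto)
  obtain R where R: "realized t R" "\<And>c k. R (monom c k) = monom (poly q (of_nat k) * c) k"
    using realized_euler by blast
  let ?F = "vact t (mx 0 0 1 0)"
  have F: "(?F ^^ n) (monom c k) = monom c (k + n)" for n c k
    by (induction n) (simp_all add: vact_lower_monom)
  have "realized t (\<lambda>p. (?F ^^ d) (R p))"
    by (rule realized_intros(4)[OF realized_funpow[OF realized_intros(2)] R(1)])
  moreover have "coeff ((?F ^^ d) (R (monom 1 k))) j = (if j = k + d then T (j, k) else 0)" for j k
    using q[of k] by (simp add: R F \<sigma>_def coeff_monom)
  ultimately show ?thesis by blast
qed

text \<open>On the other side of the main diagonal \<open>adE\<close> is a difference operator with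
  weights. Division by the coefficients of powers of the raising operator removes the weights, the
  normalised entries become a polynomial q in the row index, and the diagonal is q(x d/dx)
  E^m.\<close>

lemma realized_raise:
  assumes T: "T \<in> W"
  shows "\<exists>R. realized t R \<and> (\<forall>j k. coeff (R (monom 1 k)) j = (if k = j + m then T (j, k) else 0))"
proof -
  obtain D where D: "finite D" "\<And>T j k. T \<in> W ==> T (j, k) \<noteq> 0 ==> int k - int j \<in> D"
    using uniform_diagonals by blast
  obtain N where N: "int m + int N \<notin> D" using large_diagonal(1)[OF D(1)] by blast
  \<comment> \<open>\<open>C M k\<close> is the coefficient in E^M x^(k+M) = C x^k. Its two
    recursions \<open>C1\<close> and \<open>C2\<close>, which split off the last or the first
    factor, match the two terms of \<open>adE\<close>.\<close>
  define C where "C M k = (\<Prod>i=1..M. vc t (k + i))" for M k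
  have C0: "C M k \<noteq> 0" for M k
  proof -
    have "vc t (k + i) \<noteq> 0" if "i \<in> {1..M}" for i
      using that vc_nonzero[of "k + i - 1"] by simp
    then show ?thesis by (simp add: C_def)
  qed
  have C1: "C (Suc M) k = C M k * vc t (k + Suc M)" for M k by (simp add: C_def)
  have C2: "C (Suc M) k = vc t (Suc k) * C M (Suc k)" for M k
    by (induction M) (simp_all add: C_def)
  define \<sigma> where "\<sigma> n k = (adE t ^^ n) T (k, k + m + n) / C (m + n) k" for n k
  have it: "(adE t ^^ n) T \<in> W" for n using T W(3) by (induction n) auto
  have s: "\<sigma> (Suc n) k = 1 * (\<sigma> n (Suc k) - \<sigma> n k)" for n k
  proof -
    have "\<sigma> (Suc n) k = vc t (Suc k) * (adE t ^^ n) T (Suc k, Suc (k + m + n)) / C (Suc (m + n)) k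
        - vc t (k + Suc (m + n)) * (adE t ^^ n) T (k, k + m + n) / C (Suc (m + n)) k"
      by (simp add: \<sigma>_def adE_def diff_divide_distrib add.assoc)
    also have "vc t (Suc k) * (adE t ^^ n) T (Suc k, Suc (k + m + n)) / C (Suc (m + n)) k = \<sigma> n (Suc k)"
      unfolding C2 using vc_nonzero by (simp add: \<sigma>_def)
    also have "vc t (k + Suc (m + n)) * (adE t ^^ n) T (k, k + m + n) / C (Suc (m + n)) k = \<sigma> n k"
    proof -
      have e: "k + Suc (m + n) = Suc (k + m + n)" by simp
      show ?thesis unfolding C1 e using vc_nonzero[of "k + m + n"] by (simp add: \<sigma>_def)
    qed
    finally show ?thesis by simp
  qed
  have z: "\<sigma> N k = 0" for k
    using D(2)[OF it[of N], of k "k + m + N"] N by (auto simp: \<sigma>_def)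
  obtain q where q: "\<And>k. \<sigma> 0 k = poly q (of_nat k)"
    by (rule difference_poly[of \<sigma> 1 N]) (use s z in auto)
  obtain R where R: "realized t R" "\<And>c k. R (monom c k) = monom (poly q (of_nat k) * c) k"
    using realized_euler by blast
  let ?E = "vact t (mx 0 1 0 0)"
  have E: "(?E ^^ n) (monom c (k + n)) = monom (C n k * c) k" for n c k
    by (induction n arbitrary: c) (simp_all add: funpow_Suc_right vact_raise_monom C1 del: funpow.simps, simp add: C_def)
  have z0: "(?E ^^ n) 0 = 0" for n by (induction n) (simp_all add: vact_left)
  have E0: "(?E ^^ n) (monom c k) = 0" if "k < n" for n c k
    using that
  proof (induction n arbitrary: c k)
    case (Suc n)
    note IH = Suc.IH and k = Suc.prems
    have e: "(?E ^^ Suc n) (monom c k) = (?E ^^ n) (monom (vc t k * c) (k - 1))"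
      by (simp only: funpow_Suc_right comp_def vact_raise_monom)
    show ?case
    proof (cases k)
      case 0
      then show ?thesis unfolding e by (simp add: vc_def z0)
    next
      case (Suc l)
      then show ?thesis unfolding e using IH[of l] k by simp
    qed
  qed simp
  have "realized t (\<lambda>p. R ((?E ^^ m) p))"
    by (rule realized_intros(4)[OF R(1) realized_funpow[OF realized_intros(2)]])
  moreover have "coeff (R ((?E ^^ m) (monom 1 k))) j = (if k = j + m then T (j, k) else 0)" for j k
  proof (cases "k < m")
    case True
    then show ?thesis using realized_linear(3)[OF R(1)] by (simp add: E0)
  next
    case False
    then obtain l where l: "k = l + m" by (metis add.commute le_Suc_ex not_less)
    have "poly q (of_nat l) * C m l = T (l, l + m)" using q[of l] C0 by (simp add: \<sigma>_def field_simps)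
    then show ?thesis unfolding l by (simp add: E R(2) coeff_monom)
  qed
  ultimately show ?thesis by blast
qed

text \<open>Only finitely many diagonals occur, so the realisations of the single diagonals can be
  added up. The sign of k - j decides which of the two preceding results applies.\<close>

lemma realized_matrix:
  assumes T: "T \<in> W"
  obtains R where "realized t R" "\<And>j k. coeff (R (monom 1 k)) j = T (j, k)"
proof -
  obtain D where D: "finite D" "\<And>j k. T (j, k) \<noteq> 0 ==> int k - int j \<in> D"
    using uniform_diagonals T by blast
  have "\<exists>R. realized t R \<and> (\<forall>j k. coeff (R (monom 1 k)) j = (if int k - int j = d then T (j, k) else 0))" for d
  proof (cases "d \<ge> 0")
    case True
    have "(k = j + nat d) = (int k - int j = d)" for j k :: nat using True by auto
    then show ?thesis using realized_raise[OF T, of "nat d"] by simp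
  next
    case False
    have "(j = k + nat (- d)) = (int k - int j = d)" for j k :: nat using False by auto
    then show ?thesis using realized_lower[OF T, of "nat (- d)"] by simp
  qed
  then obtain R where R: "\<And>d. realized t (R d)"
    "\<And>d j k. coeff (R d (monom 1 k)) j = (if int k - int j = d then T (j, k) else 0)" by metis
  show thesis
  proof (rule that[of "\<lambda>p. \<Sum>d\<in>D. R d p"])
    show "realized t (\<lambda>p. \<Sum>d\<in>D. R d p)" by (rule realized_sum[OF D(1) R(1)])
    show "coeff (\<Sum>d\<in>D. R d (monom 1 k)) j = T (j, k)" for j k
      using D(2)[of j k] by (auto simp: coeff_sum R(2) sum.delta'[OF D(1)] D(1))
  qed
qed

end

text \<open>The compatibility of action and grading can be read off the formulas for
  \<open>\<Phi>\<close>. This matters for the tensor product, whose grading is known only through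
  its two slots.\<close>

lemma doublingI:
  fixes L :: "('k::field_char_0 uea, 'l, 'p) module_scheme" and N :: "('k uea, 'n, 'q) supermodule_scheme"
  assumes L: "umod g_alg L" and N: "umod q_alg N"
    and bij: "bij_betw (\<lambda>(x, y). \<Phi> x y) (carrier L \<times> carrier L) (carrier N)"
    and add: "\<And>x x' y y'. [|x \<in> carrier L; x' \<in> carrier L; y \<in> carrier L; y' \<in> carrier L|] ==>
      \<Phi> (x \<oplus>\<^bsub>L\<^esub> x') (y \<oplus>\<^bsub>L\<^esub> y') = \<Phi> x y \<oplus>\<^bsub>N\<^esub> \<Phi> x' y'"
    and cst: "\<And>c x y. [|x \<in> carrier L; y \<in> carrier L|] ==>
      ucst q_alg c \<odot>\<^bsub>N\<^esub> \<Phi> x y = \<Phi> (ucst g_alg c \<odot>\<^bsub>L\<^esub> x) (ucst g_alg c \<odot>\<^bsub>L\<^esub> y)"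
    and even: "\<And>A x y. [|x \<in> carrier L; y \<in> carrier L|] ==>
      ugen q_alg (blockM A 0) \<odot>\<^bsub>N\<^esub> \<Phi> x y =
        \<Phi> (ugen g_alg (blockM A 0) \<odot>\<^bsub>L\<^esub> x) (ugen g_alg (blockM A 0) \<odot>\<^bsub>L\<^esub> y)"
    and odd: "\<And>B x y. [|x \<in> carrier L; y \<in> carrier L|] ==>
      ugen q_alg (blockM 0 B) \<odot>\<^bsub>N\<^esub> \<Phi> x y =
        \<Phi> (ucst g_alg (tr2 B) \<odot>\<^bsub>L\<^esub> y) (ugen g_alg (blockM B 0) \<odot>\<^bsub>L\<^esub> x)"
    and gr0: "gr N \<pi> = (\<lambda>x. \<Phi> x (zr L)) ` carrier L"
    and gr1: "gr N (\<pi> + 1) = (\<lambda>y. \<Phi> (zr L) y) ` carrier L"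
  shows "doubling L N \<pi> \<Phi>"
proof -
  interpret L: umod g_alg L by fact
  interpret N: umod q_alg N by fact
  have cl: "\<Phi> x y \<in> carrier N" if "x \<in> carrier L" "y \<in> carrier L" for x y
    using bij that by (auto simp: bij_betw_def)
  have ex: "\<exists>x\<in>carrier L. \<exists>y\<in>carrier L. z = \<Phi> x y" if "z \<in> carrier N" for z
  proof -
    have "z \<in> (\<lambda>(x, y). \<Phi> x y) ` (carrier L \<times> carrier L)" using bij that by (simp add: bij_betw_def)
    then show ?thesis by auto
  qed
  have inj: "x = x' \<and> y = y'"
    if "x \<in> carrier L" "y \<in> carrier L" "x' \<in> carrier L" "y' \<in> carrier L" "\<Phi> x y = \<Phi> x' y'" for x y x' y'
    using bij that by (auto simp: bij_betw_def inj_on_def)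
  have zero: "\<Phi> (zr L) (zr L) = (zr N)"
    using add[of "(zr L)" "(zr L)" "(zr L)" "(zr L)"] cl[of "(zr L)" "(zr L)"]
    by (simp add: N.M.add.l_cancel_one')
  have gc: "ugen g_alg (blockM A 0) \<odot>\<^bsub>L\<^esub> x \<in> carrier L" if "x \<in> carrier L" for A x
    by (rule L.ge_closed[OF g_algI that])
  have g0: "ugen g_alg (blockM A 0) \<odot>\<^bsub>L\<^esub> (zr L) = (zr L)" for A by (rule L.lsmult_zero[OF L.ugen_closed[OF g_algI]])
  have Lsub: "subgroup (carrier L) (add_monoid L)" by (rule L.M.add_subgroupI) auto
  have s0: "subgroup (gr N \<pi>) (add_monoid N)" unfolding gr0
    by (rule L.image_additive_subgroup[OF N.M.abelian_group_axioms Lsub]) (simp_all add: cl flip: add)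
  have s1: "subgroup (gr N (\<pi> + 1)) (add_monoid N)" unfolding gr1
    by (rule L.image_additive_subgroup[OF N.M.abelian_group_axioms Lsub]) (simp_all add: cl flip: add)
  have par: "i = \<pi> \<or> i = \<pi> + 1" for i using bit_cases[of i] bit_cases[of \<pi>] by auto
  have pp: "\<pi> + 1 + 1 = \<pi>" by (simp add: add.assoc)
  have split: "\<Phi> x y = \<Phi> x (zr L) \<oplus>\<^bsub>N\<^esub> \<Phi> (zr L) y" if "x \<in> carrier L" "y \<in> carrier L" for x y
    using that by (simp flip: add)
  have "is_supermodule q_alg N"
  proof (rule is_supermoduleI[OF N])
    show "subgroup (gr N i) (add_monoid N)" for i using par[of i] s0 s1 by auto
  next
    fix z assume "z \<in> carrier N"
    then obtain x y where xy: "x \<in> carrier L" "y \<in> carrier L" "z = \<Phi> x y" using ex by blast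
    have m: "\<Phi> x (zr L) \<in> gr N \<pi>" "\<Phi> (zr L) y \<in> gr N (\<pi> + 1)" unfolding gr0 gr1 using xy by blast+
    have e: "z = \<Phi> x (zr L) \<oplus>\<^bsub>N\<^esub> \<Phi> (zr L) y" "z = \<Phi> (zr L) y \<oplus>\<^bsub>N\<^esub> \<Phi> x (zr L)"
      using split[OF xy(1,2)] xy by (simp_all add: N.M.a_comm cl)
    show "\<exists>a\<in>gr N 0. \<exists>b\<in>gr N 1. z = a \<oplus>\<^bsub>N\<^esub> b"
      using bit_cases[of \<pi>]
    proof
      assume "\<pi> = 0" then show ?thesis using m e(1) by auto
    next
      assume "\<pi> = 1" then show ?thesis using m e(2) by auto
    qed
  next
    fix z assume "z \<in> gr N 0" "z \<in> gr N 1"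
    then have "z \<in> gr N \<pi>" "z \<in> gr N (\<pi> + 1)" using bit_cases[of \<pi>] by auto
    then obtain x y where xy: "x \<in> carrier L" "y \<in> carrier L" "z = \<Phi> x (zr L)" "z = \<Phi> (zr L) y"
      unfolding gr0 gr1 by blast
    then have "x = (zr L) \<and> (zr L) = y" by (intro inj) auto
    then show "z = (zr N)" using xy(3) zero by simp
  next
    fix c z i assume "z \<in> gr N i"
    then show "ucst q_alg c \<odot>\<^bsub>N\<^esub> z \<in> gr N i"
      using par[of i] by (auto simp: gr0 gr1 cst)
  next
    fix X :: "'k smat" and i z j assume X: "X \<in> q_alg i" and "z \<in> gr N j"
    then have z: "(j = \<pi> \<and> (\<exists>x\<in>carrier L. z = \<Phi> x (zr L))) \<or> (j = \<pi> + 1 \<and> (\<exists>y\<in>carrier L. z = \<Phi> (zr L) y))"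
      using par[of j] by (auto simp: gr0 gr1)
    show "ugen q_alg X \<odot>\<^bsub>N\<^esub> z \<in> gr N (i + j)"
      using X
    proof (cases rule: q_alg_cases)
      case (1 A)
      then show ?thesis using z by (auto simp: gr0 gr1 even g0 intro!: imageI gc)
    next
      case (2 B)
      from z show ?thesis
      proof
        assume "j = \<pi> \<and> (\<exists>x\<in>carrier L. z = \<Phi> x (zr L))"
        then show ?thesis using 2 by (auto simp: add.commute[of 1] gr1 odd intro!: imageI gc)
      next
        assume "j = \<pi> + 1 \<and> (\<exists>y\<in>carrier L. z = \<Phi> (zr L) y)"
        moreover have "1 + (\<pi> + 1) = \<pi>" using bit_cases[of \<pi>] by auto
        ultimately show ?thesis using 2 by (auto simp: gr0 odd g0 intro!: imageI)
      qed
    qed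
  qed
  then show ?thesis
    by (intro doubling.intro doubling_axioms.intro L usmod.intro enveloping_q usmod_axioms.intro)
      (simp_all add: bij add cst even odd gr0 gr1)
qed

subsection \<open>Linear spans in modules over U(q(2))\<close>

locale qmod = umod "q_alg :: bit \<Rightarrow> 'k::field_char_0 smat set" M for M (structure)
begin

definition kspan where "kspan B = \<Inter>{W. k_subspace M W \<and> B \<subseteq> W}"

lemma k_subspaceD:
  assumes "k_subspace M W"
  shows "W \<subseteq> carrier M" "\<zero> \<in> W" "x \<in> W ==> y \<in> W ==> x \<oplus> y \<in> W" "x \<in> W ==> y \<in> W ==> x \<ominus> y \<in> W"
    "x \<in> W ==> ucst q_alg c \<odot> x \<in> W"
proof -
  have W: "subgroup W (add_monoid M)" and c: "\<forall>c. \<forall>x\<in>W. ucst q_alg c \<odot> x \<in> W"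
    using assms unfolding k_subspace_def by (rule conjunct1, rule conjunct2)
  note D = M.add_subgroupD[OF W]
  show "W \<subseteq> carrier M" "\<zero> \<in> W" by (rule D)+
  show "x \<oplus> y \<in> W" "x \<ominus> y \<in> W" if "x \<in> W" "y \<in> W" using that by (rule D)+
  show "ucst q_alg c \<odot> x \<in> W" if "x \<in> W" using c that by blast
qed

lemma k_subspaceI:
  assumes "W \<subseteq> carrier M" "\<zero> \<in> W" "\<And>x y. x \<in> W ==> y \<in> W ==> x \<oplus> y \<in> W"
    "\<And>c x. x \<in> W ==> ucst q_alg c \<odot> x \<in> W"
  shows "k_subspace M W"
proof -
  have "\<ominus> x \<in> W" if "x \<in> W" for x
  proof -
    have x: "x \<in> carrier M" using assms(1) that by blast
    show ?thesis using assms(4)[OF that, of "- 1"] by (simp add: cs_uminus[OF x] cs_one[OF x])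
  qed
  then show ?thesis
    unfolding k_subspace_def
    by (intro conjI M.add_subgroupI assms(1,2) allI ballI) (simp_all add: assms(3,4))
qed

lemma k_subspace_carrier: "k_subspace M (carrier M)"
  by (rule k_subspaceI) auto

lemma kspan_subspace:
  assumes "B \<subseteq> carrier M"
  shows "k_subspace M (kspan B)"
proof (rule k_subspaceI)
  show "kspan B \<subseteq> carrier M" unfolding kspan_def using k_subspace_carrier assms by blast
  show "\<zero> \<in> kspan B" unfolding kspan_def using k_subspaceD(2) by blast
  show "x \<oplus> y \<in> kspan B" if "x \<in> kspan B" "y \<in> kspan B" for x y
    using that k_subspaceD(3) unfolding kspan_def by blast
  show "ucst q_alg c \<odot> x \<in> kspan B" if "x \<in> kspan B" for c x
    using that k_subspaceD(5) unfolding kspan_def by blast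
qed

lemma kspan_superset: "B \<subseteq> kspan B"
  unfolding kspan_def by blast

lemma kspan_least: "k_subspace M W ==> B \<subseteq> W ==> kspan B \<subseteq> W"
  unfolding kspan_def by blast

lemma kspan_mono:
  assumes "A \<subseteq> B" shows "kspan A \<subseteq> kspan B"
  unfolding kspan_def using assms by blast

lemma kspan_image:
  assumes B: "B \<subseteq> carrier M" and W: "k_subspace M W"
    and f: "\<And>x. x \<in> carrier M ==> f x \<in> carrier M"
    and add: "\<And>x y. [|x \<in> carrier M; y \<in> carrier M|] ==> f (x \<oplus> y) = f x \<oplus> f y"
    and cs: "\<And>c x. x \<in> carrier M ==> f (ucst q_alg c \<odot> x) = ucst q_alg c \<odot> f x"
    and fB: "\<And>b. b \<in> B ==> f b \<in> W" and x: "x \<in> kspan B"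
  shows "f x \<in> W"
proof -
  note WD = k_subspaceD[OF W]
  have z: "f \<zero> = \<zero>" using add[of "\<zero>" "\<zero>"] f[of "\<zero>"] by (simp add: M.add.l_cancel_one')
  have "k_subspace M {x \<in> carrier M. f x \<in> W}"
  proof (rule k_subspaceI)
    show "x \<oplus> y \<in> {x \<in> carrier M. f x \<in> W}" if "x \<in> {x \<in> carrier M. f x \<in> W}" "y \<in> {x \<in> carrier M. f x \<in> W}" for x y
      using that WD(3) by (simp add: add)
    show "ucst q_alg c \<odot> x \<in> {x \<in> carrier M. f x \<in> W}" if "x \<in> {x \<in> carrier M. f x \<in> W}" for c x
      using that WD(5) by (simp add: cs)
    show "\<zero> \<in> {x \<in> carrier M. f x \<in> W}" using WD(2) z by simp
  qed blast
  then have "kspan B \<subseteq> {x \<in> carrier M. f x \<in> W}"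
    by (rule kspan_least) (use B fB in blast)
  with x show ?thesis by blast
qed

text \<open>The form used to enlarge ad-stable spaces: a finite-dimensional subspace is handled
  through a finite generating set, on which stability can be tested.\<close>

lemma finite_dim_iff:
  "finite_dim_subspace M W \<longleftrightarrow> (\<exists>B. finite B \<and> B \<subseteq> carrier M \<and> W = kspan B)"
proof
  assume "finite_dim_subspace M W"
  then have kW: "k_subspace M W" and "\<exists>B\<subseteq>W. finite B \<and> (\<forall>W'. k_subspace M W' \<and> B \<subseteq> W' \<longrightarrow> W \<subseteq> W')"
    unfolding finite_dim_subspace_def by (rule conjunct1, rule conjunct2)
  then obtain B where B: "B \<subseteq> W" "finite B" and min: "\<forall>W'. k_subspace M W' \<and> B \<subseteq> W' \<longrightarrow> W \<subseteq> W'"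
    by (elim exE conjE) (rule that)
  have Bc: "B \<subseteq> carrier M" using B(1) k_subspaceD(1)[OF kW] by (rule subset_trans)
  have "W \<subseteq> kspan B" using min kspan_subspace[OF Bc] kspan_superset[of B] by simp
  then have "W = kspan B" using kspan_least[OF kW B(1)] by (rule subset_antisym)
  then show "\<exists>B. finite B \<and> B \<subseteq> carrier M \<and> W = kspan B" using B(2) Bc by (intro exI conjI)
next
  assume "\<exists>B. finite B \<and> B \<subseteq> carrier M \<and> W = kspan B"
  then obtain B where B: "finite B" "B \<subseteq> carrier M" "W = kspan B" by (elim exE conjE) (rule that)
  show "finite_dim_subspace M W"
    unfolding finite_dim_subspace_def B(3)
    by (intro conjI kspan_subspace B exI[of _ B] kspan_superset allI impI, elim conjE, rule kspan_least)
qed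

end

section \<open>The bimodule of locally finite maps\<close>

text \<open>The two highest weight modules enter the sequel only through the doubling and the
  isomorphism \<open>\<theta>\<close> with the polynomial model; their construction as tops is not
  opened again.\<close>

locale verma_doubling = doubling L0 Q0 \<pi>0 \<Phi>0
  for L0 :: "('k::field_char_0 uea, 'l, 'p) module_scheme" and Q0 :: "('k uea, 'n, 'q) supermodule_scheme" and \<pi>0 \<Phi>0 +
  fixes \<theta> :: "'l \<Rightarrow> 'k poly" and t :: 'k
  assumes \<theta>: "\<theta> \<in> module_isos Ag L0 (gverma t)"
    and t: "\<And>n. 2 * t \<noteq> of_nat n"
begin

abbreviation H where "H \<equiv> hom_bimodule L0 Q0"
abbreviation F where "F \<equiv> ad_locally_finite H"
abbreviation LB where "LB \<equiv> locally_finite_bimodule L0 Q0"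

lemma H_simps:
  "carrier H = {f \<in> carrier L0 \<rightarrow>\<^sub>E carrier Q0.
           (\<forall>x \<in> carrier L0. \<forall>y \<in> carrier L0. f (x \<oplus>\<^bsub>L0\<^esub> y) = f x \<oplus>\<^bsub>Q0\<^esub> f y) \<and>
           (\<forall>c. \<forall>x \<in> carrier L0. f (ucst g_alg c \<odot>\<^bsub>L0\<^esub> x) = ucst q_alg c \<odot>\<^bsub>Q0\<^esub> f x)}"
  "(zr H) = (\<lambda>x \<in> carrier L0. (zr Q0))"
  "f \<oplus>\<^bsub>H\<^esub> h = (\<lambda>x \<in> carrier L0. f x \<oplus>\<^bsub>Q0\<^esub> h x)"
  "u \<odot>\<^bsub>H\<^esub> f = (\<lambda>x \<in> carrier L0. u \<odot>\<^bsub>Q0\<^esub> f x)"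
  "gr H i = {f \<in> carrier H. f ` carrier L0 \<subseteq> gr Q0 i}"
  "rsmult H f r = (\<lambda>x \<in> carrier L0. f (r \<odot>\<^bsub>L0\<^esub> x))"
  by (simp_all add: hom_bimodule_def Let_def)

lemma HD:
  assumes "f \<in> carrier H"
  shows "x \<in> carrier L0 ==> f x \<in> carrier Q0"
    "[|x \<in> carrier L0; y \<in> carrier L0|] ==> f (x \<oplus>\<^bsub>L0\<^esub> y) = f x \<oplus>\<^bsub>Q0\<^esub> f y"
    "x \<in> carrier L0 ==> f (ucst g_alg c \<odot>\<^bsub>L0\<^esub> x) = ucst q_alg c \<odot>\<^bsub>Q0\<^esub> f x"
    "f \<in> extensional (carrier L0)"
  using assms unfolding H_simps by (auto simp: PiE_def)

lemma HI:
  assumes "\<And>x. x \<in> carrier L0 ==> f x \<in> carrier Q0"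
    "\<And>x y. [|x \<in> carrier L0; y \<in> carrier L0|] ==> f (x \<oplus>\<^bsub>L0\<^esub> y) = f x \<oplus>\<^bsub>Q0\<^esub> f y"
    "\<And>c x. x \<in> carrier L0 ==> f (ucst g_alg c \<odot>\<^bsub>L0\<^esub> x) = ucst q_alg c \<odot>\<^bsub>Q0\<^esub> f x"
  shows "(\<lambda>x\<in>carrier L0. f x) \<in> carrier H"
  unfolding H_simps using assms by simp

lemma H_eqI:
  assumes "f \<in> carrier H" "h \<in> carrier H" "\<And>x. x \<in> carrier L0 ==> f x = h x"
  shows "f = h"
  by (rule extensionalityI[OF HD(4)[OF assms(1)] HD(4)[OF assms(2)] assms(3)])

lemma H_add_closed: "f \<in> carrier H ==> h \<in> carrier H ==> f \<oplus>\<^bsub>H\<^esub> h \<in> carrier H"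
  unfolding H_simps(3) by (rule HI) (simp_all add: HD N.M.a_ac N.lsmult_r_distr)

lemma H_smult_closed: "u \<in> Uq ==> f \<in> carrier H ==> u \<odot>\<^bsub>H\<^esub> f \<in> carrier H"
  unfolding H_simps(4) by (rule HI) (simp_all add: HD N.lsmult_r_distr N.cs_central)

lemma H_zero_closed: "(zr H) \<in> carrier H"
  unfolding H_simps(2) by (rule HI) simp_all

lemma H_rsmult_closed: "r \<in> Ug ==> f \<in> carrier H ==> rsmult H f r \<in> carrier H"
  unfolding H_simps(6) by (rule HI) (simp_all add: HD L.lsmult_r_distr flip: L.cs_central)

lemma H_eval:
  assumes "x \<in> carrier L0"
  shows "(f \<oplus>\<^bsub>H\<^esub> h) x = f x \<oplus>\<^bsub>Q0\<^esub> h x" "(u \<odot>\<^bsub>H\<^esub> f) x = u \<odot>\<^bsub>Q0\<^esub> f x" "(zr H) x = (zr Q0)"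
    "rsmult H f r x = f (r \<odot>\<^bsub>L0\<^esub> x)"
  using assms by (simp_all add: H_simps)

lemma abelian_H: "abelian_group H"
proof (rule abelian_groupI)
  fix f h g assume "f \<in> carrier H" "h \<in> carrier H" "g \<in> carrier H"
  then show "f \<oplus>\<^bsub>H\<^esub> h \<oplus>\<^bsub>H\<^esub> g = f \<oplus>\<^bsub>H\<^esub> (h \<oplus>\<^bsub>H\<^esub> g)"
    by (intro H_eqI H_add_closed) (simp_all add: H_eval HD N.M.a_assoc)
next
  fix f h assume "f \<in> carrier H" "h \<in> carrier H"
  then show "f \<oplus>\<^bsub>H\<^esub> h = h \<oplus>\<^bsub>H\<^esub> f"
    by (intro H_eqI H_add_closed) (simp_all add: H_eval HD N.M.a_comm)
next
  fix f assume f: "f \<in> carrier H"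
  then show "(zr H) \<oplus>\<^bsub>H\<^esub> f = f"
    by (intro H_eqI H_add_closed H_zero_closed) (simp_all add: H_eval HD)
  show "\<exists>h\<in>carrier H. h \<oplus>\<^bsub>H\<^esub> f = (zr H)"
  proof (rule bexI[OF _ H_smult_closed[OF N.ucst_closed[of "- 1"] f]])
    show "ucst q_alg (- 1) \<odot>\<^bsub>H\<^esub> f \<oplus>\<^bsub>H\<^esub> f = (zr H)"
      by (intro H_eqI H_add_closed H_zero_closed H_smult_closed f)
        (simp_all add: H_eval HD[OF f] N.cs_uminus N.cs_one N.M.l_neg)
  qed
qed (simp_all add: H_add_closed H_zero_closed)

lemma left_module_H: "left_module Aq H"
proof (intro left_module.intro N.ring_UEA abelian_H left_module_axioms.intro)
  fix a b :: "'k uea" and f assume "a \<in> Uq" "b \<in> Uq" "f \<in> carrier H"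
  then show "(a \<oplus>\<^bsub>Aq\<^esub> b) \<odot>\<^bsub>H\<^esub> f = a \<odot>\<^bsub>H\<^esub> f \<oplus>\<^bsub>H\<^esub> b \<odot>\<^bsub>H\<^esub> f"
    "(a \<otimes>\<^bsub>Aq\<^esub> b) \<odot>\<^bsub>H\<^esub> f = a \<odot>\<^bsub>H\<^esub> (b \<odot>\<^bsub>H\<^esub> f)"
    by (intro H_eqI H_add_closed H_smult_closed; simp add: H_eval HD N.lsmult_l_distr N.lsmult_assoc)+
next
  fix a :: "'k uea" and f h assume "a \<in> Uq" "f \<in> carrier H" "h \<in> carrier H"
  then show "a \<odot>\<^bsub>H\<^esub> (f \<oplus>\<^bsub>H\<^esub> h) = a \<odot>\<^bsub>H\<^esub> f \<oplus>\<^bsub>H\<^esub> a \<odot>\<^bsub>H\<^esub> h"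
    by (intro H_eqI H_add_closed H_smult_closed; simp add: H_eval HD N.lsmult_r_distr)
next
  fix f assume "f \<in> carrier H"
  then show "\<one>\<^bsub>Aq\<^esub> \<odot>\<^bsub>H\<^esub> f = f"
    by (intro H_eqI H_smult_closed; simp add: H_eval HD)
qed (rule H_smult_closed)

sublocale Hm: qmod H
  unfolding qmod_def by (rule left_module_umod[OF graded_lie_q left_module_H])

lemma H_minus_eval:
  assumes "f \<in> carrier H" "h \<in> carrier H" "x \<in> carrier L0"
  shows "(f \<ominus>\<^bsub>H\<^esub> h) x = f x \<ominus>\<^bsub>Q0\<^esub> h x"
proof -
  have "\<ominus>\<^bsub>H\<^esub> h = ucst q_alg (- 1) \<odot>\<^bsub>H\<^esub> h"
    using Hm.cs_uminus[OF assms(2), of 1] Hm.cs_one[OF assms(2)] by simp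
  then show ?thesis using assms by (simp add: a_minus_def H_eval HD N.cs_uminus N.cs_one)
qed

abbreviation ad where "ad A \<equiv> ad_action H (blockM A 0)"

lemma ad_closed: "f \<in> carrier H ==> ad A f \<in> carrier H"
  unfolding ad_action_def
  by (intro Hm.M.minus_closed H_smult_closed H_rsmult_closed N.ugen_closed[OF q_algI(1)] L.ugen_closed[OF g_algI])

lemma ad_eval:
  assumes "f \<in> carrier H" "x \<in> carrier L0"
  shows "ad A f x = ugen q_alg (blockM A 0) \<odot>\<^bsub>Q0\<^esub> f x \<ominus>\<^bsub>Q0\<^esub> f (ugen g_alg (blockM A 0) \<odot>\<^bsub>L0\<^esub> x)"
  unfolding ad_action_def
  using H_minus_eval[OF H_smult_closed[OF N.ugen_closed[OF q_algI(1)] assms(1)] H_rsmult_closed[OF L.ugen_closed[OF g_algI] assms(1)] assms(2)]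
    assms(2) by (simp add: H_eval)

lemma ad_linear:
  assumes "f \<in> carrier H"
  shows "h \<in> carrier H ==> ad A (f \<oplus>\<^bsub>H\<^esub> h) = ad A f \<oplus>\<^bsub>H\<^esub> ad A h"
    "ad A (ucst q_alg c \<odot>\<^bsub>H\<^esub> f) = ucst q_alg c \<odot>\<^bsub>H\<^esub> ad A f"
proof -
  have gq: "ugen q_alg (blockM A 0) \<in> Uq" by (rule N.ugen_closed[OF q_algI(1)])
  note c = ad_closed H_add_closed H_smult_closed
  assume h: "h \<in> carrier H"
  show "ad A (f \<oplus>\<^bsub>H\<^esub> h) = ad A f \<oplus>\<^bsub>H\<^esub> ad A h"
    by (intro H_eqI c assms h)
      (use gq assms h in \<open>simp_all add: ad_eval H_eval c HD g_closed N.lsmult_r_distr a_minus_def N.M.a_ac N.M.minus_add\<close>)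
next
  have gq: "ugen q_alg (blockM A 0) \<in> Uq" by (rule N.ugen_closed[OF q_algI(1)])
  note cl = ad_closed H_add_closed H_smult_closed
  show "ad A (ucst q_alg c \<odot>\<^bsub>H\<^esub> f) = ucst q_alg c \<odot>\<^bsub>H\<^esub> ad A f"
    by (intro H_eqI cl assms N.ucst_closed)
      (use gq assms in \<open>simp_all add: ad_eval H_eval cl HD g_closed N.lsmult_r_distr N.lsmult_minus a_minus_def N.cs_central[OF gq]\<close>)
qed

lemma ad_stable:
  assumes B: "B \<subseteq> carrier H" and "\<And>A b. b \<in> B ==> ad A b \<in> Hm.kspan B" "f \<in> Hm.kspan B"
  shows "ad A f \<in> Hm.kspan B"
  by (rule Hm.kspan_image[OF B Hm.kspan_subspace[OF B] ad_closed ad_linear(1) ad_linear(2) assms(2,3)])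

lemma F_iff:
  "f \<in> F \<longleftrightarrow> (\<exists>B. finite B \<and> B \<subseteq> carrier H \<and> f \<in> Hm.kspan B \<and> (\<forall>A. \<forall>h\<in>Hm.kspan B. ad A h \<in> Hm.kspan B))"
  unfolding ad_locally_finite_def mem_Collect_eq Hm.finite_dim_iff g_alg_0 q_alg_0 by auto

lemma F_closed: "f \<in> F ==> f \<in> carrier H"
  unfolding F_iff by (elim exE conjE) (rule subsetD[OF Hm.k_subspaceD(1)[OF Hm.kspan_subspace]])

lemma F_add:
  assumes "f \<in> F" "h \<in> F"
  shows "f \<oplus>\<^bsub>H\<^esub> h \<in> F"
proof -
  obtain B where B: "finite B" "B \<subseteq> carrier H" "f \<in> Hm.kspan B" "\<And>A h. h \<in> Hm.kspan B ==> ad A h \<in> Hm.kspan B"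
    using assms(1) unfolding F_iff by blast
  obtain C where C: "finite C" "C \<subseteq> carrier H" "h \<in> Hm.kspan C" "\<And>A h. h \<in> Hm.kspan C ==> ad A h \<in> Hm.kspan C"
    using assms(2) unfolding F_iff by blast
  have BC: "B \<union> C \<subseteq> carrier H" using B C by blast
  have m: "Hm.kspan B \<subseteq> Hm.kspan (B \<union> C)" "Hm.kspan C \<subseteq> Hm.kspan (B \<union> C)"
    by (rule Hm.kspan_mono, blast)+
  have "ad A b \<in> Hm.kspan (B \<union> C)" if "b \<in> B \<union> C" for A b
    using that B(4)[of b A] C(4)[of b A] m Hm.kspan_superset[of B] Hm.kspan_superset[of C] by blast
  then have "\<forall>A. \<forall>h\<in>Hm.kspan (B \<union> C). ad A h \<in> Hm.kspan (B \<union> C)" using ad_stable[OF BC] by blast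
  moreover have "f \<oplus>\<^bsub>H\<^esub> h \<in> Hm.kspan (B \<union> C)"
    using Hm.k_subspaceD(3)[OF Hm.kspan_subspace[OF BC]] B(3) C(3) m by blast
  ultimately show ?thesis unfolding F_iff using B(1) C(1) BC by (intro exI[of _ "B \<union> C"]) simp
qed

lemma F_cs: "f \<in> F ==> ucst q_alg c \<odot>\<^bsub>H\<^esub> f \<in> F"
  unfolding F_iff by (elim exE conjE, rule exI) (intro conjI Hm.k_subspaceD(5)[OF Hm.kspan_subspace], assumption+)

text \<open>Reduction to the four matrix units keeps the enlarged generating set in
  \<open>F_gen\<close> finite.\<close>

lemma gen_expand:
  assumes "f \<in> carrier H"
  shows "ugen q_alg (blockM C 0) \<odot>\<^bsub>H\<^esub> f =
    (ucst q_alg (C $ 1 $ 1) \<odot>\<^bsub>H\<^esub> (ugen q_alg (blockM (mx 1 0 0 0) 0) \<odot>\<^bsub>H\<^esub> f) \<oplus>\<^bsub>H\<^esub>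
     ucst q_alg (C $ 1 $ 2) \<odot>\<^bsub>H\<^esub> (ugen q_alg (blockM (mx 0 1 0 0) 0) \<odot>\<^bsub>H\<^esub> f)) \<oplus>\<^bsub>H\<^esub>
    (ucst q_alg (C $ 2 $ 1) \<odot>\<^bsub>H\<^esub> (ugen q_alg (blockM (mx 0 0 1 0) 0) \<odot>\<^bsub>H\<^esub> f) \<oplus>\<^bsub>H\<^esub>
     ucst q_alg (C $ 2 $ 2) \<odot>\<^bsub>H\<^esub> (ugen q_alg (blockM (mx 0 0 0 1) 0) \<odot>\<^bsub>H\<^esub> f))"
proof -
  let ?s = "\<lambda>c A. mat c ** blockM A (0 :: 'k ^ 2 ^ 2)"
  have "blockM C 0 = (?s (C $ 1 $ 1) (mx 1 0 0 0) + ?s (C $ 1 $ 2) (mx 0 1 0 0)) + (?s (C $ 2 $ 1) (mx 0 0 1 0) + ?s (C $ 2 $ 2) (mx 0 0 0 1))"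
    by (simp add: blockM_scale blockM_arith, rule mx_eqI) simp_all
  moreover have m: "?s c A \<in> q_alg 0" for c A by (simp add: blockM_scale)
  moreover have "?s c A + ?s c' A' \<in> q_alg 0" for c A c' A' by (simp add: blockM_scale blockM_arith)
  ultimately show ?thesis
    by (simp only: Hm.ge_add[where i = 0, OF _ _ assms] Hm.ge_scale[OF q_algI(1) assms])
qed

text \<open>The Leibniz rule: left multiplication by C commutes with the right action, so only the
  commutator of A and C in the left action is left over.\<close>

lemma ad_gen:
  assumes f: "f \<in> carrier H"
  shows "ad A (ugen q_alg (blockM C 0) \<odot>\<^bsub>H\<^esub> f) =
    ugen q_alg (blockM C 0) \<odot>\<^bsub>H\<^esub> ad A f \<oplus>\<^bsub>H\<^esub> ugen q_alg (blockM (A ** C - C ** A) 0) \<odot>\<^bsub>H\<^esub> f"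
proof -
  let ?A = "ugen q_alg (blockM A 0)" and ?C = "ugen q_alg (blockM C 0)" and ?a = "ugen g_alg (blockM A 0)"
  have q: "?A \<in> Uq" "?C \<in> Uq" "ugen q_alg (blockM (A ** C - C ** A) 0) \<in> Uq"
    by (rule N.ugen_closed[OF q_algI(1)])+
  have g: "?a \<in> Ug" by (rule L.ugen_closed[OF g_algI])
  have r: "rsmult H (?C \<odot>\<^bsub>H\<^esub> f) ?a = ?C \<odot>\<^bsub>H\<^esub> rsmult H f ?a"
    by (intro H_eqI H_smult_closed H_rsmult_closed f q g) (use g in \<open>simp add: H_eval L.lsmult_closed\<close>)
  have "?A \<odot>\<^bsub>H\<^esub> (?C \<odot>\<^bsub>H\<^esub> f) = ?C \<odot>\<^bsub>H\<^esub> (?A \<odot>\<^bsub>H\<^esub> f) \<oplus>\<^bsub>H\<^esub> ugen q_alg (blockM (A ** C - C ** A) 0) \<odot>\<^bsub>H\<^esub> f"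
    using Hm.ge_commute[OF q_algI(1) q_algI(1) f, of A C] q f
    by (simp add: koszul_def superbracket_blockM Hm.cs_one H_smult_closed)
  with q g f show ?thesis
    by (simp add: ad_action_def r a_minus_def Hm.lsmult_r_distr Hm.lsmult_minus H_smult_closed H_rsmult_closed Hm.M.a_ac)
qed

text \<open>If the span of \<open>B\<close> is ad-stable, then so is the span of \<open>B\<close>
  together with the products of the matrix units with elements of \<open>B\<close>, by the Leibniz
  rule. It is still finite-dimensional and contains the product.\<close>

lemma F_gen:
  assumes "f \<in> F"
  shows "ugen q_alg (blockM C 0) \<odot>\<^bsub>H\<^esub> f \<in> F"
proof -
  obtain B where B: "finite B" "B \<subseteq> carrier H" "f \<in> Hm.kspan B" "\<And>A h. h \<in> Hm.kspan B ==> ad A h \<in> Hm.kspan B"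
    using assms(1) unfolding F_iff by blast
  let ?E = "{mx 1 0 0 0, mx 0 1 0 0, mx 0 0 1 0, mx 0 0 0 (1::'k)}"
  let ?B = "B \<union> (\<lambda>(A, b). ugen q_alg (blockM A 0) \<odot>\<^bsub>H\<^esub> b) ` (?E \<times> B)"
  have q: "ugen q_alg (blockM A 0) \<in> Uq" for A :: "'k ^ 2 ^ 2" by (rule N.ugen_closed[OF q_algI(1)])
  have Bc: "?B \<subseteq> carrier H"
  proof (rule Un_least[OF B(2)], rule image_subsetI)
    fix z assume z: "z \<in> ?E \<times> B"
    obtain A b where z': "z = (A, b)" by (cases z)
    have "b \<in> B" using z unfolding z' by (rule SigmaD2)
    then show "(case z of (A, b) \<Rightarrow> ugen q_alg (blockM A 0) \<odot>\<^bsub>H\<^esub> b) \<in> carrier H"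
      unfolding z' prod.case by (intro H_smult_closed q subsetD[OF B(2)])
  qed
  note sp = Hm.k_subspaceD[OF Hm.kspan_subspace[OF Bc]]
  have basis: "ugen q_alg (blockM A 0) \<odot>\<^bsub>H\<^esub> b \<in> Hm.kspan ?B" if "A \<in> ?E" "b \<in> B" for A b
  proof -
    have "ugen q_alg (blockM A 0) \<odot>\<^bsub>H\<^esub> b \<in> ?B"
      by (rule UnI2, rule image_eqI[of _ _ "(A, b)"], unfold prod.case, rule refl, rule SigmaI[OF that])
    then show ?thesis by (rule subsetD[OF Hm.kspan_superset])
  qed
  have up: "ugen q_alg (blockM C 0) \<odot>\<^bsub>H\<^esub> h \<in> Hm.kspan ?B" if "h \<in> Hm.kspan B" for C h
  proof (rule Hm.kspan_image[OF B(2) Hm.kspan_subspace[OF Bc] _ _ _ _ that])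
    fix b assume "b \<in> B"
    moreover from this have "b \<in> carrier H" using B(2) by blast
    ultimately show "ugen q_alg (blockM C 0) \<odot>\<^bsub>H\<^esub> b \<in> Hm.kspan ?B"
      unfolding gen_expand[where C = C, OF \<open>b \<in> carrier H\<close>] by (intro sp(3) sp(5) basis) simp_all
  qed (simp_all add: Hm.lsmult_r_distr[OF q] H_smult_closed[OF q] Hm.cs_central[OF q])
  have m: "Hm.kspan B \<subseteq> Hm.kspan ?B" by (rule Hm.kspan_mono) blast
  have "ad A b \<in> Hm.kspan ?B" if "b \<in> ?B" for A b
  proof -
    show ?thesis
      using that
    proof (elim UnE imageE)
      assume "b \<in> B"
      then show ?thesis using B(4)[of b A] Hm.kspan_superset[of B] m by blast
    next
      fix z assume z: "b = (case z of (A, b) \<Rightarrow> ugen q_alg (blockM A 0) \<odot>\<^bsub>H\<^esub> b)" "z \<in> ?E \<times> B"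
      obtain C b' where z': "z = (C, b')" by (cases z)
      have "b' \<in> B" using z(2) unfolding z' by (rule SigmaD2)
      then have b': "b' \<in> carrier H" "b' \<in> Hm.kspan B" using B(2) Hm.kspan_superset by blast+
      have eq: "b = ugen q_alg (blockM C 0) \<odot>\<^bsub>H\<^esub> b'" using z(1) by (simp add: z')
      show ?thesis unfolding eq ad_gen[OF b'(1)] by (intro sp(3) up B(4) b'(2))
    qed
  qed
  note gen = this
  have st: "\<forall>A. \<forall>h\<in>Hm.kspan ?B. ad A h \<in> Hm.kspan ?B"
  proof (intro allI ballI)
    fix A h assume h: "h \<in> Hm.kspan ?B"
    show "ad A h \<in> Hm.kspan ?B" by (rule ad_stable[OF Bc _ h]) (rule gen)
  qed
  have "finite ?B" using B(1) by (intro finite_UnI finite_imageI finite_cartesian_product) simp_all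
  then show ?thesis
    unfolding F_iff
  proof (intro exI[where x = ?B] conjI)
    show "?B \<subseteq> carrier H" by (rule Bc)
    show "ugen q_alg (blockM C 0) \<odot>\<^bsub>H\<^esub> f \<in> Hm.kspan ?B" by (rule up[OF B(3)])
    show "\<forall>A. \<forall>h\<in>Hm.kspan ?B. ad A h \<in> Hm.kspan ?B" by (rule st)
  qed
qed

end

lemma left_module_restrict:
  assumes M: "left_module R M" and F: "submodule F R M"
    and N: "carrier N = F" "(zr N) = (zr M)" "\<And>x y. x \<oplus>\<^bsub>N\<^esub> y = x \<oplus>\<^bsub>M\<^esub> y" "\<And>r x. r \<odot>\<^bsub>N\<^esub> x = r \<odot>\<^bsub>M\<^esub> x"
  shows "left_module R N"
proof -
  interpret M: left_module R M by fact
  interpret F: submodule F R M by fact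
  note FD = M.M.add_subgroupD[OF F.subgroup_axioms]
  have c: "x \<in> carrier M" if "x \<in> F" for x by (rule subsetD[OF FD(1) that])
  have "abelian_group N"
  proof (rule abelian_groupI)
    fix x y z assume xyz: "x \<in> carrier N" "y \<in> carrier N" "z \<in> carrier N"
    then show "x \<oplus>\<^bsub>N\<^esub> y \<in> carrier N" unfolding N by (intro FD(4))
    from xyz show "x \<oplus>\<^bsub>N\<^esub> y \<oplus>\<^bsub>N\<^esub> z = x \<oplus>\<^bsub>N\<^esub> (y \<oplus>\<^bsub>N\<^esub> z)" unfolding N by (intro M.M.a_assoc c)
  next
    fix x y assume "x \<in> carrier N" "y \<in> carrier N"
    then show "x \<oplus>\<^bsub>N\<^esub> y = y \<oplus>\<^bsub>N\<^esub> x" unfolding N by (intro M.M.a_comm c)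
  next
    show "(zr N) \<in> carrier N" unfolding N by (rule FD(2))
  next
    fix x assume x: "x \<in> carrier N"
    then have x': "x \<in> F" by (simp only: N)
    show "(zr N) \<oplus>\<^bsub>N\<^esub> x = x" unfolding N by (rule M.M.l_zero[OF c[OF x']])
    show "\<exists>y\<in>carrier N. y \<oplus>\<^bsub>N\<^esub> x = (zr N)"
      unfolding N by (rule bexI[where x = "\<ominus>\<^bsub>M\<^esub> x"]) (rule M.M.l_neg[OF c[OF x']], rule FD(3)[OF x'])
  qed
  then show ?thesis
    by (intro left_module.intro M.R.ring_axioms left_module_axioms.intro)
      (simp_all add: N c F.smult_closed M.lsmult_l_distr M.lsmult_r_distr M.lsmult_assoc)
qed

context verma_doubling
begin

text \<open>The map with first slot a and second slot b, both taken from the enveloping algebra of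
  gl(2). By \<open>F_eq\<close> all locally finite maps have this form.\<close>

definition ff where "ff a b = (\<lambda>x\<in>carrier L0. \<Phi>0 (a \<odot>\<^bsub>L0\<^esub> x) (b \<odot>\<^bsub>L0\<^esub> x))"

lemma ff_eval: "x \<in> carrier L0 ==> ff a b x = \<Phi>0 (a \<odot>\<^bsub>L0\<^esub> x) (b \<odot>\<^bsub>L0\<^esub> x)"
  by (simp add: ff_def)

lemma ff_closed: "a \<in> Ug ==> b \<in> Ug ==> ff a b \<in> carrier H"
  unfolding ff_def
  by (rule HI) (simp_all add: Phi_closed Phi_cst L.lsmult_r_distr Phi_add L.cs_central)

lemma ff_add:
  assumes "a \<in> Ug" "b \<in> Ug" "a' \<in> Ug" "b' \<in> Ug"
  shows "ff a b \<oplus>\<^bsub>H\<^esub> ff a' b' = ff (a \<oplus>\<^bsub>Ag\<^esub> a') (b \<oplus>\<^bsub>Ag\<^esub> b')"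
  by (intro H_eqI H_add_closed ff_closed L.R.a_closed assms)
    (use assms in \<open>simp add: H_eval ff_eval L.lsmult_l_distr Phi_add\<close>)

lemma ff_smult:
  assumes u: "u \<in> Uq" and m: "dmat u p q r s" and a: "a \<in> Ug" "b \<in> Ug"
  shows "u \<odot>\<^bsub>H\<^esub> ff a b = ff (p \<otimes>\<^bsub>Ag\<^esub> a \<oplus>\<^bsub>Ag\<^esub> q \<otimes>\<^bsub>Ag\<^esub> b) (r \<otimes>\<^bsub>Ag\<^esub> a \<oplus>\<^bsub>Ag\<^esub> s \<otimes>\<^bsub>Ag\<^esub> b)"
proof -
  note c = dmat_closed[OF m]
  show ?thesis
    by (intro H_eqI H_smult_closed ff_closed L.R.a_closed L.R.m_closed u a c)
      (use u a c dmat_act[OF m] in \<open>simp add: H_eval ff_eval L.lsmult_l_distr L.lsmult_assoc\<close>)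
qed

lemma ff_rsmult:
  assumes "a \<in> Ug" "b \<in> Ug" "r \<in> Ug"
  shows "rsmult H (ff a b) r = ff (a \<otimes>\<^bsub>Ag\<^esub> r) (b \<otimes>\<^bsub>Ag\<^esub> r)"
  by (intro H_eqI H_rsmult_closed ff_closed L.R.m_closed assms)
    (use assms in \<open>simp add: H_eval ff_eval L.lsmult_assoc\<close>)

lemma F_env_map:
  assumes "u \<in> Ug" "f \<in> F"
  shows "env_map g_alg q_alg u \<odot>\<^bsub>H\<^esub> f \<in> F"
proof -
  have "\<exists>p\<in>carrier (env_free g_alg). u = env_class g_alg p" using assms by (auto simp: L.carrier_UEA)
  then obtain p where p: "p \<in> carrier (env_free g_alg)" "u = env_class g_alg p" by blast
  have "\<forall>f\<in>F. env_class q_alg p \<odot>\<^bsub>H\<^esub> f \<in> F"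
    using p(1)
  proof (induction rule: free_algebra_induct)
    case (const c)
    then show ?case using F_cs by blast
  next
    case (gen X)
    then consider A where "X = blockM A 0" | "X = 0" by (auto simp: g_alg_0 g_alg_1 q_alg_0)
    then show ?case
    proof cases
      case 1
      then show ?thesis using F_gen by blast
    next
      case 2
      then show ?thesis using F_gen[of _ 0] by (simp add: blockM_arith(4))
    qed
  next
    case (add p q)
    show ?case
    proof
      fix f assume f: "f \<in> F"
      show "env_class q_alg (p + q) \<odot>\<^bsub>H\<^esub> f \<in> F"
        using add f F_add by (simp add: free_g N.env_class_add Hm.lsmult_l_distr[OF _ _ F_closed[OF f]])
    qed
  next
    case (mult p q)
    show ?case
    proof
      fix f assume f: "f \<in> F"
      show "env_class q_alg (p * q) \<odot>\<^bsub>H\<^esub> f \<in> F"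
        using mult f by (simp add: free_g N.env_class_mult Hm.lsmult_assoc[OF _ _ F_closed[OF f]])
    qed
  qed
  with p assms show ?thesis by (simp add: env_map_g)
qed

lemma invariant_in_F:
  assumes f: "f \<in> carrier H" and a: "\<And>A. ad A f = (zr H)"
  shows "f \<in> F"
proof -
  have B: "{f} \<subseteq> carrier H" using f by simp
  have "ad A b \<in> Hm.kspan {f}" if "b \<in> {f}" for A b
    using that a Hm.k_subspaceD(2)[OF Hm.kspan_subspace[OF B]] by simp
  then have "\<forall>A. \<forall>h\<in>Hm.kspan {f}. ad A h \<in> Hm.kspan {f}" using ad_stable[OF B] by blast
  then show ?thesis unfolding F_iff using B Hm.kspan_superset[of "{f}"] by (intro exI[of _ "{f}"]) simp
qed

abbreviation "i0 \<equiv> ff \<one>\<^bsub>Ag\<^esub> (zr Ag)"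
abbreviation "i1 \<equiv> ff (zr Ag) \<one>\<^bsub>Ag\<^esub>"

lemma i_closed: "i0 \<in> carrier H" "i1 \<in> carrier H"
  by (simp_all add: ff_closed)

lemma i_eval: "x \<in> carrier L0 ==> i0 x = \<Phi>0 x (zr L0)" "x \<in> carrier L0 ==> i1 x = \<Phi>0 (zr L0) x"
  by (simp_all add: ff_eval)

text \<open>The inclusions of the two slots commute with gl(2), so the adjoint action kills
  them.\<close>

lemma i_F: "i0 \<in> F" "i1 \<in> F"
proof -
  have g0: "ugen g_alg (blockM A 0) \<odot>\<^bsub>L0\<^esub> (zr L0) = (zr L0)" for A by (rule L.lsmult_zero[OF L.ugen_closed[OF g_algI]])
  have "ad A i0 = (zr H)" "ad A i1 = (zr H)" for A
    by (intro H_eqI ad_closed i_closed H_zero_closed;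
        simp add: ad_eval[OF i_closed(1)] ad_eval[OF i_closed(2)] i_eval g_closed H_eval Phi_even g0 a_minus_def N.M.r_neg Phi_closed)+
  then show "i0 \<in> F" "i1 \<in> F" using invariant_in_F i_closed by blast+
qed

text \<open>The map is a left combination of the two inclusions, with a and b viewed in U(q(2)), and
  left multiplication by even elements preserves local finiteness.\<close>

lemma ff_F:
  assumes "a \<in> Ug" "b \<in> Ug"
  shows "ff a b \<in> F"
proof -
  have "ff a b = env_map g_alg q_alg a \<odot>\<^bsub>H\<^esub> i0 \<oplus>\<^bsub>H\<^esub> env_map g_alg q_alg b \<odot>\<^bsub>H\<^esub> i1"
  proof (intro H_eqI ff_closed assms H_add_closed H_smult_closed env_map_g_closed L.R.one_closed L.R.zero_closed)
    fix x assume "x \<in> carrier L0"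
    then show "ff a b x = (env_map g_alg q_alg a \<odot>\<^bsub>H\<^esub> i0 \<oplus>\<^bsub>H\<^esub> env_map g_alg q_alg b \<odot>\<^bsub>H\<^esub> i1) x"
      using assms Phi_split[of "a \<odot>\<^bsub>L0\<^esub> x" "b \<odot>\<^bsub>L0\<^esub> x"]
      by (simp add: H_eval i_eval env_map_act ff_eval)
  qed
  then show ?thesis using F_add F_env_map assms i_F by metis
qed

definition Pinv where "Pinv z = inv_into (carrier L0 \<times> carrier L0) (\<lambda>(x, y). \<Phi>0 x y) z"

lemma Pinv_Phi: "x \<in> carrier L0 ==> y \<in> carrier L0 ==> Pinv (\<Phi>0 x y) = (x, y)"
  unfolding Pinv_def using bij_betw_inv_into_left[OF bij, of "(x, y)"] by simp

text \<open>The Boolean selects the slot, \<open>True\<close> being the first, so that both slots go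
  through one argument as polynomials.\<close>

definition pr where "pr s z = \<theta> ((if s then fst else snd) (Pinv z))"

lemmas \<theta>D = module_isosD[OF \<theta>, unfolded gverma_simps]

lemma \<theta>_gen: "x \<in> carrier L0 ==> \<theta> (ugen g_alg (blockM A 0) \<odot>\<^bsub>L0\<^esub> x) = vact t A (\<theta> x)"
  "x \<in> carrier L0 ==> \<theta> (ucst g_alg c \<odot>\<^bsub>L0\<^esub> x) = psm c (\<theta> x)"
  using \<theta>D(4)[OF L.ugen_closed[OF g_algI]] \<theta>D(4)[OF L.ucst_closed] by (simp_all add: gverma_simps)

lemma pr_linear:
  assumes "z \<in> carrier Q0"
  shows "w \<in> carrier Q0 ==> pr s (z \<oplus>\<^bsub>Q0\<^esub> w) = pr s z + pr s w"
    "pr s (ucst q_alg c \<odot>\<^bsub>Q0\<^esub> z) = psm c (pr s z)"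
    "pr s (ugen q_alg (blockM A 0) \<odot>\<^bsub>Q0\<^esub> z) = vact t A (pr s z)"
proof -
  obtain x y where z: "x \<in> carrier L0" "y \<in> carrier L0" "z = \<Phi>0 x y" using Phi_ex[OF assms] by blast
  show "pr s (ucst q_alg c \<odot>\<^bsub>Q0\<^esub> z) = psm c (pr s z)"
    using z by (simp add: Phi_cst pr_def Pinv_Phi \<theta>_gen)
  show "pr s (ugen q_alg (blockM A 0) \<odot>\<^bsub>Q0\<^esub> z) = vact t A (pr s z)"
    using z by (simp add: Phi_even g_closed pr_def Pinv_Phi \<theta>_gen)
  assume "w \<in> carrier Q0"
  then obtain x' y' where w: "x' \<in> carrier L0" "y' \<in> carrier L0" "w = \<Phi>0 x' y'" using Phi_ex by blast
  with z show "pr s (z \<oplus>\<^bsub>Q0\<^esub> w) = pr s z + pr s w"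
    by (simp flip: Phi_add add: pr_def Pinv_Phi \<theta>D(3))
qed

definition \<psi> where "\<psi> = inv_into (carrier L0) \<theta>"

lemma \<psi>: "\<psi> p \<in> carrier L0" "\<theta> (\<psi> p) = p" "x \<in> carrier L0 ==> \<psi> (\<theta> x) = x"
  unfolding \<psi>_def using bij_betw_inv_into_right[OF \<theta>D(1)] bij_betw_inv_into_left[OF \<theta>D(1)]
    bij_betw_apply[OF bij_betw_inv_into[OF \<theta>D(1)]] by simp_all

lemma \<psi>_linear: "\<psi> (p + q) = \<psi> p \<oplus>\<^bsub>L0\<^esub> \<psi> q" "\<psi> (psm c p) = ucst g_alg c \<odot>\<^bsub>L0\<^esub> \<psi> p"
    "\<psi> (vact t A p) = ugen g_alg (blockM A 0) \<odot>\<^bsub>L0\<^esub> \<psi> p"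
proof -
  have "\<psi> (p + q) = \<psi> (\<theta> (\<psi> p \<oplus>\<^bsub>L0\<^esub> \<psi> q))" by (simp add: \<theta>D(3) \<psi>)
  then show "\<psi> (p + q) = \<psi> p \<oplus>\<^bsub>L0\<^esub> \<psi> q" by (simp add: \<psi>)
  have "\<psi> (psm c p) = \<psi> (\<theta> (ucst g_alg c \<odot>\<^bsub>L0\<^esub> \<psi> p))" by (simp add: \<theta>_gen \<psi>)
  then show "\<psi> (psm c p) = ucst g_alg c \<odot>\<^bsub>L0\<^esub> \<psi> p" by (simp add: \<psi>)
  have "\<psi> (vact t A p) = \<psi> (\<theta> (ugen g_alg (blockM A 0) \<odot>\<^bsub>L0\<^esub> \<psi> p))" by (simp add: \<theta>_gen \<psi>)
  then show "\<psi> (vact t A p) = ugen g_alg (blockM A 0) \<odot>\<^bsub>L0\<^esub> \<psi> p" by (simp add: \<psi> g_closed)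
qed

definition op where "op s f p = pr s (f (\<psi> p))"

lemma op_linear:
  assumes "f \<in> carrier H"
  shows "op s f (p + q) = op s f p + op s f q" "op s f (psm c p) = psm c (op s f p)"
    "h \<in> carrier H ==> op s (f \<oplus>\<^bsub>H\<^esub> h) p = op s f p + op s h p"
    "op s (ucst q_alg c \<odot>\<^bsub>H\<^esub> f) p = psm c (op s f p)"
    "op s (ad A f) p = vact t A (op s f p) - op s f (vact t A p)"
proof -
  note c = HD(1)[OF assms \<psi>(1)]
  show "op s f (p + q) = op s f p + op s f q"
    by (simp add: op_def \<psi>_linear HD(2)[OF assms] \<psi> pr_linear c)
  show "op s f (psm c p) = psm c (op s f p)"
    by (simp add: op_def \<psi>_linear HD(3)[OF assms] \<psi> pr_linear c)
  show "op s (ucst q_alg c \<odot>\<^bsub>H\<^esub> f) p = psm c (op s f p)"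
    by (simp add: op_def H_eval \<psi> pr_linear HD(1)[OF assms])
  show "op s (f \<oplus>\<^bsub>H\<^esub> h) p = op s f p + op s h p" if "h \<in> carrier H"
    by (simp add: op_def H_eval \<psi> pr_linear HD(1)[OF assms] HD(1)[OF that])
  have gc: "ugen q_alg (blockM A 0) \<odot>\<^bsub>Q0\<^esub> f (\<psi> p) \<in> carrier Q0" by (rule N.ge_closed[OF q_algI(1) c])
  have fc: "f (\<psi> (vact t A p)) \<in> carrier Q0" by (rule c)
  have "op s (ad A f) p + op s f (vact t A p) = pr s (ugen q_alg (blockM A 0) \<odot>\<^bsub>Q0\<^esub> f (\<psi> p))"
  proof -
    have "ad A f (\<psi> p) = ugen q_alg (blockM A 0) \<odot>\<^bsub>Q0\<^esub> f (\<psi> p) \<ominus>\<^bsub>Q0\<^esub> f (\<psi> (vact t A p))"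
      by (simp add: ad_eval[OF assms] \<psi> \<psi>_linear)
    moreover from this have "ad A f (\<psi> p) \<in> carrier Q0" using gc fc by simp
    ultimately show ?thesis
      unfolding op_def using pr_linear(1)[of "ad A f (\<psi> p)" "f (\<psi> (vact t A p))" s] gc fc
      by (simp add: a_minus_def N.M.a_assoc N.M.l_neg)
  qed
  then show "op s (ad A f) p = vact t A (op s f p) - op s f (vact t A p)"
    by (simp add: pr_linear(3)[OF c] op_def eq_diff_eq)
qed

definition ent where "ent s f = (\<lambda>(j, k). coeff (op s f (monom 1 k)) j)"

lemma op_monom: "f \<in> carrier H ==> op s f (monom c k) = psm c (op s f (monom 1 k))"
  using op_linear(2)[of f s c "monom 1 k"] by (simp add: smult_monom)

lemma vact_H: "vact t (mx 1 0 0 0) p = psm t p - PX * pderiv p"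
  by (simp add: vact_def cp_simps smult_cp)

lemma coeff_euler: "coeff (PX * pderiv p) j = of_nat j * coeff p j"
  by (cases j) (simp_all add: PX_def coeff_pderiv)

lemma coeff_vact_H: "coeff (vact t (mx 1 0 0 0) p) j = (t - of_nat j) * coeff p j"
  by (simp add: vact_H coeff_euler algebra_simps)

lemma vact_H_monom: "vact t (mx 1 0 0 0) (monom 1 k) = monom (t - of_nat k) k"
  by (rule poly_eqI) (simp add: vact_H coeff_euler)

text \<open>The link between the actual adjoint action and the recursions on matrix entries. The
  column of index k is the image of the monomial x^k.\<close>

lemma ent_ad:
  assumes f: "f \<in> carrier H"
  shows "ent s (ad (mx 1 0 0 0) f) = adH (ent s f)" "ent s (ad (mx 0 0 1 0) f) = adF (ent s f)"
    "ent s (ad (mx 0 1 0 0) f) = adE t (ent s f)"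
proof -
  show "ent s (ad (mx 1 0 0 0) f) = adH (ent s f)"
    by (rule ext)
      (simp add: ent_def adH_def op_linear(5)[OF f] vact_H_monom op_monom[OF f, of s "t - _"] coeff_vact_H
        algebra_simps split: prod.split)
  have mS: "pCons 0 (monom 1 k) = monom (1 :: 'k) (Suc k)" for k by (simp add: monom_Suc)
  show "ent s (ad (mx 0 0 1 0) f) = adF (ent s f)"
    by (rule ext)
      (auto simp: ent_def adF_def op_linear(5)[OF f] vact_lower_monom vact_lower mS coeff_pCons split: prod.split nat.split)
  show "ent s (ad (mx 0 1 0 0) f) = adE t (ent s f)"
    by (rule ext)
      (simp add: ent_def adE_def op_linear(5)[OF f] vact_raise_monom op_monom[OF f, of s "vc t _"] coeff_vact_raise
        split: prod.split, (simp add: vc_def algebra_simps)?)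
qed

text \<open>The positive answer to Kostant's problem for a simple Verma module.\<close>

lemma F_realized:
  assumes f: "f \<in> F"
  shows "\<exists>u\<in>Ug. \<forall>p. op s f p = u \<odot>\<^bsub>gverma t\<^esub> p"
proof -
  obtain B where B: "finite B" "B \<subseteq> carrier H" "f \<in> Hm.kspan B" "\<And>A h. h \<in> Hm.kspan B ==> ad A h \<in> Hm.kspan B"
    using f unfolding F_iff by blast
  note kc = Hm.k_subspaceD(1)[OF Hm.kspan_subspace[OF B(2)]]
  \<comment> \<open>Two notions of span meet here: \<open>kspan\<close> for maps and
    \<open>fs.span\<close> for their entry matrices. The preimage of the latter is a subspace
    containing \<open>B\<close>, hence contains the former.\<close>
  have "k_subspace H {h \<in> carrier H. ent s h \<in> fs.span (ent s ` B)}"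
  proof (rule Hm.k_subspaceI)
    fix h g assume hg: "h \<in> {h \<in> carrier H. ent s h \<in> fs.span (ent s ` B)}" "g \<in> {h \<in> carrier H. ent s h \<in> fs.span (ent s ` B)}"
    have "ent s (h \<oplus>\<^bsub>H\<^esub> g) = ent s h + ent s g" using hg by (auto simp: ent_def fun_eq_iff op_linear)
    then show "h \<oplus>\<^bsub>H\<^esub> g \<in> {h \<in> carrier H. ent s h \<in> fs.span (ent s ` B)}"
      using hg fs.span_add by auto
  next
    fix c h assume h: "h \<in> {h \<in> carrier H. ent s h \<in> fs.span (ent s ` B)}"
    have "ent s (ucst q_alg c \<odot>\<^bsub>H\<^esub> h) = (\<lambda>x. c * ent s h x)" using h by (auto simp: ent_def fun_eq_iff op_linear)
    then show "ucst q_alg c \<odot>\<^bsub>H\<^esub> h \<in> {h \<in> carrier H. ent s h \<in> fs.span (ent s ` B)}"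
      using h fs.span_scale[of "ent s h" _ c] by auto
  next
    have "op s (zr H) p = 0" for p
      using op_linear(4)[OF H_zero_closed, of s 0 p] Hm.cs_zero[OF H_zero_closed] by simp
    then have "ent s (zr H) = 0" by (simp add: ent_def fun_eq_iff)
    then show "(zr H) \<in> {h \<in> carrier H. ent s h \<in> fs.span (ent s ` B)}" using fs.span_zero by simp
  qed blast
  then have "Hm.kspan B \<subseteq> {h \<in> carrier H. ent s h \<in> fs.span (ent s ` B)}"
    by (rule Hm.kspan_least) (use B(2) fs.span_base in blast)
  then have W: "ent s ` Hm.kspan B \<subseteq> fs.span (ent s ` B)" by blast
  have st: "T \<in> ent s ` Hm.kspan B ==> adH T \<in> ent s ` Hm.kspan B"
    "T \<in> ent s ` Hm.kspan B ==> adF T \<in> ent s ` Hm.kspan B"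
    "T \<in> ent s ` Hm.kspan B ==> adE t T \<in> ent s ` Hm.kspan B" for T
    by (elim imageE, simp only: ent_ad[OF subsetD[OF kc], symmetric], rule imageI, rule B(4), assumption)+
  have m1: "ent s ` B \<subseteq> ent s ` Hm.kspan B" by (rule image_mono[OF Hm.kspan_superset])
  have m2: "ent s f \<in> ent s ` Hm.kspan B" by (rule imageI[OF B(3)])
  obtain R where R: "realized t R" "\<And>j k. coeff (R (monom 1 k)) j = ent s f (j, k)"
    by (rule realized_matrix[OF t finite_imageI[OF B(1)] m1 W _ _ _ m2])
      (erule st(1), erule st(2), erule st(3), erule that, assumption)
  have fH: "f \<in> carrier H" by (rule F_closed[OF f])
  have mon: "R (monom c k) = op s f (monom c k)" for c k
  proof -
    have "R (monom 1 k) = op s f (monom 1 k)" by (rule poly_eqI) (simp add: R(2) ent_def)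
    then show ?thesis
      using realized_linear(2)[OF R(1), of c "monom 1 k"] op_monom[OF fH, of s c k] by (simp add: smult_monom)
  qed
  \<comment> \<open>Equality of matrix entries settles monomials; linearity of both operators does
    the rest.\<close>
  have "R p = op s f p" for p
  proof -
    have o0: "op s f 0 = 0" using op_linear(2)[OF fH, of s 0 0] by simp
    have "R (\<Sum>i\<in>I. monom (coeff p i) i) = op s f (\<Sum>i\<in>I. monom (coeff p i) i)" if "finite I" for I
      using that by (induction I rule: finite_induct) (simp_all add: realized_linear[OF R(1)] op_linear[OF fH] mon o0)
    from this[of "{..degree p}"] show ?thesis by (simp add: poly_as_sum_of_monoms)
  qed
  note op = this
  obtain u where u: "u \<in> Ug" "\<And>p. u \<odot>\<^bsub>gverma t\<^esub> p = R p" using R(1) unfolding realized_def by blast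
  show ?thesis by (rule bexI[OF _ u(1)]) (simp add: u(2) op)
qed

text \<open>\<open>F_realized\<close> is applied to each slot of a locally finite map and yields the
  coefficients a and b; injectivity of \<open>\<theta>\<close> carries the equality from polynomials
  back to \<open>L0\<close>.\<close>

lemma F_eq: "F = {ff a b | a b. a \<in> Ug \<and> b \<in> Ug}"
proof (intro equalityI subsetI)
  fix f assume f: "f \<in> F"
  note fH = F_closed[OF f]
  obtain a where a: "a \<in> Ug" "\<And>p. op True f p = a \<odot>\<^bsub>gverma t\<^esub> p" using F_realized[OF f] by blast
  obtain b where b: "b \<in> Ug" "\<And>p. op False f p = b \<odot>\<^bsub>gverma t\<^esub> p" using F_realized[OF f] by blast
  have "f = ff a b"
  proof (rule H_eqI[OF fH ff_closed[OF a(1) b(1)]])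
    fix x assume x: "x \<in> carrier L0"
    obtain y z where yz: "y \<in> carrier L0" "z \<in> carrier L0" "f x = \<Phi>0 y z" using Phi_ex[OF HD(1)[OF fH x]] by blast
    have "\<theta> y = \<theta> (a \<odot>\<^bsub>L0\<^esub> x)" using a(2)[of "\<theta> x"] x yz by (simp add: op_def \<psi> pr_def Pinv_Phi \<theta>D(4) a(1))
    then have y: "y = a \<odot>\<^bsub>L0\<^esub> x" by (rule \<theta>D(5)[OF yz(1) L.lsmult_closed[OF a(1) x]])
    have "\<theta> z = \<theta> (b \<odot>\<^bsub>L0\<^esub> x)" using b(2)[of "\<theta> x"] x yz by (simp add: op_def \<psi> pr_def Pinv_Phi \<theta>D(4) b(1))
    then have z: "z = b \<odot>\<^bsub>L0\<^esub> x" by (rule \<theta>D(5)[OF yz(2) L.lsmult_closed[OF b(1) x]])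
    show "f x = ff a b x" unfolding yz(3) ff_eval[OF x] y z ..
  qed
  then show "f \<in> {ff a b | a b. a \<in> Ug \<and> b \<in> Ug}" using a(1) b(1) by blast
next
  fix f assume "f \<in> {ff a b | a b. a \<in> Ug \<and> b \<in> Ug}"
  then obtain a b where ab: "a \<in> Ug" "b \<in> Ug" "f = ff a b" by (elim CollectE exE conjE) (rule that)
  show "f \<in> F" unfolding ab(3) by (rule ff_F[OF ab(1,2)])
qed

end

lemma purely_even_simps:
  "carrier (purely_even M) = carrier M" "(zr (purely_even M)) = (zr M)" "x \<oplus>\<^bsub>purely_even M\<^esub> y = x \<oplus>\<^bsub>M\<^esub> y"
  "r \<odot>\<^bsub>purely_even M\<^esub> x = r \<odot>\<^bsub>M\<^esub> x" "gr (purely_even M) i = (if i = 0 then carrier M else {(zr M)})"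
  by (simp_all add: purely_even_def)

lemma left_module_purely_even: "left_module R M ==> left_module R (purely_even M)"
  by (rule left_module_image[where f = "\<lambda>x. x"]) (simp_all add: purely_even_simps)

lemma direct_sum_simps:
  "carrier (direct_sum M N) = carrier M \<times> carrier N" "(zr (direct_sum M N)) = ((zr M), (zr N))"
  "z \<oplus>\<^bsub>direct_sum M N\<^esub> w = (fst z \<oplus>\<^bsub>M\<^esub> fst w, snd z \<oplus>\<^bsub>N\<^esub> snd w)"
  "r \<odot>\<^bsub>direct_sum M N\<^esub> z = (r \<odot>\<^bsub>M\<^esub> fst z, r \<odot>\<^bsub>N\<^esub> snd z)"
  by (simp_all add: direct_sum_def)

lemma abelian_group_direct_sum:
  assumes "abelian_group M" "abelian_group N"
  shows "abelian_group (direct_sum M N)"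
proof -
  interpret M: abelian_group M by fact
  interpret N: abelian_group N by fact
  show ?thesis
  proof (rule abelian_groupI)
    fix z assume "z \<in> carrier (direct_sum M N)"
    then show "\<exists>w\<in>carrier (direct_sum M N). w \<oplus>\<^bsub>direct_sum M N\<^esub> z = (zr (direct_sum M N))"
      by (intro bexI[where x = "(\<ominus>\<^bsub>M\<^esub> fst z, \<ominus>\<^bsub>N\<^esub> snd z)"]) (auto simp: direct_sum_simps M.l_neg N.l_neg)
  qed (auto simp: direct_sum_simps M.a_ac N.a_ac)
qed

context verma_doubling
begin

lemma LB_simps:
  "carrier LB = F" "(zr LB) = (zr H)" "f \<oplus>\<^bsub>LB\<^esub> h = f \<oplus>\<^bsub>H\<^esub> h" "u \<odot>\<^bsub>LB\<^esub> f = u \<odot>\<^bsub>H\<^esub> f"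
  "rsmult LB f r = rsmult H f r" "gr LB i = gr H i \<inter> F"
  by (simp_all add: locally_finite_bimodule_def Let_def)

lemma gr_LB: "f \<in> gr LB i \<longleftrightarrow> f \<in> F \<and> (\<forall>x\<in>carrier L0. f x \<in> gr Q0 i)"
proof -
  have "gr H i = {f \<in> carrier H. f ` carrier L0 \<subseteq> gr Q0 i}" by (simp add: hom_bimodule_def Let_def)
  then show ?thesis unfolding LB_simps using F_closed[of f] by (simp add: image_subset_iff conj_commute) (rule iffI; simp)
qed

lemma F_ex: "f \<in> F ==> \<exists>a\<in>Ug. \<exists>b\<in>Ug. f = ff a b"
  unfolding F_eq mem_Collect_eq by (elim exE conjE) (intro bexI)

text \<open>For odd elements this is not visible from the adjoint action of gl(2). It follows from
  the explicit form of the locally finite maps, on whose coefficients the matrix \<open>dmat\<close>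
  acts from the left.\<close>

lemma F_smult: "u \<in> Uq ==> f \<in> F ==> u \<odot>\<^bsub>H\<^esub> f \<in> F"
proof -
  assume u: "u \<in> Uq" and "f \<in> F"
  then obtain a b where ab: "a \<in> Ug" "b \<in> Ug" "f = ff a b" using F_ex by blast
  obtain p q r s where m: "dmat u p q r s" using dmat_ex[OF u] by blast
  show ?thesis
    unfolding ab(3) ff_smult[OF u m ab(1,2)]
    by (intro ff_F L.R.a_closed L.R.m_closed dmat_closed[OF m] ab)
qed

lemma F_submodule: "submodule F Aq H"
proof (intro submodule.intro submodule_axioms.intro Hm.M.add_subgroupI F_smult)
  show "F \<subseteq> carrier H" by (rule subsetI, rule F_closed)
  have "ucst q_alg 0 \<odot>\<^bsub>H\<^esub> i0 \<in> F" by (rule F_smult[OF N.ucst_closed i_F(1)])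
  then show "(zr H) \<in> F" by (simp add: Hm.cs_zero[OF i_closed(1)])
  show "\<ominus>\<^bsub>H\<^esub> f \<in> F" if "f \<in> F" for f
    using F_smult[OF N.ucst_closed that, of "- 1"] by (simp add: Hm.cs_uminus Hm.cs_one F_closed[OF that])
qed (rule F_add)

lemma left_module_LB: "left_module Aq LB"
  by (rule left_module_restrict[OF left_module_H F_submodule]) (simp_all add: LB_simps)

lemma F_rsmult: "f \<in> F ==> r \<in> Ug ==> rsmult H f r \<in> F"
proof -
  assume r: "r \<in> Ug" and "f \<in> F"
  then obtain a b where ab: "a \<in> Ug" "b \<in> Ug" "f = ff a b" using F_ex by blast
  show ?thesis unfolding ab(3) ff_rsmult[OF ab(1,2) r] by (intro ff_F L.R.m_closed ab r)
qed

lemma tens_LB: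
  assumes "left_module Ag V"
  shows "tens Aq LB (purely_even V) Ag"
proof -
  interpret V: left_module "Ag" "purely_even V" by (rule left_module_purely_even[OF assms])
  show ?thesis
  proof (intro tens.intro left_module_LB V.M.abelian_group_axioms tens_axioms.intro)
    fix u :: "'k uea" and f and r :: "'k uea"
    assume u: "u \<in> Uq" and f: "f \<in> carrier LB" and r: "r \<in> Ug"
    have f: "f \<in> carrier H" using f F_closed by (simp add: LB_simps)
    show "u \<odot>\<^bsub>LB\<^esub> rsmult LB f r = rsmult LB (u \<odot>\<^bsub>LB\<^esub> f) r"
      unfolding LB_simps
      by (intro H_eqI H_smult_closed H_rsmult_closed u r f) (simp add: H_eval r)
  qed (simp_all add: LB_simps F_rsmult)
qed

lemma gr_LB_sub: "subgroup (gr LB i) (add_monoid LB)"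
proof -
  interpret LB: umod q_alg LB by (rule left_module_umod[OF graded_lie_q left_module_LB])
  have F: "f \<in> F" if "f \<in> gr LB i" for f using that by (simp add: gr_LB)
  show ?thesis
  proof (rule LB.M.add_subgroupI)
    show "gr LB i \<subseteq> carrier LB" by (rule subsetI) (simp add: LB_simps)
    show "(zr LB) \<in> gr LB i"
      unfolding gr_LB using LB.M.zero_closed by (simp add: LB_simps(1,2) H_eval N.grD)
    fix f assume f: "f \<in> gr LB i"
    have fc: "f \<in> carrier LB" using F[OF f] by (simp add: LB_simps)
    have "ucst q_alg (- 1) \<odot>\<^bsub>LB\<^esub> f \<in> gr LB i"
      using f F_smult[OF N.ucst_closed F[OF f], of "- 1"] unfolding gr_LB by (simp add: LB_simps(4) H_eval N.gr_cs)
    then show "\<ominus>\<^bsub>LB\<^esub> f \<in> gr LB i" by (simp add: LB.cs_uminus LB.cs_one fc)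
    fix h assume h: "h \<in> gr LB i"
    show "f \<oplus>\<^bsub>LB\<^esub> h \<in> gr LB i"
      using f h F_add[OF F[OF f] F[OF h]] unfolding gr_LB by (simp add: LB_simps(3) H_eval N.grD)
  qed
qed

end

section \<open>Tensoring with the bimodule of locally finite maps\<close>

locale verma_tensor = verma_doubling L0 Q0 \<pi>0 \<Phi>0 \<theta> t + V: umod g_alg V
  for L0 :: "('k::field_char_0 uea, 'l, 'p) module_scheme" and Q0 :: "('k uea, 'n, 'q) supermodule_scheme"
    and \<pi>0 \<Phi>0 \<theta> t and V :: "('k uea, 'v, 'r) module_scheme" +
  assumes ann: "annihilator Ag V = annihilator Ag L0"
begin

sublocale X: tens "Aq" LB "purely_even V" "Ag"
  by (rule tens_LB[OF umod_left_module[OF V.umod_axioms]])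

text \<open>The difference a - a' annihilates \<open>L0\<close>, hence \<open>V\<close>. So the
  coefficients of a locally finite map, determined only modulo the annihilator of \<open>L0\<close>,
  act on \<open>V\<close> without ambiguity.\<close>

lemma ann_eq:
  assumes a: "a \<in> Ug" "a' \<in> Ug"
    and e: "\<And>x. x \<in> carrier L0 ==> a \<odot>\<^bsub>L0\<^esub> x = a' \<odot>\<^bsub>L0\<^esub> x" and y: "y \<in> carrier V"
  shows "a \<odot>\<^bsub>V\<^esub> y = a' \<odot>\<^bsub>V\<^esub> y"
proof -
  define d where "d = a \<oplus>\<^bsub>Ag\<^esub> (ucst g_alg (- 1) \<otimes>\<^bsub>Ag\<^esub> a')"
  have d: "d \<in> Ug" unfolding d_def by (intro L.R.a_closed L.R.m_closed a L.ucst_closed)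
  have "d \<odot>\<^bsub>L0\<^esub> x = (zr L0)" if "x \<in> carrier L0" for x
    using that a by (simp add: d_def L.lsmult_l_distr L.lsmult_assoc L.cs_uminus L.cs_one e L.M.r_neg)
  then have "d \<in> annihilator Ag L0" using d by (simp add: annihilator_def)
  then have "d \<odot>\<^bsub>V\<^esub> y = (zr V)" using y unfolding ann[symmetric] by (simp add: annihilator_def)
  then have "a \<odot>\<^bsub>V\<^esub> y \<ominus>\<^bsub>V\<^esub> a' \<odot>\<^bsub>V\<^esub> y = (zr V)"
    using y a by (simp add: d_def V.lsmult_l_distr V.lsmult_assoc V.cs_uminus V.cs_one a_minus_def)
  then show ?thesis by (rule V.M.diff_eq_zeroD[OF V.lsmult_closed[OF a(1) y] V.lsmult_closed[OF a(2) y]])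
qed

lemma ff_eq:
  assumes "a \<in> Ug" "b \<in> Ug" "a' \<in> Ug" "b' \<in> Ug"
    and e: "ff a b = ff a' b'" and y: "y \<in> carrier V"
  shows "a \<odot>\<^bsub>V\<^esub> y = a' \<odot>\<^bsub>V\<^esub> y" "b \<odot>\<^bsub>V\<^esub> y = b' \<odot>\<^bsub>V\<^esub> y"
proof -
  have *: "a \<odot>\<^bsub>L0\<^esub> x = a' \<odot>\<^bsub>L0\<^esub> x \<and> b \<odot>\<^bsub>L0\<^esub> x = b' \<odot>\<^bsub>L0\<^esub> x" if x: "x \<in> carrier L0" for x
  proof (rule Phi_inj)
    show "\<Phi>0 (a \<odot>\<^bsub>L0\<^esub> x) (b \<odot>\<^bsub>L0\<^esub> x) = \<Phi>0 (a' \<odot>\<^bsub>L0\<^esub> x) (b' \<odot>\<^bsub>L0\<^esub> x)"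
      using e ff_eval[OF x] by metis
  qed (use assms x in simp_all)
  show "a \<odot>\<^bsub>V\<^esub> y = a' \<odot>\<^bsub>V\<^esub> y" by (rule ann_eq[OF assms(1,3) conjunct1[OF *] y])
  show "b \<odot>\<^bsub>V\<^esub> y = b' \<odot>\<^bsub>V\<^esub> y" by (rule ann_eq[OF assms(2,4) conjunct2[OF *] y])
qed

definition \<Phi>t where "\<Phi>t x y = X.tn i0 x \<oplus>\<^bsub>X.T\<^esub> X.tn i1 y"

lemma i_LB: "i0 \<in> carrier LB" "i1 \<in> carrier LB"
  using i_F by (simp_all add: LB_simps)

lemma tn_closed': "m \<in> F ==> y \<in> carrier V ==> X.tn m y \<in> carrier X.T"
  by (rule X.tn_closed) (simp_all add: LB_simps purely_even_simps)

lemma Phit_closed: "x \<in> carrier V ==> y \<in> carrier V ==> \<Phi>t x y \<in> carrier X.T"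
  unfolding \<Phi>t_def by (intro X.TT.a_closed tn_closed' i_F)

lemma Phit_add:
  assumes "x \<in> carrier V" "x' \<in> carrier V" "y \<in> carrier V" "y' \<in> carrier V"
  shows "\<Phi>t (x \<oplus>\<^bsub>V\<^esub> x') (y \<oplus>\<^bsub>V\<^esub> y') = \<Phi>t x y \<oplus>\<^bsub>X.T\<^esub> \<Phi>t x' y'"
proof -
  note r = X.tn_addr[unfolded purely_even_simps]
  note c = tn_closed'[OF i_F(1) assms(1)] tn_closed'[OF i_F(1) assms(2)]
    tn_closed'[OF i_F(2) assms(3)] tn_closed'[OF i_F(2) assms(4)]
  show ?thesis
    unfolding \<Phi>t_def r[OF i_LB(1) assms(1,2)] r[OF i_LB(2) assms(3,4)]
    using c by (simp add: X.TT.a_ac)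
qed

lemma ff_split:
  assumes "a \<in> Ug" "b \<in> Ug"
  shows "ff a b = rsmult LB i0 a \<oplus>\<^bsub>LB\<^esub> rsmult LB i1 b"
  using assms by (simp add: LB_simps ff_rsmult ff_add)

text \<open>The same map is also a right combination i0 a + i1 b, and the balanced tensor product
  moves a and b over to the vector y.\<close>

lemma tn_ff:
  assumes a: "a \<in> Ug" "b \<in> Ug" and y: "y \<in> carrier V"
  shows "X.tn (ff a b) y = \<Phi>t (a \<odot>\<^bsub>V\<^esub> y) (b \<odot>\<^bsub>V\<^esub> y)"
proof -
  note bal = X.tn_bal[unfolded purely_even_simps]
  have "X.tn (ff a b) y = X.tn (rsmult LB i0 a) y \<oplus>\<^bsub>X.T\<^esub> X.tn (rsmult LB i1 b) y"
    unfolding ff_split[OF a] using y a i_LB by (intro X.tn_addl X.rs_closed) (simp_all add: purely_even_simps)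
  then show ?thesis unfolding \<Phi>t_def bal[OF i_LB(1) a(1) y] bal[OF i_LB(2) a(2) y] .
qed

lemma LB_ex: "m \<in> carrier LB ==> \<exists>a\<in>Ug. \<exists>b\<in>Ug. m = ff a b"
  unfolding LB_simps by (rule F_ex)

lemma Phit_ex: "z \<in> carrier X.T ==> \<exists>x\<in>carrier V. \<exists>y\<in>carrier V. z = \<Phi>t x y"
proof (induction z rule: X.T_induct)
  case (tn m y)
  then have y: "y \<in> carrier V" by (simp add: purely_even_simps)
  obtain a b where ab: "a \<in> Ug" "b \<in> Ug" "m = ff a b" using LB_ex[OF tn(1)] by blast
  show ?case unfolding ab(3) tn_ff[OF ab(1,2) y]
    by (rule bexI[OF bexI[OF refl V.lsmult_closed[OF ab(2) y]] V.lsmult_closed[OF ab(1) y]])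
next
  case (add z w)
  then obtain x y x' y' where "x \<in> carrier V" "y \<in> carrier V" "z = \<Phi>t x y" "x' \<in> carrier V" "y' \<in> carrier V" "w = \<Phi>t x' y'"
    by blast
  then show ?case using Phit_add[of x x' y y'] V.M.a_closed by metis
qed

text \<open>Injectivity of \<open>\<Phi>t\<close> cannot be seen on generators of the tensor
  product. Instead the universal property provides a map back, sending \<open>ff a b\<close> tensor
  y to (a y, b y).\<close>

lemma Phit_inverse: "\<exists>h. \<forall>x\<in>carrier V. \<forall>y\<in>carrier V. h (\<Phi>t x y) = (x, y)"
proof -
  \<comment> \<open>Coefficients are chosen arbitrarily for every locally finite map; by
    \<open>ff_eq\<close> the values of \<open>f\<close> do not depend on the choice.\<close>
  define c where "c m = (SOME p. fst p \<in> Ug \<and> snd p \<in> Ug \<and> m = ff (fst p) (snd p))" for m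
  define f where "f m y = (fst (c m) \<odot>\<^bsub>V\<^esub> y, snd (c m) \<odot>\<^bsub>V\<^esub> y)" for m y
  have f: "f (ff a b) y = (a \<odot>\<^bsub>V\<^esub> y, b \<odot>\<^bsub>V\<^esub> y)"
    if ab: "a \<in> Ug" "b \<in> Ug" and y: "y \<in> carrier V" for a b y
  proof -
    have c: "fst (c (ff a b)) \<in> Ug \<and> snd (c (ff a b)) \<in> Ug \<and>
        ff a b = ff (fst (c (ff a b))) (snd (c (ff a b)))"
      unfolding c_def by (rule someI[of _ "(a, b)"]) (simp add: ab)
    note c = conjunct1[OF c] conjunct1[OF conjunct2[OF c]] conjunct2[OF conjunct2[OF c]]
    show ?thesis unfolding f_def using ff_eq[OF ab c y] by simp
  qed
  note pe = purely_even_simps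
  obtain h where h: "\<And>z w. [|z \<in> carrier X.T; w \<in> carrier X.T|] ==> h (z \<oplus>\<^bsub>X.T\<^esub> w) = h z \<oplus>\<^bsub>direct_sum V V\<^esub> h w"
    "\<And>m y. [|m \<in> carrier LB; y \<in> carrier V|] ==> h (X.tn m y) = f m y"
  proof (rule X.T_universal[of "direct_sum V V" f])
    show "abelian_group (direct_sum V V)" by (intro abelian_group_direct_sum V.M.abelian_group_axioms)
  next
    fix m y assume m: "m \<in> carrier LB" and "y \<in> carrier (purely_even V)"
    then have y: "y \<in> carrier V" by (simp add: pe)
    obtain a b where ab: "a \<in> Ug" "b \<in> Ug" "m = ff a b" using LB_ex[OF m] by blast
    show "f m y \<in> carrier (direct_sum V V)"
      unfolding ab(3) f[OF ab(1,2) y] direct_sum_simps using ab y by simp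
    { fix y' assume "y' \<in> carrier (purely_even V)"
      then have y': "y' \<in> carrier V" by (simp add: pe)
      show "f m (y \<oplus>\<^bsub>purely_even V\<^esub> y') = f m y \<oplus>\<^bsub>direct_sum V V\<^esub> f m y'"
        unfolding ab(3) pe f[OF ab(1,2) y] f[OF ab(1,2) y'] f[OF ab(1,2) V.M.a_closed[OF y y']] direct_sum_simps
        using ab y y' by (simp add: V.lsmult_r_distr) }
    { fix r :: "'k uea" assume r: "r \<in> Ug"
      show "f (rsmult LB m r) y = f m (r \<odot>\<^bsub>purely_even V\<^esub> y)"
        unfolding ab(3) pe LB_simps ff_rsmult[OF ab(1,2) r] f[OF ab(1,2) V.lsmult_closed[OF r y]]
          f[OF L.R.m_closed[OF ab(1) r] L.R.m_closed[OF ab(2) r] y]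
        using ab r y by (simp add: V.lsmult_assoc) }
    { fix m' assume m': "m' \<in> carrier LB"
      obtain a' b' where ab': "a' \<in> Ug" "b' \<in> Ug" "m' = ff a' b'" using LB_ex[OF m'] by blast
      show "f (m \<oplus>\<^bsub>LB\<^esub> m') y = f m y \<oplus>\<^bsub>direct_sum V V\<^esub> f m' y"
        unfolding ab(3) ab'(3) LB_simps ff_add[OF ab(1,2) ab'(1,2)] f[OF ab(1,2) y] f[OF ab'(1,2) y]
          f[OF L.R.a_closed[OF ab(1) ab'(1)] L.R.a_closed[OF ab(2) ab'(2)] y] direct_sum_simps
        using ab ab' y by (simp add: V.lsmult_l_distr) }
  next
    fix h
    assume "\<And>z w. [|z \<in> carrier X.T; w \<in> carrier X.T|] ==> h (z \<oplus>\<^bsub>X.T\<^esub> w) = h z \<oplus>\<^bsub>direct_sum V V\<^esub> h w"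
      "\<And>m y. [|m \<in> carrier LB; y \<in> carrier (purely_even V)|] ==> h (X.tn m y) = f m y"
    then show thesis unfolding pe by (rule that)
  qed
  have "h (\<Phi>t x y) = (x, y)" if xy: "x \<in> carrier V" "y \<in> carrier V" for x y
    unfolding \<Phi>t_def h(1)[OF tn_closed'[OF i_F(1) xy(1)] tn_closed'[OF i_F(2) xy(2)]] h(2)[OF i_LB(1) xy(1)] h(2)[OF i_LB(2) xy(2)]
      f[OF L.R.one_closed L.R.zero_closed xy(1)] f[OF L.R.zero_closed L.R.one_closed xy(2)]
    using xy by (simp add: direct_sum_simps)
  then show ?thesis by blast
qed

lemma Phit_bij: "bij_betw (\<lambda>(x, y). \<Phi>t x y) (carrier V \<times> carrier V) (carrier X.T)"
proof -
  obtain h where h: "\<And>x y. x \<in> carrier V ==> y \<in> carrier V ==> h (\<Phi>t x y) = (x, y)" using Phit_inverse by blast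
  show ?thesis
    unfolding bij_betw_def
  proof
    show "inj_on (\<lambda>(x, y). \<Phi>t x y) (carrier V \<times> carrier V)"
      by (rule inj_on_inverseI[of _ h]) (auto simp: h)
    show "(\<lambda>(x, y). \<Phi>t x y) ` (carrier V \<times> carrier V) = carrier X.T"
      using Phit_closed Phit_ex by fastforce
  qed
qed

text \<open>Applied to the two inclusions, u yields the two columns of its matrix:
  \<open>ff p r\<close> and \<open>ff q s\<close>.\<close>

lemma Phit_act:
  assumes u: "u \<in> Uq" and m: "dmat u p q r s" and xy: "x \<in> carrier V" "y \<in> carrier V"
  shows "u \<odot>\<^bsub>X.T\<^esub> \<Phi>t x y = \<Phi>t (p \<odot>\<^bsub>V\<^esub> x \<oplus>\<^bsub>V\<^esub> q \<odot>\<^bsub>V\<^esub> y) (r \<odot>\<^bsub>V\<^esub> x \<oplus>\<^bsub>V\<^esub> s \<odot>\<^bsub>V\<^esub> y)"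
proof -
  note c = dmat_closed[OF m]
  have i: "u \<odot>\<^bsub>LB\<^esub> i0 = ff p r" "u \<odot>\<^bsub>LB\<^esub> i1 = ff q s"
    using c by (simp_all add: LB_simps ff_smult[OF u m])
  have "u \<odot>\<^bsub>X.T\<^esub> \<Phi>t x y = X.tn (u \<odot>\<^bsub>LB\<^esub> i0) x \<oplus>\<^bsub>X.T\<^esub> X.tn (u \<odot>\<^bsub>LB\<^esub> i1) y"
    unfolding \<Phi>t_def X.T_smult(2)[OF u tn_closed'[OF i_F(1) xy(1)] tn_closed'[OF i_F(2) xy(2)]]
    using xy u i_LB by (simp add: X.tn_smult purely_even_simps)
  also have "\<dots> = \<Phi>t (p \<odot>\<^bsub>V\<^esub> x) (r \<odot>\<^bsub>V\<^esub> x) \<oplus>\<^bsub>X.T\<^esub> \<Phi>t (q \<odot>\<^bsub>V\<^esub> y) (s \<odot>\<^bsub>V\<^esub> y)"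
    unfolding i using c xy by (simp add: tn_ff)
  finally show ?thesis using c xy by (simp add: Phit_add)
qed

lemma Phit_zero: "\<Phi>t (zr V) (zr V) = (zr (X.T))"
  unfolding \<Phi>t_def using X.tn_zero_right[OF i_LB(1)] X.tn_zero_right[OF i_LB(2)] by (simp add: purely_even_simps)

lemma Phit_slots: "x \<in> carrier V ==> \<Phi>t x (zr V) = X.tn i0 x" "x \<in> carrier V ==> \<Phi>t (zr V) x = X.tn i1 x"
  unfolding \<Phi>t_def using X.tn_zero_right[OF i_LB(1)] X.tn_zero_right[OF i_LB(2)] tn_closed' i_F
  by (simp_all add: purely_even_simps)

text \<open>In a homogeneous map one of the two coefficients annihilates \<open>L0\<close>, by
  injectivity of \<open>\<Phi>0\<close>, and therefore annihilates \<open>V\<close>.\<close>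

lemma gr_slots:
  assumes ab: "a \<in> Ug" "b \<in> Ug" and y: "y \<in> carrier V"
  shows "ff a b \<in> gr LB \<pi>0 ==> b \<odot>\<^bsub>V\<^esub> y = (zr V)" "ff a b \<in> gr LB (\<pi>0 + 1) ==> a \<odot>\<^bsub>V\<^esub> y = (zr V)"
proof -
  have z: "r \<odot>\<^bsub>V\<^esub> y = (zr V)" if r: "r \<in> Ug" "\<And>x. x \<in> carrier L0 ==> r \<odot>\<^bsub>L0\<^esub> x = (zr L0)" for r
    using ann_eq[OF r(1) L.R.zero_closed _ y] r(2) y by simp
  show "b \<odot>\<^bsub>V\<^esub> y = (zr V)" if "ff a b \<in> gr LB \<pi>0"
  proof (rule z[OF ab(2)])
    fix x assume x: "x \<in> carrier L0"
    then have "\<Phi>0 (a \<odot>\<^bsub>L0\<^esub> x) (b \<odot>\<^bsub>L0\<^esub> x) \<in> gr Q0 \<pi>0" using that by (simp add: gr_LB ff_eval)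
    then obtain x' where "x' \<in> carrier L0" "\<Phi>0 (a \<odot>\<^bsub>L0\<^esub> x) (b \<odot>\<^bsub>L0\<^esub> x) = \<Phi>0 x' (zr L0)" unfolding gr0 by blast
    then show "b \<odot>\<^bsub>L0\<^esub> x = (zr L0)" using Phi_inj[of "a \<odot>\<^bsub>L0\<^esub> x" "b \<odot>\<^bsub>L0\<^esub> x" x' "(zr L0)"] x ab by simp
  qed
  show "a \<odot>\<^bsub>V\<^esub> y = (zr V)" if "ff a b \<in> gr LB (\<pi>0 + 1)"
  proof (rule z[OF ab(1)])
    fix x assume x: "x \<in> carrier L0"
    then have "\<Phi>0 (a \<odot>\<^bsub>L0\<^esub> x) (b \<odot>\<^bsub>L0\<^esub> x) \<in> gr Q0 (\<pi>0 + 1)" using that by (simp add: gr_LB ff_eval)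
    then obtain x' where "x' \<in> carrier L0" "\<Phi>0 (a \<odot>\<^bsub>L0\<^esub> x) (b \<odot>\<^bsub>L0\<^esub> x) = \<Phi>0 (zr L0) x'" unfolding gr1 by blast
    then show "a \<odot>\<^bsub>L0\<^esub> x = (zr L0)" using Phi_inj[of "a \<odot>\<^bsub>L0\<^esub> x" "b \<odot>\<^bsub>L0\<^esub> x" "(zr L0)" x'] x ab by simp
  qed
qed

text \<open>As \<open>V\<close> is placed in even degree, the parity of a tensor is that of its left
  factor. A left factor of the opposite parity can only be paired with the zero vector.\<close>

lemma gr_T: "gr X.T \<pi>0 = (\<lambda>x. \<Phi>t x (zr V)) ` carrier V" "gr X.T (\<pi>0 + 1) = (\<lambda>y. \<Phi>t (zr V) y) ` carrier V"
proof -
  have i0: "i0 \<in> gr LB \<pi>0" unfolding gr_LB using i_F gr0 by (simp add: i_eval)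
  have i1: "i1 \<in> gr LB (\<pi>0 + 1)" unfolding gr_LB using i_F gr1 by (simp add: i_eval)
  have b: "k + k = 0" "k + (k + 1) = 1" "k + 1 + k = 1" for k :: bit using bit_cases[of k] by auto
  note pe = purely_even_simps
  have sub: "gr (purely_even V) i \<subseteq> carrier (purely_even V)" for i by (simp add: pe)
  have a: "\<exists>x\<in>carrier V. a \<oplus>\<^bsub>X.T\<^esub> b = \<Phi>t x (zr V)" if "\<exists>x\<in>carrier V. a = \<Phi>t x (zr V)" "\<exists>x\<in>carrier V. b = \<Phi>t x (zr V)" for a b
  proof -
    obtain x x' where "x \<in> carrier V" "a = \<Phi>t x (zr V)" "x' \<in> carrier V" "b = \<Phi>t x' (zr V)" using \<open>\<exists>x\<in>carrier V. a = _ x\<close> \<open>\<exists>x\<in>carrier V. b = _ x\<close> by blast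
    then show ?thesis by (intro bexI[where x = "x \<oplus>\<^bsub>V\<^esub> x'"]) (simp_all flip: Phit_add)
  qed
  have a': "\<exists>x\<in>carrier V. a \<oplus>\<^bsub>X.T\<^esub> b = \<Phi>t (zr V) x" if "\<exists>x\<in>carrier V. a = \<Phi>t (zr V) x" "\<exists>x\<in>carrier V. b = \<Phi>t (zr V) x" for a b
  proof -
    obtain x x' where "x \<in> carrier V" "a = \<Phi>t (zr V) x" "x' \<in> carrier V" "b = \<Phi>t (zr V) x'" using \<open>\<exists>x\<in>carrier V. a = _ x\<close> \<open>\<exists>x\<in>carrier V. b = _ x\<close> by blast
    then show ?thesis by (intro bexI[where x = "x \<oplus>\<^bsub>V\<^esub> x'"]) (simp_all flip: Phit_add)
  qed
  have z0: "X.tn m (zr V) = \<Phi>t (zr V) (zr V)" if "m \<in> gr LB i" for m i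
    using X.tn_zero_right[of m] that by (simp add: Phit_zero gr_LB LB_simps(1) pe)
  have ex: "\<exists>a\<in>Ug. \<exists>b\<in>Ug. m = ff a b" if "m \<in> gr LB i" for m i
    using that by (intro F_ex) (simp add: gr_LB)
  show "gr X.T \<pi>0 = (\<lambda>x. \<Phi>t x (zr V)) ` carrier V"
  proof (intro equalityI subsetI)
    fix z assume "z \<in> gr X.T \<pi>0"
    then have "\<exists>x\<in>carrier V. z = \<Phi>t x (zr V)"
    proof (induction z rule: X.T_gr_induct[OF _ gr_LB_sub sub, consumes 1, case_names zero tn add])
      case zero
      then show ?case using Phit_zero[symmetric] by (rule bexI) simp
    next
      case (tn i m y)
      obtain a b where ab: "a \<in> Ug" "b \<in> Ug" "m = ff a b" using ex[OF tn(1)] by blast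
      have "i = \<pi>0 \<or> i = \<pi>0 + 1" using bit_cases[of i] bit_cases[of \<pi>0] by auto
      then show ?case
      proof
        assume i: "i = \<pi>0"
        then have y: "y \<in> carrier V" using tn(2) by (simp add: pe b)
        have "b \<odot>\<^bsub>V\<^esub> y = (zr V)" using tn(1) unfolding i ab(3) by (rule gr_slots(1)[OF ab(1,2) y])
        then show ?thesis unfolding ab(3) tn_ff[OF ab(1,2) y] by (intro bexI[OF _ V.lsmult_closed[OF ab(1) y]]) simp
      next
        assume i: "i = \<pi>0 + 1"
        then have "y = (zr V)" using tn(2) by (simp add: pe b)
        then show ?thesis using z0[OF tn(1)] by (intro bexI[OF _ V.M.zero_closed]) simp
      qed
    next
      case (add z w)
      from a[OF add(3,4)] show ?case .
    qed
    then show "z \<in> (\<lambda>x. \<Phi>t x (zr V)) ` carrier V" by blast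
  next
    fix z assume "z \<in> (\<lambda>x. \<Phi>t x (zr V)) ` carrier V"
    then obtain x where x: "x \<in> carrier V" "z = \<Phi>t x (zr V)" by blast
    show "z \<in> gr X.T \<pi>0"
      unfolding x(2) Phit_slots(1)[OF x(1)] by (rule X.tn_gr[OF i0]) (simp add: pe b x)
  qed
  show "gr X.T (\<pi>0 + 1) = (\<lambda>x. \<Phi>t (zr V) x) ` carrier V"
  proof (intro equalityI subsetI)
    fix z assume "z \<in> gr X.T (\<pi>0 + 1)"
    then have "\<exists>x\<in>carrier V. z = \<Phi>t (zr V) x"
    proof (induction z rule: X.T_gr_induct[OF _ gr_LB_sub sub, consumes 1, case_names zero tn add])
      case zero
      then show ?case using Phit_zero[symmetric] by (rule bexI) simp
    next
      case (tn i m y)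
      obtain a b where ab: "a \<in> Ug" "b \<in> Ug" "m = ff a b" using ex[OF tn(1)] by blast
      have "i = \<pi>0 \<or> i = \<pi>0 + 1" using bit_cases[of i] bit_cases[of \<pi>0] by auto
      then show ?case
      proof
        assume i: "i = \<pi>0 + 1"
        then have y: "y \<in> carrier V" using tn(2) by (simp add: pe b)
        have "a \<odot>\<^bsub>V\<^esub> y = (zr V)" using tn(1) unfolding i ab(3) by (rule gr_slots(2)[OF ab(1,2) y])
        then show ?thesis unfolding ab(3) tn_ff[OF ab(1,2) y] by (intro bexI[OF _ V.lsmult_closed[OF ab(2) y]]) simp
      next
        assume i: "i = \<pi>0"
        then have "y = (zr V)" using tn(2) by (simp add: pe b)
        then show ?thesis using z0[OF tn(1)] by (intro bexI[OF _ V.M.zero_closed]) simp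
      qed
    next
      case (add z w)
      from a'[OF add(3,4)] show ?case .
    qed
    then show "z \<in> (\<lambda>x. \<Phi>t (zr V) x) ` carrier V" by blast
  next
    fix z assume "z \<in> (\<lambda>x. \<Phi>t (zr V) x) ` carrier V"
    then obtain x where x: "x \<in> carrier V" "z = \<Phi>t (zr V) x" by blast
    show "z \<in> gr X.T (\<pi>0 + 1)"
      unfolding x(2) Phit_slots(2)[OF x(1)] by (rule X.tn_gr[OF i1]) (simp add: pe b x)
  qed
qed

lemma tensor_doubling: "doubling V (tensor Ag LB (purely_even V)) \<pi>0 \<Phi>t"
proof (rule doublingI[OF V.umod_axioms left_module_umod[OF graded_lie_q X.left_module_T] Phit_bij])
  fix x y c A B assume xy: "x \<in> carrier V" "y \<in> carrier V"
  show "ucst q_alg c \<odot>\<^bsub>X.T\<^esub> \<Phi>t x y = \<Phi>t (ucst g_alg c \<odot>\<^bsub>V\<^esub> x) (ucst g_alg c \<odot>\<^bsub>V\<^esub> y)"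
    using xy by (simp add: Phit_act[OF N.ucst_closed dmat.const])
  have g: "ugen g_alg (blockM A 0) \<odot>\<^bsub>V\<^esub> x \<in> carrier V" if "x \<in> carrier V" for x A by (rule V.ge_closed[OF g_algI that])
  show "ugen q_alg (blockM A 0) \<odot>\<^bsub>X.T\<^esub> \<Phi>t x y = \<Phi>t (ugen g_alg (blockM A 0) \<odot>\<^bsub>V\<^esub> x) (ugen g_alg (blockM A 0) \<odot>\<^bsub>V\<^esub> y)"
    using xy g by (simp add: Phit_act[OF N.ugen_closed[OF q_algI(1)] dmat.even])
  show "ugen q_alg (blockM 0 B) \<odot>\<^bsub>X.T\<^esub> \<Phi>t x y = \<Phi>t (ucst g_alg (tr2 B) \<odot>\<^bsub>V\<^esub> y) (ugen g_alg (blockM B 0) \<odot>\<^bsub>V\<^esub> x)"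
    using xy g by (simp add: Phit_act[OF N.ugen_closed[OF q_algI(2)] dmat.odd])
qed (rule Phit_add gr_T | assumption)+

end

subsection \<open>Restriction of scalars\<close>

lemma restrict_scalars_simps:
  "carrier (restrict_scalars S T M) = carrier M" "(zr (restrict_scalars S T M)) = (zr M)"
  "x \<oplus>\<^bsub>restrict_scalars S T M\<^esub> y = x \<oplus>\<^bsub>M\<^esub> y" "u \<odot>\<^bsub>restrict_scalars S T M\<^esub> x = env_map S T u \<odot>\<^bsub>M\<^esub> x"
  by (simp_all add: restrict_scalars_def module.defs)

lemma env_map_gq:
  fixes u v :: "'k::field uea"
  assumes u: "u \<in> Ug" and v: "v \<in> Ug"
  shows "env_map g_alg q_alg u \<in> Uq"
    "env_map g_alg q_alg (u \<oplus>\<^bsub>Ag\<^esub> v) = env_map g_alg q_alg u \<oplus>\<^bsub>Aq\<^esub> env_map g_alg q_alg v"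
    "env_map g_alg q_alg (u \<otimes>\<^bsub>Ag\<^esub> v) = env_map g_alg q_alg u \<otimes>\<^bsub>Aq\<^esub> env_map g_alg q_alg v"
    "env_map g_alg q_alg (ucst g_alg c :: 'k uea) = ucst q_alg c"
    "X \<in> g_alg i ==> env_map g_alg q_alg (ugen g_alg X :: 'k uea) = ugen q_alg X"
    "env_map g_alg q_alg (\<one>\<^bsub>Ag\<^esub> :: 'k uea) = \<one>\<^bsub>Aq\<^esub>"
proof -
  interpret G: enveloping "g_alg :: bit \<Rightarrow> 'k smat set" by (rule enveloping_g)
  interpret Q: enveloping "q_alg :: bit \<Rightarrow> 'k smat set" by (rule enveloping_q)
  have sub: "g_alg i \<subseteq> (q_alg i :: 'k smat set)" for i by (rule even_part_subset[OF graded_lie_q])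
  note m = env_map_class[OF G.lie Q.lie sub]
  have free: "p \<in> carrier (env_free (q_alg :: bit \<Rightarrow> 'k smat set))" if "p \<in> carrier (env_free g_alg)" for p :: "'k smat fword \<Rightarrow>\<^sub>0 'k"
    using that sub by (fastforce simp: carrier_free_algebra)
  have ex: "\<exists>p\<in>carrier (env_free g_alg). u = env_class g_alg p" if "u \<in> Ug" for u :: "'k uea"
    using that by (auto simp: G.carrier_UEA)
  obtain p q where p: "p \<in> carrier (env_free g_alg)" "u = env_class g_alg p"
    and q: "q \<in> carrier (env_free g_alg)" "v = env_class g_alg q" using ex[OF u] ex[OF v] by blast
  show "env_map g_alg q_alg u \<in> Uq" by (simp add: p m free Q.env_class_closed)
  show "env_map g_alg q_alg (u \<oplus>\<^bsub>Ag\<^esub> v) = env_map g_alg q_alg u \<oplus>\<^bsub>Aq\<^esub> env_map g_alg q_alg v"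
    using p(1) q(1) by (simp add: p(2) q(2) m free Q.env_class_add free_algebra_closed flip: G.env_class_add)
  show "env_map g_alg q_alg (u \<otimes>\<^bsub>Ag\<^esub> v) = env_map g_alg q_alg u \<otimes>\<^bsub>Aq\<^esub> env_map g_alg q_alg v"
    using p(1) q(1) by (simp add: p(2) q(2) m free Q.env_class_mult free_algebra_closed flip: G.env_class_mult)
  have c: "env_map g_alg q_alg (ucst g_alg c :: 'k uea) = ucst q_alg c" for c
    by (rule m) (auto simp: carrier_free_algebra fconst_def)
  then show "env_map g_alg q_alg (ucst g_alg c :: 'k uea) = ucst q_alg c" .
  show "env_map g_alg q_alg (\<one>\<^bsub>Ag\<^esub> :: 'k uea) = \<one>\<^bsub>Aq\<^esub>"
    using c[of 1] by (simp add: G.ucst_one Q.ucst_one)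
  show "env_map g_alg q_alg (ugen g_alg X :: 'k uea) = ugen q_alg X" if "X \<in> g_alg i"
    by (rule m[OF fgen_env_closed[where S = g_alg and i = i, OF that]])
qed

lemma left_module_restrict_scalars:
  fixes N :: "('k::field uea, 'n, 'q) module_scheme"
  assumes "left_module Aq N"
  shows "left_module Ag (restrict_scalars g_alg q_alg N)"
proof -
  interpret N: left_module "Aq" N by fact
  interpret G: enveloping "g_alg :: bit \<Rightarrow> 'k smat set" by (rule enveloping_g)
  note r = restrict_scalars_simps
  have "abelian_group (restrict_scalars g_alg q_alg N)"
  proof (rule abelian_groupI)
    fix x assume "x \<in> carrier (restrict_scalars g_alg q_alg N)"
    then show "\<exists>y\<in>carrier (restrict_scalars g_alg q_alg N). y \<oplus>\<^bsub>restrict_scalars g_alg q_alg N\<^esub> x = (zr (restrict_scalars g_alg q_alg N))"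
      by (intro bexI[where x = "\<ominus>\<^bsub>N\<^esub> x"]) (auto simp: r N.M.l_neg)
  qed (auto simp: r N.M.a_ac)
  then show ?thesis
    by (intro left_module.intro G.ring_UEA left_module_axioms.intro)
      (simp_all add: r env_map_gq(1,2,3) env_map_gq(6)[OF G.ucst_closed G.ucst_closed] N.lsmult_l_distr N.lsmult_r_distr N.lsmult_assoc)
qed

subsection \<open>The structure of simple supermodules\<close>

locale q_simple = D: doubling L0 Q0 \<pi>0 \<Phi>0 + N: usmod q_alg N
  for L0 :: "('k::field_char_0 uea, 'l, 'p) module_scheme" and Q0 :: "('k uea, 'n, 'q) supermodule_scheme"
    and \<pi>0 \<Phi>0 and N :: "('k uea, 'm, 'r) supermodule_scheme" +
  assumes simple: "simple_supermodule q_alg N"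
    and ann: "annihilator Aq N = annihilator Aq Q0"
    and nontrivial: "\<exists>A. \<exists>x\<in>carrier L0. ugen g_alg (blockM A 0) \<odot>\<^bsub>L0\<^esub> x \<noteq> (zr L0)"
begin

abbreviation Ev where "Ev A z \<equiv> ugen q_alg (blockM A 0) \<odot>\<^bsub>N\<^esub> z"
abbreviation Ob where "Ob B z \<equiv> ugen q_alg (blockM 0 B) \<odot>\<^bsub>N\<^esub> z"
abbreviation Z where "Z z \<equiv> Ob (mat 1) z"

text \<open>Equality of annihilators transfers relations: whatever can be verified to vanish in the
  explicit doubling \<open>Q0\<close> also vanishes in the abstract simple module
  \<open>N\<close>.\<close>

lemma rel:
  assumes u: "u \<in> Uq" and 0: "\<And>x y. x \<in> carrier L0 ==> y \<in> carrier L0 ==> u \<odot>\<^bsub>Q0\<^esub> \<Phi>0 x y = (zr Q0)"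
    and z: "z \<in> carrier N"
  shows "u \<odot>\<^bsub>N\<^esub> z = (zr N)"
proof -
  have "u \<odot>\<^bsub>Q0\<^esub> w = (zr Q0)" if w: "w \<in> carrier Q0" for w
  proof -
    obtain x y where xy: "x \<in> carrier L0" "y \<in> carrier L0" "w = \<Phi>0 x y" using D.Phi_ex[OF w] by blast
    show ?thesis unfolding xy(3) by (rule 0[OF xy(1,2)])
  qed
  then have "u \<in> annihilator Aq N" unfolding ann by (simp add: annihilator_def u)
  then show ?thesis using z by (simp add: annihilator_def)
qed

lemma closed: "z \<in> carrier N ==> Ev A z \<in> carrier N" "z \<in> carrier N ==> Ob B z \<in> carrier N"
  by (rule N.ge_closed[OF q_algI(1)] N.ge_closed[OF q_algI(2)], assumption)+

lemma Ob_zero: "Ob B (zr N) = (zr N)" "Ev A (zr N) = (zr N)"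
  by (rule N.lsmult_zero[OF D.N.ugen_closed[OF q_algI(2)]], rule N.lsmult_zero[OF D.N.ugen_closed[OF q_algI(1)]])

lemma Ob_add: "x \<in> carrier N ==> y \<in> carrier N ==> Ob B (x \<oplus>\<^bsub>N\<^esub> y) = Ob B x \<oplus>\<^bsub>N\<^esub> Ob B y"
  "x \<in> carrier N ==> y \<in> carrier N ==> Ev A (x \<oplus>\<^bsub>N\<^esub> y) = Ev A x \<oplus>\<^bsub>N\<^esub> Ev A y"
  by (rule N.lsmult_r_distr[OF D.N.ugen_closed[OF q_algI(2)]] N.lsmult_r_distr[OF D.N.ugen_closed[OF q_algI(1)]], assumption+)+

text \<open>In a doubling a traceless odd matrix takes the first slot to the second and kills the
  second, so two of them compose to zero.\<close>

lemma Ob_Ob: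
  assumes B: "tr2 B = 0" "tr2 B' = 0" and z: "z \<in> carrier N"
  shows "Ob B (Ob B' z) = (zr N)"
proof -
  note u = D.N.ugen_closed[OF q_algI(2), of B] D.N.ugen_closed[OF q_algI(2), of B']
  have "(ugen q_alg (blockM 0 B) \<otimes>\<^bsub>Aq\<^esub> ugen q_alg (blockM 0 B')) \<odot>\<^bsub>N\<^esub> z = (zr N)"
  proof (rule rel[OF D.N.R.m_closed[OF u] _ z])
    fix x y assume xy: "x \<in> carrier L0" "y \<in> carrier L0"
    have g: "ugen g_alg (blockM C 0) \<odot>\<^bsub>L0\<^esub> (zr L0) = (zr L0)" for C by (rule D.L.lsmult_zero[OF D.L.ugen_closed[OF g_algI]])
    show "(ugen q_alg (blockM 0 B) \<otimes>\<^bsub>Aq\<^esub> ugen q_alg (blockM 0 B')) \<odot>\<^bsub>Q0\<^esub> \<Phi>0 x y = (zr Q0)"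
      using xy u D.g_closed[OF xy(1), of B']
      by (simp add: D.N.lsmult_assoc D.Phi_closed D.Phi_odd B D.L.cs_zero g D.Phi_zero)
  qed
  then show ?thesis by (simp add: N.lsmult_assoc u z)
qed

lemma ZZ:
  assumes z: "z \<in> carrier N"
  shows "Z (Z z) = (zr N)"
proof -
  note u = D.N.ugen_closed[OF q_algI(2), of "mat 1"]
  have "(ugen q_alg (blockM 0 (mat 1)) \<otimes>\<^bsub>Aq\<^esub> ugen q_alg (blockM 0 (mat 1))) \<odot>\<^bsub>N\<^esub> z = (zr N)"
    by (rule rel[OF D.N.R.m_closed[OF u u] _ z])
      (use u in \<open>simp add: D.N.lsmult_assoc D.Phi_closed D.zbar D.Phi_zero\<close>)
  then show ?thesis by (simp add: N.lsmult_assoc u z)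
qed

lemma Ev_one: "z \<in> carrier N ==> Ev (mat 1) z = (zr N)"
  by (rule rel[OF D.N.ugen_closed[OF q_algI(1)]]) (simp_all add: D.Phi_even D.identity_acts_zero D.Phi_zero)

lemma scalar_add: "B ** mat 1 + mat 1 ** B = mat 2 ** (B :: 'k ^ 2 ^ 2)"
  by (rule mx_eqI) (simp_all add: mult_nth_2 mat_def)

text \<open>The superbracket of an odd matrix with the odd identity is twice the corresponding even
  matrix. In this way the odd operators control the even action.\<close>

lemma twoEv:
  assumes z: "z \<in> carrier N"
  shows "ucst q_alg 2 \<odot>\<^bsub>N\<^esub> Ev B z = Ob B (Z z) \<oplus>\<^bsub>N\<^esub> Z (Ob B z)"
proof -
  have b: "superbracket 1 1 (blockM 0 B) (blockM 0 (mat 1)) = mat 2 ** blockM B 0"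
    unfolding superbracket_blockM(4) scalar_add by (simp add: blockM_scale)
  have k: "koszul 1 1 = (- 1 :: 'k)" by (simp add: koszul_def)
  have c: "ucst q_alg 2 \<odot>\<^bsub>N\<^esub> Ev B z \<in> carrier N" "Z (Ob B z) \<in> carrier N" by (intro N.cs_closed closed z)+
  have "Ob B (Z z) = ucst q_alg (- 1) \<odot>\<^bsub>N\<^esub> Z (Ob B z) \<oplus>\<^bsub>N\<^esub> ucst q_alg 2 \<odot>\<^bsub>N\<^esub> Ev B z"
    using N.ge_commute[OF q_algI(2) q_algI(2) z, of B "mat 1"] unfolding b k N.ge_scale[OF q_algI(1) z] .
  then show ?thesis using c by (simp add: N.cs_uminus N.cs_one N.M.a_ac N.M.r_neg)
qed

lemma Ev_Z:
  assumes z: "z \<in> carrier N"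
  shows "Ev A (Z z) = Z (Ev A z)"
proof -
  have b: "superbracket 0 1 (blockM A 0) (blockM 0 (mat 1)) = 0"
    by (simp add: superbracket_blockM blockM_arith)
  have k: "koszul 0 1 = (1 :: 'k)" by (simp add: koszul_def)
  show ?thesis
    using N.ge_commute[OF q_algI(1) q_algI(2) z, of A "mat 1"] closed(2)[OF closed(1)[OF z]]
    unfolding b k N.ge_zero[OF z] by (simp add: N.cs_one)
qed

lemma Ob_Ev:
  assumes z: "z \<in> carrier N"
  shows "Ob B (Ev A z) = Ev A (Ob B z) \<oplus>\<^bsub>N\<^esub> Ob (B ** A - A ** B) z"
proof -
  have k: "koszul 1 0 = (1 :: 'k)" by (simp add: koszul_def)
  show ?thesis
    using N.ge_commute[OF q_algI(2) q_algI(1) z, of B A]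
    unfolding k superbracket_blockM(3) N.cs_one[OF closed(1)[OF closed(2)[OF z]]] .
qed

lemma tr2_traceless: "tr2 (B - mat (tr2 B / 2)) = (0 :: 'k)"
  by (simp add: tr2_def mat_def field_simps)

lemma Ob_split:
  assumes z: "z \<in> carrier N"
  shows "Ob B z = Ob (B - mat (tr2 B / 2)) z \<oplus>\<^bsub>N\<^esub> ucst q_alg (tr2 B / 2) \<odot>\<^bsub>N\<^esub> Z z"
proof -
  have 1: "blockM 0 (B - mat c) + blockM 0 (mat c) = blockM 0 B" for c by (simp add: blockM_arith)
  have 2: "blockM 0 (mat c) = mat c ** blockM 0 (mat 1 :: 'k ^ 2 ^ 2)" for c by (simp add: blockM_scale matrix_mul_rid)
  show ?thesis
    using N.ge_add[OF q_algI(2) q_algI(2) z, of "B - mat (tr2 B / 2)" "mat (tr2 B / 2)"]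
    unfolding 1[of "tr2 B / 2"] unfolding 2[of "tr2 B / 2"] N.ge_scale[OF q_algI(2) z] .
qed

lemma Ev_split:
  assumes z: "z \<in> carrier N"
  shows "Ev A z = Ev (A - mat (tr2 A / 2)) z"
proof -
  have 1: "blockM (A - mat c) 0 + blockM (mat c) 0 = blockM A 0" for c by (simp add: blockM_arith)
  have 2: "blockM (mat c) 0 = mat c ** blockM (mat 1 :: 'k ^ 2 ^ 2) 0" for c by (simp add: blockM_scale matrix_mul_rid)
  have "Ev A z = Ev (A - mat (tr2 A / 2)) z \<oplus>\<^bsub>N\<^esub> ucst q_alg (tr2 A / 2) \<odot>\<^bsub>N\<^esub> Ev (mat 1) z"
    using N.ge_add[OF q_algI(1) q_algI(1) z, of "A - mat (tr2 A / 2)" "mat (tr2 A / 2)"]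
    unfolding 1[of "tr2 A / 2"] unfolding 2[of "tr2 A / 2"] N.ge_scale[OF q_algI(1) z] .
  then show ?thesis using closed(1)[OF z] by (simp add: Ev_one[OF z])
qed

lemma par: "1 + \<pi> = \<pi> + 1" "1 + (\<pi> + 1) = \<pi>" "\<pi> + 1 + 1 = (\<pi> :: bit)"
  using bit_cases[of \<pi>] by auto

lemma Ob_gr: "x \<in> gr N \<pi> ==> Ob B x \<in> gr N (\<pi> + 1)" "x \<in> gr N (\<pi> + 1) ==> Ob B x \<in> gr N \<pi>"
  by (rule N.gr_ge[OF q_algI(2), of x \<pi> B, unfolded par(1)[of \<pi>]], assumption)
    (rule N.gr_ge[OF q_algI(2), of x "\<pi> + 1" B, unfolded par(2)[of \<pi>]])

lemma Ev_gr: "x \<in> gr N \<pi> ==> Ev A x \<in> gr N \<pi>"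
  using N.gr_ge[OF q_algI(1), of x \<pi> A] by simp

text \<open>If all odd operators vanish, \<open>twoEv\<close> makes the even part act by zero on
  \<open>N\<close>, hence on \<open>Q0\<close> by equality of annihilators, which contradicts
  \<open>nontrivial\<close>.\<close>

lemma not_trivial:
  assumes Z: "\<And>z. z \<in> carrier N ==> Z z = (zr N)" and O: "\<And>B z. tr2 B = 0 ==> z \<in> carrier N ==> Ob B z = (zr N)"
  shows False
proof -
  have "Ev A z = (zr N)" if z: "z \<in> carrier N" for A z
  proof -
    let ?B = "A - mat (tr2 A / 2)"
    have "ucst q_alg 2 \<odot>\<^bsub>N\<^esub> Ev ?B z = (zr N)"
      unfolding twoEv[OF z] by (simp add: Z[OF z] O[OF tr2_traceless z] Ob_zero)
    then have "Ev ?B z = (zr N)" by (rule N.cs_cancel[OF _ closed(1)[OF z], rotated]) simp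
    then show ?thesis using Ev_split[OF z, of A] by simp
  qed
  then have a: "ugen q_alg (blockM A 0) \<in> annihilator Aq Q0" for A
    unfolding ann[symmetric] by (simp add: annihilator_def D.N.ugen_closed[OF q_algI(1)])
  obtain A x where x: "x \<in> carrier L0" "ugen g_alg (blockM A 0) \<odot>\<^bsub>L0\<^esub> x \<noteq> (zr L0)" using nontrivial by blast
  have "ugen q_alg (blockM A 0) \<odot>\<^bsub>Q0\<^esub> \<Phi>0 x x = (zr Q0)" using a[of A] D.Phi_closed[OF x(1) x(1)] by (simp add: annihilator_def)
  then have "\<Phi>0 (ugen g_alg (blockM A 0) \<odot>\<^bsub>L0\<^esub> x) (ugen g_alg (blockM A 0) \<odot>\<^bsub>L0\<^esub> x) = \<Phi>0 (zr L0) (zr L0)"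
    by (simp add: D.Phi_even x D.Phi_zero)
  from D.Phi_inj[OF D.g_closed[OF x(1)] D.g_closed[OF x(1)] D.L.M.zero_closed D.L.M.zero_closed this] x(2) show False by simp
qed

lemma not_trivial_gr:
  assumes Z: "\<And>z. z \<in> gr N \<pi> ==> Z z = (zr N)" "\<And>z. z \<in> gr N (\<pi> + 1) ==> Z z = (zr N)"
    and O: "\<And>B z. tr2 B = 0 ==> z \<in> gr N \<pi> ==> Ob B z = (zr N)" "\<And>B z. tr2 B = 0 ==> z \<in> gr N (\<pi> + 1) ==> Ob B z = (zr N)"
  shows False
proof (rule not_trivial)
  fix z assume "z \<in> carrier N"
  then obtain a b where ab: "a \<in> gr N \<pi>" "b \<in> gr N (\<pi> + 1)" "z = a \<oplus>\<^bsub>N\<^esub> b" using N.gr_dec' by blast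
  show "Z z = (zr N)"
    unfolding ab(3) Ob_add(1)[OF N.gr_carrier[OF ab(1)] N.gr_carrier[OF ab(2)]] Z(1)[OF ab(1)] Z(2)[OF ab(2)] by simp
next
  fix B :: "'k ^ 2 ^ 2" and z assume B: "tr2 B = 0" and "z \<in> carrier N"
  then obtain a b where ab: "a \<in> gr N \<pi>" "b \<in> gr N (\<pi> + 1)" "z = a \<oplus>\<^bsub>N\<^esub> b" using N.gr_dec' by blast
  show "Ob B z = (zr N)"
    unfolding ab(3) Ob_add(1)[OF N.gr_carrier[OF ab(1)] N.gr_carrier[OF ab(2)]] O(1)[OF B ab(1)] O(2)[OF B ab(2)] by simp
qed

text \<open>The sum of the two subgroups is a graded submodule, to which simplicity applies. By
  \<open>Ob_split\<close> every odd matrix is a traceless one plus a multiple of the odd identity,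
  so stability is required for these two kinds only.\<close>

lemma dichotomy:
  assumes A: "subgroup A (add_monoid N)" "A \<subseteq> gr N \<pi>" and B: "subgroup B (add_monoid N)" "B \<subseteq> gr N (\<pi> + 1)"
    and c: "\<And>c x. x \<in> A ==> ucst q_alg c \<odot>\<^bsub>N\<^esub> x \<in> A" "\<And>c x. x \<in> B ==> ucst q_alg c \<odot>\<^bsub>N\<^esub> x \<in> B"
    and e: "\<And>M x. x \<in> A ==> Ev M x \<in> A" "\<And>M x. x \<in> B ==> Ev M x \<in> B"
    and t: "\<And>M x. tr2 M = 0 ==> x \<in> A ==> Ob M x \<in> B" "\<And>M x. tr2 M = 0 ==> x \<in> B ==> Ob M x \<in> A"
    and z: "\<And>x. x \<in> A ==> Z x \<in> B" "\<And>x. x \<in> B ==> Z x \<in> A"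
  shows "(A = {(zr N)} \<and> B = {(zr N)}) \<or> (A = gr N \<pi> \<and> B = gr N (\<pi> + 1))"
proof -
  note DA = N.M.add_subgroupD[OF A(1)] and DB = N.M.add_subgroupD[OF B(1)]
  have cA: "x \<in> carrier N" if "x \<in> A" for x by (rule subsetD[OF DA(1) that])
  have cB: "x \<in> carrier N" if "x \<in> B" for x by (rule subsetD[OF DB(1) that])
  have oA: "Ob M x \<in> B" if x: "x \<in> A" for M x
    unfolding Ob_split[OF cA[OF x], of M] by (rule DB(4)[OF t(1)[OF tr2_traceless x] c(2)[OF z(1)[OF x]]])
  have oB: "Ob M x \<in> A" if x: "x \<in> B" for M x
    unfolding Ob_split[OF cB[OF x], of M] by (rule DA(4)[OF t(2)[OF tr2_traceless x] c(1)[OF z(2)[OF x]]])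
  define H where "H = (\<lambda>(a, b). a \<oplus>\<^bsub>N\<^esub> b) ` (A \<times> B)"
  have HI: "w \<in> H" if "a \<in> A" "b \<in> B" "w = a \<oplus>\<^bsub>N\<^esub> b" for w a b
    unfolding H_def by (rule image_eqI[of _ _ "(a, b)"]) (simp_all add: that)
  have HE: "\<exists>a\<in>A. \<exists>b\<in>B. w = a \<oplus>\<^bsub>N\<^esub> b" if "w \<in> H" for w
    using that unfolding H_def by auto
  have "submodule H Aq N"
  proof (rule N.usubmoduleI)
    show "subgroup H (add_monoid N)"
    proof (rule N.M.add_subgroupI)
      show "H \<subseteq> carrier N" unfolding H_def using cA cB by auto
      show "(zr N) \<in> H" by (rule HI[OF DA(2) DB(2)]) simp
    next
      fix w assume "w \<in> H"
      then obtain a b where ab: "a \<in> A" "b \<in> B" "w = a \<oplus>\<^bsub>N\<^esub> b" using HE by blast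
      show "\<ominus>\<^bsub>N\<^esub> w \<in> H"
        by (rule HI[OF DA(3)[OF ab(1)] DB(3)[OF ab(2)]]) (simp add: ab(3) N.M.minus_add cA[OF ab(1)] cB[OF ab(2)])
      fix w' assume "w' \<in> H"
      then obtain a' b' where ab': "a' \<in> A" "b' \<in> B" "w' = a' \<oplus>\<^bsub>N\<^esub> b'" using HE by blast
      show "w \<oplus>\<^bsub>N\<^esub> w' \<in> H"
        by (rule HI[OF DA(4)[OF ab(1) ab'(1)] DB(4)[OF ab(2) ab'(2)]])
          (simp add: ab(3) ab'(3) N.M.a_ac cA[OF ab(1)] cB[OF ab(2)] cA[OF ab'(1)] cB[OF ab'(2)])
    qed
  next
    fix k w assume "w \<in> H"
    then obtain a b where ab: "a \<in> A" "b \<in> B" "w = a \<oplus>\<^bsub>N\<^esub> b" using HE by blast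
    show "ucst q_alg k \<odot>\<^bsub>N\<^esub> w \<in> H"
      by (rule HI[OF c(1)[OF ab(1)] c(2)[OF ab(2)]])
        (simp add: ab(3) N.lsmult_r_distr cA[OF ab(1)] cB[OF ab(2)])
  next
    fix X :: "'k smat" and i w assume X: "X \<in> q_alg i" and "w \<in> H"
    then obtain a b where ab: "a \<in> A" "b \<in> B" "w = a \<oplus>\<^bsub>N\<^esub> b" using HE by blast
    note ca = cA[OF ab(1)] cB[OF ab(2)]
    show "ugen q_alg X \<odot>\<^bsub>N\<^esub> w \<in> H"
      using X
    proof (cases rule: q_alg_cases)
      case (1 M)
      show ?thesis unfolding 1 ab(3) Ob_add(2)[OF ca] by (rule HI[OF e(1)[OF ab(1)] e(2)[OF ab(2)] refl])
    next
      case (2 M)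
      show ?thesis unfolding 2 ab(3) Ob_add(1)[OF ca]
        by (rule HI[OF oB[OF ab(2)] oA[OF ab(1)] N.M.a_comm[OF closed(2)[OF ca(1)] closed(2)[OF ca(2)]]])
    qed
  qed
  moreover have "\<exists>a\<in>H \<inter> gr N 0. \<exists>b\<in>H \<inter> gr N 1. w = a \<oplus>\<^bsub>N\<^esub> b" if w: "w \<in> H" for w
  proof -
    obtain a b where ab: "a \<in> A" "b \<in> B" "w = a \<oplus>\<^bsub>N\<^esub> b" using HE[OF w] by blast
    have a: "a \<in> H" by (rule HI[OF ab(1) DB(2)]) (simp add: cA[OF ab(1)])
    have b: "b \<in> H" by (rule HI[OF DA(2) ab(2)]) (simp add: cB[OF ab(2)])
    note g = subsetD[OF A(2) ab(1)] subsetD[OF B(2) ab(2)]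
    show ?thesis
      using bit_cases[of \<pi>]
    proof
      assume \<pi>: "\<pi> = 0"
      show ?thesis using g a b unfolding \<pi> by (intro bexI[of _ a] bexI[of _ b]) (simp_all add: ab(3))
    next
      assume \<pi>: "\<pi> = 1"
      show ?thesis using g a b unfolding \<pi>
        by (intro bexI[of _ b] bexI[of _ a]) (simp_all add: ab(3) N.M.a_comm[OF cA[OF ab(1)] cB[OF ab(2)]])
    qed
  qed
  ultimately have "graded_submodule q_alg N H" by (simp add: graded_submodule_def)
  then have "H = {(zr N)} \<or> H = carrier N" by (rule simple_supermoduleD(3)[OF simple])
  then show ?thesis
  proof
    assume H: "H = {(zr N)}"
    have "a = (zr N)" if a: "a \<in> A" for a
      using HI[OF a DB(2) refl] cA[OF a] by (simp add: H)
    moreover have "b = (zr N)" if b: "b \<in> B" for b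
      using HI[OF DA(2) b refl] cB[OF b] by (simp add: H)
    ultimately have "A \<subseteq> {(zr N)}" "B \<subseteq> {(zr N)}" by (simp_all add: subset_iff)
    with DA(2) DB(2) have "A = {(zr N)}" "B = {(zr N)}" by auto
    then show ?thesis by simp
  next
    assume H: "H = carrier N"
    have "x \<in> A" if x: "x \<in> gr N \<pi>" for x
    proof -
      have "x \<in> H" unfolding H by (rule N.gr_carrier[OF x])
      then obtain a b where ab: "a \<in> A" "b \<in> B" "x = a \<oplus>\<^bsub>N\<^esub> b" using HE by blast
      have "x \<oplus>\<^bsub>N\<^esub> (zr N) = a \<oplus>\<^bsub>N\<^esub> b" using ab(3) N.gr_carrier[OF x] by simp
      then have "x = a" by (rule N.gr_unique(1)[OF x N.grD(2) subsetD[OF A(2) ab(1)] subsetD[OF B(2) ab(2)]])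
      then show ?thesis using ab(1) by simp
    qed
    moreover have "x \<in> B" if x: "x \<in> gr N (\<pi> + 1)" for x
    proof -
      have "x \<in> H" unfolding H by (rule N.gr_carrier[OF x])
      then obtain a b where ab: "a \<in> A" "b \<in> B" "x = a \<oplus>\<^bsub>N\<^esub> b" using HE by blast
      have "(zr N) \<oplus>\<^bsub>N\<^esub> x = a \<oplus>\<^bsub>N\<^esub> b" using ab(3) N.gr_carrier[OF x] by simp
      then have "x = b" by (rule N.gr_unique(2)[OF N.grD(2) x subsetD[OF A(2) ab(1)] subsetD[OF B(2) ab(2)]])
      then show ?thesis using ab(2) by simp
    qed
    ultimately have "gr N \<pi> \<subseteq> A" "gr N (\<pi> + 1) \<subseteq> B" by (simp_all add: subset_iff)
    then show ?thesis using A(2) B(2) by simp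
  qed
qed

section \<open>Kernels of the odd operators in a simple supermodule\<close>

definition ker where "ker U \<pi> = {x \<in> gr N \<pi>. \<forall>u\<in>U. u \<odot>\<^bsub>N\<^esub> x = (zr N)}"

lemma ker_sub:
  assumes U: "U \<subseteq> Uq"
  shows "subgroup (ker U \<pi>) (add_monoid N)" "ker U \<pi> \<subseteq> gr N \<pi>" "x \<in> ker U \<pi> ==> ucst q_alg c \<odot>\<^bsub>N\<^esub> x \<in> ker U \<pi>"
proof -
  have u: "u \<in> Uq" if "u \<in> U" for u by (rule subsetD[OF U that])
  have cs: "ucst q_alg c \<odot>\<^bsub>N\<^esub> x \<in> ker U \<pi>" if x: "x \<in> ker U \<pi>" for x c
  proof -
    have x': "x \<in> gr N \<pi>" "\<And>u. u \<in> U ==> u \<odot>\<^bsub>N\<^esub> x = (zr N)" using x by (simp_all add: ker_def)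
    show ?thesis
      unfolding ker_def
    proof (intro CollectI conjI ballI N.gr_cs x'(1))
      fix v assume v: "v \<in> U"
      show "v \<odot>\<^bsub>N\<^esub> (ucst q_alg c \<odot>\<^bsub>N\<^esub> x) = (zr N)"
        unfolding N.cs_central[OF u[OF v] N.gr_carrier[OF x'(1)], symmetric] x'(2)[OF v] by simp
    qed
  qed
  then show "x \<in> ker U \<pi> ==> ucst q_alg c \<odot>\<^bsub>N\<^esub> x \<in> ker U \<pi>" .
  show s: "ker U \<pi> \<subseteq> gr N \<pi>" by (auto simp: ker_def)
  show "subgroup (ker U \<pi>) (add_monoid N)"
  proof (rule N.M.add_subgroupI)
    show "ker U \<pi> \<subseteq> carrier N" using s N.grD(1) by (rule subset_trans)
    show "(zr N) \<in> ker U \<pi>" unfolding ker_def using u by (simp add: N.grD(2))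
    show "\<ominus>\<^bsub>N\<^esub> x \<in> ker U \<pi>" if x: "x \<in> ker U \<pi>" for x
      using cs[OF x, of "- 1"] N.gr_carrier[OF subsetD[OF s x]] by (simp add: N.cs_uminus N.cs_one)
    fix x y assume x: "x \<in> ker U \<pi>" and y: "y \<in> ker U \<pi>"
    note g = subsetD[OF s x] subsetD[OF s y]
    show "x \<oplus>\<^bsub>N\<^esub> y \<in> ker U \<pi>"
      unfolding ker_def
    proof (intro CollectI conjI ballI N.grD(4) g)
      fix v assume v: "v \<in> U"
      have "v \<odot>\<^bsub>N\<^esub> x = (zr N)" "v \<odot>\<^bsub>N\<^esub> y = (zr N)" using x y v by (simp_all add: ker_def)
      then show "v \<odot>\<^bsub>N\<^esub> (x \<oplus>\<^bsub>N\<^esub> y) = (zr N)"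
        by (simp add: N.lsmult_r_distr[OF u[OF v] N.gr_carrier[OF g(1)] N.gr_carrier[OF g(2)]])
    qed
  qed
qed

definition "kZ = ker {ugen q_alg (blockM 0 (mat 1))}"
definition "kO = ker ((\<lambda>B. ugen q_alg (blockM 0 B)) ` {B. tr2 B = 0})"

lemma kZ_iff: "x \<in> kZ \<pi> \<longleftrightarrow> x \<in> gr N \<pi> \<and> Z x = (zr N)"
  by (simp add: kZ_def ker_def)

lemma kO_iff: "x \<in> kO \<pi> \<longleftrightarrow> x \<in> gr N \<pi> \<and> (\<forall>B. tr2 B = 0 \<longrightarrow> Ob B x = (zr N))"
  unfolding kO_def ker_def mem_Collect_eq ball_simps ..

lemma kZ_sub: "subgroup (kZ \<pi>) (add_monoid N)" "kZ \<pi> \<subseteq> gr N \<pi>" "x \<in> kZ \<pi> ==> ucst q_alg c \<odot>\<^bsub>N\<^esub> x \<in> kZ \<pi>"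
  unfolding kZ_def by (rule ker_sub; simp add: D.N.ugen_closed[OF q_algI(2)])+

lemma kO_sub: "subgroup (kO \<pi>) (add_monoid N)" "kO \<pi> \<subseteq> gr N \<pi>" "x \<in> kO \<pi> ==> ucst q_alg c \<odot>\<^bsub>N\<^esub> x \<in> kO \<pi>"
proof -
  have U: "(\<lambda>B. ugen q_alg (blockM 0 B)) ` {B. tr2 B = 0} \<subseteq> carrier (Aq :: 'k uea ring)"
    by (rule image_subsetI, rule D.N.ugen_closed[OF q_algI(2)])
  note k = ker_sub[OF U, folded kO_def]
  show "subgroup (kO \<pi>) (add_monoid N)" "kO \<pi> \<subseteq> gr N \<pi>" by (rule k)+
  show "x \<in> kO \<pi> ==> ucst q_alg c \<odot>\<^bsub>N\<^esub> x \<in> kO \<pi>" by (rule k)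
qed

lemma zero_ker: "(zr N) \<in> kZ \<pi>" "(zr N) \<in> kO \<pi>"
  by (rule N.M.add_subgroupD(2)[OF kZ_sub(1)], rule N.M.add_subgroupD(2)[OF kO_sub(1)])

text \<open>The vectors of parity \<open>\<pi>\<close> killed by Z and those of opposite parity
  killed by the traceless odd matrices form a stable pair: traceless matrices lead from the former
  into the latter by \<open>Ob_Ob\<close>, and Z leads back by \<open>ZZ\<close>.\<close>

lemma kernels: "(kZ \<pi> = {(zr N)} \<and> kO (\<pi> + 1) = {(zr N)}) \<or> (kZ \<pi> = gr N \<pi> \<and> kO (\<pi> + 1) = gr N (\<pi> + 1))"
proof (rule dichotomy[OF kZ_sub(1,2) kO_sub(1,2) kZ_sub(3) kO_sub(3)])
  fix x M assume x: "x \<in> kZ \<pi>"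
  then have x': "x \<in> gr N \<pi>" "Z x = (zr N)" by (simp_all add: kZ_iff)
  note c = N.gr_carrier[OF x'(1)]
  show "Ev M x \<in> kZ \<pi>" unfolding kZ_iff by (simp add: Ev_gr x' Ob_zero flip: Ev_Z[OF c])
  show "Ob M x \<in> kO (\<pi> + 1)" if "tr2 M = 0" unfolding kO_iff by (simp add: Ob_gr x' Ob_Ob[OF _ that c])
  show "Z x \<in> kO (\<pi> + 1)" unfolding x'(2) by (rule zero_ker)
next
  fix x M assume x: "x \<in> kO (\<pi> + 1)"
  then have x': "x \<in> gr N (\<pi> + 1)" "\<And>B. tr2 B = 0 ==> Ob B x = (zr N)" by (simp_all add: kO_iff)
  note c = N.gr_carrier[OF x'(1)]
  show "Ev M x \<in> kO (\<pi> + 1)"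
    unfolding kO_iff by (simp add: Ev_gr x' Ob_Ev[OF c] Ob_zero tr2_commutator)
  show "Ob M x \<in> kZ \<pi>" if "tr2 M = 0" unfolding x'(2)[OF that] by (rule zero_ker)
  show "Z x \<in> kZ \<pi>" unfolding kZ_iff by (simp add: Ob_gr x' ZZ[OF c])
qed

text \<open>If the pair of kernels vanishes for the parity 0, then Z maps odd vectors into the
  kernel of Z in parity 0, by \<open>ZZ\<close>, so Z is zero on them; likewise traceless matrices
  are zero on even vectors. The other parity then has full kernels.\<close>

lemma parity_ex: "\<exists>\<pi>. kZ \<pi> = gr N \<pi> \<and> kO (\<pi> + 1) = gr N (\<pi> + 1)"
  using kernels[of 0]
proof
  assume "kZ 0 = {(zr N)} \<and> kO (0 + 1) = {(zr N)}"
  then have 0: "kZ 0 = {(zr N)}" "kO 1 = {(zr N)}" by simp_all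
  have "x \<in> kZ 1" if x: "x \<in> gr N 1" for x
  proof -
    have "Z x \<in> kZ 0" unfolding kZ_iff using Ob_gr(2)[of x 0] x ZZ[OF N.gr_carrier[OF x]] by simp
    then show ?thesis unfolding 0 kZ_iff using x by simp
  qed
  moreover have "x \<in> kO 0" if x: "x \<in> gr N 0" for x
  proof -
    have "Ob M x = (zr N)" if M: "tr2 M = 0" for M
    proof -
      have "Ob M x \<in> kO 1" unfolding kO_iff using Ob_gr(1)[OF x] by (simp add: Ob_Ob[OF _ M N.gr_carrier[OF x]])
      then show ?thesis unfolding 0 by simp
    qed
    then show ?thesis unfolding kO_iff using x by simp
  qed
  ultimately have s: "gr N 1 \<subseteq> kZ 1" "gr N 0 \<subseteq> kO 0" by (simp_all add: subset_iff)
  have "kZ 1 = gr N 1" by (rule equalityI[OF kZ_sub(2) s(1)])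
  moreover have "kO 0 = gr N 0" by (rule equalityI[OF kO_sub(2) s(2)])
  ultimately have "kZ 1 = gr N 1" "kO 0 = gr N 0" .
  then show ?thesis by (intro exI[of _ 1]) simp
qed (rule exI)

lemma zero_sub: "subgroup {(zr N)} (add_monoid N)"
  by (rule N.M.add_subgroupI) simp_all

text \<open>The part of parity \<open>\<pi> + 1\<close> serves as \<open>L\<close> and as the second
  slot. Z is a bijection from it onto the part of parity \<open>\<pi>\<close>, which thereby becomes
  the first slot; both halves of this bijectivity come from \<open>dichotomy\<close>.\<close>

lemma doubling_ex: "\<exists>\<pi> L \<Phi>. doubling (L :: ('k uea, 'm) module) N \<pi> \<Phi>"
proof -
  obtain \<pi> where \<pi>: "kZ \<pi> = gr N \<pi>" "kO (\<pi> + 1) = gr N (\<pi> + 1)" using parity_ex by blast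
  have Zx: "Z x = (zr N)" if x: "x \<in> gr N \<pi>" for x
  proof -
    have "x \<in> kZ \<pi>" unfolding \<pi>(1) by (rule x)
    then show ?thesis unfolding kZ_iff by (rule conjunct2)
  qed
  have Oy: "Ob B y = (zr N)" if B: "tr2 B = 0" and y: "y \<in> gr N (\<pi> + 1)" for B y
  proof -
    have "y \<in> kO (\<pi> + 1)" unfolding \<pi>(2) by (rule y)
    then show ?thesis unfolding kO_iff using B by simp
  qed
  have OZ: "Ob B (Z y) = ucst q_alg 2 \<odot>\<^bsub>N\<^esub> Ev B y" if B: "tr2 B = 0" and y: "y \<in> gr N (\<pi> + 1)" for B y
    using twoEv[OF N.gr_carrier[OF y], of B] closed(2)[OF closed(2)[OF N.gr_carrier[OF y]]] by (simp add: Oy[OF B y] Ob_zero)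
  \<comment> \<open>Injectivity of Z on the second slot: its kernel there and the zero subgroup form
    a stable pair. If the kernel were everything, all odd operators would vanish.\<close>
  have "({(zr N)} = {(zr N)} \<and> kZ (\<pi> + 1) = {(zr N)}) \<or> ({(zr N)} = gr N \<pi> \<and> kZ (\<pi> + 1) = gr N (\<pi> + 1))"
  proof (rule dichotomy[OF zero_sub _ kZ_sub(1,2) _ kZ_sub(3)])
    show "{(zr N)} \<subseteq> gr N \<pi>" by (simp add: N.grD(2))
    fix x M
    show "Z x \<in> {(zr N)}" "Ev M x \<in> kZ (\<pi> + 1)" "tr2 M = 0 ==> Ob M x \<in> {(zr N)}" if "x \<in> kZ (\<pi> + 1)"
    proof -
      have x': "x \<in> gr N (\<pi> + 1)" "Z x = (zr N)" using that by (simp_all add: kZ_iff)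
      show "Z x \<in> {(zr N)}" by (simp add: x')
      show "Ev M x \<in> kZ (\<pi> + 1)" unfolding kZ_iff by (simp add: Ev_gr x' Ob_zero flip: Ev_Z[OF N.gr_carrier[OF x'(1)]])
      show "Ob M x \<in> {(zr N)}" if "tr2 M = 0" using Oy[OF that x'(1)] by simp
    qed
  qed (simp_all add: Ob_zero zero_ker)
  then have inj: "y = (zr N)" if y: "y \<in> gr N (\<pi> + 1)" "Z y = (zr N)" for y
  proof
    assume k: "{(zr N)} = {(zr N)} \<and> kZ (\<pi> + 1) = {(zr N)}"
    have "y \<in> kZ (\<pi> + 1)" unfolding kZ_iff by (intro conjI y)
    then show ?thesis unfolding conjunct2[OF k] by simp
  next
    assume k: "{(zr N)} = gr N \<pi> \<and> kZ (\<pi> + 1) = gr N (\<pi> + 1)"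
    have False
    proof (rule not_trivial_gr[of \<pi>])
      show "Z z = (zr N)" if z: "z \<in> gr N (\<pi> + 1)" for z
      proof -
        have "z \<in> kZ (\<pi> + 1)" unfolding conjunct2[OF k] by (rule z)
        then show ?thesis unfolding kZ_iff by (rule conjunct2)
      qed
      show "Ob B z = (zr N)" if "tr2 B = 0" "z \<in> gr N \<pi>" for B z
        using that(2) unfolding conjunct1[OF k, symmetric] by (simp add: Ob_zero)
      show "Z z = (zr N)" if "z \<in> gr N \<pi>" for z by (rule Zx[OF that])
      show "Ob B z = (zr N)" if "tr2 B = 0" "z \<in> gr N (\<pi> + 1)" for B z by (rule Oy[OF that])
    qed
    then show ?thesis ..
  qed
  \<comment> \<open>Surjectivity of Z: its image and the whole second slot form a stable pair,
    because a traceless B takes Z y to 2 B y by \<open>OZ\<close>.\<close>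
  have "(Z ` gr N (\<pi> + 1) = {(zr N)} \<and> gr N (\<pi> + 1) = {(zr N)}) \<or> (Z ` gr N (\<pi> + 1) = gr N \<pi> \<and> gr N (\<pi> + 1) = gr N (\<pi> + 1))"
  proof (rule dichotomy)
    show "subgroup (Z ` gr N (\<pi> + 1)) (add_monoid N)"
      by (rule N.image_additive_subgroup[OF N.M.abelian_group_axioms N.gr_sub])
        (simp_all add: closed Ob_add N.gr_carrier)
    show "Z ` gr N (\<pi> + 1) \<subseteq> gr N \<pi>" by (rule image_subsetI, rule Ob_gr)
    have I: "w \<in> Z ` gr N (\<pi> + 1)" if "w = Z y" "y \<in> gr N (\<pi> + 1)" for w y using that by (rule image_eqI)
    fix x c M
    show "ucst q_alg c \<odot>\<^bsub>N\<^esub> x \<in> Z ` gr N (\<pi> + 1)" if x: "x \<in> Z ` gr N (\<pi> + 1)"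
    proof -
      obtain y where y: "x = Z y" "y \<in> gr N (\<pi> + 1)" using x by blast
      show ?thesis unfolding y(1)
        by (rule I[OF N.cs_central[OF D.N.ugen_closed[OF q_algI(2)] N.gr_carrier[OF y(2)]] N.gr_cs[OF y(2)]])
    qed
    show "Ev M x \<in> Z ` gr N (\<pi> + 1)" if x: "x \<in> Z ` gr N (\<pi> + 1)"
    proof -
      obtain y where y: "x = Z y" "y \<in> gr N (\<pi> + 1)" using x by blast
      show ?thesis unfolding y(1) by (rule I[OF Ev_Z[OF N.gr_carrier[OF y(2)]] Ev_gr[OF y(2)]])
    qed
    show "Ob M x \<in> gr N (\<pi> + 1)" if M: "tr2 M = 0" and x: "x \<in> Z ` gr N (\<pi> + 1)"
    proof -
      obtain y where y: "x = Z y" "y \<in> gr N (\<pi> + 1)" using x by blast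
      show ?thesis unfolding y(1) OZ[OF M y(2)] by (rule N.gr_cs[OF Ev_gr[OF y(2)]])
    qed
    show "Z x \<in> gr N (\<pi> + 1)" if x: "x \<in> Z ` gr N (\<pi> + 1)"
    proof -
      obtain y where y: "x = Z y" "y \<in> gr N (\<pi> + 1)" using x by blast
      show ?thesis unfolding y(1) ZZ[OF N.gr_carrier[OF y(2)]] by (rule N.grD(2))
    qed
    show "Ob M x \<in> Z ` gr N (\<pi> + 1)" if M: "tr2 M = 0" and x: "x \<in> gr N (\<pi> + 1)"
      unfolding Oy[OF M x] by (rule I[OF Ob_zero(1)[symmetric] N.grD(2)])
    show "Z x \<in> Z ` gr N (\<pi> + 1)" if x: "x \<in> gr N (\<pi> + 1)" by (rule imageI[OF x])
  qed (simp_all add: N.gr_sub N.gr_cs Ev_gr)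
  then have surj: "Z ` gr N (\<pi> + 1) = gr N \<pi>"
  proof
    assume "Z ` gr N (\<pi> + 1) = {(zr N)} \<and> gr N (\<pi> + 1) = {(zr N)}"
    then have k: "gr N (\<pi> + 1) = {(zr N)}" by (rule conjunct2)
    have False
    proof (rule not_trivial_gr[of \<pi>])
      show "Z z = (zr N)" if "z \<in> gr N (\<pi> + 1)" for z using that unfolding k by (simp add: Ob_zero)
      show "Ob B z = (zr N)" if "tr2 B = 0" "z \<in> gr N \<pi>" for B z using Ob_gr(1)[OF that(2), of B] unfolding k by simp
      show "Z z = (zr N)" if "z \<in> gr N \<pi>" for z by (rule Zx[OF that])
      show "Ob B z = (zr N)" if "tr2 B = 0" "z \<in> gr N (\<pi> + 1)" for B z by (rule Oy[OF that])
    qed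
    then show ?thesis ..
  qed (rule conjunct1)
  define R where "R = restrict_scalars g_alg q_alg N"
  define L where "L = R\<lparr>carrier := gr N (\<pi> + 1)\<rparr>"
  have r: "carrier R = carrier N" "(zr R) = (zr N)" "x \<oplus>\<^bsub>R\<^esub> y = x \<oplus>\<^bsub>N\<^esub> y" "u \<odot>\<^bsub>R\<^esub> x = env_map g_alg q_alg u \<odot>\<^bsub>N\<^esub> x" for x y u
    by (simp_all add: R_def restrict_scalars_simps)
  have l: "carrier L = gr N (\<pi> + 1)" "(zr L) = (zr N)" "x \<oplus>\<^bsub>L\<^esub> y = x \<oplus>\<^bsub>N\<^esub> y" "u \<odot>\<^bsub>L\<^esub> x = env_map g_alg q_alg u \<odot>\<^bsub>N\<^esub> x" for x y u
    by (simp_all add: L_def r)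
  have lmR: "left_module Ag R" unfolding R_def by (rule left_module_restrict_scalars[OF N.left_module_axioms])
  interpret R: umod g_alg R by (rule left_module_umod[OF D.L.lie lmR])
  have "submodule (gr N (\<pi> + 1)) Ag R"
  proof (rule R.usubmoduleI)
    have cs: "ucst g_alg c \<odot>\<^bsub>R\<^esub> x \<in> gr N (\<pi> + 1)" if "x \<in> gr N (\<pi> + 1)" for c x
      unfolding r env_map_gq(4)[OF D.L.R.one_closed D.L.R.one_closed] by (rule N.gr_cs[OF that])
    then show "ucst g_alg c \<odot>\<^bsub>R\<^esub> x \<in> gr N (\<pi> + 1)" if "x \<in> gr N (\<pi> + 1)" for c x using that .
    show "ugen g_alg X \<odot>\<^bsub>R\<^esub> x \<in> gr N (\<pi> + 1)" if X: "X \<in> g_alg i" and x: "x \<in> gr N (\<pi> + 1)" for X i x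
    proof -
      have e: "ugen g_alg X \<odot>\<^bsub>R\<^esub> x = ugen q_alg X \<odot>\<^bsub>N\<^esub> x"
        unfolding r env_map_gq(5)[OF D.L.R.one_closed D.L.R.one_closed X] ..
      from X bit_cases[of i] consider A where "X = blockM A 0" | "X = 0" by (auto simp: g_alg_0 g_alg_1 q_alg_0)
      then show ?thesis
      proof cases
        case (1 A)
        show ?thesis unfolding e unfolding 1 by (rule Ev_gr[OF x])
      next
        case 2
        show ?thesis unfolding e unfolding 2 N.ge_zero[OF N.gr_carrier[OF x]] by (rule N.grD(2))
      qed
    qed
    show "subgroup (gr N (\<pi> + 1)) (add_monoid R)"
    proof (rule R.M.add_subgroupI)
      show "\<ominus>\<^bsub>R\<^esub> x \<in> gr N (\<pi> + 1)" if "x \<in> gr N (\<pi> + 1)" for x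
        using cs[OF that, of "- 1"] N.gr_carrier[OF that] by (simp add: R.cs_uminus R.cs_one r(1))
    qed (simp_all add: r(1-3) N.grD)
  qed
  then have lmL: "left_module Ag L" by (rule left_module_restrict[OF lmR]) (simp_all add: L_def)
  interpret L: umod g_alg L by (rule left_module_umod[OF D.L.lie lmL])
  have Lc: "ucst g_alg c \<odot>\<^bsub>L\<^esub> x = ucst q_alg c \<odot>\<^bsub>N\<^esub> x" for c x
    unfolding l env_map_gq(4)[OF D.L.R.one_closed D.L.R.one_closed] ..
  have Lg: "ugen g_alg (blockM A 0) \<odot>\<^bsub>L\<^esub> x = Ev A x" for A x
    unfolding l env_map_gq(5)[OF D.L.R.one_closed D.L.R.one_closed g_algI] ..
  \<comment> \<open>The one half reflects that the odd identity of a doubling sends (0, y) to (2 y,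
    0): thus Z y has to be \<open>\<Phi>\<close> of 2 y and 0.\<close>
  define \<Phi> where "\<Phi> x y = ucst q_alg (inverse 2) \<odot>\<^bsub>N\<^esub> Z x \<oplus>\<^bsub>N\<^esub> y" for x y
  have gh: "ucst q_alg c \<odot>\<^bsub>N\<^esub> Z x \<in> gr N \<pi>" if "x \<in> gr N (\<pi> + 1)" for x c by (rule N.gr_cs[OF Ob_gr(2)[OF that]])
  note gc = N.gr_carrier
  have cs2: "ucst q_alg c \<odot>\<^bsub>N\<^esub> Z x = Z (ucst q_alg c \<odot>\<^bsub>N\<^esub> x)" if "x \<in> carrier N" for c x
    by (rule N.cs_central[OF D.N.ugen_closed[OF q_algI(2)] that])
  have half: "\<Phi> (ucst q_alg 2 \<odot>\<^bsub>N\<^esub> x) y = Z x \<oplus>\<^bsub>N\<^esub> y" if "x \<in> gr N (\<pi> + 1)" for x y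
    unfolding \<Phi>_def cs2[OF gc[OF that], symmetric] N.cs_inverse[of 2, OF _ closed(2)[OF gc[OF that]], OF zero_neq_numeral[symmetric]] ..
  have \<Phi>i: "x = x' \<and> y = y'" if g: "x \<in> gr N (\<pi> + 1)" "y \<in> gr N (\<pi> + 1)" "x' \<in> gr N (\<pi> + 1)" "y' \<in> gr N (\<pi> + 1)"
    and e: "\<Phi> x y = \<Phi> x' y'" for x y x' y'
  proof -
    note e' = e[unfolded \<Phi>_def]
    have "ucst q_alg (inverse 2) \<odot>\<^bsub>N\<^esub> Z x = ucst q_alg (inverse 2) \<odot>\<^bsub>N\<^esub> Z x'"
      by (rule N.gr_unique(1)[OF gh[OF g(1)] g(2) gh[OF g(3)] g(4) e'])
    note e1 = this
    have i2: "inverse 2 \<noteq> (0 :: 'k)" by simp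
    have "Z x = ucst q_alg (inverse (inverse 2)) \<odot>\<^bsub>N\<^esub> (ucst q_alg (inverse 2) \<odot>\<^bsub>N\<^esub> Z x)"
      by (rule N.cs_inverse[OF i2 closed(2)[OF gc[OF g(1)]], symmetric])
    also have "\<dots> = ucst q_alg (inverse (inverse 2)) \<odot>\<^bsub>N\<^esub> (ucst q_alg (inverse 2) \<odot>\<^bsub>N\<^esub> Z x')"
      by (simp only: e1)
    also have "\<dots> = Z x'" by (rule N.cs_inverse[OF i2 closed(2)[OF gc[OF g(3)]]])
    finally have z: "Z x = Z x'" .
    have m: "ucst q_alg (- 1) \<odot>\<^bsub>N\<^esub> x' \<in> gr N (\<pi> + 1)" by (rule N.gr_cs[OF g(3)])
    have "Z (x \<oplus>\<^bsub>N\<^esub> ucst q_alg (- 1) \<odot>\<^bsub>N\<^esub> x') = Z x \<oplus>\<^bsub>N\<^esub> ucst q_alg (- 1) \<odot>\<^bsub>N\<^esub> Z x'"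
      unfolding Ob_add(1)[OF gc[OF g(1)] gc[OF m]] cs2[OF gc[OF g(3)]] ..
    also have "\<dots> = (zr N)" using closed(2)[OF gc[OF g(3)], of "mat 1"] by (simp add: z N.cs_uminus N.cs_one N.M.r_neg)
    finally have "x \<oplus>\<^bsub>N\<^esub> ucst q_alg (- 1) \<odot>\<^bsub>N\<^esub> x' = (zr N)" by (rule inj[OF N.grD(4)[OF g(1) m]])
    then have "x \<ominus>\<^bsub>N\<^esub> x' = (zr N)" using gc[OF g(3)] by (simp add: N.cs_uminus N.cs_one a_minus_def)
    then have "x = x'" by (rule N.M.diff_eq_zeroD[OF gc[OF g(1)] gc[OF g(3)]])
    moreover have "y = y'" by (rule N.gr_unique(2)[OF gh[OF g(1)] g(2) gh[OF g(3)] g(4) e'])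
    ultimately show ?thesis ..
  qed
  have \<Phi>s: "\<exists>x\<in>gr N (\<pi> + 1). \<exists>y\<in>gr N (\<pi> + 1). w = \<Phi> x y" if w: "w \<in> carrier N" for w
  proof -
    obtain a b where ab: "a \<in> gr N \<pi>" "b \<in> gr N (\<pi> + 1)" "w = a \<oplus>\<^bsub>N\<^esub> b" using N.gr_dec'[OF w] by blast
    from ab(1) obtain x where x: "a = Z x" "x \<in> gr N (\<pi> + 1)" unfolding surj[symmetric] by blast
    show ?thesis unfolding ab(3) x(1) half[OF x(2), symmetric] by (rule bexI[OF bexI[OF refl ab(2)] N.gr_cs[OF x(2)]])
  qed
  have \<Phi>c: "\<Phi> x y \<in> carrier N" if "x \<in> gr N (\<pi> + 1)" "y \<in> gr N (\<pi> + 1)" for x y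
    unfolding \<Phi>_def by (intro N.M.a_closed gc[OF gh[OF that(1)]] gc[OF that(2)])
  have "doubling L N \<pi> \<Phi>"
  proof (rule doublingI[OF L.umod_axioms N.umod_axioms])
    show "bij_betw (\<lambda>(x, y). \<Phi> x y) (carrier L \<times> carrier L) (carrier N)"
      unfolding bij_betw_def l
    proof
      show "inj_on (\<lambda>(x, y). \<Phi> x y) (gr N (\<pi> + 1) \<times> gr N (\<pi> + 1))"
      proof (rule inj_onI)
        fix p q assume p: "p \<in> gr N (\<pi> + 1) \<times> gr N (\<pi> + 1)" and q: "q \<in> gr N (\<pi> + 1) \<times> gr N (\<pi> + 1)"
          and e: "(case p of (x, y) \<Rightarrow> \<Phi> x y) = (case q of (x, y) \<Rightarrow> \<Phi> x y)"
        have "fst p = fst q \<and> snd p = snd q"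
          by (rule \<Phi>i) (use p q e in \<open>simp_all add: case_prod_beta mem_Times_iff\<close>)
        then show "p = q" by (simp add: prod_eq_iff)
      qed
      show "(\<lambda>(x, y). \<Phi> x y) ` (gr N (\<pi> + 1) \<times> gr N (\<pi> + 1)) = carrier N"
      proof (intro equalityI subsetI)
        fix w assume "w \<in> (\<lambda>(x, y). \<Phi> x y) ` (gr N (\<pi> + 1) \<times> gr N (\<pi> + 1))"
        then obtain x y where xy: "x \<in> gr N (\<pi> + 1)" "y \<in> gr N (\<pi> + 1)" "w = \<Phi> x y" by auto
        show "w \<in> carrier N" unfolding xy(3) by (rule \<Phi>c[OF xy(1,2)])
      next
        fix w assume "w \<in> carrier N"
        from \<Phi>s[OF this] obtain x y where xy: "x \<in> gr N (\<pi> + 1)" "y \<in> gr N (\<pi> + 1)" "w = \<Phi> x y" by blast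
        show "w \<in> (\<lambda>(x, y). \<Phi> x y) ` (gr N (\<pi> + 1) \<times> gr N (\<pi> + 1))"
          by (rule image_eqI[of _ _ "(x, y)"]) (simp_all add: xy)
      qed
    qed
  next
    fix x x' y y' assume "x \<in> carrier L" "x' \<in> carrier L" "y \<in> carrier L" "y' \<in> carrier L"
    then have c: "x \<in> carrier N" "x' \<in> carrier N" "y \<in> carrier N" "y' \<in> carrier N" by (simp_all add: l gc)
    then have "Z x \<in> carrier N" "Z x' \<in> carrier N" by (simp_all add: closed)
    with c show "\<Phi> (x \<oplus>\<^bsub>L\<^esub> x') (y \<oplus>\<^bsub>L\<^esub> y') = \<Phi> x y \<oplus>\<^bsub>N\<^esub> \<Phi> x' y'"
      by (simp add: \<Phi>_def l Ob_add N.lsmult_r_distr N.M.a_ac)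
  next
    fix c and A B :: "'k ^ 2 ^ 2" and x y assume "x \<in> carrier L" "y \<in> carrier L"
    then have g: "x \<in> gr N (\<pi> + 1)" "y \<in> gr N (\<pi> + 1)" by (simp_all add: l)
    note c = gc[OF g(1)] gc[OF g(2)]
    have h: "ucst q_alg (inverse 2) \<odot>\<^bsub>N\<^esub> Z x \<in> carrier N" by (rule gc[OF gh[OF g(1)]])
    have com: "ucst q_alg c \<odot>\<^bsub>N\<^esub> (ucst q_alg d \<odot>\<^bsub>N\<^esub> w) = ucst q_alg d \<odot>\<^bsub>N\<^esub> (ucst q_alg c \<odot>\<^bsub>N\<^esub> w)" if "w \<in> carrier N" for c d w
      by (rule N.cs_central[OF D.N.ucst_closed that])
    show "ucst q_alg c \<odot>\<^bsub>N\<^esub> \<Phi> x y = \<Phi> (ucst g_alg c \<odot>\<^bsub>L\<^esub> x) (ucst g_alg c \<odot>\<^bsub>L\<^esub> y)"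
      unfolding \<Phi>_def Lc N.lsmult_r_distr[OF D.N.ucst_closed h c(2)] cs2[OF c(1), of c, symmetric] com[OF closed(2)[OF c(1)], of c] ..
    have sc: "u \<odot>\<^bsub>N\<^esub> (ucst q_alg d \<odot>\<^bsub>N\<^esub> w) = ucst q_alg d \<odot>\<^bsub>N\<^esub> (u \<odot>\<^bsub>N\<^esub> w)" if "u \<in> Uq" "w \<in> carrier N" for u d w
      by (rule N.cs_central[OF that, symmetric])
    show "Ev A (\<Phi> x y) = \<Phi> (ugen g_alg (blockM A 0) \<odot>\<^bsub>L\<^esub> x) (ugen g_alg (blockM A 0) \<odot>\<^bsub>L\<^esub> y)"
      unfolding \<Phi>_def Lg Ob_add(2)[OF h c(2)] sc[OF D.N.ugen_closed[OF q_algI(1)] closed(2)[OF c(1)]] Ev_Z[OF c(1)] ..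
    have zy: "Z (\<Phi> x y) = Z y"
      unfolding \<Phi>_def Ob_add(1)[OF h c(2)] sc[OF D.N.ugen_closed[OF q_algI(2)] closed(2)[OF c(1)]] ZZ[OF c(1)]
      using closed(2)[OF c(2)] by simp
    \<comment> \<open>The traceless part leads from the first slot to the second and kills the
      second; the scalar part does the opposite. Together they give the two entries of the doubling
      rule.\<close>
    define M where "M = B - mat (tr2 B / 2)"
    have M: "tr2 M = 0" unfolding M_def by (rule tr2_traceless)
    have Bx: "Ev B x \<in> carrier N" by (rule closed(1)[OF c(1)])
    have "Ob M (\<Phi> x y) = ucst q_alg (inverse 2) \<odot>\<^bsub>N\<^esub> (ucst q_alg 2 \<odot>\<^bsub>N\<^esub> Ev M x)"
      unfolding \<Phi>_def Ob_add(1)[OF h c(2)] sc[OF D.N.ugen_closed[OF q_algI(2)] closed(2)[OF c(1)]] OZ[OF M g(1)] Oy[OF M g(2)]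
      using closed(1)[OF c(1)] by simp
    also have "\<dots> = Ev B x"
      using N.cs_inverse[of 2, OF _ closed(1)[OF c(1)]] Ev_split[OF c(1), of B] by (simp add: M_def)
    finally have "Ob M (\<Phi> x y) = Ev B x" .
    note OM = this
    have "Ob B (\<Phi> x y) = Ev B x \<oplus>\<^bsub>N\<^esub> ucst q_alg (tr2 B / 2) \<odot>\<^bsub>N\<^esub> Z y"
      unfolding Ob_split[OF \<Phi>c[OF g], of B] M_def[symmetric] OM zy ..
    also have "\<dots> = \<Phi> (ucst q_alg (tr2 B) \<odot>\<^bsub>N\<^esub> y) (Ev B x)"
    proof -
      have d: "inverse 2 * tr2 B = tr2 B / 2" by (simp add: field_simps)
      have e: "ucst q_alg (inverse 2) \<odot>\<^bsub>N\<^esub> (ucst q_alg (tr2 B) \<odot>\<^bsub>N\<^esub> Z y) = ucst q_alg (tr2 B / 2) \<odot>\<^bsub>N\<^esub> Z y"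
        unfolding N.cs_mult[OF closed(2)[OF c(2)], symmetric] d ..
      show ?thesis
        unfolding \<Phi>_def cs2[OF c(2), symmetric] e by (rule N.M.a_comm[OF Bx N.cs_closed[OF closed(2)[OF c(2)]]])
    qed
    finally show "Ob B (\<Phi> x y) = \<Phi> (ucst g_alg (tr2 B) \<odot>\<^bsub>L\<^esub> y) (ugen g_alg (blockM B 0) \<odot>\<^bsub>L\<^esub> x)"
      unfolding Lc Lg .
  next
    show "gr N \<pi> = (\<lambda>x. \<Phi> x (zr L)) ` carrier L"
    proof (intro equalityI subsetI)
      fix a assume a: "a \<in> gr N \<pi>"
      from a obtain x where x: "a = Z x" "x \<in> gr N (\<pi> + 1)" unfolding surj[symmetric] by blast
      have "a = \<Phi> (ucst q_alg 2 \<odot>\<^bsub>N\<^esub> x) (zr L)" unfolding half[OF x(2)] l using closed(2)[OF gc[OF x(2)]] x(1) by simp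
      then show "a \<in> (\<lambda>x. \<Phi> x (zr L)) ` carrier L" unfolding l by (rule image_eqI) (rule N.gr_cs[OF x(2)])
    next
      fix a assume "a \<in> (\<lambda>x. \<Phi> x (zr L)) ` carrier L"
      then obtain x where x: "a = \<Phi> x (zr N)" "x \<in> gr N (\<pi> + 1)" unfolding l by blast
      show "a \<in> gr N \<pi>" unfolding x(1) \<Phi>_def N.M.r_zero[OF gc[OF gh[OF x(2)]]] by (rule gh[OF x(2)])
    qed
    have "\<Phi> (zr L) y = y" if "y \<in> gr N (\<pi> + 1)" for y
      unfolding \<Phi>_def l Ob_zero using gc[OF that] by simp
    note e = this
    have "(\<lambda>y. \<Phi> (zr L) y) ` gr N (\<pi> + 1) = (\<lambda>y. y) ` gr N (\<pi> + 1)" by (rule image_cong[OF refl e])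
    then show "gr N (\<pi> + 1) = (\<lambda>y. \<Phi> (zr L) y) ` carrier L" by (simp add: l)
  qed
  then show ?thesis by blast
qed

end

subsection \<open>Isomorphism classes of doublings\<close>

text \<open>Elements of U(q(2)) act in every doubling by the same matrices \<open>dmat\<close> over
  U(gl(2)), so applying f in both slots is linear.\<close>

lemma doubling_iso:
  fixes L :: "('k::field_char_0 uea, 'l, 'p) module_scheme" and N :: "('k uea, 'n, 'q) supermodule_scheme"
    and L' :: "('k uea, 'm, 'r) module_scheme" and N' :: "('k uea, 'o, 's) supermodule_scheme"
  assumes "doubling L N \<pi> \<Phi>" "doubling L' N' \<pi>' \<Phi>'" and f: "f \<in> module_isos Ag L L'"
  shows "\<exists>g\<in>module_isos Aq N N'. g ` gr N \<pi> = gr N' \<pi>' \<and> g ` gr N (\<pi> + 1) = gr N' (\<pi>' + 1)"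
proof -
  interpret A: doubling L N \<pi> \<Phi> by fact
  interpret B: doubling L' N' \<pi>' \<Phi>' by fact
  note fD = module_isosD[OF f]
  have f0: "f (zr L) = (zr L')" by (rule module_isos_zero[OF f A.L.left_module_axioms B.L.left_module_axioms])
  have fL: "f ` carrier L = carrier L'" using fD(1) by (simp add: bij_betw_def)
  define P where "P = inv_into (carrier L \<times> carrier L) (\<lambda>(x, y). \<Phi> x y)"
  have P: "P (\<Phi> x y) = (x, y)" if "x \<in> carrier L" "y \<in> carrier L" for x y
    unfolding P_def using bij_betw_inv_into_left[OF A.bij, of "(x, y)"] that by simp
  define g where "g z = \<Phi>' (f (fst (P z))) (f (snd (P z)))" for z
  have g: "g (\<Phi> x y) = \<Phi>' (f x) (f y)" if "x \<in> carrier L" "y \<in> carrier L" for x y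
    by (simp add: g_def P that)
  have "g \<in> module_isos Aq N N'"
    unfolding module_isos_def mem_Collect_eq bij_betw_def
  proof (intro conjI ballI)
    show "inj_on g (carrier N)"
    proof (rule inj_onI)
      fix z w assume z: "z \<in> carrier N" and w: "w \<in> carrier N" and e: "g z = g w"
      obtain x y where xy: "x \<in> carrier L" "y \<in> carrier L" "z = \<Phi> x y" using A.Phi_ex[OF z] by blast
      obtain x' y' where xy': "x' \<in> carrier L" "y' \<in> carrier L" "w = \<Phi> x' y'" using A.Phi_ex[OF w] by blast
      from e have "\<Phi>' (f x) (f y) = \<Phi>' (f x') (f y')" by (simp add: xy xy' g)
      then have "f x = f x' \<and> f y = f y'" by (rule B.Phi_inj[rotated 4]) (simp_all add: fD(2) xy xy')
      then show "z = w" using fD(5)[OF xy(1) xy'(1)] fD(5)[OF xy(2) xy'(2)] by (simp add: xy(3) xy'(3))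
    qed
    show "g ` carrier N = carrier N'"
    proof (intro equalityI subsetI)
      fix w assume "w \<in> g ` carrier N"
      then obtain z where z: "z \<in> carrier N" "w = g z" by blast
      obtain x y where xy: "x \<in> carrier L" "y \<in> carrier L" "z = \<Phi> x y" using A.Phi_ex[OF z(1)] by blast
      show "w \<in> carrier N'" unfolding z(2) xy(3) g[OF xy(1,2)] by (rule B.Phi_closed[OF fD(2)[OF xy(1)] fD(2)[OF xy(2)]])
    next
      fix w assume "w \<in> carrier N'"
      from B.Phi_ex[OF this] obtain a b where ab: "a \<in> carrier L'" "b \<in> carrier L'" "w = \<Phi>' a b" by blast
      obtain x y where xy: "x \<in> carrier L" "a = f x" "y \<in> carrier L" "b = f y" using ab(1,2) unfolding fL[symmetric] by blast
      have "w = g (\<Phi> x y)" by (simp add: g ab(3) xy)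
      then show "w \<in> g ` carrier N" by (rule image_eqI) (rule A.Phi_closed[OF xy(1,3)])
    qed
  next
    fix z w assume z: "z \<in> carrier N" and w: "w \<in> carrier N"
    obtain x y where xy: "x \<in> carrier L" "y \<in> carrier L" "z = \<Phi> x y" using A.Phi_ex[OF z] by blast
    obtain x' y' where xy': "x' \<in> carrier L" "y' \<in> carrier L" "w = \<Phi> x' y'" using A.Phi_ex[OF w] by blast
    show "g (z \<oplus>\<^bsub>N\<^esub> w) = g z \<oplus>\<^bsub>N'\<^esub> g w"
      using xy(1,2) xy'(1,2) by (simp add: xy(3) xy'(3) g fD(2,3) B.Phi_add flip: A.Phi_add)
  next
    fix u :: "'k uea" and z assume u: "u \<in> Uq" and z: "z \<in> carrier N"
    obtain x y where xy: "x \<in> carrier L" "y \<in> carrier L" "z = \<Phi> x y" using A.Phi_ex[OF z] by blast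
    obtain a b c d where m: "dmat u a b c d" using dmat_ex[OF u] by blast
    note mc = dmat_closed[OF m]
    show "g (u \<odot>\<^bsub>N\<^esub> z) = u \<odot>\<^bsub>N'\<^esub> g z"
      using xy(1,2) mc by (simp add: xy(3) g A.dmat_act[OF m] B.dmat_act[OF m] fD(2,3,4))
  qed
  moreover have "g ` gr N \<pi> = gr N' \<pi>'"
    unfolding A.gr0 B.gr0 image_image fL[symmetric] by (rule image_cong[OF refl]) (simp add: g f0)
  moreover have "g ` gr N (\<pi> + 1) = gr N' (\<pi>' + 1)"
    unfolding A.gr1 B.gr1 image_image fL[symmetric] by (rule image_cong[OF refl]) (simp add: g f0)
  ultimately show ?thesis by (intro bexI conjI)
qed

lemma parity_change_simps:
  "module_isos R M (parity_change N) = module_isos R M N" "gr (parity_change N) i = gr N (i + 1)"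
  by (simp_all add: module_isos_def parity_change_def)

text \<open>The isomorphism matches first slots with first slots. It preserves parity if these have
  equal parity and reverses it otherwise, which is the case for
  \<open>parity_change\<close>.\<close>

lemma doubling_iso_up_to_parity:
  fixes L :: "('k::field_char_0 uea, 'l, 'p) module_scheme" and N :: "('k uea, 'n, 'q) supermodule_scheme"
    and L' :: "('k uea, 'm, 'r) module_scheme" and N' :: "('k uea, 'o, 's) supermodule_scheme"
  assumes A: "doubling L N \<pi> \<Phi>" and B: "doubling L' N' \<pi>' \<Phi>'" and iso: "module_iso Ag L L'"
  shows "iso_up_to_parity N N'"
proof -
  obtain f where f: "f \<in> module_isos Ag L L'" using iso unfolding module_iso_def by blast
  obtain g where g: "g \<in> module_isos Aq N N'" "g ` gr N \<pi> = gr N' \<pi>'" "g ` gr N (\<pi> + 1) = gr N' (\<pi>' + 1)"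
    using doubling_iso[OF A B f] by blast
  have i: "i = \<pi> \<or> i = \<pi> + 1" for i using bit_cases[of i] bit_cases[of \<pi>] by auto
  have p: "\<pi> + 1 + 1 = \<pi>" by (simp add: add.assoc)
  have "\<pi>' = \<pi> \<or> \<pi>' = \<pi> + 1" by (rule i)
  then show ?thesis
  proof
    assume e: "\<pi>' = \<pi>"
    have "g ` gr N i \<subseteq> gr N' i" for i using i[of i] g(2,3) unfolding e by (elim disjE) simp_all
    then have "supermodule_iso q_alg N N'" unfolding supermodule_iso_def using g(1) by blast
    then show ?thesis by (simp add: iso_up_to_parity_def)
  next
    assume e: "\<pi>' = \<pi> + 1"
    have "g ` gr N i \<subseteq> gr N' (i + 1)" for i using i[of i] g(2,3) unfolding e p by (elim disjE) (simp_all add: p)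
    then have "supermodule_iso q_alg N (parity_change N')"
      unfolding supermodule_iso_def parity_change_simps using g(1) by blast
    then show ?thesis by (simp add: iso_up_to_parity_def)
  qed
qed

text \<open>The copy of parity \<open>\<pi>\<close> is recovered as the image of the odd identity matrix.\<close>

lemma iso_up_to_parity_doubling:
  fixes L :: "('k::field_char_0 uea, 'l, 'p) module_scheme" and N :: "('k uea, 'n, 'q) supermodule_scheme"
    and L' :: "('k uea, 'm, 'r) module_scheme" and N' :: "('k uea, 'o, 's) supermodule_scheme"
  assumes "doubling L N \<pi> \<Phi>" "doubling L' N' \<pi>' \<Phi>'" and iso: "iso_up_to_parity N N'"
  shows "module_iso Ag L L'"
proof -
  interpret A: doubling L N \<pi> \<Phi> by fact
  interpret B: doubling L' N' \<pi>' \<Phi>' by fact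
  obtain h where h: "h \<in> module_isos Aq N N'"
    using iso unfolding iso_up_to_parity_def supermodule_iso_def parity_change_simps by blast
  note hD = module_isosD[OF h]
  have hN: "h ` carrier N = carrier N'" using hD(1) by (simp add: bij_betw_def)
  let ?z = "ugen q_alg (blockM 0 (mat 1)) :: 'k uea"
  have z: "?z \<in> Uq" by (rule A.N.ugen_closed[OF q_algI(2)])
  have two: "2 \<noteq> (0 :: 'k)" by simp
  \<comment> \<open>The odd identity doubles what it moves into the first slot; one half in the
    argument makes every vector of that slot a value.\<close>
  have Az: "?z \<odot>\<^bsub>N\<^esub> \<Phi> (zr L) (ucst g_alg (inverse 2) \<odot>\<^bsub>L\<^esub> x) = \<Phi> x (zr L)" if x: "x \<in> carrier L" for x
    using x A.L.cs_inverse[of "inverse 2" x] by (simp add: A.zbar)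
  have Bz: "?z \<odot>\<^bsub>N'\<^esub> \<Phi>' (zr L') (ucst g_alg (inverse 2) \<odot>\<^bsub>L'\<^esub> x) = \<Phi>' x (zr L')" if x: "x \<in> carrier L'" for x
    using x B.L.cs_inverse[of "inverse 2" x] by (simp add: B.zbar)
  have "\<forall>x\<in>carrier L. \<exists>a. a \<in> carrier L' \<and> h (\<Phi> x (zr L)) = \<Phi>' a (zr L')"
  proof
    fix x assume x: "x \<in> carrier L"
    define w where "w = \<Phi> (zr L) (ucst g_alg (inverse 2) \<odot>\<^bsub>L\<^esub> x)"
    have w: "w \<in> carrier N" unfolding w_def using x by (simp add: A.Phi_closed)
    obtain a b where ab: "a \<in> carrier L'" "b \<in> carrier L'" "h w = \<Phi>' a b" using B.Phi_ex[OF hD(2)[OF w]] by blast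
    have "h (\<Phi> x (zr L)) = ?z \<odot>\<^bsub>N'\<^esub> h w" unfolding Az[OF x, symmetric] w_def[symmetric] by (rule hD(4)[OF z w])
    then have "h (\<Phi> x (zr L)) = \<Phi>' (ucst g_alg 2 \<odot>\<^bsub>L'\<^esub> b) (zr L')" unfolding ab(3) B.zbar[OF ab(1,2)] .
    then show "\<exists>a. a \<in> carrier L' \<and> h (\<Phi> x (zr L)) = \<Phi>' a (zr L')" using ab(2) by (intro exI conjI) simp_all
  qed
  from bchoice[OF this] obtain f where f: "\<And>x. x \<in> carrier L ==> f x \<in> carrier L'"
    "\<And>x. x \<in> carrier L ==> h (\<Phi> x (zr L)) = \<Phi>' (f x) (zr L')" by blast
  have fI: "f x = a" if "x \<in> carrier L" "a \<in> carrier L'" "h (\<Phi> x (zr L)) = \<Phi>' a (zr L')" for x a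
  proof -
    have "f x = a \<and> (zr L') = (zr L')"
      by (rule B.Phi_inj) (use that f in simp_all)
    then show ?thesis ..
  qed
  have c: "\<Phi> x (zr L) \<in> carrier N" if "x \<in> carrier L" for x using that by (simp add: A.Phi_closed)
  have "f \<in> module_isos Ag L L'"
    unfolding module_isos_def mem_Collect_eq bij_betw_def
  proof (intro conjI ballI)
    show "inj_on f (carrier L)"
    proof (rule inj_onI)
      fix x y assume x: "x \<in> carrier L" and y: "y \<in> carrier L" and e: "f x = f y"
      have "h (\<Phi> x (zr L)) = h (\<Phi> y (zr L))" unfolding f(2)[OF x] f(2)[OF y] e ..
      then have "\<Phi> x (zr L) = \<Phi> y (zr L)" by (rule hD(5)[OF c[OF x] c[OF y]])
      then show "x = y" using A.Phi_inj[OF x A.L.M.zero_closed y A.L.M.zero_closed] by blast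
    qed
    show "f ` carrier L = carrier L'"
    proof (intro equalityI subsetI)
      fix a assume "a \<in> f ` carrier L"
      then show "a \<in> carrier L'" using f(1) by blast
    next
      fix a assume a: "a \<in> carrier L'"
      define w where "w = \<Phi>' (zr L') (ucst g_alg (inverse 2) \<odot>\<^bsub>L'\<^esub> a)"
      have "w \<in> carrier N'" unfolding w_def using a by (simp add: B.Phi_closed)
      then obtain v where v: "v \<in> carrier N" "w = h v" unfolding hN[symmetric] by blast
      obtain x y where xy: "x \<in> carrier L" "y \<in> carrier L" "v = \<Phi> x y" using A.Phi_ex[OF v(1)] by blast
      have y2: "ucst g_alg 2 \<odot>\<^bsub>L\<^esub> y \<in> carrier L" using xy by simp
      have "h (\<Phi> (ucst g_alg 2 \<odot>\<^bsub>L\<^esub> y) (zr L)) = ?z \<odot>\<^bsub>N'\<^esub> w"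
        unfolding A.zbar[OF xy(1,2), symmetric] v(2) xy(3) by (rule hD(4)[OF z A.Phi_closed[OF xy(1,2)]])
      also have "\<dots> = \<Phi>' a (zr L')" unfolding w_def by (rule Bz[OF a])
      finally have "f (ucst g_alg 2 \<odot>\<^bsub>L\<^esub> y) = a" by (rule fI[OF y2 a])
      then show "a \<in> f ` carrier L" using y2 by (rule image_eqI[OF sym])
    qed
  next
    fix x y assume x: "x \<in> carrier L" and y: "y \<in> carrier L"
    have "h (\<Phi> (x \<oplus>\<^bsub>L\<^esub> y) (zr L)) = h (\<Phi> x (zr L)) \<oplus>\<^bsub>N'\<^esub> h (\<Phi> y (zr L))"
      unfolding hD(3)[OF c[OF x] c[OF y], symmetric] using x y by (simp flip: A.Phi_add)
    also have "\<dots> = \<Phi>' (f x \<oplus>\<^bsub>L'\<^esub> f y) (zr L')"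
      unfolding f(2)[OF x] f(2)[OF y] using f(1)[OF x] f(1)[OF y] by (simp flip: B.Phi_add)
    finally show "f (x \<oplus>\<^bsub>L\<^esub> y) = f x \<oplus>\<^bsub>L'\<^esub> f y" by (rule fI[rotated 2]) (use x y f(1) in simp_all)
  next
    fix u :: "'k uea" and x assume u: "u \<in> Ug" and x: "x \<in> carrier L"
    have "h (\<Phi> (u \<odot>\<^bsub>L\<^esub> x) (zr L)) = h (env_map g_alg q_alg u \<odot>\<^bsub>N\<^esub> \<Phi> x (zr L))"
      using u x by (simp add: A.env_map_act)
    also have "\<dots> = env_map g_alg q_alg u \<odot>\<^bsub>N'\<^esub> \<Phi>' (f x) (zr L')"
      unfolding f(2)[OF x, symmetric] by (rule hD(4)[OF A.env_map_g_closed[OF u] c[OF x]])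
    also have "\<dots> = \<Phi>' (u \<odot>\<^bsub>L'\<^esub> f x) (zr L')" using u f(1)[OF x] by (simp add: B.env_map_act)
    finally show "f (u \<odot>\<^bsub>L\<^esub> x) = u \<odot>\<^bsub>L'\<^esub> f x" by (rule fI[rotated 2]) (use u x f(1) in simp_all)
  qed
  then show ?thesis unfolding module_iso_def by blast
qed

subsection \<open>Copies of simple modules in large types\<close>

lemma transport_module:
  fixes M :: "('a, 'b, 'm) module_scheme"
  assumes M: "left_module R M" and \<eta>: "inj_on \<eta> (carrier M)"
  shows "\<exists>M' :: ('a, 'c) module. left_module R M' \<and> \<eta> \<in> module_isos R M M'"
proof -
  interpret M: left_module R M by fact
  define i where "i = inv_into (carrier M) \<eta>"
  have i: "i (\<eta> x) = x" if "x \<in> carrier M" for x unfolding i_def by (rule inv_into_f_f[OF \<eta> that])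
  define M' :: "('a, 'c) module" where "M' = \<lparr>carrier = \<eta> ` carrier M, mult = undefined, one = undefined,
    ring.zero = \<eta> (zr M), add = (\<lambda>a b. \<eta> (i a \<oplus>\<^bsub>M\<^esub> i b)), smult = (\<lambda>r a. \<eta> (r \<odot>\<^bsub>M\<^esub> i a))\<rparr>"
  have "left_module R M'" by (rule left_module_image[OF M, where f = \<eta>]) (simp_all add: M'_def i)
  moreover have "\<eta> \<in> module_isos R M M'" using \<eta> by (simp add: module_isos_def bij_betw_def M'_def i)
  ultimately show ?thesis by blast
qed

lemma transport_supermodule:
  fixes M :: "('k::field uea, 'b, 'm) supermodule_scheme"
  assumes lie: "graded_lie S" and M: "is_supermodule S M" and \<eta>: "inj_on \<eta> (carrier M)"
  shows "\<exists>M' :: ('k uea, 'c) supermodule. is_supermodule S M' \<and> \<eta> \<in> module_isos (UEA S) M M' \<and> (\<forall>i. \<eta> ` gr M i = gr M' i)"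
proof -
  interpret M: umod S M by (rule is_supermodule_umod[OF lie M])
  define i where "i = inv_into (carrier M) \<eta>"
  have i: "i (\<eta> x) = x" if "x \<in> carrier M" for x unfolding i_def by (rule inv_into_f_f[OF \<eta> that])
  define M' :: "('k uea, 'c) supermodule" where "M' = \<lparr>carrier = \<eta> ` carrier M, mult = undefined, one = undefined,
    ring.zero = \<eta> (zr M), add = (\<lambda>a b. \<eta> (i a \<oplus>\<^bsub>M\<^esub> i b)), smult = (\<lambda>r a. \<eta> (r \<odot>\<^bsub>M\<^esub> i a)), gr = (\<lambda>k. \<eta> ` gr M k)\<rparr>"
  have b: "bij_betw \<eta> (carrier M) (carrier M')" using \<eta> by (simp add: bij_betw_def M'_def)
  have "is_supermodule S M'" by (rule supermodule_image[OF lie M b]) (simp_all add: M'_def i)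
  moreover have "\<eta> \<in> module_isos (UEA S) M M'" using b by (simp add: module_isos_def M'_def i)
  moreover have "\<forall>k. \<eta> ` gr M k = gr M' k" by (simp add: M'_def)
  ultimately show ?thesis by blast
qed

lemma inj_pair: "\<exists>p :: 'k::field_char_0 \<times> 'k \<Rightarrow> 'k. inj p"
proof -
  have "(card_of ((UNIV :: 'k set) \<times> (UNIV :: 'k set)), card_of (UNIV :: 'k set)) \<in> ordIso"
    by (rule card_of_Times_same_infinite[OF infinite_UNIV_char_0])
  then have "\<exists>p. bij_betw p ((UNIV :: 'k set) \<times> (UNIV :: 'k set)) (UNIV :: 'k set)" unfolding card_of_ordIso .
  then obtain p :: "'k \<times> 'k \<Rightarrow> 'k" where "bij_betw p (UNIV \<times> UNIV) UNIV" ..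
  then show ?thesis unfolding bij_betw_def by (intro exI[of _ p]) simp
qed

text \<open>Nested pairing ending in 0 is injective only among lists of equal length, since 0 may
  itself be the code of a pair; the length is therefore stored as well.\<close>

lemma inj_list: "\<exists>e :: 'k::field_char_0 list \<Rightarrow> 'k. inj e"
proof -
  obtain p :: "'k \<times> 'k \<Rightarrow> 'k" where p: "inj p" using inj_pair by blast
  define enc where "enc xs = foldr (\<lambda>x r. p (x, r)) xs 0" for xs
  have enc: "length xs = length ys ==> enc xs = enc ys \<longrightarrow> xs = ys" for xs ys
    by (induction xs ys rule: list_induct2) (simp_all add: enc_def inj_eq[OF p])
  have "inj (\<lambda>xs. p (of_nat (length xs), enc xs))"
    by (rule injI) (simp add: inj_eq[OF p] enc)
  then show ?thesis by blast
qed

lemma inj_vec: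
  assumes e: "inj (e :: 'a \<Rightarrow> 'k::field_char_0)"
  shows "\<exists>e' :: 'a ^ 'n \<Rightarrow> 'k. inj e'"
proof -
  obtain l :: "'k list \<Rightarrow> 'k" where l: "inj l" using inj_list by blast
  obtain xs :: "'n list" where xs: "set xs = UNIV" using finite_list[OF finite] by blast
  have "inj (\<lambda>x :: 'a ^ 'n. l (map (\<lambda>i. e (x $ i)) xs))"
    by (rule injI) (simp add: inj_eq[OF l] inj_eq[OF e] xs vec_eq_iff)
  then show ?thesis by blast
qed

lemma inj_fword:
  assumes e: "inj (e :: 'a \<Rightarrow> 'k::field_char_0)"
  shows "\<exists>e' :: 'a fword \<Rightarrow> 'k. inj e'"
proof -
  obtain l :: "'k list \<Rightarrow> 'k" where l: "inj l" using inj_list by blast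
  have "inj (\<lambda>w. l (map e (letters w)))"
    by (rule injI) (simp add: inj_eq[OF l] inj_map_eq_map[OF e] fword.expand)
  then show ?thesis by blast
qed

text \<open>An element is coded by the list of its pairs of key and value, in an arbitrary order of
  the keys. The set of these pairs determines the values on the support, and comparison in both
  directions settles the rest.\<close>

lemma inj_poly_mapping:
  assumes e: "inj (e :: 'a \<Rightarrow> 'k::field_char_0)"
  shows "\<exists>e' :: ('a \<Rightarrow>\<^sub>0 'k) \<Rightarrow> 'k. inj e'"
proof -
  obtain l :: "'k list \<Rightarrow> 'k" where l: "inj l" using inj_list by blast
  obtain p :: "'k \<times> 'k \<Rightarrow> 'k" where p: "inj p" using inj_pair by blast
  define ks where "ks q = (SOME xs. set xs = Poly_Mapping.keys q)" for q :: "'a \<Rightarrow>\<^sub>0 'k"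
  have ks: "set (ks q) = Poly_Mapping.keys q" for q
    unfolding ks_def by (rule someI_ex[OF finite_list[OF finite_keys]])
  define e' where "e' q = l (map (\<lambda>k. p (e k, Poly_Mapping.lookup q k)) (ks q))" for q
  have sub: "Poly_Mapping.lookup q k = Poly_Mapping.lookup q' k"
    if eq: "e' q = e' q'" and k: "k \<in> Poly_Mapping.keys q" for q q' k
  proof -
    have "map (\<lambda>k. p (e k, Poly_Mapping.lookup q k)) (ks q) = map (\<lambda>k. p (e k, Poly_Mapping.lookup q' k)) (ks q')"
      using eq unfolding e'_def by (rule injD[OF l])
    then have "(\<lambda>k. p (e k, Poly_Mapping.lookup q k)) ` set (ks q) = (\<lambda>k. p (e k, Poly_Mapping.lookup q' k)) ` set (ks q')"
      unfolding set_map[symmetric] by (rule arg_cong)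
    then have "p (e k, Poly_Mapping.lookup q k) \<in> (\<lambda>k. p (e k, Poly_Mapping.lookup q' k)) ` Poly_Mapping.keys q'"
      using k unfolding ks by blast
    then obtain k' where "p (e k, Poly_Mapping.lookup q k) = p (e k', Poly_Mapping.lookup q' k')" by blast
    then have "e k = e k'" "Poly_Mapping.lookup q k = Poly_Mapping.lookup q' k'" by (simp_all add: inj_eq[OF p])
    then show ?thesis by (simp add: inj_eq[OF e])
  qed
  have "inj e'"
  proof (rule injI)
    fix q q' assume eq: "e' q = e' q'"
    show "q = q'"
    proof (rule poly_mapping_eqI)
      fix k
      consider "k \<in> Poly_Mapping.keys q" | "k \<in> Poly_Mapping.keys q'" | "k \<notin> Poly_Mapping.keys q" "k \<notin> Poly_Mapping.keys q'" by blast
      then show "Poly_Mapping.lookup q k = Poly_Mapping.lookup q' k"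
      proof cases
        case 1
        then show ?thesis by (rule sub[OF eq])
      next
        case 2
        then show ?thesis by (rule sub[OF eq[symmetric], symmetric])
      next
        case 3
        then show ?thesis by (simp add: in_keys_iff)
      qed
    qed
  qed
  then show ?thesis by blast
qed

text \<open>A simple module is cyclic, hence a quotient of the free algebra.\<close>

lemma inj_simple_module:
  fixes M :: "('k::field_char_0 uea, 'b, 'm) module_scheme"
  assumes lie: "graded_lie S" and M: "simple_module (UEA S) M"
  shows "\<exists>e :: 'b \<Rightarrow> 'k. inj_on e (carrier M)"
proof -
  interpret M: umod S M using M by (intro left_module_umod[OF lie]) (simp add: simple_module_def)
  have "carrier M \<noteq> {(zr M)}" using M by (simp add: simple_module_def)
  then obtain x0 where x0: "x0 \<in> carrier M" "x0 \<noteq> (zr M)" using M.M.zero_closed by blast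
  define C where "C = (\<lambda>u. u \<odot>\<^bsub>M\<^esub> x0) ` carrier (UEA S)"
  have CI: "x \<in> C" if "x = u \<odot>\<^bsub>M\<^esub> x0" "u \<in> carrier (UEA S)" for x u unfolding C_def using that by (rule image_eqI)
  have CE: "\<exists>u\<in>carrier (UEA S). x = u \<odot>\<^bsub>M\<^esub> x0" if "x \<in> C" for x using that unfolding C_def by blast
  have "submodule C (UEA S) M"
  proof (intro submodule.intro submodule_axioms.intro M.M.add_subgroupI)
    show "C \<subseteq> carrier M" unfolding C_def using x0(1) by auto
    show "(zr M) \<in> C" by (rule CI[OF _ M.R.zero_closed]) (simp add: x0)
    fix x assume "x \<in> C"
    then obtain u where u: "u \<in> carrier (UEA S)" "x = u \<odot>\<^bsub>M\<^esub> x0" using CE by blast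
    show "\<ominus>\<^bsub>M\<^esub> x \<in> C"
      by (rule CI[of _ "ucst S (- 1) \<otimes>\<^bsub>UEA S\<^esub> u"]) (simp_all add: u x0 M.lsmult_assoc M.cs_uminus M.cs_one)
    show "r \<odot>\<^bsub>M\<^esub> x \<in> C" if "r \<in> carrier (UEA S)" for r
      by (rule CI[of _ "r \<otimes>\<^bsub>UEA S\<^esub> u"]) (simp_all add: u x0 M.lsmult_assoc that)
    fix y assume "y \<in> C"
    then obtain v where v: "v \<in> carrier (UEA S)" "y = v \<odot>\<^bsub>M\<^esub> x0" using CE by blast
    show "x \<oplus>\<^bsub>M\<^esub> y \<in> C"
      by (rule CI[of _ "u \<oplus>\<^bsub>UEA S\<^esub> v"]) (simp_all add: u v x0 M.lsmult_l_distr)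
  qed
  then have "C = {(zr M)} \<or> C = carrier M" using M by (simp add: simple_module_def)
  moreover have "x0 \<in> C" by (rule CI[OF _ M.R.one_closed]) (simp add: x0)
  ultimately have C: "C = carrier M" using x0(2) by blast
  have Ceq: "C = (\<lambda>p. env_class S p \<odot>\<^bsub>M\<^esub> x0) ` carrier (env_free S)"
    by (simp add: C_def M.carrier_UEA image_image)
  define c where "c = inv_into (carrier (env_free S)) (\<lambda>p. env_class S p \<odot>\<^bsub>M\<^esub> x0)"
  have c: "x = env_class S (c x) \<odot>\<^bsub>M\<^esub> x0" if x: "x \<in> carrier M" for x
    unfolding c_def by (rule f_inv_into_f[symmetric]) (use x in \<open>simp only: Ceq[symmetric] C\<close>)
  have "\<exists>e :: 'k smat \<Rightarrow> 'k. inj e"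
  proof -
    obtain e :: "'k ^ (2 + 2) \<Rightarrow> 'k" where e: "inj e" using inj_vec[OF inj_on_id2] by blast
    show ?thesis by (rule inj_vec[OF e])
  qed
  then obtain e :: "'k smat \<Rightarrow> 'k" where e: "inj e" by blast
  obtain e1 :: "'k smat fword \<Rightarrow> 'k" where e1: "inj e1" using inj_fword[OF e] by blast
  obtain e2 :: "('k smat fword \<Rightarrow>\<^sub>0 'k) \<Rightarrow> 'k" where e2: "inj e2" using inj_poly_mapping[OF e1] by blast
  have "inj_on (\<lambda>x. e2 (c x)) (carrier M)"
  proof (rule inj_onI)
    fix x y assume x: "x \<in> carrier M" and y: "y \<in> carrier M" and "e2 (c x) = e2 (c y)"
    then have e: "c x = c y" by (simp add: inj_eq[OF e2])
    have "x = env_class S (c x) \<odot>\<^bsub>M\<^esub> x0" by (rule c[OF x])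
    also have "\<dots> = env_class S (c y) \<odot>\<^bsub>M\<^esub> x0" by (simp only: e)
    also have "\<dots> = y" by (rule c[OF y, symmetric])
    finally show "x = y" .
  qed
  then show ?thesis by (intro exI)
qed

subsection \<open>The underlying module of the even part\<close>

lemma left_module_direct_sum:
  assumes "left_module R M" "left_module R N"
  shows "left_module R (direct_sum M N)"
proof -
  interpret M: left_module R M by fact
  interpret N: left_module R N by fact
  show ?thesis
    by (intro left_module.intro M.R.ring_axioms abelian_group_direct_sum M.M.abelian_group_axioms
        N.M.abelian_group_axioms left_module_axioms.intro)
      (auto simp: direct_sum_simps M.lsmult_l_distr N.lsmult_l_distr M.lsmult_r_distr N.lsmult_r_distr
        M.lsmult_assoc N.lsmult_assoc)
qed

context doubling
begin

abbreviation Ng where "Ng \<equiv> restrict_scalars g_alg q_alg N"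

lemma left_module_Ng: "left_module Ag Ng"
  by (rule left_module_restrict_scalars[OF N.left_module_axioms])

lemma slot:
  assumes c: "\<And>x. x \<in> carrier L ==> \<iota> x \<in> carrier N"
    and a: "\<And>x y. [|x \<in> carrier L; y \<in> carrier L|] ==> \<iota> (x \<oplus>\<^bsub>L\<^esub> y) = \<iota> x \<oplus>\<^bsub>N\<^esub> \<iota> y"
    and i: "\<And>x y. [|x \<in> carrier L; y \<in> carrier L; \<iota> x = \<iota> y|] ==> x = y"
    and u: "\<And>u x. [|u \<in> Ug; x \<in> carrier L|] ==> \<iota> (u \<odot>\<^bsub>L\<^esub> x) = env_map g_alg q_alg u \<odot>\<^bsub>N\<^esub> \<iota> x"
    and z: "\<iota> (zr L) = (zr N)"
  shows "left_module Ag (Ng\<lparr>carrier := \<iota> ` carrier L\<rparr>)"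
    "\<iota> \<in> module_isos Ag L (Ng\<lparr>carrier := \<iota> ` carrier L\<rparr>)"
    "submodule (\<iota> ` carrier L) Ag Ng"
proof -
  note r = restrict_scalars_simps
  show "left_module Ag (Ng\<lparr>carrier := \<iota> ` carrier L\<rparr>)"
    by (rule left_module_image[OF L.left_module_axioms, where f = \<iota>]) (simp_all add: r a u z)
  have "inj_on \<iota> (carrier L)" by (rule inj_onI, rule i)
  then show "\<iota> \<in> module_isos Ag L (Ng\<lparr>carrier := \<iota> ` carrier L\<rparr>)"
    by (simp add: module_isos_def bij_betw_def r a u)
  interpret R: left_module "Ag" Ng by (rule left_module_Ng)
  show "submodule (\<iota> ` carrier L) Ag Ng"
  proof (intro submodule.intro submodule_axioms.intro R.M.add_subgroupI)
    show "\<iota> ` carrier L \<subseteq> carrier Ng" using c by (simp add: r image_subset_iff)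
    show "(zr Ng) \<in> \<iota> ` carrier L" by (rule image_eqI[of _ _ "(zr L)"]) (simp_all add: r z)
    fix w assume "w \<in> \<iota> ` carrier L"
    then obtain x where x: "w = \<iota> x" "x \<in> carrier L" by blast
    have "\<ominus>\<^bsub>Ng\<^esub> w = \<iota> (\<ominus>\<^bsub>L\<^esub> x)"
    proof (rule R.M.minus_equality)
      show "\<iota> (\<ominus>\<^bsub>L\<^esub> x) \<oplus>\<^bsub>Ng\<^esub> w = (zr Ng)" using x by (simp add: r z L.M.l_neg flip: a)
    qed (simp_all add: r c x)
    then show "\<ominus>\<^bsub>Ng\<^esub> w \<in> \<iota> ` carrier L" by (rule image_eqI) (simp add: x)
    show "v \<odot>\<^bsub>Ng\<^esub> w \<in> \<iota> ` carrier L" if v: "v \<in> Ug" for v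
      by (rule image_eqI[of _ _ "v \<odot>\<^bsub>L\<^esub> x"]) (simp_all add: r u x v)
    fix w' assume "w' \<in> \<iota> ` carrier L"
    then obtain x' where x': "w' = \<iota> x'" "x' \<in> carrier L" by blast
    show "w \<oplus>\<^bsub>Ng\<^esub> w' \<in> \<iota> ` carrier L"
      by (rule image_eqI[of _ _ "x \<oplus>\<^bsub>L\<^esub> x'"]) (simp_all add: r a x x')
  qed
qed

lemma slot_left: "x \<in> carrier L ==> y \<in> carrier L ==> \<Phi> x (zr L) = \<Phi> y (zr L) ==> x = y"
  using Phi_inj[of x "(zr L)" y "(zr L)"] by simp

lemma slot_right: "x \<in> carrier L ==> y \<in> carrier L ==> \<Phi> (zr L) x = \<Phi> (zr L) y ==> x = y"
  using Phi_inj[of "(zr L)" x "(zr L)" y] by simp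

lemma slots:
  "left_module Ag (Ng\<lparr>carrier := (\<lambda>x. \<Phi> x (zr L)) ` carrier L\<rparr>)"
  "(\<lambda>x. \<Phi> x (zr L)) \<in> module_isos Ag L (Ng\<lparr>carrier := (\<lambda>x. \<Phi> x (zr L)) ` carrier L\<rparr>)"
  "submodule ((\<lambda>x. \<Phi> x (zr L)) ` carrier L) Ag Ng"
  "left_module Ag (Ng\<lparr>carrier := (\<lambda>x. \<Phi> (zr L) x) ` carrier L\<rparr>)"
  "(\<lambda>x. \<Phi> (zr L) x) \<in> module_isos Ag L (Ng\<lparr>carrier := (\<lambda>x. \<Phi> (zr L) x) ` carrier L\<rparr>)"
  "submodule ((\<lambda>x. \<Phi> (zr L) x) ` carrier L) Ag Ng"
proof -
  have p1: "\<Phi> x (zr L) \<in> carrier N" "\<Phi> (zr L) x \<in> carrier N" if "x \<in> carrier L" for x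
    using that by (simp_all add: Phi_closed)
  have p2: "\<Phi> (x \<oplus>\<^bsub>L\<^esub> y) (zr L) = \<Phi> x (zr L) \<oplus>\<^bsub>N\<^esub> \<Phi> y (zr L)" "\<Phi> (zr L) (x \<oplus>\<^bsub>L\<^esub> y) = \<Phi> (zr L) x \<oplus>\<^bsub>N\<^esub> \<Phi> (zr L) y"
    if "x \<in> carrier L" "y \<in> carrier L" for x y
    using that by (simp_all flip: Phi_add)
  have p3: "\<Phi> (u \<odot>\<^bsub>L\<^esub> x) (zr L) = env_map g_alg q_alg u \<odot>\<^bsub>N\<^esub> \<Phi> x (zr L)"
    "\<Phi> (zr L) (u \<odot>\<^bsub>L\<^esub> x) = env_map g_alg q_alg u \<odot>\<^bsub>N\<^esub> \<Phi> (zr L) x"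
    if "u \<in> Ug" "x \<in> carrier L" for u x
    using that by (simp_all add: env_map_act)
  note s1 = slot[where \<iota> = "\<lambda>x. \<Phi> x (zr L)", OF p1(1) p2(1) slot_left p3(1) Phi_zero]
  note s2 = slot[where \<iota> = "\<lambda>x. \<Phi> (zr L) x", OF p1(2) p2(2) slot_right p3(2) Phi_zero]
  show "left_module Ag (Ng\<lparr>carrier := (\<lambda>x. \<Phi> x (zr L)) ` carrier L\<rparr>)"
    "(\<lambda>x. \<Phi> x (zr L)) \<in> module_isos Ag L (Ng\<lparr>carrier := (\<lambda>x. \<Phi> x (zr L)) ` carrier L\<rparr>)"
    "submodule ((\<lambda>x. \<Phi> x (zr L)) ` carrier L) Ag Ng"
    by (rule s1; assumption)+
  show "left_module Ag (Ng\<lparr>carrier := (\<lambda>x. \<Phi> (zr L) x) ` carrier L\<rparr>)"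
    "(\<lambda>x. \<Phi> (zr L) x) \<in> module_isos Ag L (Ng\<lparr>carrier := (\<lambda>x. \<Phi> (zr L) x) ` carrier L\<rparr>)"
    "submodule ((\<lambda>x. \<Phi> (zr L) x) ` carrier L) Ag Ng"
    by (rule s2; assumption)+
qed

lemma Ng_direct_sum: "module_iso Ag Ng (direct_sum L L)"
proof -
  have "(\<lambda>(x, y). \<Phi> x y) \<in> module_isos Ag (direct_sum L L) Ng"
    unfolding module_isos_def mem_Collect_eq direct_sum_simps restrict_scalars_simps
    by (intro conjI bij) (auto simp: Phi_add env_map_act)
  then have "inv_into (carrier (direct_sum L L)) (\<lambda>(x, y). \<Phi> x y) \<in> module_isos Ag Ng (direct_sum L L)"
    by (rule module_isos_inv[OF _ left_module_direct_sum[OF L.left_module_axioms L.left_module_axioms]])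
  then show ?thesis unfolding module_iso_def by blast
qed

text \<open>The even part is the first or the second slot according to \<open>\<pi>\<close>, and
  over gl(2) both are copies of \<open>L\<close>.\<close>

lemma Ng_even: "module_iso Ag (Ng\<lparr>carrier := gr N 0\<rparr>) L"
  using bit_cases[of \<pi>]
proof
  assume "\<pi> = 0"
  then have g: "gr N 0 = (\<lambda>x. \<Phi> x (zr L)) ` carrier L" using gr0 by simp
  show ?thesis unfolding g module_iso_def using module_isos_inv[OF slots(2) L.left_module_axioms] by blast
next
  assume "\<pi> = 1"
  then have g: "gr N 0 = (\<lambda>x. \<Phi> (zr L) x) ` carrier L" using gr1 by simp
  show ?thesis unfolding g module_iso_def using module_isos_inv[OF slots(5) L.left_module_axioms] by blast
qed

text \<open>Both slots are simple submodules over gl(2), and together they span the module.\<close>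

lemma Ng_semisimple:
  assumes L: "simple_module Ag L"
  shows "semisimple_module Ag Ng"
  unfolding semisimple_module_def
proof (intro conjI left_module_Ng allI impI)
  interpret R: left_module "Ag" Ng by (rule left_module_Ng)
  fix H assume "submodule H Ag Ng \<and> (\<forall>K. submodule K Ag Ng \<and> simple_module Ag (Ng\<lparr>carrier := K\<rparr>) \<longrightarrow> K \<subseteq> H)"
  then have H: "submodule H Ag Ng"
    and K: "\<And>K. [|submodule K Ag Ng; simple_module Ag (Ng\<lparr>carrier := K\<rparr>)|] ==> K \<subseteq> H" by simp_all
  note HD = R.M.add_subgroupD[OF submodule.axioms(1)[OF H], unfolded restrict_scalars_simps]
  note s1 = K[OF slots(3) module_isos_simple[OF slots(2) L slots(1)]]
  note s2 = K[OF slots(6) module_isos_simple[OF slots(5) L slots(4)]]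
  show "H = carrier Ng"
    unfolding restrict_scalars_simps
  proof (intro equalityI subsetI)
    show "w \<in> carrier N" if "w \<in> H" for w by (rule subsetD[OF HD(1) that])
    fix w assume "w \<in> carrier N"
    from Phi_ex[OF this] obtain x y where xy: "x \<in> carrier L" "y \<in> carrier L" "w = \<Phi> x y" by blast
    show "w \<in> H" unfolding xy(3) Phi_split[OF xy(1,2)]
      by (rule HD(4)[OF subsetD[OF s1 imageI[OF xy(1)]] subsetD[OF s2 imageI[OF xy(2)]]])
  qed
qed

end

subsection \<open>The bijection\<close>

text \<open>A relation \<open>D\<close> that is total on both sides and matches \<open>RA\<close>
  with \<open>RB\<close> induces a bijection of classes. The laws of \<open>RB\<close> used in the
  proof are inherited from \<open>RA\<close> through \<open>D\<close>.\<close>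

lemma bij_betw_quotients:
  assumes RA: "RA \<subseteq> A \<times> A" "\<And>a. a \<in> A ==> (a, a) \<in> RA" "\<And>a b. (a, b) \<in> RA ==> (b, a) \<in> RA"
      "\<And>a b c. (a, b) \<in> RA ==> (b, c) \<in> RA ==> (a, c) \<in> RA"
    and A: "\<And>a. a \<in> A ==> \<exists>b\<in>B. D a b" and B: "\<And>b. b \<in> B ==> \<exists>a\<in>A. D a b"
    and D: "\<And>a b a' b'. [|a \<in> A; b \<in> B; a' \<in> A; b' \<in> B; D a b; D a' b'|] ==> (a, a') \<in> RA \<longleftrightarrow> (b, b') \<in> RB"
    and RB: "RB \<subseteq> B \<times> B"
    and F: "\<And>c b. c \<in> A // RA ==> b \<in> F c \<longleftrightarrow> b \<in> B \<and> (\<exists>a\<in>c. \<exists>a'\<in>A. D a' b \<and> (a', a) \<in> RA)"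
  shows "bij_betw F (A // RA) (B // RB)"
proof -
  have cls: "F (RA `` {a}) = RB `` {b}" if ab: "a \<in> A" "b \<in> B" "D a b" for a b
  proof (intro equalityI subsetI)
    note q = quotientI[OF ab(1), of RA]
    fix b' assume "b' \<in> F (RA `` {a})"
    then obtain a1 a' where b': "b' \<in> B" "(a, a1) \<in> RA" "a' \<in> A" "D a' b'" "(a', a1) \<in> RA" unfolding F[OF q] by blast
    have "(a, a') \<in> RA" by (rule RA(4)[OF b'(2) RA(3)[OF b'(5)]])
    then have "(b, b') \<in> RB" using D[OF ab(1,2) b'(3,1) ab(3) b'(4)] by (rule rev_iffD1)
    then show "b' \<in> RB `` {b}" by blast
  next
    note q = quotientI[OF ab(1), of RA]
    fix b' assume "b' \<in> RB `` {b}"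
    then have b: "(b, b') \<in> RB" by blast
    then have b': "b' \<in> B" using RB by blast
    from B[OF this] obtain a' where a': "a' \<in> A" "D a' b'" by blast
    have "(a, a') \<in> RA" using b D[OF ab(1,2) a'(1) b' ab(3) a'(2)] by (rule rev_iffD2)
    then have "(a', a) \<in> RA" by (rule RA(3))
    then show "b' \<in> F (RA `` {a})" unfolding F[OF q] using b' a' RA(2)[OF ab(1)] by blast
  qed
  show ?thesis
    unfolding bij_betw_def
  proof
    show "inj_on F (A // RA)"
    proof (rule inj_onI)
      fix c c' assume "c \<in> A // RA" "c' \<in> A // RA" and e: "F c = F c'"
      then obtain a a' where a: "a \<in> A" "c = RA `` {a}" "a' \<in> A" "c' = RA `` {a'}" by (elim quotientE) (rule that)
      obtain b b' where b: "b \<in> B" "D a b" "b' \<in> B" "D a' b'" using A[OF a(1)] A[OF a(3)] by blast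
      have "RB `` {b} = RB `` {b'}" using e unfolding a cls[OF a(1) b(1,2)] cls[OF a(3) b(3,4)] .
      moreover have "(b', b') \<in> RB" using RA(2)[OF a(3)] D[OF a(3) b(3) a(3) b(3) b(4) b(4)] by (rule rev_iffD1)
      ultimately have "(b, b') \<in> RB" by blast
      then have r: "(a, a') \<in> RA" using D[OF a(1) b(1) a(3) b(3) b(2) b(4)] by (rule rev_iffD2)
      show "c = c'"
        unfolding a(2,4)
      proof (intro equalityI subsetI)
        fix x assume "x \<in> RA `` {a}"
        then have "(a, x) \<in> RA" by blast
        then have "(a', x) \<in> RA" by (rule RA(4)[OF RA(3)[OF r]])
        then show "x \<in> RA `` {a'}" by blast
      next
        fix x assume "x \<in> RA `` {a'}"
        then have "(a', x) \<in> RA" by blast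
        then have "(a, x) \<in> RA" by (rule RA(4)[OF r])
        then show "x \<in> RA `` {a}" by blast
      qed
    qed
    show "F ` (A // RA) = B // RB"
    proof (intro equalityI subsetI)
      fix d assume "d \<in> F ` (A // RA)"
      then obtain a where a: "a \<in> A" "d = F (RA `` {a})" by (elim imageE quotientE) (rule that, assumption, simp)
      obtain b where b: "b \<in> B" "D a b" using A[OF a(1)] by blast
      show "d \<in> B // RB" unfolding a(2) cls[OF a(1) b] by (rule quotientI[OF b(1)])
    next
      fix d assume "d \<in> B // RB"
      then obtain b where b: "b \<in> B" "d = RB `` {b}" by (elim quotientE) (rule that)
      obtain a where a: "a \<in> A" "D a b" using B[OF b(1)] by blast
      show "d \<in> F ` (A // RA)"
        by (rule image_eqI[OF _ quotientI[OF a(1)]]) (simp only: b(2) cls[OF a(1) b(1) a(2)])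
    qed
  qed
qed

lemma module_iso_refl: "module_iso R M M"
proof -
  have "(\<lambda>x. x) \<in> module_isos R M M" by (simp add: module_isos_def bij_betw_def)
  then show ?thesis unfolding module_iso_def by blast
qed

lemma module_iso_sym: "left_module R M ==> module_iso R M N ==> module_iso R N M"
  unfolding module_iso_def using module_isos_inv[of _ R M N] by blast

lemma module_iso_trans: "module_iso R M N ==> module_iso R N P ==> module_iso R M P"
  unfolding module_iso_def using module_isos_comp[of _ R M N _ P] by blast

context
  fixes sq :: "'k::field_char_0 \<Rightarrow> 'k" and im t :: 'k
  assumes sq: "\<And>z. sq z ^ 2 = z" and im: "im ^ 2 = - 1" and t: "\<And>n. 2 * t \<noteq> of_nat n"
begin

lemma Lq_doubling: "\<exists>\<pi> \<Phi> \<theta>. verma_doubling (Lg (t, - t)) (Lq sq im (t, - t)) \<pi> \<Phi> \<theta> t"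
proof -
  have t0: "t \<noteq> 0" using t[of 0] by simp
  obtain \<theta> where \<theta>: "\<theta> \<in> module_isos Ag (Lg (t, - t)) (gverma t)" and Lg: "umod g_alg (Lg (t, - t))"
    using Lg_iso[OF t] by blast
  obtain f \<pi> where f: "f \<in> module_isos Aq (Lq sq im (t, - t)) (qverma t \<pi>)"
    and gr: "\<And>i. f ` gr (Lq sq im (t, - t)) i = gr (qverma t \<pi>) i" and Lq: "is_supermodule q_alg (Lq sq im (t, - t))"
    by (rule Lq_iso[OF sq im t0 t]) (rule that)
  interpret Q: usmod q_alg "Lq sq im (t, - t)" by (intro usmod.intro enveloping_q usmod_axioms.intro Lq)
  let ?g = "inv_into (carrier (Lq sq im (t, - t))) f"
  have g: "?g \<in> module_isos Aq (qverma t \<pi>) (Lq sq im (t, - t))"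
    by (rule module_isos_inv[OF f Q.left_module_axioms])
  have inj: "inj_on f (carrier (Lq sq im (t, - t)))" using module_isosD(1)[OF f] by (simp add: bij_betw_def)
  have "?g ` gr (qverma t \<pi>) i = gr (Lq sq im (t, - t)) i" for i
    unfolding gr[symmetric] by (rule inv_into_image_cancel[OF inj Q.grD(1)])
  from doubling_transport[OF qverma_doubling Lg Lq \<theta> g this]
  have "verma_doubling (Lg (t, - t)) (Lq sq im (t, - t)) \<pi> (\<lambda>x y. ?g (\<theta> x, \<theta> y)) \<theta> t"
    by (intro verma_doubling.intro verma_doubling_axioms.intro \<theta> t)
  then show ?thesis by (intro exI)
qed

lemma simples_gD:
  assumes "L \<in> simples_g (t, - t)"
  shows "simple_module Ag L" "annihilator Ag L = annihilator Ag (Lg (t, - t))" "umod g_alg L"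
proof -
  show s: "simple_module Ag L" and "annihilator Ag L = annihilator Ag (Lg (t, - t))"
    using assms by (simp_all add: simples_g_def)
  from s have "left_module Ag L" by (simp add: simple_module_def)
  then show "umod g_alg L" by (rule left_module_umod[OF graded_lie_g])
qed

lemma tensor_L_doubling:
  assumes L: "L \<in> simples_g (t, - t)"
  shows "\<exists>\<pi> \<Phi>. doubling L (tensor_L sq im (t, - t) L) \<pi> \<Phi>"
proof -
  obtain \<pi> \<Phi> \<theta> where "verma_doubling (Lg (t, - t)) (Lq sq im (t, - t)) \<pi> \<Phi> \<theta> t" using Lq_doubling by blast
  then interpret verma_tensor "Lg (t, - t)" "Lq sq im (t, - t)" \<pi> \<Phi> \<theta> t L
    by (intro verma_tensor.intro verma_tensor_axioms.intro simples_gD[OF L])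
  show ?thesis unfolding tensor_L_def L_bimodule_def using tensor_doubling by (intro exI)
qed

text \<open>The lowering element is multiplication by x on the Verma module, so it does not lie in
  the annihilator; a module with the same annihilator is therefore not killed by it.\<close>

lemma lowering_acts:
  assumes "left_module Ag L" and ann: "annihilator Ag L = annihilator Ag (Lg (t, - t))"
  shows "\<exists>A. \<exists>x\<in>carrier L. ugen g_alg (blockM A 0) \<odot>\<^bsub>L\<^esub> x \<noteq> (zr L)"
proof -
  obtain \<theta> where \<theta>: "\<theta> \<in> module_isos Ag (Lg (t, - t)) (gverma t)" and Lg: "umod g_alg (Lg (t, - t))"
    using Lg_iso[OF t] by blast
  let ?u = "ugen g_alg (blockM (mx 0 0 1 0) 0) :: 'k uea"
  have u: "?u \<in> Ug" by (rule enveloping.ugen_closed[OF enveloping_g g_algI])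
  have "?u \<odot>\<^bsub>gverma t\<^esub> 1 \<noteq> (zr (gverma t))" by (simp add: gverma_simps vact_lower)
  then have "?u \<notin> annihilator Ag (gverma t)" by (auto simp: annihilator_def gverma_simps(1))
  then have "?u \<notin> annihilator Ag L"
    unfolding ann module_isos_annihilator[OF \<theta> umod_left_module[OF Lg] umod_left_module[OF umod_gverma]] .
  then show ?thesis using u unfolding annihilator_def by blast
qed

text \<open>\<open>Lq\<close> is itself a doubling of \<open>Lg\<close>. The annihilators of a
  module and of its doubling determine each other, so equality with the prescribed annihilator
  passes in both directions, and simplicity does by \<open>simple_N\<close> and
  \<open>simple_L\<close>.\<close>

lemma simples_doubling:
  fixes L :: "('k uea, 'l) module" and N :: "('k uea, 'n) supermodule"
  assumes "doubling L N \<pi> \<Phi>"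
  shows "L \<in> simples_g (t, - t) \<longleftrightarrow> N \<in> simples_q sq im (t, - t)"
proof -
  interpret A: doubling L N \<pi> \<Phi> by fact
  obtain \<pi>0 \<Phi>0 \<theta> where "verma_doubling (Lg (t, - t)) (Lq sq im (t, - t)) \<pi>0 \<Phi>0 \<theta> t" using Lq_doubling by blast
  then interpret B: verma_doubling "Lg (t, - t)" "Lq sq im (t, - t)" \<pi>0 \<Phi>0 \<theta> t .
  show ?thesis
  proof
    assume L: "L \<in> simples_g (t, - t)"
    obtain A x where "x \<in> carrier L" "ugen g_alg (blockM A 0) \<odot>\<^bsub>L\<^esub> x \<noteq> (zr L)"
      using lowering_acts[OF A.L.left_module_axioms simples_gD(2)[OF L]] by blast
    then have "simple_supermodule q_alg N" by (rule A.simple_N[OF simples_gD(1)[OF L]])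
    moreover have "annihilator Aq N = annihilator Aq (Lq sq im (t, - t))"
      unfolding A.annihilator_N B.annihilator_N simples_gD(2)[OF L] ..
    ultimately show "N \<in> simples_q sq im (t, - t)" by (simp add: simples_q_def)
  next
    assume N: "N \<in> simples_q sq im (t, - t)"
    then have "simple_module Ag L" by (intro A.simple_L) (simp add: simples_q_def)
    moreover have "annihilator Aq N = annihilator Aq (Lq sq im (t, - t))" using N by (simp add: simples_q_def)
    then have "annihilator Ag L = annihilator Ag (Lg (t, - t))"
      unfolding A.annihilator_L B.annihilator_L by simp
    ultimately show "L \<in> simples_g (t, - t)" by (simp add: simples_g_def)
  qed
qed

text \<open>\<open>doubling_ex\<close> finds the gl(2)-module on the type of \<open>N\<close>. A
  simple module embeds into the field, and the field into the universe, so a copy can be placed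
  there.\<close>

lemma ex_simple_g:
  fixes e :: "'k \<Rightarrow> 'm" and N :: "('k uea, 'n) supermodule"
  assumes e: "inj e" and N: "N \<in> simples_q sq im (t, - t)"
  shows "\<exists>L\<in>(simples_g (t, - t) :: ('k uea, 'm) module set). \<exists>\<pi> \<Phi>. doubling L N \<pi> \<Phi>"
proof -
  obtain \<pi>0 \<Phi>0 \<theta> where "verma_doubling (Lg (t, - t)) (Lq sq im (t, - t)) \<pi>0 \<Phi>0 \<theta> t" using Lq_doubling by blast
  then interpret B: verma_doubling "Lg (t, - t)" "Lq sq im (t, - t)" \<pi>0 \<Phi>0 \<theta> t .
  have s: "simple_supermodule q_alg N" and ann: "annihilator Aq N = annihilator Aq (Lq sq im (t, - t))"
    using N by (simp_all add: simples_q_def)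
  note sN = simple_supermoduleD(1)[OF s]
  have "usmod q_alg N" by (intro usmod.intro enveloping_q usmod_axioms.intro sN)
  then have "q_simple (Lg (t, - t)) (Lq sq im (t, - t)) \<pi>0 \<Phi>0 N"
    by (intro q_simple.intro q_simple_axioms.intro B.doubling_axioms s ann lowering_acts[OF B.L.left_module_axioms refl])
  from q_simple.doubling_ex[OF this] obtain \<pi> \<Phi> and L1 :: "('k uea, 'n) module" where d: "doubling L1 N \<pi> \<Phi>" by blast
  have L1: "L1 \<in> simples_g (t, - t)" using simples_doubling[OF d] N by simp
  note lm1 = umod_left_module[OF simples_gD(3)[OF L1]]
  obtain e1 :: "'n \<Rightarrow> 'k" where e1: "inj_on e1 (carrier L1)" using inj_simple_module[OF graded_lie_g simples_gD(1)[OF L1]] by blast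
  have "inj_on (e \<circ> e1) (carrier L1)" by (rule comp_inj_on[OF e1 inj_on_subset[OF e subset_UNIV]])
  from transport_module[OF lm1 this] obtain L :: "('k uea, 'm) module"
    where L: "left_module Ag L" and h: "e \<circ> e1 \<in> module_isos Ag L1 L" by blast
  have i: "(\<lambda>x. x) \<in> module_isos Aq N N" by (simp add: module_isos_def bij_betw_def)
  have dL: "doubling L N \<pi> (\<lambda>x y. \<Phi> (inv_into (carrier L1) (e \<circ> e1) x) (inv_into (carrier L1) (e \<circ> e1) y))"
    by (rule doubling_transport[OF d left_module_umod[OF graded_lie_g L] sN module_isos_inv[OF h lm1] i]) simp
  then have "L \<in> simples_g (t, - t)" using simples_doubling[OF dL] N by simp
  with dL show ?thesis by blast
qed

text \<open>The tensor product has pairs of vectors of \<open>L\<close> as its elements, up to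
  bijection. Such pairs can be coded in the field, hence in the universe.\<close>

lemma ex_simple_q:
  fixes e :: "'k \<Rightarrow> 'n" and L :: "('k uea, 'm) module"
  assumes e: "inj e" and L: "L \<in> simples_g (t, - t)"
  shows "\<exists>N\<in>(simples_q sq im (t, - t) :: ('k uea, 'n) supermodule set). \<exists>\<pi> \<Phi>. doubling L N \<pi> \<Phi>"
proof -
  obtain \<pi> \<Phi> where d: "doubling L (tensor_L sq im (t, - t) L) \<pi> \<Phi>" using tensor_L_doubling[OF L] by blast
  define T where "T = tensor_L sq im (t, - t) L"
  interpret T: doubling L T \<pi> \<Phi> unfolding T_def by (rule d)
  obtain e1 :: "'m \<Rightarrow> 'k" where e1: "inj_on e1 (carrier L)" using inj_simple_module[OF graded_lie_g simples_gD(1)[OF L]] by blast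
  obtain p :: "'k \<times> 'k \<Rightarrow> 'k" where p: "inj p" using inj_pair by blast
  define P where "P = inv_into (carrier L \<times> carrier L) (\<lambda>(x, y). \<Phi> x y)"
  have P: "P (\<Phi> x y) = (x, y)" if "x \<in> carrier L" "y \<in> carrier L" for x y
    unfolding P_def using bij_betw_inv_into_left[OF T.bij, of "(x, y)"] that by simp
  define \<eta> where "\<eta> z = e (p (e1 (fst (P z)), e1 (snd (P z))))" for z
  have "inj_on \<eta> (carrier T)"
  proof (rule inj_onI)
    fix z w assume z: "z \<in> carrier T" and w: "w \<in> carrier T" and eq: "\<eta> z = \<eta> w"
    obtain x y where xy: "x \<in> carrier L" "y \<in> carrier L" "z = \<Phi> x y" using T.Phi_ex[OF z] by blast
    obtain x' y' where xy': "x' \<in> carrier L" "y' \<in> carrier L" "w = \<Phi> x' y'" using T.Phi_ex[OF w] by blast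
    have "e1 x = e1 x'" "e1 y = e1 y'"
      using eq by (simp_all add: \<eta>_def inj_eq[OF e] inj_eq[OF p] xy xy' P)
    then have "x = x'" "y = y'" using inj_onD[OF e1] xy xy' by blast+
    then show "z = w" by (simp add: xy(3) xy'(3))
  qed
  from transport_supermodule[OF graded_lie_q T.N.smod this] obtain N :: "('k uea, 'n) supermodule"
    where N: "is_supermodule q_alg N" "\<eta> \<in> module_isos Aq T N" "\<And>i. \<eta> ` gr T i = gr N i" by blast
  have i: "(\<lambda>x. x) \<in> module_isos Ag L L" by (simp add: module_isos_def bij_betw_def)
  note dN = doubling_transport[OF T.doubling_axioms T.L.umod_axioms N(1) i N(2) N(3)]
  have "N \<in> simples_q sq im (t, - t)" using simples_doubling[OF dN] L by simp
  with dN show ?thesis by blast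
qed

text \<open>The correspondence between representatives is that N is a doubling of L: total on both
  sides by \<open>ex_simple_q\<close> and \<open>ex_simple_g\<close>, and compatible with
  isomorphism by the two lemmas on classes of doublings.\<close>

lemma tensor_class_bij:
  assumes m: "\<exists>e :: 'k \<Rightarrow> 'm. inj e" and n: "\<exists>e :: 'k \<Rightarrow> 'n. inj e"
  shows "bij_betw (tensor_class sq im (t, - t))
    (Irr_g (t, - t) :: ('k uea, 'm) module set set) (Irr_q sq im (t, - t) :: ('k uea, 'n) supermodule set set)"
  unfolding Irr_g_def Irr_q_def
proof (rule bij_betw_quotients[where D = "\<lambda>L N. \<exists>\<pi> \<Phi>. doubling L N \<pi> \<Phi>"])
  let ?A = "simples_g (t, - t) :: ('k uea, 'm) module set" and ?B = "simples_q sq im (t, - t) :: ('k uea, 'n) supermodule set"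
  let ?RA = "{(L, L'). L \<in> ?A \<and> L' \<in> ?A \<and> module_iso Ag L L'}"
  let ?RB = "{(N, N'). N \<in> ?B \<and> N' \<in> ?B \<and> iso_up_to_parity N N'}"
  show "?RA \<subseteq> ?A \<times> ?A" "?RB \<subseteq> ?B \<times> ?B" by blast+
  show "(L, L) \<in> ?RA" if "L \<in> ?A" for L using that by (simp add: module_iso_refl)
  show "(L', L) \<in> ?RA" if "(L, L') \<in> ?RA" for L L'
    using that module_iso_sym[OF umod_left_module[OF simples_gD(3)], of L L'] by simp
  show "(L, L'') \<in> ?RA" if "(L, L') \<in> ?RA" "(L', L'') \<in> ?RA" for L L' L''
    using that module_iso_trans[of "Ag" L L' L''] by simp
  obtain em :: "'k \<Rightarrow> 'm" where em: "inj em" using m by blast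
  obtain en :: "'k \<Rightarrow> 'n" where en: "inj en" using n by blast
  show "\<exists>N\<in>?B. \<exists>\<pi> \<Phi>. doubling L N \<pi> \<Phi>" if "L \<in> ?A" for L by (rule ex_simple_q[OF en that])
  show ex: "\<exists>L\<in>?A. \<exists>\<pi> \<Phi>. doubling L N \<pi> \<Phi>" if "N \<in> ?B" for N by (rule ex_simple_g[OF em that])
  show "(L, L') \<in> ?RA \<longleftrightarrow> (N, N') \<in> ?RB"
    if c: "L \<in> ?A" "N \<in> ?B" "L' \<in> ?A" "N' \<in> ?B" and d: "\<exists>\<pi> \<Phi>. doubling L N \<pi> \<Phi>" "\<exists>\<pi> \<Phi>. doubling L' N' \<pi> \<Phi>" for L N L' N'
  proof -
    obtain \<pi> \<Phi> \<pi>' \<Phi>' where d: "doubling L N \<pi> \<Phi>" "doubling L' N' \<pi>' \<Phi>'" using d by blast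
    show ?thesis using c doubling_iso_up_to_parity[OF d] iso_up_to_parity_doubling[OF d] by auto
  qed
  fix c and N :: "('k uea, 'n) supermodule" assume c: "c \<in> ?A // ?RA"
  have cA: "L \<in> ?A" if "L \<in> c" for L using c that by (elim quotientE) blast
  \<comment> \<open>The tensor product is a doubling of L, so N is isomorphic to it up to parity
    exactly when the module that N doubles is isomorphic to L. This identifies
    \<open>tensor_class\<close> with the map induced by the correspondence.\<close>
  have "iso_up_to_parity N (tensor_L sq im (t, - t) L) \<longleftrightarrow> (\<exists>L'\<in>?A. (\<exists>\<pi> \<Phi>. doubling L' N \<pi> \<Phi>) \<and> (L', L) \<in> ?RA)"
    if N: "N \<in> ?B" and L: "L \<in> c" for L
  proof
    obtain \<pi> \<Phi> where d: "doubling L (tensor_L sq im (t, - t) L) \<pi> \<Phi>" using tensor_L_doubling[OF cA[OF L]] by blast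
    {
      assume i: "iso_up_to_parity N (tensor_L sq im (t, - t) L)"
      obtain L' \<pi>' \<Phi>' where d': "L' \<in> ?A" "doubling L' N \<pi>' \<Phi>'" using ex[OF N] by blast
      have "(L', L) \<in> ?RA" using iso_up_to_parity_doubling[OF d'(2) d i] d'(1) cA[OF L] by simp
      with d' show "\<exists>L'\<in>?A. (\<exists>\<pi> \<Phi>. doubling L' N \<pi> \<Phi>) \<and> (L', L) \<in> ?RA" by blast
    next
      assume "\<exists>L'\<in>?A. (\<exists>\<pi> \<Phi>. doubling L' N \<pi> \<Phi>) \<and> (L', L) \<in> ?RA"
      then obtain L' where L': "\<exists>\<pi> \<Phi>. doubling L' N \<pi> \<Phi>" "(L', L) \<in> ?RA" by (elim bexE conjE) (rule that)
      have i: "module_iso Ag L' L" using L'(2) by simp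
      from L'(1) obtain \<pi>' \<Phi>' where d': "doubling L' N \<pi>' \<Phi>'" by (elim exE) (rule that)
      show "iso_up_to_parity N (tensor_L sq im (t, - t) L)" by (rule doubling_iso_up_to_parity[OF d' d i])
    }
  qed
  note iff = this
  have e: "N \<in> tensor_class sq im (t, - t) c \<longleftrightarrow> N \<in> ?B \<and> (\<exists>L\<in>c. iso_up_to_parity N (tensor_L sq im (t, - t) L))"
    by (simp add: tensor_class_def)
  show "N \<in> tensor_class sq im (t, - t) c \<longleftrightarrow> N \<in> ?B \<and> (\<exists>L\<in>c. \<exists>L'\<in>?A. (\<exists>\<pi> \<Phi>. doubling L' N \<pi> \<Phi>) \<and> (L', L) \<in> ?RA)"
    unfolding e by (rule conj_cong[OF refl], rule bex_cong[OF refl], rule iff; assumption)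
qed

end

theorem proposition15:
  fixes t im :: "'k::{alg_closed_field, field_char_0}"
    and sq :: "'k \<Rightarrow> 'k"
  assumes "uncountable (UNIV :: 'k set)"
    and "\<And>z. sq z ^ 2 = z"
    and "im ^ 2 = -1"
    and "t \<notin> range (\<lambda>n::nat. of_nat n / 2)"
    and "\<exists>e :: 'k \<Rightarrow> 'm. inj e"
    and "\<exists>e :: 'k \<Rightarrow> 'n. inj e"
  shows
    "(\<forall>L :: ('k uea, 'l) module. L \<in> simples_g (t, -t) \<longrightarrow>
        tensor_L sq im (t, -t) L \<in> simples_q sq im (t, -t)) \<and>
     bij_betw (tensor_class sq im (t, -t))
        (Irr_g (t, -t) :: ('k uea, 'm) module set set)
        (Irr_q sq im (t, -t) :: ('k uea, 'n) supermodule set set) \<and>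
     (\<forall>L :: ('k uea, 'l) module. L \<in> simples_g (t, -t) \<longrightarrow>
       (let N = tensor_L sq im (t, -t) L; Ng = restrict_scalars g_alg q_alg N
        in semisimple_module (UEA g_alg) Ng \<and>
           module_iso (UEA g_alg) Ng (direct_sum L L) \<and>
           module_iso (UEA g_alg) (Ng\<lparr>carrier := gr N 0\<rparr>) L))"
proof -
  have t: "2 * t \<noteq> of_nat n" for n
  proof
    assume "2 * t = of_nat n"
    then have "t = of_nat n / 2" by (simp add: field_simps)
    then show False using assms(4) by blast
  qed
  have d: "L \<in> simples_g (t, - t) \<Longrightarrow> \<exists>\<pi> \<Phi>. doubling L (tensor_L sq im (t, - t) L) \<pi> \<Phi>" for L :: "('k uea, 'l) module"
    by (rule tensor_L_doubling[OF assms(2,3) t])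
  show ?thesis
  proof (intro conjI allI impI tensor_class_bij[OF assms(2,3) t assms(5,6)])
    fix L :: "('k uea, 'l) module" assume L: "L \<in> simples_g (t, - t)"
    obtain \<pi> \<Phi> where D: "doubling L (tensor_L sq im (t, - t) L) \<pi> \<Phi>" using d[OF L] by blast
    show "tensor_L sq im (t, - t) L \<in> simples_q sq im (t, - t)"
      using simples_doubling[OF assms(2,3) t D] L by (rule iffD1)
    have s: "simple_module (UEA g_alg) L" using L by (simp add: simples_g_def)
    show "let N = tensor_L sq im (t, - t) L; Ng = restrict_scalars g_alg q_alg N
      in semisimple_module (UEA g_alg) Ng \<and> module_iso (UEA g_alg) Ng (direct_sum L L) \<and>
         module_iso (UEA g_alg) (Ng\<lparr>carrier := gr N 0\<rparr>) L"
      unfolding Let_def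
      by (intro conjI doubling.Ng_semisimple[OF D s] doubling.Ng_direct_sum[OF D] doubling.Ng_even[OF D])
  qed
qed

end
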